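(* Let $G$ be a finite group acting on a finite set $X$ such that the corresponding complex permutation representation $V(X)$ is multiplicity free with $m+1$ distinct irreducibles occurring in it. Assume $m\ge 1$, and let $n$ be a positive integer. Then the following hold. (i) There exists an orthogonal semisymmetric Jordan basis $J_X(n)$ of $V(B_X(n))$, such that (ii)–(iv) below hold. (ii) $J_X(n)$ can be expressed as a disjoint union $$J_X(n)=\bigcup_{(k,s,p)\in \mathcal{J}_X(n)} J_X(n,k,s,p),$$ where $J_X(n,k,s,p)$ consists of $\mu(n,k,s,p)$ semisymmetric Jordan chains starting at rank $k$ and ending at rank $n+s-k$. Let $J_X'(n)$ denote the orthonormal basis obtained by normalizing the vectors in $J_X(n)$. Define a $B_X(n)\times J_X'(n)$ unitary matrix $M(n)$ as follows: for $v\in J_X'(n)$, the column of $M(n)$ indexed by $v$ is the coordinate vector of $v$ in the standard basis $B_X(n)$. (iii) $M(n)^*\mathcal{A}_X(n)M(n)$ consists of all $J_X'(n)\times J_X'(n)$ block diagonal matrices with a block corresponding to each (normalized) semisymmetric Jordan chain in $J_X(n)$ and such that, for each $(k,s,p)\in\mathcal{J}_X(n)$, the $\mu(n,k,s,p)$ blocks corresponding to the chains in $J_X(n,k,s,p)$ are identical (the rows and columns of a block being indexed by the ranks $k,k+1,\ldots,n+s-k$ of the vectors of the chain). (iv) Conjugating by $M(n)$ (that is, $M\mapsto M(n)^*MM(n)$) and, for each $(k,s,p)\in\mathcal{J}_X(n)$, preserving only one among the duplicate blocks corresponding to the chains in $J_X(n,k,s,p)$, gives a $*$-algebra isomorphism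 $$\Phi:\mathcal{A}_X(n)\cong\bigoplus_{(k,s,p)\in\mathcal{J}_X(n)}\mathrm{Mat}\big((n+s-2k+1)\times(n+s-2k+1)\big),$$ where the rows and columns of the block for $(k,s,p)$ are indexed by the set $\{k,k+1,\ldots,n+s-k\}$. Moreover, for $(i,j,t,l)\in\mathcal{I}_X(n)$, writing $\Phi(M_{i,j}^{t,l})=(N_{k,s,p})_{(k,s,p)\in\mathcal{J}_X(n)}$, we have $$N_{k,s,p}=\begin{cases}\binom{n+s-2k}{i-k}^{-\frac12}\binom{n+s-2k}{j-k}^{-\frac12}\,\alpha_{i,j,k,s}^{n,t,l,p}\,E_{i,j,k,s} & \text{if } k\le i,j\le n+s-k,\\ 0&\text{otherwise.}\end{cases}$$
   Context: General notation. $\mathbb N=\{0,1,2,\ldots\}$, $[n]=\{1,\ldots,n\}$. For a finite set $S$, $V(S)$ is the complex vector space with basis $S$, with the inner product making $S$ orthonormal. $C(n,m)$ is the set of $(l_1,\ldots,l_m)\in\mathbb N^m$ with sum $n$. Binomial coefficients $\binom{a}{b}$ are $0$ if $a<0$ or $b<0$ (and if $b>a$); a multinomial coefficient $\binom{a}{k_1,\ldots,k_r}$ is $0$ if any of $a,k_1,\ldots,k_r$ is negative or if $a\ne k_1+\cdots+k_r$. $0^0=1$, and an empty sum is $0$. $\mathrm{Mat}(p\times p)$ is the algebra of complex $p\times p$ matrices. Generalized Boolean algebra. Let $L_0\notin X$ be a symbol, $Y=\{L_0\}\cup X$, $B_X(n)=Y^n$. For $a=(a_1,\ldots,a_n)\in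 B_X(n)$, $S(a)=\{i: a_i\ne L_0\}$. Partially order $B_X(n)$ by $a\le b$ iff $S(a)\subseteq S(b)$ and $a_i=b_i$ for all $i\in S(a)$; this is a graded poset of rank $n$ with rank of $a$ equal to $|S(a)|$. The wreath product $G\sim S_n$ acts on $B_X(n)$ by $(g_1,\ldots,g_n,\pi)(a_1,\ldots,a_n)=(b_1,\ldots,b_n)$, where $b_i=g_ia_{\pi^{-1}(i)}$ if $a_{\pi^{-1}(i)}\neq L_0$ and $b_i=L_0$ otherwise. Linear operators $f$ on $V(B_X(n))$ are represented by $B_X(n)\times B_X(n)$ matrices $M_f$, acting on column vectors (so $f(b)=\sum_a M_f(a,b)\,a$). Set $\mathcal{A}_X(n)=\{M_f: f\in \mathrm{End}_{G\sim S_n}(V(B_X(n)))\}$. Orbits and basis of $\mathcal A_X(n)$. Let $Z_0,Z_1,\ldots,Z_m$ be the orbits of $G$ on $X\times X$, with $Z_0$ the diagonal (there are exactly $m+1$ orbits). For $a,b\in B_X(n)$ put $\mathcal{C}(a,b)=(l_0,\ldots,l_m)$ with $l_j=|\{i\in S(a)\cap S(b):(a_i,b_i)\in Z_j\}|$. For $0\le i,j,t\le n$ and $l\in\mathbb N^{m+1}$, $M_{i,j}^{t,l}$ is the $B_X(n)\times B_X(n)$ matrix with $(a,b)$ entry $1$ if $|S(a)|=i$, $|S(b)|=j$, $|S(a)\cap S(b)|=t$, $\mathcal{C}(a,b)=l$, and $0$ otherwise. $\mathcal{I}_X(n)=\{(i,j,t,l): i,j,t\in\mathbb N,\ t\le i,\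 t\le j,\ i+j-t\le n,\ l\in C(t,m+1)\}$. The set $\{M_{i,j}^{t,l}:(i,j,t,l)\in\mathcal{I}_X(n)\}$ is a basis of $\mathcal{A}_X(n)$. Jordan chains. Let $P$ be a finite graded poset of rank $n$ with rank function $r$. A nonzero $v\in V(P)$ is homogeneous of rank $i$, written $r(v)=i$, if it lies in the span of the elements of rank $i$. The up operator $U$ is the linear map with $U(x)=\sum_y y$ over all $y$ covering $x$. A graded Jordan chain is a sequence $(v_1,\ldots,v_h)$ of nonzero homogeneous vectors with $U(v_{i-1})=v_i$ for $2\le i\le h$ and $U(v_h)=0$; it starts at rank $r(v_1)$ and ends at rank $r(v_h)$. It is a semisymmetric Jordan chain if $r(v_1)+r(v_h)\ge n$. A semisymmetric Jordan basis of $V(P)$ is a basis that is a disjoint union of semisymmetric Jordan chains; it is orthogonal if its elements are pairwise orthogonal. A square matrix indexed by a set $A$ partitioned as $A_1\cup\cdots\cup A_q$ is block diagonal with a block corresponding to each $A_i$ if its $(x,y)$ entry is $0$ whenever $x,y$ are in different parts. Representation data. Let $V(X)=W_0\oplus\cdots\oplus W_m$ be the orthogonal decomposition into distinct irreducible $G$-submodules, $W_0$ being the trivial one, and $d_w=\dim W_w$. For $u=0,\ldots,m$ let $f_u:V(X)\to V(X)$ be $f_u(y)=\sum_{x:(x,y)\in Z_u}x$ for $y\in X$. By Schur's lemma $f_u$ acts on $W_w$ as a scalar, denoted $\lambda(u,w)$. Index set and multiplicities. For $0\le k\le n$, put $k^-=\max(0,2k-n)$. $\mathcal{J}_X(n)=\{(k,s,p):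 0\le k\le n,\ k^-\le s\le k,\ p\in C(s,m)\}$. For $(k,s,p)\in\mathcal{J}_X(n)$, $p=(p_1,\ldots,p_m)$, $$\mu(n,k,s,p)=\binom{n}{n-s,p_1,\ldots,p_m}d_1^{p_1}\cdots d_m^{p_m}\left\{\binom{n-s}{k-s}-\binom{n-s}{k-s-1}\right\}.$$ Coefficients. $$\beta_{i,j,k}^{n,t}=\sum_{u=0}^n(-1)^{u-t}\binom{u}{t}\binom{n-2k}{u-k}\binom{n-k-u}{i-u}\binom{n-k-u}{j-u}.$$ For $l=(l_0,\ldots,l_m)$, $p=(p_0,\ldots,p_m)\in\mathbb Z^{m+1}$, $$\Lambda(\lambda,l,p)=\sum\left\{\prod_{w=0}^m\binom{p_w}{r(0,w),\ldots,r(m,w)}\right\}\left\{\prod_{u=0}^m\prod_{w=0}^m\lambda(u,w)^{r(u,w)}\right\},$$ the sum being over all $\{0,\ldots,m\}\times\{0,\ldots,m\}$ nonnegative integer matrices $(r(u,w))$ with row sums $l_0,\ldots,l_m$ and column sums $p_0,\ldots,p_m$. For $l\in C(t,m+1)$ and $p=(p_1,\ldots,p_m)\in C(s,m)$, with $p_0=t-s$ and $p^+=(p_0,p_1,\ldots,p_m)$, $$\alpha_{i,j,k,s}^{n,t,l,p}=|X|^{\frac{i+j}{2}-t}\,\Lambda(\lambda,l,p^+)\,\beta_{i-s,j-s,k-s}^{n-s,t-s}$$ (when $t<s$ this is $0$, since $\Lambda(\lambda,l,p^+)$ is then an empty sum). For $0\le k\le n$, $k^-\le s\le k$, $k\le i,j\le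 n+s-k$, $E_{i,j,k,s}$ is the $\{k,\ldots,n+s-k\}\times\{k,\ldots,n+s-k\}$ matrix with entry $1$ in row $i$ and column $j$ and $0$ elsewhere. *)

theory Defs
  imports
    "HOL-Analysis.Analysis"
    "HOL-Algebra.Group_Action"
    "HOL-Library.Function_Algebras"
begin

section \<open>Free complex vector spaces and matrices with arbitrary index sets\<close>

text \<open>A vector with coordinates indexed by a set \<open>S\<close> is a function vanishing outside \<open>S\<close>;
  addition and zero are the pointwise ones of \<^theory>\<open>HOL-Library.Function_Algebras\<close>.\<close>

definition cscale :: "complex \<Rightarrow> ('a \<Rightarrow> complex) \<Rightarrow> 'a \<Rightarrow> complex" where
  "cscale c v = (\<lambda>x. c * v x)"

global_interpretation cfun: vector_space cscale
  by unfold_locales (simp_all add: cscale_def fun_eq_iff algebra_simps)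

definition V :: "'a set \<Rightarrow> ('a \<Rightarrow> complex) set" where
  "V S = {v. \<forall>x. x \<notin> S \<longrightarrow> v x = 0}"

definition ket :: "'a \<Rightarrow> 'a \<Rightarrow> complex" where
  "ket x = (\<lambda>y. if y = x then 1 else 0)"

definition cinner :: "'a set \<Rightarrow> ('a \<Rightarrow> complex) \<Rightarrow> ('a \<Rightarrow> complex) \<Rightarrow> complex" where
  "cinner S u v = (\<Sum>x\<in>S. u x * cnj (v x))"

definition normalize_vec :: "'a set \<Rightarrow> ('a \<Rightarrow> complex) \<Rightarrow> 'a \<Rightarrow> complex" where
  "normalize_vec S v = cscale (complex_of_real (1 / L2_set (\<lambda>x. cmod (v x)) S)) v"

text \<open>The linear extension to \<open>V S\<close> of a map \<open>\<sigma>\<close> from \<open>S\<close> to itself, that is, of the rule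
  sending the basis vector \<open>x\<close> to the basis vector \<open>\<sigma> x\<close>.\<close>

definition push :: "'a set \<Rightarrow> ('a \<Rightarrow> 'a) \<Rightarrow> ('a \<Rightarrow> complex) \<Rightarrow> 'a \<Rightarrow> complex" where
  "push S \<sigma> v = (\<lambda>y. \<Sum>x | x \<in> S \<and> \<sigma> x = y. v x)"

text \<open>Matrices with rows indexed by \<open>R\<close> and columns indexed by \<open>C\<close>; the index set over which
  a product is summed is an explicit argument of \<open>mmul\<close>.\<close>

definition mats :: "'a set \<Rightarrow> 'b set \<Rightarrow> ('a \<Rightarrow> 'b \<Rightarrow> complex) set" where
  "mats R C = {M. \<forall>x y. \<not> (x \<in> R \<and> y \<in> C) \<longrightarrow> M x y = 0}"

definition mmul :: "'b set \<Rightarrow> ('a \<Rightarrow> 'b \<Rightarrow> complex) \<Rightarrow> ('b \<Rightarrow> 'c \<Rightarrow> complex) \<Rightarrow> 'a \<Rightarrow> 'c \<Rightarrow> complex" where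
  "mmul K M N = (\<lambda>x z. \<Sum>y\<in>K. M x y * N y z)"

definition adj :: "('a \<Rightarrow> 'b \<Rightarrow> complex) \<Rightarrow> 'b \<Rightarrow> 'a \<Rightarrow> complex" where
  "adj M = (\<lambda>y x. cnj (M x y))"

definition idmat :: "'a set \<Rightarrow> 'a \<Rightarrow> 'a \<Rightarrow> complex" where
  "idmat S = (\<lambda>x y. if x \<in> S \<and> x = y then 1 else 0)"

definition block_diagonal :: "'a set set \<Rightarrow> ('a \<Rightarrow> 'a \<Rightarrow> complex) \<Rightarrow> bool" where
  "block_diagonal \<P> M \<longleftrightarrow>
     (\<forall>A\<in>\<P>. \<forall>A'\<in>\<P>. A \<noteq> A' \<longrightarrow> (\<forall>x\<in>A. \<forall>y\<in>A'. M x y = 0))"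


section \<open>Complex *-algebras\<close>

text \<open>Addition is the type class operation.\<close>

record 'a star_algebra =
  elts :: "'a set"
  scl :: "complex \<Rightarrow> 'a \<Rightarrow> 'a"
  prd :: "'a \<Rightarrow> 'a \<Rightarrow> 'a"
  str :: "'a \<Rightarrow> 'a"
  unt :: "'a"

definition star_algebra_iso ::
  "'a::plus star_algebra \<Rightarrow> 'b::plus star_algebra \<Rightarrow> ('a \<Rightarrow> 'b) \<Rightarrow> bool" where
  "star_algebra_iso A B f \<longleftrightarrow>
     bij_betw f (elts A) (elts B) \<and>
     unt A \<in> elts A \<and> f (unt A) = unt B \<and>
     (\<forall>x\<in>elts A. \<forall>y\<in>elts A. x + y \<in> elts A \<and> f (x + y) = f x + f y) \<and>
     (\<forall>c. \<forall>x\<in>elts A. scl A c x \<in> elts A \<and> f (scl A c x) = scl B c (f x)) \<and>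
     (\<forall>x\<in>elts A. \<forall>y\<in>elts A. prd A x y \<in> elts A \<and> f (prd A x y) = prd B (f x) (f y)) \<and>
     (\<forall>x\<in>elts A. str A x \<in> elts A \<and> f (str A x) = str B (f x))"

definition matrix_star_algebra ::
  "'a set \<Rightarrow> ('a \<Rightarrow> 'a \<Rightarrow> complex) set \<Rightarrow> ('a \<Rightarrow> 'a \<Rightarrow> complex) star_algebra" where
  "matrix_star_algebra S \<A> =
     \<lparr>elts = \<A>, scl = (\<lambda>c M x y. c * M x y), prd = mmul S, str = adj, unt = idmat S\<rparr>"

text \<open>The direct sum over \<open>q \<in> Q\<close> of the full matrix algebras with index sets \<open>L q\<close>.\<close>

definition matrix_direct_sum ::
  "'q set \<Rightarrow> ('q \<Rightarrow> 'a set) \<Rightarrow> ('q \<Rightarrow> 'a \<Rightarrow> 'a \<Rightarrow> complex) star_algebra" where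
  "matrix_direct_sum Q L =
     \<lparr>elts = {N. (\<forall>q\<in>Q. N q \<in> mats (L q) (L q)) \<and> (\<forall>q. q \<notin> Q \<longrightarrow> N q = 0)},
      scl = (\<lambda>c N q x y. c * N q x y),
      prd = (\<lambda>N N' q. mmul (L q) (N q) (N' q)),
      str = (\<lambda>N q. adj (N q)),
      unt = (\<lambda>q. if q \<in> Q then idmat (L q) else 0)\<rparr>"


section \<open>Permutation representations\<close>

text \<open>Throughout, \<open>G\<close> acts on the finite set \<open>X\<close> through \<open>\<phi>\<close> and \<open>g\<close> acts on \<open>V X\<close> by
  \<open>push X (\<phi> g)\<close>.\<close>

definition submodule ::
  "('g, 'r) monoid_scheme \<Rightarrow> 'x set \<Rightarrow> ('g \<Rightarrow> 'x \<Rightarrow> 'x) \<Rightarrow> ('x \<Rightarrow> complex) set \<Rightarrow> bool" where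
  "submodule G X \<phi> W \<longleftrightarrow>
     cfun.subspace W \<and> W \<subseteq> V X \<and> (\<forall>g\<in>carrier G. \<forall>v\<in>W. push X (\<phi> g) v \<in> W)"

definition irreducible_submodule ::
  "('g, 'r) monoid_scheme \<Rightarrow> 'x set \<Rightarrow> ('g \<Rightarrow> 'x \<Rightarrow> 'x) \<Rightarrow> ('x \<Rightarrow> complex) set \<Rightarrow> bool" where
  "irreducible_submodule G X \<phi> W \<longleftrightarrow>
     submodule G X \<phi> W \<and> W \<noteq> {0} \<and>
     (\<forall>W'. submodule G X \<phi> W' \<and> W' \<subseteq> W \<longrightarrow> W' = {0} \<or> W' = W)"

text \<open>A linear map between subspaces is given by a linear map of the ambient space (every linear
  map on a subspace extends).\<close>

definition isomorphic_submodules ::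
  "('g, 'r) monoid_scheme \<Rightarrow> 'x set \<Rightarrow> ('g \<Rightarrow> 'x \<Rightarrow> 'x) \<Rightarrow>
     ('x \<Rightarrow> complex) set \<Rightarrow> ('x \<Rightarrow> complex) set \<Rightarrow> bool" where
  "isomorphic_submodules G X \<phi> W W' \<longleftrightarrow>
     (\<exists>f. Vector_Spaces.linear cscale cscale f \<and> bij_betw f W W' \<and>
          (\<forall>g\<in>carrier G. \<forall>v\<in>W. f (push X (\<phi> g) v) = push X (\<phi> g) (f v)))"

definition multiplicity_free_decomposition ::
  "('g, 'r) monoid_scheme \<Rightarrow> 'x set \<Rightarrow> ('g \<Rightarrow> 'x \<Rightarrow> 'x) \<Rightarrow> nat \<Rightarrow>
     (nat \<Rightarrow> ('x \<Rightarrow> complex) set) \<Rightarrow> bool" where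
  "multiplicity_free_decomposition G X \<phi> m W \<longleftrightarrow>
     (\<forall>w\<le>m. irreducible_submodule G X \<phi> (W w)) \<and>
     (\<forall>w\<le>m. \<forall>w'\<le>m. w \<noteq> w' \<longrightarrow> \<not> isomorphic_submodules G X \<phi> (W w) (W w')) \<and>
     (\<forall>v\<in>V X. \<exists>!f. f \<in> (\<Pi>\<^sub>E w\<in>{..m}. W w) \<and> v = (\<Sum>w\<le>m. f w))"

definition multiplicity_free ::
  "('g, 'r) monoid_scheme \<Rightarrow> 'x set \<Rightarrow> ('g \<Rightarrow> 'x \<Rightarrow> 'x) \<Rightarrow> nat \<Rightarrow> bool" where
  "multiplicity_free G X \<phi> m \<longleftrightarrow> (\<exists>W. multiplicity_free_decomposition G X \<phi> m W)"

text \<open>The orthogonal decomposition, with the trivial representation in position \<open>0\<close>.\<close>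

definition irreducible_labelling ::
  "('g, 'r) monoid_scheme \<Rightarrow> 'x set \<Rightarrow> ('g \<Rightarrow> 'x \<Rightarrow> 'x) \<Rightarrow> nat \<Rightarrow>
     (nat \<Rightarrow> ('x \<Rightarrow> complex) set) \<Rightarrow> bool" where
  "irreducible_labelling G X \<phi> m W \<longleftrightarrow>
     multiplicity_free_decomposition G X \<phi> m W \<and>
     (\<forall>w\<le>m. \<forall>w'\<le>m. w \<noteq> w' \<longrightarrow> (\<forall>u\<in>W w. \<forall>v\<in>W w'. cinner X u v = 0)) \<and>
     (\<forall>g\<in>carrier G. \<forall>v\<in>W 0. push X (\<phi> g) v = v)"

definition orbital_labelling ::
  "('g, 'r) monoid_scheme \<Rightarrow> 'x set \<Rightarrow> ('g \<Rightarrow> 'x \<Rightarrow> 'x) \<Rightarrow> nat \<Rightarrow>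
     (nat \<Rightarrow> ('x \<times> 'x) set) \<Rightarrow> bool" where
  "orbital_labelling G X \<phi> m Z \<longleftrightarrow>
     bij_betw Z {..m} (orbits G (X \<times> X) (\<lambda>g. map_prod (\<phi> g) (\<phi> g))) \<and> Z 0 = Id_on X"

text \<open>The operator \<open>f_u\<close> attached to the orbit \<open>R = Z_u\<close>, extended linearly from
  \<open>f_u(y) = \<Sum> x\<close>, the sum being over all \<open>x\<close> with \<open>(x, y) \<in> R\<close>.\<close>

definition orbital_op :: "'x set \<Rightarrow> ('x \<times> 'x) set \<Rightarrow> ('x \<Rightarrow> complex) \<Rightarrow> 'x \<Rightarrow> complex" where
  "orbital_op X R v = (\<lambda>x. \<Sum>y | y \<in> X \<and> (x, y) \<in> R. v y)"

definition lam ::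
  "'x set \<Rightarrow> (nat \<Rightarrow> ('x \<times> 'x) set) \<Rightarrow> (nat \<Rightarrow> ('x \<Rightarrow> complex) set) \<Rightarrow> nat \<Rightarrow> nat \<Rightarrow> complex" where
  "lam X Z W u w = (THE c. \<forall>v\<in>W w. orbital_op X (Z u) v = cscale c v)"


section \<open>The generalized Boolean algebra and its commutant\<close>

text \<open>\<open>L_0\<close> is \<open>None\<close>; tuples are lists, and their positions are numbered from \<open>0\<close>.\<close>

definition BX :: "'x set \<Rightarrow> nat \<Rightarrow> 'x option list set" where
  "BX X n = {a. length a = n \<and> set a \<subseteq> insert None (Some ` X)}"

definition supp :: "'x option list \<Rightarrow> nat set" where
  "supp a = {i. i < length a \<and> a ! i \<noteq> None}"

definition rk :: "'x option list \<Rightarrow> nat" where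
  "rk a = card (supp a)"

definition BX_le :: "'x option list \<Rightarrow> 'x option list \<Rightarrow> bool" where
  "BX_le a b \<longleftrightarrow> supp a \<subseteq> supp b \<and> (\<forall>i\<in>supp a. a ! i = b ! i)"

definition wreath :: "('g, 'r) monoid_scheme \<Rightarrow> nat \<Rightarrow> ((nat \<Rightarrow> 'g) \<times> (nat \<Rightarrow> nat)) set" where
  "wreath G n = {(g, \<pi>). g \<in> (\<Pi>\<^sub>E i\<in>{..<n}. carrier G) \<and> \<pi> permutes {..<n}}"

fun wreath_act ::
  "('g \<Rightarrow> 'x \<Rightarrow> 'x) \<Rightarrow> nat \<Rightarrow> (nat \<Rightarrow> 'g) \<times> (nat \<Rightarrow> nat) \<Rightarrow> 'x option list \<Rightarrow> 'x option list" where
  "wreath_act \<phi> n (g, \<pi>) a = map (\<lambda>i. map_option (\<phi> (g i)) (a ! inv_into UNIV \<pi> i)) [0..<n]"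

definition equivariant_endos ::
  "('g, 'r) monoid_scheme \<Rightarrow> 'x set \<Rightarrow> ('g \<Rightarrow> 'x \<Rightarrow> 'x) \<Rightarrow> nat \<Rightarrow>
     (('x option list \<Rightarrow> complex) \<Rightarrow> 'x option list \<Rightarrow> complex) set" where
  "equivariant_endos G X \<phi> n =
     {f. Vector_Spaces.linear cscale cscale f \<and> f ` V (BX X n) \<subseteq> V (BX X n) \<and>
         (\<forall>h\<in>wreath G n. \<forall>v\<in>V (BX X n).
            f (push (BX X n) (wreath_act \<phi> n h) v) = push (BX X n) (wreath_act \<phi> n h) (f v))}"

definition matrix_of_op :: "'a set \<Rightarrow> (('a \<Rightarrow> complex) \<Rightarrow> 'a \<Rightarrow> complex) \<Rightarrow> 'a \<Rightarrow> 'a \<Rightarrow> complex" where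
  "matrix_of_op S f = (\<lambda>a b. if a \<in> S \<and> b \<in> S then f (ket b) a else 0)"

definition AX ::
  "('g, 'r) monoid_scheme \<Rightarrow> 'x set \<Rightarrow> ('g \<Rightarrow> 'x \<Rightarrow> 'x) \<Rightarrow> nat \<Rightarrow>
     ('x option list \<Rightarrow> 'x option list \<Rightarrow> complex) set" where
  "AX G X \<phi> n = matrix_of_op (BX X n) ` equivariant_endos G X \<phi> n"

text \<open>\<open>compositions n m\<close> is \<open>C(n, m)\<close>.\<close>

definition compositions :: "nat \<Rightarrow> nat \<Rightarrow> nat list set" where
  "compositions n m = {l. length l = m \<and> sum_list l = n}"

definition orbit_type ::
  "nat \<Rightarrow> (nat \<Rightarrow> ('x \<times> 'x) set) \<Rightarrow> 'x option list \<Rightarrow> 'x option list \<Rightarrow> nat list" where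
  "orbit_type m Z a b =
     map (\<lambda>j. card {i \<in> supp a \<inter> supp b. (the (a ! i), the (b ! i)) \<in> Z j}) [0..<Suc m]"

definition orbit_matrix ::
  "'x set \<Rightarrow> nat \<Rightarrow> (nat \<Rightarrow> ('x \<times> 'x) set) \<Rightarrow> nat \<Rightarrow> nat \<Rightarrow> nat \<Rightarrow> nat \<Rightarrow> nat list \<Rightarrow>
     'x option list \<Rightarrow> 'x option list \<Rightarrow> complex" where
  "orbit_matrix X m Z n i j t l =
     (\<lambda>a b. if a \<in> BX X n \<and> b \<in> BX X n \<and> card (supp a) = i \<and> card (supp b) = j \<and>
               card (supp a \<inter> supp b) = t \<and> orbit_type m Z a b = l then 1 else 0)"

definition IX :: "nat \<Rightarrow> nat \<Rightarrow> (nat \<times> nat \<times> nat \<times> nat list) set" where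
  "IX m n = {(i, j, t, l). t \<le> i \<and> t \<le> j \<and> i + j - t \<le> n \<and> l \<in> compositions t (m + 1)}"


section \<open>Jordan chains in finite graded posets\<close>

text \<open>A poset is given by its finite set \<open>P\<close> of elements, its order \<open>leq\<close>, its rank function
  \<open>r\<close> and its rank \<open>n\<close>.\<close>

definition covers :: "'a set \<Rightarrow> ('a \<Rightarrow> 'a \<Rightarrow> bool) \<Rightarrow> 'a \<Rightarrow> 'a \<Rightarrow> bool" where
  "covers P leq y x \<longleftrightarrow>
     x \<in> P \<and> y \<in> P \<and> leq x y \<and> x \<noteq> y \<and> (\<forall>z\<in>P. leq x z \<and> leq z y \<longrightarrow> z = x \<or> z = y)"

definition up :: "'a set \<Rightarrow> ('a \<Rightarrow> 'a \<Rightarrow> bool) \<Rightarrow> ('a \<Rightarrow> complex) \<Rightarrow> 'a \<Rightarrow> complex" where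
  "up P leq v = (\<lambda>y. \<Sum>x | x \<in> P \<and> covers P leq y x. v x)"

definition homogeneous :: "'a set \<Rightarrow> ('a \<Rightarrow> nat) \<Rightarrow> nat \<Rightarrow> ('a \<Rightarrow> complex) \<Rightarrow> bool" where
  "homogeneous P r i v \<longleftrightarrow> v \<noteq> 0 \<and> v \<in> V {x \<in> P. r x = i}"

definition vrank :: "'a set \<Rightarrow> ('a \<Rightarrow> nat) \<Rightarrow> ('a \<Rightarrow> complex) \<Rightarrow> nat" where
  "vrank P r v = (THE i. homogeneous P r i v)"

definition jordan_chain ::
  "'a set \<Rightarrow> ('a \<Rightarrow> 'a \<Rightarrow> bool) \<Rightarrow> ('a \<Rightarrow> nat) \<Rightarrow> ('a \<Rightarrow> complex) list \<Rightarrow> bool" where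
  "jordan_chain P leq r c \<longleftrightarrow>
     c \<noteq> [] \<and> (\<forall>v\<in>set c. \<exists>i. homogeneous P r i v) \<and>
     (\<forall>q. Suc q < length c \<longrightarrow> up P leq (c ! q) = c ! Suc q) \<and> up P leq (last c) = 0"

definition semisymmetric_chain ::
  "'a set \<Rightarrow> ('a \<Rightarrow> 'a \<Rightarrow> bool) \<Rightarrow> ('a \<Rightarrow> nat) \<Rightarrow> nat \<Rightarrow> ('a \<Rightarrow> complex) list \<Rightarrow> bool" where
  "semisymmetric_chain P leq r n c \<longleftrightarrow>
     jordan_chain P leq r c \<and> vrank P r (hd c) + vrank P r (last c) \<ge> n"

definition disjoint_chains :: "'a list set \<Rightarrow> bool" where
  "disjoint_chains \<C> \<longleftrightarrow> (\<forall>c\<in>\<C>. \<forall>c'\<in>\<C>. c \<noteq> c' \<longrightarrow> set c \<inter> set c' = {})"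

definition chain_union :: "'a list set \<Rightarrow> 'a set" where
  "chain_union \<C> = (\<Union>c\<in>\<C>. set c)"

definition orthogonal_semisymmetric_jordan_basis ::
  "'a set \<Rightarrow> ('a \<Rightarrow> 'a \<Rightarrow> bool) \<Rightarrow> ('a \<Rightarrow> nat) \<Rightarrow> nat \<Rightarrow> ('a \<Rightarrow> complex) set \<Rightarrow> bool" where
  "orthogonal_semisymmetric_jordan_basis P leq r n J \<longleftrightarrow>
     cfun.independent J \<and> cfun.span J = V P \<and>
     (\<forall>u\<in>J. \<forall>v\<in>J. u \<noteq> v \<longrightarrow> cinner P u v = 0) \<and>
     (\<exists>\<C>. (\<forall>c\<in>\<C>. semisymmetric_chain P leq r n c) \<and> disjoint_chains \<C> \<and> J = chain_union \<C>)"

text \<open>The matrix with rows indexed by \<open>S\<close> whose column indexed by \<open>v \<in> J\<close> is \<open>v\<close> itself.\<close>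

definition basis_matrix :: "'a set \<Rightarrow> ('a \<Rightarrow> complex) set \<Rightarrow> 'a \<Rightarrow> ('a \<Rightarrow> complex) \<Rightarrow> complex" where
  "basis_matrix S J = (\<lambda>a v. if a \<in> S \<and> v \<in> J then v a else 0)"

definition conjugate ::
  "'a set \<Rightarrow> ('a \<Rightarrow> 'b \<Rightarrow> complex) \<Rightarrow> ('a \<Rightarrow> 'a \<Rightarrow> complex) \<Rightarrow> 'b \<Rightarrow> 'b \<Rightarrow> complex" where
  "conjugate S U M = mmul S (mmul S (adj U) M) U"


section \<open>Index set, multiplicities and coefficients\<close>

definition ibinom :: "int \<Rightarrow> int \<Rightarrow> int" where
  "ibinom a b = (if a < 0 \<or> b < 0 then 0 else int (nat a choose nat b))"

definition imultinom :: "int \<Rightarrow> int list \<Rightarrow> int" where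
  "imultinom a ks =
     (if a < 0 \<or> (\<exists>k\<in>set ks. k < 0) \<or> a \<noteq> sum_list ks then 0
      else fact (nat a) div prod_list (map (\<lambda>k. fact (nat k)) ks))"

text \<open>The truncated difference \<open>2 * k - n\<close> of natural numbers is \<open>max(0, 2k - n)\<close>.\<close>

definition JX :: "nat \<Rightarrow> nat \<Rightarrow> (nat \<times> nat \<times> nat list) set" where
  "JX m n = {(k, s, p). k \<le> n \<and> 2 * k - n \<le> s \<and> s \<le> k \<and> p \<in> compositions s m}"

text \<open>In \<open>mu\<close> and \<open>alpha\<close>, \<open>p = [p_1, \<dots>, p_m]\<close>, so that \<open>p_w\<close> is \<open>p ! (w - 1)\<close>; in
  \<open>Lambda\<close>, \<open>l\<close> and \<open>p\<close> have \<open>m + 1\<close> entries, numbered from \<open>0\<close>.\<close>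

definition mu :: "nat \<Rightarrow> (nat \<Rightarrow> nat) \<Rightarrow> nat \<Rightarrow> nat \<Rightarrow> nat \<Rightarrow> nat list \<Rightarrow> int" where
  "mu m d n k s p =
     imultinom (int n) ((int n - int s) # map int p) * (\<Prod>w = 1..m. int (d w) ^ (p ! (w - 1))) *
     (ibinom (int n - int s) (int k - int s) - ibinom (int n - int s) (int k - int s - 1))"

definition beta :: "int \<Rightarrow> int \<Rightarrow> int \<Rightarrow> int \<Rightarrow> int \<Rightarrow> complex" where
  "beta n t i j k =
     (\<Sum>u = 0..n. (-1) powi (u - t) *
        of_int (ibinom u t * ibinom (n - 2 * k) (u - k) *
                ibinom (n - k - u) (i - u) * ibinom (n - k - u) (j - u)))"

text \<open>The nonnegative integer matrices with row sums \<open>l\<close> and column sums \<open>p\<close>, rows and columns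
  being indexed by \<open>0, \<dots>, m\<close>.\<close>

definition contingency :: "nat \<Rightarrow> int list \<Rightarrow> int list \<Rightarrow> (nat \<Rightarrow> nat \<Rightarrow> nat) set" where
  "contingency m l p =
     {r. (\<forall>u w. \<not> (u \<le> m \<and> w \<le> m) \<longrightarrow> r u w = 0) \<and>
         (\<forall>u\<le>m. int (\<Sum>w\<le>m. r u w) = l ! u) \<and>
         (\<forall>w\<le>m. int (\<Sum>u\<le>m. r u w) = p ! w)}"

definition Lambda :: "nat \<Rightarrow> (nat \<Rightarrow> nat \<Rightarrow> complex) \<Rightarrow> int list \<Rightarrow> int list \<Rightarrow> complex" where
  "Lambda m ev l p =
     (\<Sum>r\<in>contingency m l p.
        (\<Prod>w\<le>m. of_int (imultinom (p ! w) (map (\<lambda>u. int (r u w)) [0..<Suc m]))) *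
        (\<Prod>u\<le>m. \<Prod>w\<le>m. ev u w ^ r u w))"

definition alpha ::
  "'x set \<Rightarrow> nat \<Rightarrow> (nat \<Rightarrow> nat \<Rightarrow> complex) \<Rightarrow> nat \<Rightarrow> nat \<Rightarrow> nat list \<Rightarrow> nat list \<Rightarrow>
     nat \<Rightarrow> nat \<Rightarrow> nat \<Rightarrow> nat \<Rightarrow> complex" where
  "alpha X m ev n t l p i j k s =
     complex_of_real (real (card X) powr ((real i + real j) / 2 - real t)) *
     Lambda m ev (map int l) ((int t - int s) # map int p) *
     beta (int n - int s) (int t - int s) (int i - int s) (int j - int s) (int k - int s)"

definition unit_matrix :: "nat \<Rightarrow> nat \<Rightarrow> nat \<Rightarrow> nat \<Rightarrow> complex" where
  "unit_matrix i j = (\<lambda>a b. if a = i \<and> b = j then 1 else 0)"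

end

theory Submission
  imports Defs "HOL-Combinatorics.Permutations"
begin

text \<open>\<open>V (BX X n)\<close> is the \<open>n\<close>-th tensor power of \<open>\<complex> L_0 \<oplus> V X\<close>. Fix an orthonormal basis of
  \<open>V X\<close> adapted to \<open>W_0, \<dots>, W_m\<close>. Place basis vectors of the nontrivial \<open>W_w\<close> at \<open>s\<close> chosen
  positions; at each of the remaining \<open>n - s\<close> positions, \<open>L_0\<close> and the normalized sum of \<open>X\<close> span a
  copy of the two-letter alphabet. The resulting subspaces are pairwise orthogonal copies of
  the Boolean algebra of rank \<open>n - s\<close>, on which the up operator is \<open>sqrt |X|\<close> times the Boolean one,
  so an orthonormal family of Boolean primitive vectors generates the Jordan basis.
  The orbit matrices are sums of tensor products: the nontrivial positions contribute the
  eigenvalues \<open>\<lambda>(u, w)\<close>, which together with the trivial ones add up to \<open>\<Lambda>\<close>, and the Boolean part is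
  Schrijver's computation, which gives \<open>\<beta>\<close>. Hence the orbit matrices become block matrices of
  the asserted shape; that every such block matrix occurs follows by counting dimensions.\<close>

section \<open>Orthonormal families\<close>

text \<open>The work is done with the unit vectors \<open>uvec\<close>; the chain vectors
  \<open>raw\<close> are positive multiples of them, so normalizing returns \<open>uvec\<close>, and
  every entry of a conjugated matrix is a value of the form \<open>mform\<close>. Spanning is mostly
  used as a completeness relation: the sum over e of e x * cnj (e y) is 1 if x = y and 0 otherwise.
  Such kernels multiply over positions, which makes the lifted family complete without a dimension
  count. The Boolean part rests on the commutator of raising and lowering, a scalar on each level;
  it yields chain lengths, norms and the effect of powers of one operator on powers of the other.
  The orbit type is the only condition that couples positions: summing over assignments of an
  orbital to each common position turns it into products, and grouping the assignments by
  contingency table gives \<open>Lambda\<close>. In the final count, completeness makes a commutant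
  matrix with zero blocks vanish, so the block images of the orbit matrices are independent, and the
  matrix units are at most as many as they are.\<close>

lemma sum_fun_app: "(\<Sum>i\<in>I. f i) x = (\<Sum>i\<in>I. f i x)"
  by (induction I rule: infinite_finite_induct) simp_all

lemma cinner_diff_left: "cinner S (u - v) w = cinner S u w - cinner S v w"
  by (simp add: cinner_def algebra_simps sum_subtractf)

lemma cinner_diff_right: "cinner S u (v - w) = cinner S u v - cinner S u w"
  by (simp add: cinner_def algebra_simps sum_subtractf)

lemma cinner_zero_left [simp]: "cinner S 0 w = 0"
  and cinner_zero_right [simp]: "cinner S w 0 = 0"
  by (simp_all add: cinner_def)

lemma cinner_scale_left: "cinner S (cscale c u) w = c * cinner S u w"
  by (simp add: cinner_def cscale_def sum_distrib_left mult.assoc)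

lemma cinner_scale_right: "cinner S u (cscale c w) = cnj c * cinner S u w"
  by (simp add: cinner_def cscale_def sum_distrib_left algebra_simps)

lemma cinner_sum_left: "cinner S (\<Sum>i\<in>I. f i) w = (\<Sum>i\<in>I. cinner S (f i) w)"
  unfolding cinner_def sum_fun_app sum_distrib_right by (rule sum.swap)

lemma cinner_sum_right: "cinner S w (\<Sum>i\<in>I. f i) = (\<Sum>i\<in>I. cinner S w (f i))"
  unfolding cinner_def sum_fun_app cnj_sum sum_distrib_left by (rule sum.swap)

lemma cnj_cinner: "cnj (cinner S u v) = cinner S v u"
  by (simp add: cinner_def mult.commute)

lemma cinner_self: "cinner S v v = complex_of_real (\<Sum>x\<in>S. (cmod (v x))\<^sup>2)"
  by (simp add: cinner_def complex_norm_square[symmetric] del: of_real_power)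

lemma cinner_self_L2: "cinner S v v = complex_of_real ((L2_set (\<lambda>x. cmod (v x)) S)\<^sup>2)"
  by (simp add: cinner_self L2_set_def sum_nonneg)

lemma cinner_self_eq_0:
  assumes "finite S" "v \<in> V S"
  shows "cinner S v v = 0 \<longleftrightarrow> v = 0"
proof
  assume "cinner S v v = 0"
  then have "(\<Sum>x\<in>S. (cmod (v x))\<^sup>2) = 0"
    unfolding cinner_self of_real_eq_0_iff .
  then have "\<forall>x\<in>S. v x = 0"
    using assms(1) by (simp add: sum_nonneg_eq_0_iff)
  then show "v = 0"
    using assms(2) by (auto simp: V_def fun_eq_iff)
qed simp

lemma L2_norm_pos:
  assumes "finite S" "v \<in> V S" "v \<noteq> 0"
  shows "0 < L2_set (\<lambda>x. cmod (v x)) S"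
proof -
  have "L2_set (\<lambda>x. cmod (v x)) S \<noteq> 0"
    using cinner_self_eq_0[OF assms(1,2)] assms(3) unfolding cinner_self_L2
    by (metis of_real_0 zero_power2)
  then show ?thesis
    using L2_set_nonneg[of "\<lambda>x. cmod (v x)" S] by linarith
qed

lemma cinner_normalize:
  "cinner S (normalize_vec S u) (normalize_vec S v) = cinner S u v /
     complex_of_real (L2_set (\<lambda>x. cmod (u x)) S * L2_set (\<lambda>x. cmod (v x)) S)"
  by (simp add: normalize_vec_def cinner_scale_left cinner_scale_right)

lemma cinner_normalize_self:
  assumes "finite S" "v \<in> V S" "v \<noteq> 0"
  shows "cinner S (normalize_vec S v) (normalize_vec S v) = 1"
  using L2_norm_pos[OF assms]
  by (simp add: cinner_normalize cinner_self_L2[of S v] power2_eq_square)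

lemma V_subspace: "cfun.subspace (V S)"
  by (auto simp: cfun.subspace_def V_def cscale_def)

lemma V_eq_sum_ket:
  assumes "finite S" "v \<in> V S"
  shows "v = (\<Sum>x\<in>S. cscale (v x) (ket x))"
proof
  fix y
  have "(\<Sum>x\<in>S. cscale (v x) (ket x)) y = (\<Sum>x\<in>S. if y = x then v x else 0)"
    by (simp add: sum_fun_app cscale_def ket_def if_distrib cong: if_cong)
  also have "\<dots> = v y"
    using assms by (auto simp: V_def)
  finally show "v y = (\<Sum>x\<in>S. cscale (v x) (ket x)) y" ..
qed

lemma V_subset_span_ket: "finite S \<Longrightarrow> V S \<subseteq> cfun.span (ket ` S)"
  by (rule subsetI, subst V_eq_sum_ket, assumption+)
    (intro cfun.span_sum cfun.span_scale cfun.span_base imageI)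

lemma ket_in_V [simp]: "ket x \<in> V S \<longleftrightarrow> x \<in> S"
  by (auto simp: V_def ket_def)

lemma cinner_ket_right: "finite S \<Longrightarrow> v \<in> V S \<Longrightarrow> cinner S v (ket x) = v x"
  by (auto simp: cinner_def ket_def V_def if_distrib cong: if_cong)

lemma orthogonal_independent:
  assumes "\<And>u v. u \<in> E \<Longrightarrow> v \<in> E \<Longrightarrow> u \<noteq> v \<Longrightarrow> cinner S u v = 0"
    and "\<And>v. v \<in> E \<Longrightarrow> cinner S v v \<noteq> 0"
  shows "cfun.independent E"
  unfolding cfun.independent_explicit_finite_subsets
proof safe
  fix F u v
  assume F: "F \<subseteq> E" "finite F" and z: "(\<Sum>v\<in>F. cscale (u v) v) = 0" and v: "v \<in> F"
  have "0 = cinner S (\<Sum>v\<in>F. cscale (u v) v) v"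
    by (simp add: z)
  also have "\<dots> = (\<Sum>w\<in>F. u w * cinner S w v)"
    by (simp add: cinner_sum_left cinner_scale_left)
  also have "\<dots> = (\<Sum>w\<in>F. if w = v then u w * cinner S v v else 0)"
    using assms(1) F v by (intro sum.cong) (auto simp: subset_iff)
  also have "\<dots> = u v * cinner S v v"
    using F v by simp
  finally show "u v = 0"
    using assms(2) F v by auto
qed

section \<open>Orthonormal sets: extension, expansion and completeness\<close>

definition orthonormal :: "'a set \<Rightarrow> ('a \<Rightarrow> complex) set \<Rightarrow> bool" where
  "orthonormal S E \<longleftrightarrow>
     E \<subseteq> V S \<and> (\<forall>u\<in>E. \<forall>v\<in>E. cinner S u v = (if u = v then 1 else 0))"

lemma orthonormal_independent: "orthonormal S E \<Longrightarrow> cfun.independent E"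
  by (rule orthogonal_independent[of _ S]) (auto simp: orthonormal_def)

lemma orthonormal_card:
  assumes "finite S" "orthonormal S E"
  shows "finite E \<and> card E \<le> card S"
proof -
  have "E \<subseteq> cfun.span (ket ` S)"
    using assms V_subset_span_ket by (fastforce simp: orthonormal_def)
  then have "finite E \<and> card E \<le> card (ket ` S)"
    using cfun.independent_span_bound[OF _ orthonormal_independent] assms by blast
  then show ?thesis
    using card_image_le[OF assms(1), of ket] by linarith
qed

lemma orthonormal_expand:
  assumes "finite S" "orthonormal S E" "v \<in> cfun.span E"
  shows "v = (\<Sum>e\<in>E. cscale (cinner S v e) e)"
proof -
  have fin: "finite E"
    using orthonormal_card assms by blast
  then obtain u where v: "v = (\<Sum>e\<in>E. cscale (u e) e)"
    using assms(3) by (auto simp: cfun.span_finite)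
  have "cinner S v e = u e" if "e \<in> E" for e
  proof -
    have "cinner S v e = (\<Sum>w\<in>E. u w * cinner S w e)"
      by (simp add: v cinner_sum_left cinner_scale_left)
    also have "\<dots> = (\<Sum>w\<in>E. if w = e then u w else 0)"
      using assms that by (intro sum.cong) (auto simp: orthonormal_def)
    finally show ?thesis
      using fin that by simp
  qed
  then show ?thesis
    by (subst v) (auto intro: sum.cong)
qed

text \<open>Gram-Schmidt in extremal form. Orthonormal sets have at most \<open>card S\<close>
  elements, so one of largest size inside \<open>W\<close> exists; the normalized residual of a
  vector outside its span would enlarge it.\<close>

lemma orthonormal_basis_exists:
  assumes "finite S" "cfun.subspace W" "W \<subseteq> V S"
  obtains E where "orthonormal S E" "E \<subseteq> W" "cfun.span E = W"
proof -
  let ?P = "\<lambda>E. orthonormal S E \<and> E \<subseteq> W"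
  have "?P {}"
    by (simp add: orthonormal_def)
  moreover have "\<forall>E. ?P E \<longrightarrow> card E < Suc (card S)"
    using orthonormal_card[OF assms(1)] by (auto simp: less_Suc_eq_le)
  ultimately have "\<exists>E. ?P E \<and> (\<forall>F. ?P F \<longrightarrow> card F \<le> card E)"
    using ex_has_greatest_nat[of ?P "{}" card "Suc (card S)"] by blast
  then obtain E where E: "?P E" and max: "\<And>F. ?P F \<Longrightarrow> card F \<le> card E"
    by blast
  have fin: "finite E"
    using orthonormal_card E assms(1) by blast
  have "v \<in> cfun.span E" if "v \<in> W" for v
  proof (rule ccontr)
    assume nv: "v \<notin> cfun.span E"
    let ?p = "\<Sum>e\<in>E. cscale (cinner S v e) e"
    let ?u = "v - ?p"
    have pE: "?p \<in> cfun.span E"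
      by (intro cfun.span_sum cfun.span_scale cfun.span_base)
    have "?p \<in> W"
      using pE E cfun.span_minimal assms(2) by blast
    then have uW: "?u \<in> W"
      using that assms(2) cfun.subspace_diff by blast
    have u0: "?u \<noteq> 0"
      using nv pE by auto
    have orth: "cinner S ?u e = 0" if "e \<in> E" for e
    proof -
      have "cinner S ?p e = (\<Sum>w\<in>E. if w = e then cinner S v w else 0)"
        unfolding cinner_sum_left cinner_scale_left
        using E that by (intro sum.cong) (auto simp: orthonormal_def)
      then show ?thesis
        using fin that by (simp add: cinner_diff_left)
    qed
    let ?w = "normalize_vec S ?u"
    have uV: "?u \<in> V S"
      using uW assms(3) by blast
    have ww: "cinner S ?w ?w = 1"
      using cinner_normalize_self[OF assms(1) uV u0] .
    have we: "cinner S ?w e = 0" "cinner S e ?w = 0" if "e \<in> E" for e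
    proof -
      show "cinner S ?w e = 0"
        using orth[OF that] by (simp add: normalize_vec_def cinner_scale_left)
      then have "cnj (cinner S ?w e) = 0"
        by simp
      then show "cinner S e ?w = 0"
        by (simp only: cnj_cinner)
    qed
    have wE: "?w \<notin> E"
      using we ww by fastforce
    have wW: "?w \<in> W"
      using uW assms(2) cfun.subspace_scale unfolding normalize_vec_def by blast
    have "?P (insert ?w E)"
      unfolding orthonormal_def
      using E ww we wW wE assms(3) by (auto simp: orthonormal_def)
    from max[OF this] show False
      using wE fin by simp
  qed
  then have "cfun.span E = W"
    using E cfun.span_minimal[OF _ assms(2)] by blast
  then show ?thesis
    using that E by blast
qed

text \<open>The coefficients of \<open>ket y\<close> in the basis are cnj (e y), and evaluating its
  expansion at \<open>x\<close> gives the kernel. For \<open>y\<close> outside \<open>S\<close>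
  every e y is zero.\<close>

lemma orthonormal_complete:
  assumes "finite S" "orthonormal S E" "V S \<subseteq> cfun.span E" "x \<in> S"
  shows "(\<Sum>e\<in>E. e x * cnj (e y)) = (if x = y then 1 else 0)"
proof (cases "y \<in> S")
  case True
  have "ket y = (\<Sum>e\<in>E. cscale (cinner S (ket y) e) e)"
    using assms True by (intro orthonormal_expand) auto
  moreover have "cinner S (ket y) e = cnj (e y)" if "e \<in> E" for e
    using cinner_ket_right[OF assms(1), of e y] that assms(2)
    by (subst cnj_cinner[symmetric]) (auto simp: orthonormal_def)
  ultimately have "ket y = (\<Sum>e\<in>E. cscale (cnj (e y)) e)"
    by simp
  then have "ket y x = (\<Sum>e\<in>E. cscale (cnj (e y)) e) x"
    by simp
  then show ?thesis
    by (simp add: sum_fun_app cscale_def ket_def mult.commute)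
next
  case False
  then have "e y = 0" if "e \<in> E" for e
    using assms(2) that by (auto simp: orthonormal_def V_def)
  then show ?thesis
    using False assms(4) by (auto intro!: sum.neutral)
qed

text \<open>An independent family that is at least as large as a spanning set of kets leaves no room
  for a further independent vector. Independence is stated by coefficients, which also forces the
  family to be injective. It is applied to the projection kernels on \<open>X\<close> and to the
  block images of the orbit matrices.\<close>

lemma independent_family_spans:
  fixes A :: "'i \<Rightarrow> 'a \<Rightarrow> complex"
  assumes "finite I" "finite K" "card K \<le> card I" "\<And>i. i \<in> I \<Longrightarrow> A i \<in> V K"
    and ind: "\<And>x. (\<Sum>i\<in>I. cscale (x i) (A i)) = 0 \<Longrightarrow> \<forall>i\<in>I. x i = 0"
    and "v \<in> V K"
  shows "\<exists>x. v = (\<Sum>i\<in>I. cscale (x i) (A i))"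
proof -
  have inj: "inj_on A I"
  proof (rule inj_onI, rule ccontr)
    fix i j
    assume ij: "i \<in> I" "j \<in> I" "A i = A j" "i \<noteq> j"
    let ?x = "\<lambda>q. if q = i then 1 else if q = j then - 1 else (0::complex)"
    have "(\<Sum>q\<in>I. cscale (?x q) (A q)) = (\<Sum>q\<in>{i, j}. cscale (?x q) (A q))"
      using ij assms(1) by (intro sum.mono_neutral_right) auto
    also have "\<dots> = 0"
      using ij by simp
    finally show False
      using ind[of ?x] ij by auto
  qed
  have indA: "cfun.independent (A ` I)"
  proof (rule cfun.independent_if_scalars_zero)
    fix f w
    assume "(\<Sum>w\<in>A ` I. cscale (f w) w) = 0" "w \<in> A ` I"
    then show "f w = 0"
      using ind[of "f \<circ> A"] by (auto simp: sum.reindex[OF inj])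
  qed (use assms in simp)
  have sub: "A ` I \<subseteq> cfun.span (ket ` K)"
    using V_subset_span_ket[OF assms(2)] assms(4) by blast
  have "w \<in> cfun.span (A ` I)" if w: "w \<in> ket ` K" for w
  proof (rule ccontr)
    assume nw: "w \<notin> cfun.span (A ` I)"
    then have "cfun.independent (insert w (A ` I))"
      using indA by (simp add: cfun.independent_insert)
    moreover have "insert w (A ` I) \<subseteq> cfun.span (ket ` K)"
      using sub w by (auto intro: cfun.span_base)
    ultimately have "card (insert w (A ` I)) \<le> card (ket ` K :: ('a \<Rightarrow> complex) set)"
      using cfun.independent_span_bound assms(2) by (metis finite_imageI)
    moreover have "card (insert w (A ` I)) = Suc (card I)"
      using nw cfun.span_base[of w "A ` I"] assms(1) card_image[OF inj]
      by (auto simp: card_insert_if)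
    ultimately show False
      using card_image_le[OF assms(2), of ket] assms(3) by linarith
  qed
  then have "cfun.span (ket ` K) \<subseteq> cfun.span (A ` I)"
    by (intro cfun.span_minimal) auto
  then have "v \<in> cfun.span (A ` I)"
    using V_subset_span_ket[OF assms(2)] assms(6) by blast
  then obtain u where "v = (\<Sum>w\<in>A ` I. cscale (u w) w)"
    using assms(1) by (auto simp: cfun.span_finite)
  then show ?thesis
    by (intro exI[of _ "u \<circ> A"]) (simp add: sum.reindex[OF inj])
qed

section \<open>Counting functions with prescribed fibre sizes\<close>

text \<open>A product of multinomial coefficients, one for each fibre of \<open>w\<close>, written
  without division: such a function splits the fibre over v into parts of sizes r u v.\<close>

lemma card_functions_with_cell_counts:
  fixes w :: "'i \<Rightarrow> 'v" and r :: "'u \<Rightarrow> 'v \<Rightarrow> nat"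
  assumes "finite T" "finite Us" "finite Vs" "w ` T \<subseteq> Vs"
    and "\<forall>v\<in>Vs. (\<Sum>u\<in>Us. r u v) = card {i\<in>T. w i = v}"
  shows "card {c \<in> T \<rightarrow>\<^sub>E Us. \<forall>u\<in>Us. \<forall>v\<in>Vs. card {i\<in>T. c i = u \<and> w i = v} = r u v} *
      (\<Prod>u\<in>Us. \<Prod>v\<in>Vs. fact (r u v)) = (\<Prod>v\<in>Vs. fact (card {i\<in>T. w i = v}) :: nat)"
  using assms(1,4,5)
proof (induction T arbitrary: r rule: finite_induct)
  case empty
  have r0: "r u v = 0" if "u \<in> Us" "v \<in> Vs" for u v
    using empty.prems(2) that assms(2) by auto
  have "(\<Prod>u\<in>Us. \<Prod>v\<in>Vs. fact (r u v)) = (1::nat)"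
    by (simp add: r0)
  moreover have "{c \<in> {} \<rightarrow>\<^sub>E Us. \<forall>u\<in>Us. \<forall>v\<in>Vs. card {i\<in>{}. c i = u \<and> w i = v} = r u v}
      = {\<lambda>_. undefined}"
    by (auto simp: r0)
  ultimately show ?case
    by simp
next
  case (insert i0 T)
  define v0 where "v0 = w i0"
  define C where "C T r = {c \<in> T \<rightarrow>\<^sub>E Us. \<forall>u\<in>Us. \<forall>v\<in>Vs. card {i\<in>T. c i = u \<and> w i = v} = r u v}"
    for T r
  \<comment> \<open>The table left for the other points once \<open>i0\<close> has received the
    value u: one unit is taken from the cell (u, v0), which therefore has to be positive.\<close>
  define del where "del u = (\<lambda>u' v'. if u' = u \<and> v' = v0 then r u v0 - 1 else r u' v')" for u
  define A where "A = {u\<in>Us. 0 < r u v0}"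
  have v0: "v0 \<in> Vs" and wT: "w ` T \<subseteq> Vs"
    using insert.prems(1) by (auto simp: v0_def)
  have cellw: "card {i \<in> insert i0 T. w i = v} = card {i\<in>T. w i = v} + (if v = v0 then 1 else 0)"
    for v
  proof -
    have "{i \<in> insert i0 T. w i = v} = (if v = v0 then {i0} else {}) \<union> {i\<in>T. w i = v}"
      by (auto simp: v0_def)
    then show ?thesis
      using insert.hyps by (simp add: card_insert_if)
  qed
  have cell: "card {i \<in> insert i0 T. (c(i0 := u)) i = u' \<and> w i = v'} =
      card {i\<in>T. c i = u' \<and> w i = v'} + (if u' = u \<and> v' = v0 then 1 else 0)" for c u u' v'
  proof -
    have "{i \<in> insert i0 T. (c(i0 := u)) i = u' \<and> w i = v'} =
        (if u' = u \<and> v' = v0 then {i0} else {}) \<union> {i\<in>T. c i = u' \<and> w i = v'}"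
      using insert.hyps by (auto simp: v0_def)
    then show ?thesis
      using insert.hyps by (simp add: card_insert_if)
  qed
  have finC: "finite (C T r)" for r
    by (rule finite_subset[OF _ finite_PiE[OF insert.hyps(1)]]) (use assms(2) in \<open>auto simp: C_def\<close>)
  have mem: "c(i0 := u) \<in> C (insert i0 T) r \<longleftrightarrow> u \<in> A \<and> c \<in> C T (del u)"
    if "c \<in> T \<rightarrow>\<^sub>E Us" "u \<in> Us" for c u
  proof -
    have "c(i0 := u) \<in> insert i0 T \<rightarrow>\<^sub>E Us"
      using that by (auto simp: PiE_iff extensional_def)
    then have "c(i0 := u) \<in> C (insert i0 T) r \<longleftrightarrow>
        (\<forall>u'\<in>Us. \<forall>v'\<in>Vs. card {i\<in>T. c i = u' \<and> w i = v'} + (if u' = u \<and> v' = v0 then 1 else 0) = r u' v')"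
      unfolding C_def mem_Collect_eq cell by simp
    also have "\<dots> \<longleftrightarrow> u \<in> A \<and> (\<forall>u'\<in>Us. \<forall>v'\<in>Vs. card {i\<in>T. c i = u' \<and> w i = v'} = del u u' v')"
      using that v0 by (fastforce simp: del_def A_def)
    finally show ?thesis
      using that by (simp add: C_def)
  qed
  have eq: "C (insert i0 T) r = (\<lambda>(u, c). c(i0 := u)) ` (SIGMA u:A. C T (del u))"
  proof (intro equalityI subsetI)
    fix c assume c: "c \<in> C (insert i0 T) r"
    then have "c \<in> (\<lambda>(y, g). g(i0 := y)) ` (Us \<times> (T \<rightarrow>\<^sub>E Us))"
      by (simp add: C_def PiE_insert_eq)
    then obtain u g where "c = g(i0 := u)" "u \<in> Us" "g \<in> T \<rightarrow>\<^sub>E Us"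
      by auto
    then show "c \<in> (\<lambda>(u, c). c(i0 := u)) ` (SIGMA u:A. C T (del u))"
      using mem c by (intro image_eqI[of _ _ "(u, g)"]) auto
  next
    fix c assume "c \<in> (\<lambda>(u, c). c(i0 := u)) ` (SIGMA u:A. C T (del u))"
    then obtain u g where ug: "c = g(i0 := u)" "u \<in> A" "g \<in> C T (del u)"
      by auto
    then have "g \<in> T \<rightarrow>\<^sub>E Us" "u \<in> Us"
      by (auto simp: C_def A_def)
    then show "c \<in> C (insert i0 T) r"
      using mem ug by auto
  qed
  have inj: "inj_on (\<lambda>(u, c). c(i0 := u)) (SIGMA u:A. C T (del u))"
    using inj_combinator[OF insert.hyps(2), of "\<lambda>_. Us"]
    by (rule inj_on_subset) (auto simp: C_def A_def)
  have finA: "finite A"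
    using assms(2) by (simp add: A_def)
  have fr: "(\<Prod>u'\<in>Us. \<Prod>v\<in>Vs. fact (r u' v)) = r u v0 * (\<Prod>u'\<in>Us. \<Prod>v\<in>Vs. fact (del u u' v) :: nat)"
    if u: "u \<in> A" for u
  proof -
    have uv: "(u, v0) \<in> Us \<times> Vs"
      using u v0 by (simp add: A_def)
    have fin: "finite (Us \<times> Vs)"
      using assms by simp
    have "(\<Prod>u'\<in>Us. \<Prod>v\<in>Vs. fact (r u' v)) =
        fact (r u v0) * (\<Prod>(u', v)\<in>Us \<times> Vs - {(u, v0)}. fact (r u' v) :: nat)"
      unfolding prod.cartesian_product by (subst prod.remove[OF fin uv]) simp
    also have "(\<Prod>(u', v)\<in>Us \<times> Vs - {(u, v0)}. fact (r u' v) :: nat) =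
        (\<Prod>(u', v)\<in>Us \<times> Vs - {(u, v0)}. fact (del u u' v))"
    proof (intro prod.cong refl)
      fix y assume "y \<in> Us \<times> Vs - {(u, v0)}"
      then have "\<not> (fst y = u \<and> snd y = v0)"
        by auto
      then show "case_prod (\<lambda>u' v. fact (r u' v) :: nat) y = case_prod (\<lambda>u' v. fact (del u u' v)) y"
        by (auto simp: del_def split_beta)
    qed
    also have "fact (r u v0) = r u v0 * (fact (del u u v0) :: nat)"
      using u fact_reduce[of "r u v0", where 'a = nat] by (simp add: A_def del_def)
    finally show ?thesis
      unfolding prod.cartesian_product by (subst prod.remove[OF fin uv]) (simp add: mult.assoc)
  qed
  have IH: "card (C T (del u)) * (\<Prod>u'\<in>Us. \<Prod>v\<in>Vs. fact (del u u' v)) =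
      (\<Prod>v\<in>Vs. fact (card {i\<in>T. w i = v}) :: nat)" if u: "u \<in> A" for u
    unfolding C_def
  proof (rule insert.IH[OF wT], rule ballI)
    fix v assume v: "v \<in> Vs"
    have "(\<Sum>u'\<in>Us. r u' v) = (\<Sum>u'\<in>Us. del u u' v + (if u' = u \<and> v = v0 then 1 else 0))"
      using u by (intro sum.cong) (auto simp: del_def A_def)
    also have "\<dots> = (\<Sum>u'\<in>Us. del u u' v) + (if v = v0 then 1 else 0)"
      using u assms(2) by (simp add: sum.distrib A_def)
    finally show "(\<Sum>u'\<in>Us. del u u' v) = card {i\<in>T. w i = v}"
      using insert.prems(2) v cellw[of v] by simp
  qed
  have "card (C (insert i0 T) r) * (\<Prod>u\<in>Us. \<Prod>v\<in>Vs. fact (r u v)) =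
      (\<Sum>u\<in>A. card (C T (del u)) * (\<Prod>u\<in>Us. \<Prod>v\<in>Vs. fact (r u v)))"
    unfolding eq card_image[OF inj] using finA finC by (simp add: sum_distrib_right)
  \<comment> \<open>Every choice of u contributes r u v0 times one common product. These factors add
    up to the column sum at v0, the size of the enlarged fibre, which is exactly what its factorial
    gains.\<close>
  also have "\<dots> = (\<Sum>u\<in>A. r u v0 * (\<Prod>v\<in>Vs. fact (card {i\<in>T. w i = v})))"
  proof (intro sum.cong refl)
    fix u assume u: "u \<in> A"
    show "card (C T (del u)) * (\<Prod>u\<in>Us. \<Prod>v\<in>Vs. fact (r u v)) =
        r u v0 * (\<Prod>v\<in>Vs. fact (card {i\<in>T. w i = v}))"
      unfolding fr[OF u] IH[OF u, symmetric] by (simp only: mult.left_commute)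
  qed
  also have "\<dots> = (\<Sum>u\<in>A. r u v0) * (\<Prod>v\<in>Vs. fact (card {i\<in>T. w i = v}))"
    by (simp add: sum_distrib_right)
  also have "(\<Sum>u\<in>A. r u v0) = (\<Sum>u\<in>Us. r u v0)"
    using assms(2) by (intro sum.mono_neutral_left) (auto simp: A_def)
  also have "\<dots> = card {i \<in> insert i0 T. w i = v0}"
    using insert.prems(2) v0 by blast
  also have "\<dots> * (\<Prod>v\<in>Vs. fact (card {i\<in>T. w i = v})) =
      (\<Prod>v\<in>Vs. fact (card {i \<in> insert i0 T. w i = v}))"
  proof -
    have *: "(\<Prod>v\<in>Vs - {v0}. fact (card {i \<in> insert i0 T. w i = v})) =
        (\<Prod>v\<in>Vs - {v0}. fact (card {i\<in>T. w i = v}) :: nat)"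
      unfolding cellw by (intro prod.cong) auto
    show ?thesis
      unfolding prod.remove[OF assms(3) v0] * unfolding cellw by (simp add: algebra_simps)
  qed
  finally show ?case
    by (simp add: C_def)
qed

text \<open>The case of a single fibre, with \<open>w\<close> constant in the unit type.\<close>

lemma card_functions_with_counts:
  fixes l :: "'u \<Rightarrow> nat" and T :: "'i set"
  assumes "finite T" "finite Us" "(\<Sum>u\<in>Us. l u) = card T"
  shows "card {c \<in> T \<rightarrow>\<^sub>E Us. \<forall>u\<in>Us. card {i\<in>T. c i = u} = l u} * (\<Prod>u\<in>Us. fact (l u)) =
      (fact (card T) :: nat)"
  using card_functions_with_cell_counts[of T Us "{()}" "\<lambda>_ :: 'i. ()" "\<lambda>u _. l u"] assms
  by (simp add: image_subset_iff)

lemma card_functions_with_counts_div: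
  fixes l :: "'u \<Rightarrow> nat"
  assumes "finite T" "finite Us" "(\<Sum>u\<in>Us. l u) = card T"
  shows "card {c \<in> T \<rightarrow>\<^sub>E Us. \<forall>u\<in>Us. card {i\<in>T. c i = u} = l u} =
      fact (card T) div (\<Prod>u\<in>Us. fact (l u))"
  unfolding card_functions_with_counts[OF assms, symmetric]
  by (rule nonzero_mult_div_cancel_right[symmetric]) (use assms(2) in simp)

text \<open>In the counting identity the right-hand side is a factorial, so the number of such
  functions cannot be zero.\<close>

lemma functions_with_counts_exist:
  fixes l :: "'u \<Rightarrow> nat"
  assumes "finite T" "finite Us" "(\<Sum>u\<in>Us. l u) = card T"
  obtains c where "c \<in> T \<rightarrow>\<^sub>E Us" "\<And>u. u \<in> Us \<Longrightarrow> card {i\<in>T. c i = u} = l u"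
proof -
  have "card {c \<in> T \<rightarrow>\<^sub>E Us. \<forall>u\<in>Us. card {i\<in>T. c i = u} = l u} \<noteq> 0"
    using card_functions_with_counts[OF assms] by (metis fact_nonzero mult_is_0)
  then have "{c \<in> T \<rightarrow>\<^sub>E Us. \<forall>u\<in>Us. card {i\<in>T. c i = u} = l u} \<noteq> {}"
    by (metis card.empty)
  then show ?thesis
    using that by auto
qed

section \<open>From labelled positions to sums over contingency tables\<close>

lemma imultinom_upto:
  assumes "a = int (\<Sum>u\<le>m. l u)"
  shows "imultinom a (map (\<lambda>u. int (l u)) [0..<Suc m]) =
    int (fact (\<Sum>u\<le>m. l u) div (\<Prod>u\<le>m. fact (l u)))"
proof -
  have set: "set [0..<Suc m] = {..m}"
    by auto
  have 1: "sum_list (map (\<lambda>u. int (l u)) [0..<Suc m]) = int (\<Sum>u\<le>m. l u)"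
    unfolding sum.distinct_set_conv_list[OF distinct_upt, symmetric] set by simp
  have 2: "prod_list (map (\<lambda>u. fact (l u) :: int) [0..<Suc m]) = (\<Prod>u\<le>m. fact (l u))"
    unfolding prod.distinct_set_conv_list[OF distinct_upt, symmetric] set by simp
  have 3: "prod_list (map (\<lambda>k. fact (nat k)) (map (\<lambda>u. int (l u)) [0..<Suc m])) =
      int (\<Prod>u\<le>m. fact (l u))"
    using 2 by (simp add: comp_def)
  show ?thesis
    unfolding imultinom_def 3 1 assms by (auto simp: zdiv_int simp del: of_nat_sum of_nat_prod)
qed

lemma prod_by_cells:
  fixes h :: "'u \<Rightarrow> 'v \<Rightarrow> 'c::comm_monoid_mult"
  assumes "finite T" "finite Us" "finite Vs" "c ` T \<subseteq> Us" "w ` T \<subseteq> Vs"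
  shows "(\<Prod>i\<in>T. h (c i) (w i)) = (\<Prod>u\<in>Us. \<Prod>v\<in>Vs. h u v ^ card {i\<in>T. c i = u \<and> w i = v})"
proof -
  have "(\<Prod>i\<in>T. h (c i) (w i)) =
      (\<Prod>y\<in>Us \<times> Vs. \<Prod>i\<in>{i\<in>T. (c i, w i) = y}. h (c i) (w i))"
    using assms by (intro prod.group[symmetric]) auto
  also have "\<dots> = (\<Prod>(u, v)\<in>Us \<times> Vs. h u v ^ card {i\<in>T. c i = u \<and> w i = v})"
    by (intro prod.cong) auto
  finally show ?thesis
    by (simp add: prod.cartesian_product)
qed

text \<open>Each entry is bounded by its column sum, hence by the largest entry of \<open>p\<close>.
  Finiteness is what permits grouping functions by their tables.\<close>

lemma finite_contingency:
  assumes "length p = Suc m"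
  shows "finite (contingency m l p)"
proof -
  let ?b = "nat (Max (set p))"
  have "contingency m l p \<subseteq> (\<lambda>f u w. if u \<le> m \<and> w \<le> m then f (u, w) else 0) `
      (({..m} \<times> {..m}) \<rightarrow>\<^sub>E {..?b})"
  proof
    fix r assume r: "r \<in> contingency m l p"
    have b: "r u w \<le> ?b" if "u \<le> m" "w \<le> m" for u w
    proof -
      have "r u w \<le> (\<Sum>u\<le>m. r u w)"
        using that by (intro member_le_sum) auto
      also have "int (\<Sum>u\<le>m. r u w) \<le> Max (set p)"
        using r that assms by (auto simp: contingency_def intro!: Max_ge)
      finally show ?thesis
        by linarith
    qed
    show "r \<in> (\<lambda>f u w. if u \<le> m \<and> w \<le> m then f (u, w) else 0) `
      (({..m} \<times> {..m}) \<rightarrow>\<^sub>E {..?b})"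
      by (rule image_eqI[of _ _ "restrict (case_prod r) ({..m} \<times> {..m})"])
        (use r b in \<open>auto simp: contingency_def fun_eq_iff\<close>)
  qed
  then show ?thesis
    by (rule finite_subset) (auto intro!: finite_PiE)
qed

text \<open>Origin of \<open>Lambda\<close>: group the functions by the table counting the i with c
  i = u and w i = v. On a group the product of the values of \<open>ev\<close> is constant, and the
  size of the group is a product of multinomial coefficients, one per column.\<close>

lemma sum_functions_eq_Lambda:
  assumes T: "finite T" and w: "w ` T \<subseteq> {..m}" and len: "length p = Suc m"
    and l: "\<And>u. u \<le> m \<Longrightarrow> ls ! u = int (l u)"
    and p: "\<And>v. v \<le> m \<Longrightarrow> p ! v = int (card {i\<in>T. w i = v})"
  shows "(\<Sum>c\<in>{c \<in> T \<rightarrow>\<^sub>E {..m}. \<forall>u\<le>m. card {i\<in>T. c i = u} = l u}. \<Prod>i\<in>T. ev (c i) (w i)) =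
    Lambda m ev ls p"
proof -
  let ?C = "{c \<in> T \<rightarrow>\<^sub>E {..m}. \<forall>u\<le>m. card {i\<in>T. c i = u} = l u}"
  define F where "F c = (\<lambda>u v. if u \<le> m \<and> v \<le> m then card {i\<in>T. c i = u \<and> w i = v} else 0)"
    for c :: "'a \<Rightarrow> nat"
  have finC: "finite ?C"
    by (rule finite_subset[OF _ finite_PiE[OF T, of "\<lambda>_. {..m}"]]) auto
  have rows: "(\<Sum>v\<le>m. card {i\<in>T. c i = u \<and> w i = v}) = card {i\<in>T. c i = u}" for c :: "'a \<Rightarrow> nat" and u
  proof -
    have "card {i\<in>T. c i = u} = (\<Sum>i\<in>{i\<in>T. c i = u}. 1)"
      by simp
    also have "\<dots> = (\<Sum>v\<in>{..m}. \<Sum>i\<in>{i\<in>{i\<in>T. c i = u}. w i = v}. 1)"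
      using T w by (intro sum.group[symmetric]) auto
    finally show ?thesis
      by (simp add: conj_assoc)
  qed
  have cols: "(\<Sum>u\<le>m. card {i\<in>T. c i = u \<and> w i = v}) = card {i\<in>T. w i = v}"
    if "c \<in> T \<rightarrow>\<^sub>E {..m}" for c :: "'a \<Rightarrow> nat" and v
  proof -
    have "card {i\<in>T. w i = v} = (\<Sum>i\<in>{i\<in>T. w i = v}. 1)"
      by simp
    also have "\<dots> = (\<Sum>u\<in>{..m}. \<Sum>i\<in>{i\<in>{i\<in>T. w i = v}. c i = u}. 1)"
      using T that by (intro sum.group[symmetric]) auto
    finally show ?thesis
      by (simp add: conj_ac)
  qed
  have FC: "F ` ?C \<subseteq> contingency m ls p"
    using rows cols by (auto simp: contingency_def F_def l p simp flip: of_nat_sum)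
  have "(\<Sum>c\<in>?C. \<Prod>i\<in>T. ev (c i) (w i)) =
      (\<Sum>r\<in>contingency m ls p. \<Sum>c\<in>{c\<in>?C. F c = r}. \<Prod>i\<in>T. ev (c i) (w i))"
    using finC finite_contingency[OF len] FC by (intro sum.group[symmetric])
  also have "\<dots> = Lambda m ev ls p"
    unfolding Lambda_def
  proof (rule sum.cong[OF refl])
    fix r assume r: "r \<in> contingency m ls p"
    have rl: "(\<Sum>v\<le>m. r u v) = l u" if "u \<le> m" for u
      using r that by (auto simp: contingency_def l simp flip: of_nat_sum)
    have rp: "(\<Sum>u\<le>m. r u v) = card {i\<in>T. w i = v}" if "v \<le> m" for v
      using r that by (auto simp: contingency_def p simp flip: of_nat_sum)
    have r0: "r u v = 0" if "\<not> (u \<le> m \<and> v \<le> m)" for u v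
      using r that by (auto simp: contingency_def)
    let ?D = "{c \<in> T \<rightarrow>\<^sub>E {..m}. \<forall>u\<in>{..m}. \<forall>v\<in>{..m}. card {i\<in>T. c i = u \<and> w i = v} = r u v}"
    have D: "{c\<in>?C. F c = r} = ?D"
    proof (intro equalityI subsetI)
      fix c assume "c \<in> ?D"
      moreover from this have "F c = r"
        by (auto simp: F_def fun_eq_iff r0)
      moreover have "card {i\<in>T. c i = u} = l u" if "u \<le> m" for u
        using rows[of c u] rl[OF that] \<open>c \<in> ?D\<close> that by simp
      ultimately show "c \<in> {c\<in>?C. F c = r}"
        by simp
    qed (auto simp: F_def)
    have "(\<Prod>i\<in>T. ev (c i) (w i)) = (\<Prod>u\<le>m. \<Prod>v\<le>m. ev u v ^ r u v)" if c: "c \<in> ?D" for c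
    proof -
      have "(\<Prod>i\<in>T. ev (c i) (w i)) =
          (\<Prod>u\<le>m. \<Prod>v\<le>m. ev u v ^ card {i\<in>T. c i = u \<and> w i = v})"
        using T w c by (intro prod_by_cells) auto
      then show ?thesis
        using c by simp
    qed
    then have *: "(\<Sum>c\<in>{c\<in>?C. F c = r}. \<Prod>i\<in>T. ev (c i) (w i)) =
        of_nat (card ?D) * (\<Prod>u\<le>m. \<Prod>v\<le>m. ev u v ^ r u v)"
      unfolding D by simp
    have cD: "card ?D = (\<Prod>v\<le>m. fact (\<Sum>u\<le>m. r u v) div (\<Prod>u\<le>m. fact (r u v)))"
    proof -
      \<comment> \<open>The counting identity itself gives the divisibility, so that
        \<open>div\<close> in the multinomial coefficients is exact.\<close>
      have dvd: "(\<Prod>u\<le>m. fact (r u v)) dvd (fact (\<Sum>u\<le>m. r u v) :: nat)" for v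
        using card_functions_with_counts[of "{..<\<Sum>u\<le>m. r u v}" "{..m}" "\<lambda>u. r u v"]
        unfolding card_lessThan by (metis (no_types, lifting) dvd_triv_right finite_atMost finite_lessThan)
      have "card ?D * (\<Prod>u\<le>m. \<Prod>v\<le>m. fact (r u v)) =
          (\<Prod>v\<le>m. fact (card {i\<in>T. w i = v}) :: nat)"
        using T w rp by (intro card_functions_with_cell_counts) auto
      also have "\<dots> = (\<Prod>v\<le>m. (fact (\<Sum>u\<le>m. r u v) div (\<Prod>u\<le>m. fact (r u v))) *
          (\<Prod>u\<le>m. fact (r u v)))"
        by (intro prod.cong refl) (simp add: rp[symmetric] dvd dvd_div_mult_self)
      also have "\<dots> = (\<Prod>v\<le>m. fact (\<Sum>u\<le>m. r u v) div (\<Prod>u\<le>m. fact (r u v))) *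
          (\<Prod>u\<le>m. \<Prod>v\<le>m. fact (r u v))"
        unfolding prod.distrib by (rule arg_cong[OF prod.swap])
      finally show ?thesis
        by (simp add: prod_zero_iff)
    qed
    have im: "imultinom (p ! v) (map (\<lambda>u. int (r u v)) [0..<Suc m]) =
        int (fact (\<Sum>u\<le>m. r u v) div (\<Prod>u\<le>m. fact (r u v)))" if "v \<le> m" for v
      using that by (intro imultinom_upto) (simp add: p rp)
    have "(\<Prod>w\<le>m. of_int (imultinom (p ! w) (map (\<lambda>u. int (r u w)) [0..<Suc m]))) =
        (of_nat (card ?D) :: complex)"
      unfolding cD of_nat_prod by (intro prod.cong refl) (simp add: im del: upt_Suc of_nat_sum)
    then show "(\<Sum>c\<in>{c\<in>?C. F c = r}. \<Prod>i\<in>T. ev (c i) (w i)) =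
        (\<Prod>w\<le>m. of_int (imultinom (p ! w) (map (\<lambda>u. int (r u w)) [0..<Suc m]))) *
        (\<Prod>u\<le>m. \<Prod>w\<le>m. ev u w ^ r u w)"
      unfolding * by (rule arg_cong2[where f = "(*)", OF sym refl])
  qed
  finally show ?thesis .
qed

section \<open>Jordan chains in the Boolean algebra\<close>

lemma orthogonal_projection_exists:
  assumes "finite S" "cfun.subspace W" "W \<subseteq> V S"
  obtains p where "p \<in> W" "\<And>w. w \<in> W \<Longrightarrow> cinner S (v - p) w = 0"
proof -
  obtain E where E: "orthonormal S E" "E \<subseteq> W" "cfun.span E = W"
    using orthonormal_basis_exists[OF assms] .
  have fin: "finite E"
    using orthonormal_card[OF assms(1) E(1)] by blast
  let ?p = "\<Sum>e\<in>E. cscale (cinner S v e) e"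
  have orth: "cinner S (v - ?p) e = 0" if "e \<in> E" for e
  proof -
    have "cinner S ?p e = (\<Sum>w\<in>E. if w = e then cinner S v w else 0)"
      unfolding cinner_sum_left cinner_scale_left
      using E that by (intro sum.cong) (auto simp: orthonormal_def)
    then show ?thesis
      using fin that by (simp add: cinner_diff_left)
  qed
  have "cinner S (v - ?p) w = 0" if "w \<in> W" for w
  proof -
    have "w \<in> cfun.span E"
      using that E by simp
    then obtain u where "w = (\<Sum>e\<in>E. cscale (u e) e)"
      using fin by (auto simp: cfun.span_finite)
    then show ?thesis
      using orth by (simp add: cinner_sum_right cinner_scale_right)
  qed
  moreover have "?p \<in> W"
    unfolding E(3)[symmetric] by (intro cfun.span_sum cfun.span_scale cfun.span_base)
  ultimately show ?thesis
    using that by blast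
qed

text \<open>The indexed form allows sums over labels of basis vectors. Distinct labels automatically
  give distinct vectors.\<close>

definition orthonormal_family :: "'a set \<Rightarrow> 'i set \<Rightarrow> ('i \<Rightarrow> 'a \<Rightarrow> complex) \<Rightarrow> bool" where
  "orthonormal_family S I f \<longleftrightarrow> (\<forall>i\<in>I. f i \<in> V S) \<and>
     (\<forall>i\<in>I. \<forall>j\<in>I. cinner S (f i) (f j) = (if i = j then 1 else 0))"

lemma orthonormal_family_image:
  assumes "orthonormal_family S I f"
  shows "inj_on f I" "orthonormal S (f ` I)"
proof -
  show inj: "inj_on f I"
    using assms unfolding orthonormal_family_def inj_on_def by (metis zero_neq_one)
  show "orthonormal S (f ` I)"
    using assms inj by (fastforce simp: orthonormal_family_def orthonormal_def inj_on_def)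
qed

lemma orthonormal_family_complete:
  assumes "finite S" "orthonormal_family S I f" "V S \<subseteq> cfun.span (f ` I)" "x \<in> S"
  shows "(\<Sum>i\<in>I. f i x * cnj (f i y)) = (if x = y then 1 else 0)"
  using orthonormal_complete[OF assms(1) orthonormal_family_image(2)[OF assms(2)] assms(3,4), of y]
  by (simp add: sum.reindex[OF orthonormal_family_image(1)[OF assms(2)]])

lemma orthonormal_family_finite:
  assumes "finite S" "orthonormal_family S I f"
  shows "finite I"
  using orthonormal_card[OF assms(1) orthonormal_family_image(2)[OF assms(2)]]
    orthonormal_family_image(1)[OF assms(2)] finite_imageD by blast

text \<open>Compute the trace of the completeness kernel in two ways, by members of the family and
  by points of \<open>S\<close>.\<close>

lemma orthonormal_family_card:
  assumes "finite S" "orthonormal_family S I f" "V S \<subseteq> cfun.span (f ` I)"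
  shows "card I = card S"
proof -
  have fin: "finite I"
    using orthonormal_family_finite[OF assms(1,2)] .
  have "(of_nat (card I) :: complex) = (\<Sum>i\<in>I. cinner S (f i) (f i))"
    using assms(2) by (simp add: orthonormal_family_def)
  also have "\<dots> = (\<Sum>x\<in>S. \<Sum>i\<in>I. f i x * cnj (f i x))"
    unfolding cinner_def by (rule sum.swap)
  also have "\<dots> = of_nat (card S)"
    using orthonormal_family_complete[OF assms] by simp
  finally show ?thesis
    by simp
qed

section \<open>The raising and lowering operators on subsets\<close>

definition level :: "'i set \<Rightarrow> nat \<Rightarrow> 'i set set" where
  "level T j = {A. A \<subseteq> T \<and> card A = j}"

text \<open>In coordinates this is the up operator of the subset lattice: the value at a set
  collects the sets that it covers. \<open>lower\<close> is the transpose.\<close>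

definition raise :: "'i set \<Rightarrow> ('i set \<Rightarrow> complex) \<Rightarrow> 'i set \<Rightarrow> complex" where
  "raise T y = (\<lambda>A. if A \<subseteq> T then \<Sum>i\<in>A. y (A - {i}) else 0)"

definition lower :: "'i set \<Rightarrow> ('i set \<Rightarrow> complex) \<Rightarrow> 'i set \<Rightarrow> complex" where
  "lower T y = (\<lambda>A. if A \<subseteq> T then \<Sum>i\<in>T - A. y (insert i A) else 0)"

text \<open>The lowest weight vectors of rank \<open>k\<close> for the sl2 action given by
  \<open>raise\<close> and \<open>lower\<close>.\<close>

definition primitive :: "'i set \<Rightarrow> nat \<Rightarrow> ('i set \<Rightarrow> complex) set" where
  "primitive T k = {y \<in> V (level T k). lower T y = 0}"

lemma level_subset: "level T j \<subseteq> Pow T"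
  by (auto simp: level_def)

lemma V_mono: "S \<subseteq> S' \<Longrightarrow> V S \<subseteq> V S'"
  by (auto simp: V_def)

lemma raise_add: "raise T (y + z) = raise T y + raise T z"
  and raise_scale: "raise T (cscale c y) = cscale c (raise T y)"
  and lower_add: "lower T (y + z) = lower T y + lower T z"
  and lower_scale: "lower T (cscale c y) = cscale c (lower T y)"
  by (auto simp: raise_def lower_def fun_eq_iff sum.distrib cscale_def sum_distrib_left)

lemma raise_zero [simp]: "raise T 0 = 0" and lower_zero [simp]: "lower T 0 = 0"
  by (auto simp: raise_def lower_def fun_eq_iff)

lemma linear_raise: "Vector_Spaces.linear cscale cscale (raise T)"
  by unfold_locales (simp_all only: raise_add raise_scale)

lemma raise_pow_scale: "(raise T ^^ r) (cscale c y) = cscale c ((raise T ^^ r) y)"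
  by (induction r) (simp_all add: raise_scale)

lemma raise_adjoint:
  assumes "finite T"
  shows "cinner (Pow T) (raise T y) z = cinner (Pow T) y (lower T z)"
proof -
  have "cinner (Pow T) (raise T y) z = (\<Sum>A\<in>Pow T. \<Sum>i\<in>A. y (A - {i}) * cnj (z A))"
    by (simp add: cinner_def raise_def sum_distrib_right)
  also have "\<dots> = (\<Sum>(A, i)\<in>(SIGMA A:Pow T. A). y (A - {i}) * cnj (z A))"
    using assms finite_subset by (intro sum.Sigma) auto
  also have "\<dots> = (\<Sum>(B, i)\<in>(SIGMA B:Pow T. T - B). y B * cnj (z (insert i B)))"
    by (rule sum.reindex_bij_witness[of _ "\<lambda>(B, i). (insert i B, i)" "\<lambda>(A, i). (A - {i}, i)"])
      (auto simp: insert_absorb)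
  also have "\<dots> = (\<Sum>B\<in>Pow T. \<Sum>i\<in>T - B. y B * cnj (z (insert i B)))"
    using assms finite_subset by (intro sum.Sigma[symmetric]) auto
  also have "\<dots> = cinner (Pow T) y (lower T z)"
    by (simp add: cinner_def lower_def sum_distrib_left)
  finally show ?thesis .
qed

lemma lower_adjoint:
  assumes "finite T"
  shows "cinner (Pow T) (lower T y) z = cinner (Pow T) y (raise T z)"
  using raise_adjoint[OF assms, of z y] by (metis cnj_cinner)

lemma raise_level:
  assumes "finite T" "y \<in> V (level T j)"
  shows "raise T y \<in> V (level T (Suc j))"
  unfolding V_def
proof (intro CollectI allI impI)
  fix A assume A: "A \<notin> level T (Suc j)"
  have "y (A - {i}) = 0" if "A \<subseteq> T" "i \<in> A" for i
  proof -
    have "card A \<noteq> Suc j" "finite A"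
      using A that assms(1) finite_subset by (auto simp: level_def)
    then have "A - {i} \<notin> level T j"
      using card_Suc_Diff1[of A i] that by (auto simp: level_def simp del: card_Diff_insert)
    then show ?thesis
      using assms(2) by (auto simp: V_def)
  qed
  then show "raise T y A = 0"
    by (simp add: raise_def)
qed

lemma lower_level:
  assumes "finite T" "y \<in> V (level T (Suc j))"
  shows "lower T y \<in> V (level T j)"
  unfolding V_def
proof (intro CollectI allI impI)
  fix A assume A: "A \<notin> level T j"
  have "y (insert i A) = 0" if "A \<subseteq> T" "i \<in> T - A" for i
  proof -
    have "insert i A \<notin> level T (Suc j)"
      using A that assms(1) finite_subset[of A T] by (auto simp: level_def)
    then show ?thesis
      using assms(2) by (auto simp: V_def)
  qed
  then show "lower T y A = 0"
    by (simp add: lower_def)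
qed

lemma raise_pow_level:
  assumes "finite T" "y \<in> V (level T k)"
  shows "(raise T ^^ r) y \<in> V (level T (k + r))"
  by (induction r) (simp_all add: assms raise_level)

lemma lower_level_0:
  assumes "finite T" "y \<in> V (level T 0)"
  shows "lower T y = 0"
proof
  fix A
  have "y (insert i A) = 0" if "A \<subseteq> T" for i
  proof -
    have "insert i A \<notin> level T 0"
      using that assms(1) finite_subset[of A T] by (auto simp: level_def)
    then show ?thesis
      using assms(2) by (auto simp: V_def)
  qed
  then show "lower T y A = 0 A"
    by (simp add: lower_def)
qed

text \<open>Adding one element and removing a different one gives the same exchanges in either
  order. The two sides differ only in the returns to the set itself: card T - j for one order, j for
  the other.\<close>

lemma lower_raise_commutator:
  assumes T: "finite T" and y: "y \<in> V (level T j)"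
  shows "lower T (raise T y) = raise T (lower T y) + cscale (of_int (int (card T) - 2 * int j)) y"
proof
  fix A
  show "lower T (raise T y) A =
      (raise T (lower T y) + cscale (of_int (int (card T) - 2 * int j)) y) A"
  proof (cases "A \<subseteq> T")
    case False
    then have "A \<notin> level T j"
      by (simp add: level_def)
    then show ?thesis
      using False y by (auto simp: lower_def raise_def V_def cscale_def)
  next
    case A: True
    have finA: "finite A" and finTA: "finite (T - A)"
      using A T finite_subset by auto
    have "lower T (raise T y) A = (\<Sum>i\<in>T - A. \<Sum>k\<in>insert i A. y (insert i A - {k}))"
      using A by (auto simp: lower_def raise_def intro!: sum.cong)
    also have "\<dots> = (\<Sum>i\<in>T - A. y A + (\<Sum>k\<in>A. y (insert i A - {k})))"
      using finA by (intro sum.cong refl) (auto simp: insert_Diff_if)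
    also have "\<dots> = of_nat (card (T - A)) * y A + (\<Sum>i\<in>T - A. \<Sum>k\<in>A. y (insert i A - {k}))"
      by (simp add: sum.distrib)
    finally have 1: "lower T (raise T y) A = \<dots>" .
    have "raise T (lower T y) A = (\<Sum>k\<in>A. \<Sum>i\<in>insert k (T - A). y (insert i (A - {k})))"
      using A by (auto simp: lower_def raise_def intro!: sum.cong)
    also have "\<dots> = (\<Sum>k\<in>A. y A + (\<Sum>i\<in>T - A. y (insert i A - {k})))"
      using finTA by (intro sum.cong refl arg_cong2[where f = "(+)"])
        (auto simp: insert_absorb insert_Diff_if intro!: sum.cong)
    also have "\<dots> = of_nat (card A) * y A + (\<Sum>i\<in>T - A. \<Sum>k\<in>A. y (insert i A - {k}))"
      by (simp add: sum.distrib sum.swap[of _ "T - A" A])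
    finally have 2: "raise T (lower T y) A = \<dots>" .
    have c: "card (T - A) = card T - card A" "card A \<le> card T"
      using A T finA by (auto simp: card_Diff_subset card_mono)
    have "y A = 0 \<or> card A = j"
      using y A by (auto simp: V_def level_def)
    then show ?thesis
      using c by (auto simp: 1 2 cscale_def algebra_simps of_nat_diff)
  qed
qed

text \<open>The commutator scalars card T - 2 (k + q) for q = 0, ..., r add up to (r + 1) (card T -
  2 k - r), and \<open>lower T y = 0\<close> starts the induction.\<close>

lemma lower_raise_pow:
  assumes T: "finite T" and y: "y \<in> primitive T k"
  shows "lower T ((raise T ^^ Suc r) y) =
    cscale (of_int (int (Suc r) * (int (card T) - 2 * int k - int r))) ((raise T ^^ r) y)"
proof (induction r)
  case 0
  show ?case
    using lower_raise_commutator[OF T, of y k] y by (simp add: primitive_def)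
next
  case (Suc r)
  have "(raise T ^^ Suc r) y \<in> V (level T (k + Suc r))"
    using y by (intro raise_pow_level T) (simp add: primitive_def)
  then have "lower T ((raise T ^^ Suc (Suc r)) y) = raise T (lower T ((raise T ^^ Suc r) y)) +
      cscale (of_int (int (card T) - 2 * int (k + Suc r))) ((raise T ^^ Suc r) y)"
    using lower_raise_commutator[OF T] by simp
  also have "\<dots> = cscale (of_int (int (Suc r) * (int (card T) - 2 * int k - int r)) +
      of_int (int (card T) - 2 * int (k + Suc r))) ((raise T ^^ Suc r) y)"
    unfolding Suc.IH raise_scale cfun.scale_left_distrib by simp
  also have "of_int (int (Suc r) * (int (card T) - 2 * int k - int r)) +
      of_int (int (card T) - 2 * int (k + Suc r)) =
      (of_int (int (Suc (Suc r)) * (int (card T) - 2 * int k - int (Suc r))) :: complex)"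
    unfolding of_int_add[symmetric] of_int_eq_iff by (simp add: algebra_simps)
  finally show ?case .
qed

lemma cinner_raise_pow_Suc:
  assumes T: "finite T" and z: "z \<in> primitive T k"
  shows "cinner (Pow T) ((raise T ^^ Suc q) y) ((raise T ^^ Suc r) z) =
    of_int (int (Suc r) * (int (card T) - 2 * int k - int r)) *
    cinner (Pow T) ((raise T ^^ q) y) ((raise T ^^ r) z)"
proof -
  have "cinner (Pow T) ((raise T ^^ Suc q) y) ((raise T ^^ Suc r) z) =
      cinner (Pow T) ((raise T ^^ q) y) (lower T ((raise T ^^ Suc r) z))"
    using raise_adjoint[OF T] by simp
  then show ?thesis
    unfolding lower_raise_pow[OF T z] cinner_scale_right by simp
qed

text \<open>The squared norm of \<open>raise T y\<close> is card T - 2 k times that of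
  \<open>y\<close>. A negative factor is possible only for y = 0.\<close>

lemma primitive_trivial:
  assumes T: "finite T" and y: "y \<in> primitive T k" and k: "card T < 2 * k"
  shows "y = 0"
proof (rule ccontr)
  assume y0: "y \<noteq> 0"
  have yV: "y \<in> V (Pow T)"
    using y V_mono[OF level_subset] by (auto simp: primitive_def)
  have "cinner (Pow T) (raise T y) (raise T y) =
      of_int (int (card T) - 2 * int k) * cinner (Pow T) y y"
    using cinner_raise_pow_Suc[OF T y, of 0 y 0] by simp
  then have "complex_of_real ((L2_set (\<lambda>x. cmod (raise T y x)) (Pow T))\<^sup>2) =
      complex_of_real (of_int (int (card T) - 2 * int k) * (L2_set (\<lambda>x. cmod (y x)) (Pow T))\<^sup>2)"
    unfolding cinner_self_L2 by simp
  then have "(L2_set (\<lambda>x. cmod (raise T y x)) (Pow T))\<^sup>2 =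
      of_int (int (card T) - 2 * int k) * (L2_set (\<lambda>x. cmod (y x)) (Pow T))\<^sup>2"
    unfolding of_real_eq_iff .
  moreover have "0 < (L2_set (\<lambda>x. cmod (y x)) (Pow T))\<^sup>2"
    using L2_norm_pos[OF _ yV y0] T by simp
  then have "of_int (int (card T) - 2 * int k) * (L2_set (\<lambda>x. cmod (y x)) (Pow T))\<^sup>2 < (0::real)"
    using k by (intro mult_neg_pos) auto
  ultimately show False
    by (smt (verit) zero_le_power2)
qed

text \<open>The squared norm of the \<open>r\<close>-th vector of the Jordan chain of a primitive unit vector of
  rank \<open>k\<close> when \<open>N = card T\<close>.\<close>

definition chain_norm2 :: "nat \<Rightarrow> nat \<Rightarrow> nat \<Rightarrow> nat" where
  "chain_norm2 N k r = (fact r)\<^sup>2 * ((N - 2 * k) choose r)"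

text \<open>The closed form satisfies the recursion for squared norms that
  \<open>lower_raise_pow\<close> dictates. Integers are used because the factor becomes negative
  beyond the end of the chain, where both binomial coefficients are zero.\<close>

lemma chain_norm2_Suc:
  assumes "2 * k \<le> N"
  shows "int (chain_norm2 N k (Suc r)) =
    int (Suc r) * (int N - 2 * int k - int r) * int (chain_norm2 N k r)"
proof (cases "r \<le> N - 2 * k")
  case True
  have "Suc r * ((N - 2 * k) choose Suc r) = ((N - 2 * k) - r) * ((N - 2 * k) choose r)"
    using binomial_absorb_comp[of "N - 2 * k" r] Suc_times_binomial_eq
    by (metis binomial_absorption mult.commute binomial_eq_0_iff choose_mult_lemma)
  moreover have "chain_norm2 N k (Suc r) =
      Suc r * (fact r)\<^sup>2 * (Suc r * ((N - 2 * k) choose Suc r))"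
    by (simp add: chain_norm2_def power2_eq_square algebra_simps)
  ultimately have "chain_norm2 N k (Suc r) = Suc r * ((N - 2 * k) - r) * chain_norm2 N k r"
    by (simp only: chain_norm2_def mult.assoc mult.left_commute)
  moreover have "int ((N - 2 * k) - r) = int N - 2 * int k - int r"
    using True assms by (simp add: of_nat_diff)
  ultimately show ?thesis
    by (metis of_nat_mult)
qed (simp add: chain_norm2_def binomial_eq_0)

text \<open>Moving one \<open>raise\<close> across the inner product as \<open>lower\<close>
  shortens both powers by one. Equal powers shrink together and leave the norm factor; otherwise one
  runs out first and \<open>lower\<close> annihilates a primitive vector.\<close>

lemma cinner_raise_pow:
  assumes T: "finite T" and y: "y \<in> primitive T k" and z: "z \<in> primitive T k'"
    and k': "2 * k' \<le> card T"
  shows "cinner (Pow T) ((raise T ^^ q) y) ((raise T ^^ r) z) =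
    (if q = r then of_nat (chain_norm2 (card T) k' r) * cinner (Pow T) y z else 0)"
proof (induction q arbitrary: r)
  case 0
  show ?case
  proof (cases r)
    case (Suc r')
    have "cinner (Pow T) y ((raise T ^^ r) z) = cinner (Pow T) (lower T y) ((raise T ^^ r') z)"
      using lower_adjoint[OF T] Suc by simp
    then show ?thesis
      using y Suc by (simp add: primitive_def cinner_def)
  qed (simp add: chain_norm2_def)
next
  case (Suc q)
  show ?case
  proof (cases r)
    case 0
    have "cinner (Pow T) ((raise T ^^ Suc q) y) z = cinner (Pow T) ((raise T ^^ q) y) (lower T z)"
      using raise_adjoint[OF T] by simp
    then show ?thesis
      using z 0 by (simp add: primitive_def cinner_def)
  next
    case r: (Suc r')
    have c: "(of_nat (chain_norm2 (card T) k' (Suc r')) :: complex) =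
        of_int (int (Suc r') * (int (card T) - 2 * int k' - int r')) *
        of_nat (chain_norm2 (card T) k' r')"
      using arg_cong[OF chain_norm2_Suc[OF k', of r'], of "of_int :: int \<Rightarrow> complex"]
      by (simp only: of_int_mult of_int_of_nat_eq)
    show ?thesis
      unfolding r cinner_raise_pow_Suc[OF T z] Suc.IH c by simp
  qed
qed


lemma raise_pow_eq_0:
  assumes T: "finite T" and y: "y \<in> primitive T k" and k: "2 * k \<le> card T"
    and r: "card T - 2 * k < r"
  shows "(raise T ^^ r) y = 0"
proof -
  have "cinner (Pow T) ((raise T ^^ r) y) ((raise T ^^ r) y) = 0"
    using cinner_raise_pow[OF T y y k, of r r] r by (simp add: chain_norm2_def binomial_eq_0)
  moreover have "(raise T ^^ r) y \<in> V (Pow T)"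
    using raise_pow_level[OF T, of y k r] y V_mono[OF level_subset] by (auto simp: primitive_def)
  ultimately show ?thesis
    using cinner_self_eq_0[of "Pow T"] T by simp
qed

lemma primitive_subspace: "cfun.subspace (primitive T k)"
  using V_subspace[of "level T k"]
  by (auto simp: cfun.subspace_def primitive_def lower_add lower_scale)

lemma primitive_subset: "primitive T k \<subseteq> V (Pow T)"
  using V_mono[OF level_subset] by (auto simp: primitive_def)

section \<open>An orthonormal Jordan basis of the Boolean algebra\<close>

definition primitive_basis :: "'i set \<Rightarrow> nat \<Rightarrow> ('i set \<Rightarrow> complex) set" where
  "primitive_basis T k =
     (SOME E. orthonormal (Pow T) E \<and> E \<subseteq> primitive T k \<and> cfun.span E = primitive T k)"

lemma primitive_basis:
  assumes "finite T"
  shows "orthonormal (Pow T) (primitive_basis T k)" "primitive_basis T k \<subseteq> primitive T k"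
    "cfun.span (primitive_basis T k) = primitive T k"
proof -
  have "\<exists>E. orthonormal (Pow T) E \<and> E \<subseteq> primitive T k \<and> cfun.span E = primitive T k"
    using orthonormal_basis_exists[OF _ primitive_subspace primitive_subset, of T k] assms
    by (metis finite_Pow_iff)
  from someI_ex[OF this]
  show "orthonormal (Pow T) (primitive_basis T k)" "primitive_basis T k \<subseteq> primitive T k"
    "cfun.span (primitive_basis T k) = primitive T k"
    by (simp_all add: primitive_basis_def)
qed

lemma primitive_basis_finite: "finite T \<Longrightarrow> finite (primitive_basis T k)"
  using orthonormal_card[OF _ primitive_basis(1)] by (metis finite_Pow_iff)

lemma primitive_basis_rank:
  assumes T: "finite T" and y: "y \<in> primitive_basis T k"
  shows "2 * k \<le> card T"
proof (rule ccontr)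
  assume "\<not> 2 * k \<le> card T"
  then have "y = 0"
    using primitive_trivial[OF T] primitive_basis(2)[OF T] y by (metis not_le subsetD)
  moreover have "cinner (Pow T) y y = 1"
    using primitive_basis(1)[OF T, of k] y by (auto simp: orthonormal_def)
  ultimately show False
    by simp
qed

text \<open>Normalized chain vector of a primitive unit vector. The last index is the rank
  \<open>a\<close>, not the place \<open>a - k\<close> in the chain, because ranks index the rows
  and columns of the blocks.\<close>

definition chain_vec :: "'i set \<Rightarrow> nat \<Rightarrow> ('i set \<Rightarrow> complex) \<Rightarrow> nat \<Rightarrow> 'i set \<Rightarrow> complex" where
  "chain_vec T k y a = cscale (complex_of_real (1 / sqrt (real (chain_norm2 (card T) k (a - k)))))
     ((raise T ^^ (a - k)) y)"

definition chain_index :: "'i set \<Rightarrow> (nat \<times> ('i set \<Rightarrow> complex) \<times> nat) set" where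
  "chain_index T = {(k, y, a). y \<in> primitive_basis T k \<and> k \<le> a \<and> a \<le> card T - k}"

lemma chain_norm2_pos: "r \<le> N - 2 * k \<Longrightarrow> 0 < chain_norm2 N k r"
  by (simp add: chain_norm2_def)

lemma cinner_levels:
  assumes "y \<in> V (level T k)" "z \<in> V (level T k')" "k \<noteq> k'"
  shows "cinner S y z = 0"
  unfolding cinner_def
proof (rule sum.neutral, rule ballI)
  fix A
  have "A \<notin> level T k \<or> A \<notin> level T k'"
    using assms(3) by (auto simp: level_def)
  then show "y A * cnj (z A) = 0"
    using assms(1,2) by (auto simp: V_def)
qed

lemma chain_vec_level:
  assumes "finite T" "y \<in> primitive T k" "k \<le> a"
  shows "chain_vec T k y a \<in> V (level T a)"
  using raise_pow_level[OF assms(1), of y k "a - k"] assms(2,3)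
    cfun.subspace_scale[OF V_subspace] unfolding chain_vec_def
  by (simp add: primitive_def)

lemma chain_vec_index_level:
  "finite T \<Longrightarrow> (k, y, a) \<in> chain_index T \<Longrightarrow> chain_vec T k y a \<in> V (level T a)"
  using chain_vec_level[of T y k a] primitive_basis(2)[of T k] by (auto simp: chain_index_def)

lemma chain_vec_orthonormal:
  assumes T: "finite T"
  shows "orthonormal_family (Pow T) (chain_index T) (\<lambda>(k, y, a). chain_vec T k y a)"
  unfolding orthonormal_family_def
proof (intro conjI ballI)
  fix i assume "i \<in> chain_index T"
  then show "(case i of (k, y, a) \<Rightarrow> chain_vec T k y a) \<in> V (Pow T)"
    using chain_vec_index_level[OF T, of "fst i" "fst (snd i)" "snd (snd i)"]
      V_mono[OF level_subset] by (auto simp: split_beta)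
next
  fix i j assume "i \<in> chain_index T" "j \<in> chain_index T"
  then obtain k y a k' z b where i: "i = (k, y, a)" and j: "j = (k', z, b)"
    and y: "y \<in> primitive_basis T k" "k \<le> a" "a \<le> card T - k"
    and z: "z \<in> primitive_basis T k'" "k' \<le> b" "b \<le> card T - k'"
    by (auto simp: chain_index_def)
  have yp: "y \<in> primitive T k" and zp: "z \<in> primitive T k'"
    using y z primitive_basis(2)[OF T] by auto
  have k: "2 * k' \<le> card T"
    using primitive_basis_rank[OF T z(1)] .
  have "cinner (Pow T) (chain_vec T k y a) (chain_vec T k' z b) = (if i = j then 1 else 0)"
  proof (cases "k = k' \<and> a - k = b - k'")
    case False
    then have "a - k \<noteq> b - k' \<or> cinner (Pow T) y z = 0"
      using cinner_levels[of y T k z k'] yp zp by (auto simp: primitive_def)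
    moreover have "i \<noteq> j"
      using False i j by auto
    ultimately show ?thesis
      unfolding chain_vec_def cinner_scale_left cinner_scale_right cinner_raise_pow[OF T yp zp k]
      by auto
  next
    case True
    have r: "b - k' \<le> card T - 2 * k'"
      using z by linarith
    have ij: "i = j \<longleftrightarrow> y = z"
      using True i j y z by auto
    have yz: "cinner (Pow T) y z = (if y = z then 1 else 0)"
      using primitive_basis(1)[OF T, of k] y(1) z(1) True by (auto simp: orthonormal_def)
    let ?c = "real (chain_norm2 (card T) k' (b - k'))"
    have "0 < ?c"
      using chain_norm2_pos[OF r] by simp
    then have "complex_of_real (1 / sqrt ?c) * (complex_of_real (1 / sqrt ?c) * complex_of_real ?c) = 1"
      unfolding of_real_mult[symmetric] by (simp add: real_div_sqrt)
    then show ?thesis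
      using True unfolding chain_vec_def cinner_scale_left cinner_scale_right
        cinner_raise_pow[OF T yp zp k] yz ij
      by (auto simp: algebra_simps)
  qed
  then show "cinner (Pow T) (case i of (k, y, a) \<Rightarrow> chain_vec T k y a)
      (case j of (k, y, a) \<Rightarrow> chain_vec T k y a) = (if i = j then 1 else 0)"
    by (simp add: i j)
qed

lemma linear_image_subspace:
  assumes "Vector_Spaces.linear cscale cscale f" "cfun.subspace W"
  shows "cfun.subspace (f ` W)"
proof -
  interpret f: Vector_Spaces.linear cscale cscale f by fact
  show ?thesis
    using f.subspace_image[OF assms(2)] .
qed

text \<open>A vector of rank \<open>Suc j\<close> orthogonal to the image of \<^const>\<open>raise\<close> is killed by the
  adjoint \<^const>\<open>lower\<close>, that is, primitive.\<close>

lemma level_span_raise_primitive: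
  assumes T: "finite T"
  shows "V (level T j) \<subseteq> cfun.span (\<Union>k\<in>{..j}. (raise T ^^ (j - k)) ` primitive_basis T k)"
proof (induction j)
  case 0
  have "V (level T 0) \<subseteq> primitive T 0"
    using lower_level_0[OF T] by (auto simp: primitive_def)
  then show ?case
    using primitive_basis(3)[OF T, of 0] by simp
next
  case (Suc j)
  let ?X = "\<lambda>j. \<Union>k\<in>{..j}. (raise T ^^ (j - k)) ` primitive_basis T k"
  interpret R: Vector_Spaces.linear cscale cscale "raise T"
    by (rule linear_raise)
  have RX: "raise T ` ?X j \<subseteq> ?X (Suc j)"
  proof
    fix v assume "v \<in> raise T ` ?X j"
    then obtain k y where k: "k \<le> j" "y \<in> primitive_basis T k" "v = raise T ((raise T ^^ (j - k)) y)"
      by auto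
    then have "v = (raise T ^^ (Suc j - k)) y"
      by (simp add: Suc_diff_le)
    then show "v \<in> ?X (Suc j)"
      using k by (intro UN_I[of k]) auto
  qed
  show ?case
  proof
    fix v assume v: "v \<in> V (level T (Suc j))"
    have sub: "raise T ` V (level T j) \<subseteq> V (Pow T)"
      using raise_level[OF T] V_mono[OF level_subset] by blast
    obtain p where p: "p \<in> raise T ` V (level T j)"
        "\<And>w. w \<in> raise T ` V (level T j) \<Longrightarrow> cinner (Pow T) (v - p) w = 0"
      using orthogonal_projection_exists[OF _ linear_image_subspace[OF linear_raise V_subspace] sub, of v] T
      by blast
    have "p \<in> V (level T (Suc j))"
      using p(1) raise_level[OF T] by blast
    then have vp: "v - p \<in> V (level T (Suc j))"
      using v cfun.subspace_diff[OF V_subspace] by blast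
    let ?d = "lower T (v - p)"
    have d: "?d \<in> V (level T j)"
      using lower_level[OF T vp] .
    have "cinner (Pow T) ?d ?d = 0"
      using p(2)[of "raise T ?d"] d by (simp add: lower_adjoint[OF T])
    then have "?d = 0"
      using cinner_self_eq_0[of "Pow T" ?d] T d V_mono[OF level_subset] by blast
    then have "v - p \<in> primitive T (Suc j)"
      using vp by (simp add: primitive_def)
    then have "v - p \<in> cfun.span (primitive_basis T (Suc j))"
      by (simp add: primitive_basis(3)[OF T])
    also have "\<dots> \<subseteq> cfun.span (?X (Suc j))"
      by (intro cfun.span_mono) (auto intro!: UN_I[of "Suc j"])
    finally have 1: "v - p \<in> cfun.span (?X (Suc j))" .
    have "p \<in> raise T ` cfun.span (?X j)"
      using p(1) Suc.IH by blast
    also have "\<dots> = cfun.span (raise T ` ?X j)"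
      by (rule R.span_image[symmetric])
    also have "\<dots> \<subseteq> cfun.span (?X (Suc j))"
      by (rule cfun.span_mono[OF RX])
    finally have 2: "p \<in> cfun.span (?X (Suc j))" .
    show "v \<in> cfun.span (?X (Suc j))"
      using cfun.span_add[OF 1 2] by simp
  qed
qed

text \<open>Up to rank card T - k the raised basis vectors are positive multiples of chain vectors;
  beyond that rank they are zero.\<close>

lemma level_span_chain_vec:
  assumes T: "finite T"
  shows "V (level T j) \<subseteq>
    cfun.span ((\<lambda>(k, y, a). chain_vec T k y a) ` {(k, y, a) \<in> chain_index T. a = j})"
    (is "_ \<subseteq> cfun.span ?B")
proof -
  have "(raise T ^^ (j - k)) y \<in> cfun.span ?B" if k: "k \<le> j" and y: "y \<in> primitive_basis T k" for k y
  proof (cases "j \<le> card T - k")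
    case True
    then have "(k, y, j) \<in> chain_index T"
      using k y by (simp add: chain_index_def)
    then have b: "chain_vec T k y j \<in> ?B"
      by (intro image_eqI[of _ _ "(k, y, j)"]) auto
    let ?c = "real (chain_norm2 (card T) k (j - k))"
    have "0 < ?c"
      using chain_norm2_pos[of "j - k" "card T" k] True by simp
    then have "(raise T ^^ (j - k)) y = cscale (complex_of_real (sqrt ?c)) (chain_vec T k y j)"
      by (simp add: chain_vec_def)
    then show ?thesis
      using b by (simp only: cfun.span_scale cfun.span_base)
  next
    case False
    then have "(raise T ^^ (j - k)) y = 0"
      using primitive_basis(2)[OF T] y primitive_basis_rank[OF T y]
      by (intro raise_pow_eq_0[OF T]) auto
    then show ?thesis
      by (simp only: cfun.span_zero)
  qed
  then have "cfun.span (\<Union>k\<in>{..j}. (raise T ^^ (j - k)) ` primitive_basis T k) \<subseteq> cfun.span ?B"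
    by (intro cfun.span_minimal) auto
  then show ?thesis
    using level_span_raise_primitive[OF T] by blast
qed

lemma chain_vec_span:
  assumes T: "finite T"
  shows "V (Pow T) \<subseteq> cfun.span ((\<lambda>(k, y, a). chain_vec T k y a) ` chain_index T)"
    (is "_ \<subseteq> cfun.span ?B")
proof
  fix v :: "'a set \<Rightarrow> complex" assume v: "v \<in> V (Pow T)"
  define f where "f j = (\<lambda>A. if A \<in> level T j then v A else 0)" for j
  have "v = (\<Sum>j\<le>card T. f j)"
  proof
    fix A
    show "v A = (\<Sum>j\<le>card T. f j) A"
    proof (cases "A \<subseteq> T")
      case True
      then have "(\<Sum>j\<le>card T. f j) A = (\<Sum>j\<le>card T. if j = card A then v A else 0)"
        unfolding sum_fun_app by (intro sum.cong) (auto simp: f_def level_def)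
      then show ?thesis
        using card_mono[OF T True] by simp
    next
      case False
      then show ?thesis
        using v by (auto simp: sum_fun_app f_def level_def V_def)
    qed
  qed
  moreover have "f j \<in> cfun.span ?B" for j
  proof -
    have "f j \<in> V (level T j)"
      by (auto simp: f_def V_def)
    then have "f j \<in> cfun.span ((\<lambda>(k, y, a). chain_vec T k y a) ` {(k, y, a) \<in> chain_index T. a = j})"
      using level_span_chain_vec[OF T] by blast
    also have "\<dots> \<subseteq> cfun.span ?B"
      by (intro cfun.span_mono image_mono) auto
    finally show ?thesis .
  qed
  ultimately show "v \<in> cfun.span ?B"
    by (simp only: cfun.span_sum)
qed

lemma chain_vec_complete:
  assumes T: "finite T" and "A \<subseteq> T"
  shows "(\<Sum>(k, y, a)\<in>chain_index T. chain_vec T k y a A * cnj (chain_vec T k y a B)) =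
    (if A = B then 1 else 0)"
  using orthonormal_family_complete[OF _ chain_vec_orthonormal[OF T] chain_vec_span[OF T], of A B] assms
  by (simp add: split_beta)

lemma card_level: "finite T \<Longrightarrow> card (level T j) = card T choose j"
  using n_subsets[of T j] by (simp add: level_def)

text \<open>Level \<open>j\<close> carries one chain vector for each primitive basis vector of rank
  k <= j: since 2 j <= card T, none of these chains ends before rank \<open>j\<close>.\<close>

lemma sum_card_primitive_basis:
  assumes T: "finite T" and j: "2 * j \<le> card T"
  shows "(\<Sum>k\<le>j. card (primitive_basis T k)) = card T choose j"
proof -
  let ?I = "{(k, y, a) \<in> chain_index T. a = j}"
  let ?f = "\<lambda>(k, y, a). chain_vec T k y a"
  have "orthonormal_family (level T j) ?I ?f"
    unfolding orthonormal_family_def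
  proof (intro conjI ballI)
    fix i assume i: "i \<in> ?I"
    then show fi: "?f i \<in> V (level T j)"
      using chain_vec_index_level[OF T] by auto
    fix i' assume i': "i' \<in> ?I"
    have "cinner (level T j) (?f i) (?f i') = cinner (Pow T) (?f i) (?f i')"
      unfolding cinner_def using fi T level_subset[of T j]
      by (intro sum.mono_neutral_left) (auto simp: V_def)
    also have "\<dots> = (if i = i' then 1 else 0)"
      using chain_vec_orthonormal[OF T] i i' unfolding orthonormal_family_def by blast
    finally show "cinner (level T j) (?f i) (?f i') = (if i = i' then 1 else 0)" .
  qed
  moreover have "finite (level T j)"
    using T level_subset[of T j] finite_subset by blast
  ultimately have "card ?I = card (level T j)"
    using level_span_chain_vec[OF T] by (intro orthonormal_family_card) auto
  moreover have "?I = (\<lambda>(k, y). (k, y, j)) ` (SIGMA k:{..j}. primitive_basis T k)"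
    using j by (auto simp: chain_index_def)
  then have "card ?I = (\<Sum>k\<le>j. card (primitive_basis T k))"
    using primitive_basis_finite[OF T] by (simp add: card_image inj_on_def)
  ultimately show ?thesis
    by (simp add: card_level[OF T])
qed

text \<open>Difference of two consecutive sums over the ranks; for k = 0 the value of
  \<open>ibinom\<close> at -1 supplies the missing term.\<close>

lemma card_primitive_basis:
  assumes T: "finite T" and k: "2 * k \<le> card T"
  shows "int (card (primitive_basis T k)) =
    ibinom (int (card T)) (int k) - ibinom (int (card T)) (int k - 1)"
proof (cases k)
  case 0
  then show ?thesis
    using sum_card_primitive_basis[OF T, of 0] by (simp add: ibinom_def)
next
  case (Suc q)
  then show ?thesis
    using sum_card_primitive_basis[OF T, of k] sum_card_primitive_basis[OF T, of q] k
    by (simp add: ibinom_def nat_add_distrib)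
qed

section \<open>The subset matrices of the Boolean algebra\<close>

text \<open>The orbit matrix of the ordinary Boolean algebra for sizes \<open>i\<close>,
  \<open>j\<close> and intersection size \<open>t\<close>, written as an operator.\<close>

definition subset_op ::
  "'i set \<Rightarrow> nat \<Rightarrow> nat \<Rightarrow> nat \<Rightarrow> ('i set \<Rightarrow> complex) \<Rightarrow> 'i set \<Rightarrow> complex" where
  "subset_op T i j t y =
     (\<lambda>A. if A \<in> level T i then \<Sum>B | B \<in> level T j \<and> card (A \<inter> B) = t. y B else 0)"

lemma raise_apply: "A \<subseteq> T \<Longrightarrow> raise T y A = (\<Sum>i\<in>A. y (A - {i}))"
  and lower_apply: "A \<subseteq> T \<Longrightarrow> lower T y A = (\<Sum>i\<in>T - A. y (insert i A))"
  by (simp_all add: raise_def lower_def)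

lemma raise_pow_zero: "(raise T ^^ p) 0 = 0" and lower_pow_zero: "(lower T ^^ p) 0 = 0"
  by (induction p) (simp_all only: funpow.simps id_apply comp_apply raise_zero lower_zero)

text \<open>A subset with q elements fewer is reached in \<open>fact q\<close> orders of removal.
  The induction counts pairs of such a subset and the element removed first.\<close>

lemma raise_pow_eq_sum:
  assumes T: "finite T" and "A \<subseteq> T"
  shows "(raise T ^^ q) y A = of_nat (fact q) * (\<Sum>B | B \<subseteq> A \<and> card (A - B) = q. y B)"
  using assms(2)
proof (induction q arbitrary: A)
  case 0
  have "finite A"
    using 0 T finite_subset by blast
  then have "{B. B \<subseteq> A \<and> card (A - B) = 0} = {A}"
    by auto
  then show ?case
    by simp
next
  case (Suc q)
  have fin: "finite A"
    using Suc T finite_subset by blast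
  have c: "card (A - B) = Suc (card (A - {i} - B))" if "i \<in> A" "i \<notin> B" for i B
  proof -
    have "A - B = insert i (A - {i} - B)"
      using that by auto
    then show ?thesis
      using fin by (metis Diff_iff card_insert_disjoint finite_Diff insertI1)
  qed
  have "(raise T ^^ Suc q) y A =
      (\<Sum>i\<in>A. of_nat (fact q) * (\<Sum>B | B \<subseteq> A - {i} \<and> card (A - {i} - B) = q. y B))"
    unfolding funpow.simps comp_apply raise_apply[OF Suc.prems]
    using Suc.prems by (intro sum.cong refl Suc.IH) auto
  also have "\<dots> = of_nat (fact q) * (\<Sum>i\<in>A. \<Sum>B | B \<subseteq> A - {i} \<and> card (A - {i} - B) = q. y B)"
    by (simp add: sum_distrib_left)
  also have "(\<Sum>i\<in>A. \<Sum>B | B \<subseteq> A - {i} \<and> card (A - {i} - B) = q. y B) =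
      (\<Sum>(i, B)\<in>(SIGMA i:A. {B. B \<subseteq> A - {i} \<and> card (A - {i} - B) = q}). y B)"
    using fin by (intro sum.Sigma) auto
  also have "\<dots> = (\<Sum>(B, i)\<in>(SIGMA B:{B. B \<subseteq> A \<and> card (A - B) = Suc q}. A - B). y B)"
  proof (rule sum.reindex_bij_witness[of _ "\<lambda>(B, i). (i, B)" "\<lambda>(i, B). (B, i)"])
    fix p assume "p \<in> (SIGMA i:A. {B. B \<subseteq> A - {i} \<and> card (A - {i} - B) = q})"
    then show "(case p of (i, B) \<Rightarrow> (B, i)) \<in> (SIGMA B:{B. B \<subseteq> A \<and> card (A - B) = Suc q}. A - B)"
      using c by (auto simp: subset_Diff_insert)
  next
    fix p assume "p \<in> (SIGMA B:{B. B \<subseteq> A \<and> card (A - B) = Suc q}. A - B)"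
    then show "(case p of (B, i) \<Rightarrow> (i, B)) \<in> (SIGMA i:A. {B. B \<subseteq> A - {i} \<and> card (A - {i} - B) = q})"
      using c by (auto simp: subset_Diff_insert)
  qed auto
  also have "\<dots> = (\<Sum>B | B \<subseteq> A \<and> card (A - B) = Suc q. \<Sum>i\<in>A - B. y B)"
    using fin by (intro sum.Sigma[symmetric]) auto
  also have "\<dots> = of_nat (Suc q) * (\<Sum>B | B \<subseteq> A \<and> card (A - B) = Suc q. y B)"
    by (simp add: sum_distrib_left)
  finally show ?case
    by (simp add: algebra_simps)
qed

lemma lower_pow_eq_sum:
  assumes T: "finite T" and "C \<subseteq> T"
  shows "(lower T ^^ q) y C =
    of_nat (fact q) * (\<Sum>B | C \<subseteq> B \<and> B \<subseteq> T \<and> card (B - C) = q. y B)"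
  using assms(2)
proof (induction q arbitrary: C)
  case 0
  have "{B. C \<subseteq> B \<and> B \<subseteq> T \<and> card (B - C) = 0} = {C}"
    using 0 T finite_subset[of _ T] by auto
  then show ?case
    by simp
next
  case (Suc q)
  let ?D = "\<lambda>C q. {B. C \<subseteq> B \<and> B \<subseteq> T \<and> card (B - C) = q}"
  have fin: "finite (?D C q)" for C q
    by (rule finite_subset[of _ "Pow T"]) (use T in auto)
  have c: "card (B - C) = Suc (card (B - insert i C))" if "i \<in> B" "i \<notin> C" "B \<subseteq> T" for i B
  proof -
    have "B - C = insert i (B - insert i C)"
      using that by auto
    then show ?thesis
      using that T by (metis Diff_iff card_insert_disjoint finite_Diff finite_subset insertI1)
  qed
  have "(lower T ^^ Suc q) y C =
      (\<Sum>i\<in>T - C. of_nat (fact q) * (\<Sum>B\<in>?D (insert i C) q. y B))"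
    unfolding funpow.simps comp_apply lower_apply[OF Suc.prems]
    using Suc.prems by (intro sum.cong refl Suc.IH) auto
  also have "\<dots> = of_nat (fact q) * (\<Sum>i\<in>T - C. \<Sum>B\<in>?D (insert i C) q. y B)"
    by (simp add: sum_distrib_left)
  also have "(\<Sum>i\<in>T - C. \<Sum>B\<in>?D (insert i C) q. y B) =
      (\<Sum>(i, B)\<in>(SIGMA i:T - C. ?D (insert i C) q). y B)"
    using T fin by (intro sum.Sigma) auto
  also have "\<dots> = (\<Sum>(B, i)\<in>(SIGMA B:?D C (Suc q). B - C). y B)"
  proof (rule sum.reindex_bij_witness[of _ "\<lambda>(B, i). (i, B)" "\<lambda>(i, B). (B, i)"])
    fix p assume "p \<in> (SIGMA i:T - C. ?D (insert i C) q)"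
    then show "(case p of (i, B) \<Rightarrow> (B, i)) \<in> (SIGMA B:?D C (Suc q). B - C)"
      using c by auto
  next
    fix p assume "p \<in> (SIGMA B:?D C (Suc q). B - C)"
    then show "(case p of (B, i) \<Rightarrow> (i, B)) \<in> (SIGMA i:T - C. ?D (insert i C) q)"
      using c by auto
  qed auto
  also have "\<dots> = (\<Sum>B\<in>?D C (Suc q). \<Sum>i\<in>B - C. y B)"
    using T fin finite_subset[of _ T] by (intro sum.Sigma[symmetric]) auto
  also have "\<dots> = of_nat (Suc q) * (\<Sum>B\<in>?D C (Suc q). y B)"
    by (simp add: sum_distrib_left)
  finally show ?case
    by (simp add: algebra_simps)
qed

text \<open>Binomial inversion: (u choose t) (q choose u) = (q choose t) (q - t choose u - t), and
  the alternating sum of the last factor over u is zero unless q = t.\<close>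

lemma binomial_inversion_indicator:
  assumes "q \<le> N"
  shows "(\<Sum>u\<le>N. (- 1) ^ (u + t) * of_nat ((u choose t) * (q choose u))) =
    (if q = t then 1 else 0 :: complex)"
proof (cases "t \<le> q")
  case False
  have "(u choose t) * (q choose u) = 0" for u
    using False by (cases "u < t") (auto simp: binomial_eq_0)
  then show ?thesis
    using False by (simp only: of_nat_0 mult_zero_right sum.neutral_const) simp
next
  case True
  have "(\<Sum>u\<le>N. (- 1) ^ (u + t) * of_nat ((u choose t) * (q choose u))) =
      (\<Sum>u\<in>{t..q}. (- 1) ^ (u + t) * of_nat ((u choose t) * (q choose u)) :: complex)"
    using assms by (intro sum.mono_neutral_right) (auto simp: not_le)
  also have "\<dots> = (\<Sum>v\<le>q - t. (- 1) ^ (v + t + t) * of_nat ((v + t choose t) * (q choose (v + t))))"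
    using True by (intro sum.reindex_bij_witness[of _ "\<lambda>v. v + t" "\<lambda>u. u - t"]) auto
  also have "\<dots> = (\<Sum>v\<le>q - t. of_nat (q choose t) * ((- 1) ^ v * of_nat ((q - t) choose v)))"
  proof (intro sum.cong refl)
    fix v assume v: "v \<in> {..q - t}"
    have "(q choose (v + t)) * (v + t choose t) = (q choose t) * ((q - t) choose v)"
      using choose_mult[of t "v + t" q] v True by simp
    then have "of_nat ((v + t choose t) * (q choose (v + t))) =
        (of_nat ((q choose t) * ((q - t) choose v)) :: complex)"
      by (simp only: mult.commute)
    moreover have "(- 1) ^ (v + t + t) = ((- 1) ^ v :: complex)"
      by (simp add: power_add flip: power_mult_distrib)
    ultimately show "(- 1) ^ (v + t + t) * of_nat ((v + t choose t) * (q choose (v + t))) =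
        of_nat (q choose t) * ((- 1) ^ v * of_nat ((q - t) choose v) :: complex)"
      by simp
  qed
  also have "\<dots> = of_nat (q choose t) * (\<Sum>v\<le>q - t. (- 1) ^ v * of_nat ((q - t) choose v))"
    by (simp add: sum_distrib_left)
  also have "\<dots> = (if q = t then 1 else 0)"
    using True choose_alternating_sum[of "q - t", where 'a = complex] by auto
  finally show ?thesis .
qed

text \<open>Lowering from rank \<open>j\<close> to u and raising to rank \<open>i\<close> counts,
  apart from two factorials, the u-subsets common to A and B. Inverting the numbers (card (A
  \<inter> B) choose u) isolates the pairs with intersection size \<open>t\<close>.\<close>

lemma subset_op_eq_raise_lower:
  assumes T: "finite T" and y: "y \<in> V (level T j)"
  shows "subset_op T i j t y = (\<Sum>u\<le>min i j.
    cscale ((- 1) ^ (u + t) * of_nat (u choose t) / of_nat (fact (i - u) * fact (j - u)))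
      ((raise T ^^ (i - u)) ((lower T ^^ (j - u)) y)))"
proof
  fix A
  have lev: "(raise T ^^ (i - u)) ((lower T ^^ (j - u)) y) \<in> V (level T i)" if u: "u \<le> min i j" for u
  proof -
    have "(lower T ^^ r) y \<in> V (level T (j - r))" if "r \<le> j" for r
      using that
    proof (induction r)
      case (Suc r)
      then have "(lower T ^^ r) y \<in> V (level T (Suc (j - Suc r)))"
        by (simp add: Suc_diff_Suc)
      then show ?case
        using lower_level[OF T] by simp
    qed (simp add: y)
    from this[of "j - u"] have "(lower T ^^ (j - u)) y \<in> V (level T u)"
      using u by simp
    then show ?thesis
      using raise_pow_level[OF T, of _ u "i - u"] u by simp
  qed
  show "subset_op T i j t y A = (\<Sum>u\<le>min i j.
    cscale ((- 1) ^ (u + t) * of_nat (u choose t) / of_nat (fact (i - u) * fact (j - u)))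
      ((raise T ^^ (i - u)) ((lower T ^^ (j - u)) y))) A"
  proof (cases "A \<in> level T i")
    case False
    then show ?thesis
      using lev by (auto simp: subset_op_def sum_fun_app cscale_def V_def)
  next
    case A: True
    then have AT: "A \<subseteq> T" and cA: "card A = i" and finA: "finite A"
      using T finite_subset by (auto simp: level_def)
    have finl: "finite (level T q)" for q
      using T level_subset[of T q] finite_subset by blast
    have summand: "cscale ((- 1) ^ (u + t) * of_nat (u choose t) / of_nat (fact (i - u) * fact (j - u)))
        ((raise T ^^ (i - u)) ((lower T ^^ (j - u)) y)) A =
        (\<Sum>B\<in>level T j. y B * ((- 1) ^ (u + t) * of_nat ((u choose t) * (card (A \<inter> B) choose u))))"
      if u: "u \<le> min i j" for u
    proof -
      have "(raise T ^^ (i - u)) ((lower T ^^ (j - u)) y) A = of_nat (fact (i - u)) *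
          (\<Sum>C | C \<subseteq> A \<and> card (A - C) = i - u. (lower T ^^ (j - u)) y C)"
        by (rule raise_pow_eq_sum[OF T AT])
      also have "{C. C \<subseteq> A \<and> card (A - C) = i - u} = {C. C \<subseteq> A \<and> card C = u}"
      proof (intro Collect_cong conj_cong refl)
        fix C assume "C \<subseteq> A"
        then have "card (A - C) = card A - card C" "card C \<le> card A"
          using finA by (simp_all add: card_Diff_subset finite_subset card_mono)
        then show "card (A - C) = i - u \<longleftrightarrow> card C = u"
          using u cA by auto
      qed
      also have "(\<Sum>C | C \<subseteq> A \<and> card C = u. (lower T ^^ (j - u)) y C) =
          (\<Sum>C | C \<subseteq> A \<and> card C = u. of_nat (fact (j - u)) * (\<Sum>B | B \<in> level T j \<and> C \<subseteq> B. y B))"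
      proof (intro sum.cong refl)
        fix C assume C: "C \<in> {C. C \<subseteq> A \<and> card C = u}"
        then have CT: "C \<subseteq> T" and finC: "finite C"
          using AT finA finite_subset by auto
        have "{B. C \<subseteq> B \<and> B \<subseteq> T \<and> card (B - C) = j - u} = {B. B \<in> level T j \<and> C \<subseteq> B}"
        proof (intro equalityI subsetI)
          fix B assume B: "B \<in> {B. C \<subseteq> B \<and> B \<subseteq> T \<and> card (B - C) = j - u}"
          then have "finite B"
            using T finite_subset by auto
          then have "card B \<ge> card C"
            using B by (auto intro: card_mono)
          then show "B \<in> {B. B \<in> level T j \<and> C \<subseteq> B}"
            using B C u finC by (auto simp: level_def card_Diff_subset)
        next
          fix B assume "B \<in> {B. B \<in> level T j \<and> C \<subseteq> B}"
          then show "B \<in> {B. C \<subseteq> B \<and> B \<subseteq> T \<and> card (B - C) = j - u}"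
            using C finC by (auto simp: level_def card_Diff_subset)
        qed
        then show "(lower T ^^ (j - u)) y C =
            of_nat (fact (j - u)) * (\<Sum>B | B \<in> level T j \<and> C \<subseteq> B. y B)"
          using lower_pow_eq_sum[OF T CT] by simp
      qed
      also have "\<dots> = of_nat (fact (j - u)) *
          (\<Sum>C | C \<subseteq> A \<and> card C = u. \<Sum>B | B \<in> level T j \<and> C \<subseteq> B. y B)"
        by (simp add: sum_distrib_left)
      also have "(\<Sum>C | C \<subseteq> A \<and> card C = u. \<Sum>B | B \<in> level T j \<and> C \<subseteq> B. y B) =
          (\<Sum>B\<in>level T j. \<Sum>C | C \<in> {C. C \<subseteq> A \<and> card C = u} \<and> C \<subseteq> B. y B)"
        using finA finl by (subst sum.swap_restrict) auto
      also have "\<dots> = (\<Sum>B\<in>level T j. y B * of_nat (card (A \<inter> B) choose u))"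
      proof (intro sum.cong refl)
        fix B
        have "{C. C \<in> {C. C \<subseteq> A \<and> card C = u} \<and> C \<subseteq> B} = {C. C \<subseteq> A \<inter> B \<and> card C = u}"
          by auto
        then show "(\<Sum>C | C \<in> {C. C \<subseteq> A \<and> card C = u} \<and> C \<subseteq> B. y B) =
            y B * of_nat (card (A \<inter> B) choose u)"
          using n_subsets[of "A \<inter> B" u] finA by simp
      qed
      finally have "(raise T ^^ (i - u)) ((lower T ^^ (j - u)) y) A =
          of_nat (fact (i - u)) * (of_nat (fact (j - u)) *
          (\<Sum>B\<in>level T j. y B * of_nat (card (A \<inter> B) choose u)))" .
      then show ?thesis
        unfolding cscale_def by (simp add: sum_distrib_left field_simps)
    qed
    let ?h = "\<lambda>u B. y B * ((- 1) ^ (u + t) * of_nat ((u choose t) * (card (A \<inter> B) choose u)))"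
    have "(\<Sum>u\<le>min i j. cscale ((- 1) ^ (u + t) * of_nat (u choose t) / of_nat (fact (i - u) * fact (j - u)))
      ((raise T ^^ (i - u)) ((lower T ^^ (j - u)) y))) A = (\<Sum>u\<le>min i j. \<Sum>B\<in>level T j. ?h u B)"
      unfolding sum_fun_app using summand by (intro sum.cong) auto
    also have "\<dots> = (\<Sum>B\<in>level T j. \<Sum>u\<le>min i j. ?h u B)"
      by (rule sum.swap)
    also have "\<dots> = (\<Sum>B\<in>level T j. if card (A \<inter> B) = t then y B else 0)"
    proof (intro sum.cong refl)
      fix B assume B: "B \<in> level T j"
      then have "finite B"
        using T finite_subset by (auto simp: level_def)
      then have "card (A \<inter> B) \<le> min i j"
        using B cA finA by (auto simp: level_def intro!: card_mono)
      then show "(\<Sum>u\<le>min i j. ?h u B) = (if card (A \<inter> B) = t then y B else 0)"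
        unfolding sum_distrib_left[symmetric] by (subst binomial_inversion_indicator) auto
    qed
    also have "\<dots> = subset_op T i j t y A"
      using A finl by (simp add: subset_op_def sum.inter_filter)
    finally show ?thesis ..
  qed
qed

text \<open>Iterating \<open>lower_raise_pow\<close> multiplies the factors h (card T - 2 k - h + 1)
  for h = r, r - 1, ..., r - q + 1. Their product is collected into factorials and one binomial
  coefficient.\<close>

lemma lower_pow_raise_pow:
  assumes T: "finite T" and y: "y \<in> primitive T k" and k: "2 * k \<le> card T"
    and r: "r \<le> card T - 2 * k" and q: "q \<le> r"
  shows "(lower T ^^ q) ((raise T ^^ r) y) =
    cscale (of_nat (fact r * fact q * ((card T - 2 * k - r + q) choose q)) / of_nat (fact (r - q)))
      ((raise T ^^ (r - q)) y)"
  using q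
proof (induction q)
  case (Suc q)
  define M where "M = card T - 2 * k"
  obtain p where p: "r - q = Suc p" "r - Suc q = p"
    using Suc.prems by (metis Suc_diff_Suc Suc_le_lessD)
  define b where "b = M - r + q"
  have "int (card T) - 2 * int k - int p = int (Suc b)"
    unfolding b_def M_def using p k r Suc.prems by arith
  then have "int (Suc p) * (int (card T) - 2 * int k - int p) = int (Suc p * Suc b)"
    by (simp only: of_nat_mult)
  then have low: "lower T ((raise T ^^ Suc p) y) = cscale (of_nat (Suc p * Suc b)) ((raise T ^^ p) y)"
    unfolding lower_raise_pow[OF T y] by (metis of_int_of_nat_eq)
  have 1: "Suc q * (Suc b choose Suc q) = Suc b * (b choose q)"
    by (rule Suc_times_binomial_eq[symmetric, THEN trans[rotated]]) (simp add: mult.commute)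
  have 2: "(of_nat (Suc q) * of_nat (Suc b choose Suc q) :: complex) =
      of_nat (Suc b) * of_nat (b choose q)"
    unfolding of_nat_mult[symmetric] 1 ..
  have "(lower T ^^ Suc q) ((raise T ^^ r) y) =
      cscale (of_nat (fact r * fact q * (b choose q)) / of_nat (fact (Suc p)))
        (lower T ((raise T ^^ Suc p) y))"
    using Suc p by (simp add: lower_scale M_def b_def del: of_nat_mult of_nat_fact fact_Suc)
  also have "\<dots> = cscale (of_nat (fact r * fact q * (b choose q)) / of_nat (fact (Suc p)) *
      of_nat (Suc p * Suc b)) ((raise T ^^ p) y)"
    unfolding low cfun.scale_scale ..
  also have "of_nat (fact r * fact q * (b choose q)) / of_nat (fact (Suc p)) * of_nat (Suc p * Suc b) =
      of_nat (fact r) * of_nat (fact q) * (of_nat (Suc b) * of_nat (b choose q)) / (of_nat (fact p) :: complex)"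
    unfolding of_nat_mult fact_Suc by (simp add: field_simps del: of_nat_Suc)
  also have "\<dots> = of_nat (fact r * fact (Suc q) * (Suc b choose Suc q)) / of_nat (fact p)"
    unfolding 2[symmetric] of_nat_mult fact_Suc by (simp del: of_nat_Suc binomial_Suc_Suc)
  also have "Suc b = card T - 2 * k - r + Suc q"
    by (simp add: b_def M_def)
  finally show ?case
    using p(2) by simp
qed (simp add: cfun.scale_one)

lemma lower_pow_raise_pow_eq_0:
  assumes T: "finite T" and y: "y \<in> primitive T k" and k: "2 * k \<le> card T"
    and r: "r \<le> card T - 2 * k" and q: "r < q"
  shows "(lower T ^^ q) ((raise T ^^ r) y) = 0"
proof -
  have "(lower T ^^ Suc r) ((raise T ^^ r) y) = 0"
    using lower_pow_raise_pow[OF T y k r, of r] y by (simp add: lower_scale primitive_def)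
  moreover note lower_pow_zero
  moreover have "q = (q - Suc r) + Suc r"
    using q by simp
  ultimately show ?thesis
    by (metis comp_apply funpow_add)
qed

section \<open>Schrijver's coefficients on Jordan chains\<close>

text \<open>For u < k or u > min i j some binomial coefficient has a negative lower entry and is
  zero; on the remaining range all arguments are natural numbers. A negative exponent of -1 occurs
  only together with (u choose t) = 0.\<close>

lemma beta_nat:
  assumes "k \<le> i" "i \<le> N - k" "k \<le> j" "j \<le> N - k"
  shows "beta (int N) (int t) (int i) (int j) (int k) =
    (\<Sum>u\<in>{k..min i j}. (- 1) ^ (u + t) * of_nat ((u choose t) * ((N - 2 * k) choose (u - k)) *
      ((N - k - u) choose (i - u)) * ((N - k - u) choose (j - u))))"
proof -
  let ?g = "\<lambda>u. (-1) powi (u - int t) *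
        of_int (ibinom u t * ibinom (int N - 2 * int k) (u - int k) *
                ibinom (int N - int k - u) (int i - u) * ibinom (int N - int k - u) (int j - u)) :: complex"
  have "beta (int N) (int t) (int i) (int j) (int k) = (\<Sum>u\<in>int ` {0..N}. ?g u)"
    unfolding beta_def image_int_atLeastAtMost by simp
  also have "\<dots> = (\<Sum>u\<in>{0..N}. ?g (int u))"
    by (subst sum.reindex) auto
  also have "\<dots> = (\<Sum>u\<in>{k..min i j}. ?g (int u))"
    using assms by (intro sum.mono_neutral_right) (auto simp: ibinom_def not_le)
  also have "\<dots> = (\<Sum>u\<in>{k..min i j}. (- 1) ^ (u + t) * of_nat ((u choose t) * ((N - 2 * k) choose (u - k)) *
      ((N - k - u) choose (i - u)) * ((N - k - u) choose (j - u))))"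
  proof (intro sum.cong refl)
    fix u assume u: "u \<in> {k..min i j}"
    have b: "ibinom (int a) (int b) = int (a choose b)" for a b
      by (simp add: ibinom_def)
    have d: "int N - 2 * int k = int (N - 2 * k)" "int u - int k = int (u - k)"
      "int N - int k - int u = int (N - k - u)" "int i - int u = int (i - u)" "int j - int u = int (j - u)"
      using u assms by auto
    have s: "(-1) powi (int u - int t) * of_nat (u choose t) = ((- 1) ^ (u + t) * of_nat (u choose t) :: complex)"
    proof (cases "t \<le> u")
      case True
      then have "int u - int t = int (u - t)"
        by simp
      moreover have "(- 1) ^ (u + t) = ((- 1) ^ (u - t) :: complex)"
        using True by (simp add: minus_one_power_iff)
      ultimately show ?thesis
        by (simp only: power_int_of_nat)
    qed (simp add: binomial_eq_0)
    show "?g (int u) = (- 1) ^ (u + t) * of_nat ((u choose t) * ((N - 2 * k) choose (u - k)) *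
      ((N - k - u) choose (i - u)) * ((N - k - u) choose (j - u)))"
      unfolding d b using s by (simp add: mult.assoc[symmetric] del: of_nat_diff)
  qed
  finally show ?thesis .
qed

text \<open>Lowering to rank u and raising again stays on the chain of \<open>y\<close> and gives
  zero for u < k. Hence the vector of rank \<open>j\<close> goes to a multiple of the vector of rank
  \<open>i\<close> of the same chain.\<close>

lemma subset_op_raise_pow:
  assumes T: "finite T" and y: "y \<in> primitive T k" and k: "2 * k \<le> card T"
    and j: "k \<le> j" "j \<le> card T - k"
  shows "subset_op T i j t ((raise T ^^ (j - k)) y) = cscale (\<Sum>u\<in>{k..min i j}.
      (- 1) ^ (u + t) * of_nat ((u choose t) * fact (j - k) * ((card T - k - u) choose (j - u))) /
      of_nat (fact (u - k) * fact (i - u))) ((raise T ^^ (i - k)) y)"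
proof -
  have r: "j - k \<le> card T - 2 * k"
    using j by simp
  have lev: "(raise T ^^ (j - k)) y \<in> V (level T j)"
    using raise_pow_level[OF T, of y k "j - k"] y j by (simp add: primitive_def)
  let ?s = "\<lambda>u. cscale ((- 1) ^ (u + t) * of_nat (u choose t) / of_nat (fact (i - u) * fact (j - u)))
      ((raise T ^^ (i - u)) ((lower T ^^ (j - u)) ((raise T ^^ (j - k)) y)))"
  have "subset_op T i j t ((raise T ^^ (j - k)) y) = (\<Sum>u\<le>min i j. ?s u)"
    by (rule subset_op_eq_raise_lower[OF T lev])
  also have "\<dots> = (\<Sum>u\<in>{k..min i j}. ?s u)"
  proof (rule sum.mono_neutral_right)
    show "\<forall>u\<in>{..min i j} - {k..min i j}. ?s u = 0"
    proof
      fix u assume "u \<in> {..min i j} - {k..min i j}"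
      then have "j - k < j - u"
        using j by auto
      then have "(lower T ^^ (j - u)) ((raise T ^^ (j - k)) y) = 0"
        by (rule lower_pow_raise_pow_eq_0[OF T y k r])
      then show "?s u = 0"
        by (simp only: raise_pow_zero cfun.scale_zero_right)
    qed
  qed auto
  also have "\<dots> = (\<Sum>u\<in>{k..min i j}. cscale ((- 1) ^ (u + t) * of_nat ((u choose t) * fact (j - k) *
      ((card T - k - u) choose (j - u))) / of_nat (fact (u - k) * fact (i - u))) ((raise T ^^ (i - k)) y))"
  proof (rule sum.cong[OF refl])
    fix u assume u: "u \<in> {k..min i j}"
    have e: "j - k - (j - u) = u - k" "card T - 2 * k - (j - k) + (j - u) = card T - k - u"
      using u j by auto
    have q: "j - u \<le> j - k"
      using u by auto
    have c: "(raise T ^^ (i - u)) ((raise T ^^ (u - k)) y) = (raise T ^^ (i - k)) y"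
    proof -
      have "i - k = (i - u) + (u - k)"
        using u by auto
      then show ?thesis
        by (simp only: funpow_add comp_apply)
    qed
    have "(- 1) ^ (u + t) * of_nat (u choose t) / of_nat (fact (i - u) * fact (j - u)) *
        (of_nat (fact (j - k) * fact (j - u) * (card T - k - u choose (j - u))) / of_nat (fact (u - k))) =
        ((- 1) ^ (u + t) * of_nat ((u choose t) * fact (j - k) *
      ((card T - k - u) choose (j - u))) / of_nat (fact (u - k) * fact (i - u)) :: complex)"
      by (simp add: field_simps)
    then show "?s u = cscale ((- 1) ^ (u + t) * of_nat ((u choose t) * fact (j - k) *
      ((card T - k - u) choose (j - u))) / of_nat (fact (u - k) * fact (i - u))) ((raise T ^^ (i - k)) y)"
      unfolding lower_pow_raise_pow[OF T y k r q] e raise_pow_scale c cfun.scale_scale by simp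
  qed
  also have "\<dots> = cscale (\<Sum>u\<in>{k..min i j}.
      (- 1) ^ (u + t) * of_nat ((u choose t) * fact (j - k) * ((card T - k - u) choose (j - u))) /
      of_nat (fact (u - k) * fact (i - u))) ((raise T ^^ (i - k)) y)"
    by (rule cfun.scale_sum_left[symmetric])
  finally show ?thesis .
qed

text \<open>Passing to unit vectors multiplies the scalar by a ratio of norms. After the summand has
  been made symmetric in \<open>i\<close> and \<open>j\<close>, what remains besides
  \<open>beta\<close> are the two inverse square roots.\<close>

theorem subset_op_chain_vec:
  assumes T: "finite T" and y: "y \<in> primitive T k" and k: "2 * k \<le> card T"
    and j: "k \<le> j" "j \<le> card T - k"
  shows "subset_op T i j t (chain_vec T k y j) =
    (if k \<le> i \<and> i \<le> card T - k then
       cscale (complex_of_real (1 / sqrt (real ((card T - 2 * k) choose (i - k))) *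
                 (1 / sqrt (real ((card T - 2 * k) choose (j - k))))) *
               beta (int (card T)) (int t) (int i) (int j) (int k))
         (chain_vec T k y i)
     else 0)"
proof -
  define N where "N = card T"
  define M where "M = N - 2 * k"
  let ?c = "\<lambda>i. complex_of_real (1 / sqrt (real (chain_norm2 N k (i - k))))"
  let ?S = "(\<Sum>u\<in>{k..min i j}.
      (- 1) ^ (u + t) * of_nat ((u choose t) * fact (j - k) * ((N - k - u) choose (j - u))) /
      of_nat (fact (u - k) * fact (i - u))) :: complex"
  have scale: "subset_op T i j t (cscale c v) = cscale c (subset_op T i j t v)" for c v
    by (auto simp: subset_op_def cscale_def fun_eq_iff sum_distrib_left)
  have main: "subset_op T i j t (chain_vec T k y j) = cscale (?c j * ?S) ((raise T ^^ (i - k)) y)"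
    unfolding chain_vec_def scale subset_op_raise_pow[OF T y k j] cfun.scale_scale N_def ..
  show ?thesis
  proof (cases "k \<le> i \<and> i \<le> card T - k")
    case False
    \<comment> \<open>Below the start of the chain the sum is empty; beyond its end the power of
      \<open>raise\<close> vanishes.\<close>
    then have "{k..min i j} = {} \<or> (raise T ^^ (i - k)) y = 0"
      using raise_pow_eq_0[OF T y k, of "i - k"] k by force
    then show ?thesis
      unfolding main using False by (auto simp: cscale_def)
  next
    case True
    then have i: "k \<le> i" "i \<le> N - k"
      by (auto simp: N_def)
    have Ci: "0 < M choose (i - k)" and Cj: "0 < M choose (j - k)"
      using i j by (auto simp: M_def N_def)
    \<comment> \<open>With M = N - 2 k, the identity (M choose i - k) (i - k choose u - k) = (M
      choose u - k) (N - k - u choose i - u) makes each summand symmetric in \<open>i\<close> and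
      \<open>j\<close>, apart from factorials.\<close>
    have e: "of_nat (fact (i - k)) * of_nat (M choose (i - k)) * ?S =
        of_nat (fact (j - k)) * beta (int N) (int t) (int i) (int j) (int k)"
      unfolding beta_nat[OF i j[folded N_def]] sum_distrib_left
    proof (rule sum.cong[OF refl])
      fix u assume u: "u \<in> {k..min i j}"
      have "fact (u - k) * fact (i - k - (u - k)) * (i - k choose (u - k)) = (fact (i - k) :: nat)"
        using u by (intro binomial_fact_lemma) auto
      moreover have "i - k - (u - k) = i - u"
        using u by auto
      ultimately have f: "of_nat (fact (i - k)) =
          (of_nat (fact (u - k) * fact (i - u)) * of_nat (i - k choose (u - k)) :: complex)"
        unfolding of_nat_mult[symmetric] by simp
      have "(M choose (i - k)) * (i - k choose (u - k)) =
          (M choose (u - k)) * ((M - (u - k)) choose (i - k - (u - k)))"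
        using u i by (intro choose_mult) (auto simp: M_def)
      moreover have "M - (u - k) = N - k - u"
        using u by (auto simp: M_def)
      ultimately have g: "(of_nat (M choose (i - k)) * of_nat (i - k choose (u - k)) :: complex) =
          of_nat (M choose (u - k)) * of_nat ((N - k - u) choose (i - u))"
        unfolding of_nat_mult[symmetric] using \<open>i - k - (u - k) = i - u\<close> by simp
      have nz: "(of_nat (fact (u - k) * fact (i - u)) :: complex) \<noteq> 0"
        by simp
      have "of_nat (fact (i - k)) * of_nat (M choose (i - k)) *
          ((- 1) ^ (u + t) * of_nat ((u choose t) * fact (j - k) * ((N - k - u) choose (j - u))) /
          of_nat (fact (u - k) * fact (i - u))) =
          (of_nat (M choose (i - k)) * of_nat (i - k choose (u - k))) *
          ((- 1) ^ (u + t) * of_nat ((u choose t) * fact (j - k) * ((N - k - u) choose (j - u))) :: complex)"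
        unfolding f using nz by (simp add: field_simps del: of_nat_mult of_nat_fact)
      also have "\<dots> = of_nat (fact (j - k)) * ((- 1) ^ (u + t) * of_nat ((u choose t) * ((N - 2 * k) choose (u - k)) *
            ((N - k - u) choose (i - u)) * ((N - k - u) choose (j - u))))"
        unfolding g unfolding M_def by (simp add: algebra_simps)
      finally show "of_nat (fact (i - k)) * of_nat (M choose (i - k)) *
          ((- 1) ^ (u + t) * of_nat ((u choose t) * fact (j - k) * ((N - k - u) choose (j - u))) /
          of_nat (fact (u - k) * fact (i - u))) =
          (of_nat (fact (j - k)) * ((- 1) ^ (u + t) * of_nat ((u choose t) * ((N - 2 * k) choose (u - k)) *
            ((N - k - u) choose (i - u)) * ((N - k - u) choose (j - u)))) :: complex)" .
    qed
    have nz: "(of_nat (fact (i - k)) * of_nat (M choose (i - k)) :: complex) \<noteq> 0"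
      using Ci by simp
    have S: "?S = of_nat (fact (j - k)) * beta (int N) (int t) (int i) (int j) (int k) /
        (of_nat (fact (i - k)) * of_nat (M choose (i - k)))"
      by (rule eq_divide_imp[OF nz], subst mult.commute, rule e)
    have n: "sqrt (real (chain_norm2 N k r)) = fact r * sqrt (real (M choose r))" for r
      by (simp add: chain_norm2_def M_def real_sqrt_mult)
    have sq: "complex_of_real (sqrt (real (M choose (i - k)))) * complex_of_real (sqrt (real (M choose (i - k)))) =
        of_nat (M choose (i - k))"
      unfolding of_real_mult[symmetric] by simp
    have "?c j * ?S = complex_of_real (1 / sqrt (real (M choose (i - k))) *
                 (1 / sqrt (real (M choose (j - k))))) * beta (int N) (int t) (int i) (int j) (int k) * ?c i"
      unfolding S n sq[symmetric] using Ci Cj by (simp add: field_simps)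
    then show ?thesis
      unfolding main using True by (simp add: chain_vec_def N_def M_def)
  qed
qed

lemma subset_op_other_level:
  assumes "y \<in> V (level T j')" "j' \<noteq> j"
  shows "subset_op T i j t y = 0"
proof
  fix A
  have "y B = 0" if "B \<in> level T j" for B
    using assms that by (auto simp: V_def level_def)
  then show "subset_op T i j t y A = 0 A"
    by (auto simp: subset_op_def)
qed

section \<open>Orbitals and isotypic components\<close>

lemma push_apply:
  assumes "inj_on \<sigma> S" "x \<in> S"
  shows "push S \<sigma> v (\<sigma> x) = v x"
proof -
  have "{x' \<in> S. \<sigma> x' = \<sigma> x} = {x}"
    using assms by (auto simp: inj_on_def)
  then show ?thesis
    by (simp add: push_def)
qed

lemma push_in_V: "\<sigma> ` S \<subseteq> S \<Longrightarrow> push S \<sigma> v \<in> V S"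
  by (auto simp: V_def push_def intro!: sum.neutral)

locale multiplicity_free_action = group_action G X \<phi>
  for G :: "('g, 'r) monoid_scheme" and X :: "'x set" and \<phi> :: "'g \<Rightarrow> 'x \<Rightarrow> 'x" +
  fixes m :: nat and Z :: "nat \<Rightarrow> ('x \<times> 'x) set" and W :: "nat \<Rightarrow> ('x \<Rightarrow> complex) set"
  assumes finX: "finite X"
    and orbital: "orbital_labelling G X \<phi> m Z"
    and irred: "irreducible_labelling G X \<phi> m W"
begin

section \<open>Orbitals of the action\<close>

lemma action_bij: "g \<in> carrier G \<Longrightarrow> bij_betw (\<phi> g) X X"
  using bij_prop0 by (simp add: Bij_def)

lemma action_in: "g \<in> carrier G \<Longrightarrow> x \<in> X \<Longrightarrow> \<phi> g x \<in> X"
  using surj_prop by blast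

lemma action_inv: "g \<in> carrier G \<Longrightarrow> x \<in> X \<Longrightarrow> \<phi> (inv\<^bsub>G\<^esub> g) (\<phi> g x) = x"
  by (rule orbit_sym_aux[OF _ _ refl])

lemma is_group: "group G"
  by (rule group_hom.axioms(1)[OF group_hom])

lemma inv_carrier: "g \<in> carrier G \<Longrightarrow> inv\<^bsub>G\<^esub> g \<in> carrier G"
  by (rule group.inv_closed[OF is_group])

lemma Z_orbit:
  assumes "u \<le> m"
  obtains x y where "x \<in> X" "y \<in> X" "Z u = {(\<phi> g x, \<phi> g y) | g. g \<in> carrier G}"
proof -
  have "Z u \<in> orbits G (X \<times> X) (\<lambda>g. map_prod (\<phi> g) (\<phi> g))"
    using orbital assms by (auto simp: orbital_labelling_def bij_betw_def)
  then obtain x y where "x \<in> X" "y \<in> X" "Z u = orbit G (\<lambda>g. map_prod (\<phi> g) (\<phi> g)) (x, y)"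
    by (auto simp: orbits_def)
  then show ?thesis
    using that by (auto simp: orbit_def)
qed

lemma Z_subset: "u \<le> m \<Longrightarrow> Z u \<subseteq> X \<times> X"
  by (erule Z_orbit) (auto intro: action_in)

lemma Z_transitive:
  assumes "u \<le> m" "(x, y) \<in> Z u" "(x', y') \<in> Z u"
  obtains g where "g \<in> carrier G" "\<phi> g x = x'" "\<phi> g y = y'"
proof -
  obtain a b where ab: "a \<in> X" "b \<in> X" "Z u = {(\<phi> g a, \<phi> g b) | g. g \<in> carrier G}"
    using Z_orbit[OF assms(1)] .
  obtain g h where g: "g \<in> carrier G" "x = \<phi> g a" "y = \<phi> g b"
    and h: "h \<in> carrier G" "x' = \<phi> h a" "y' = \<phi> h b"
    using assms ab(3) by auto
  interpret group G by (rule is_group)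
  have "\<phi> (h \<otimes>\<^bsub>G\<^esub> inv\<^bsub>G\<^esub> g) (\<phi> g c) = \<phi> h c" if "c \<in> X" for c
    using composition_rule[of "\<phi> g c" h "inv\<^bsub>G\<^esub> g"] g(1) h(1) that
    by (simp add: action_in action_inv)
  then show ?thesis
    using that[of "h \<otimes>\<^bsub>G\<^esub> inv\<^bsub>G\<^esub> g"] g h ab by simp
qed

lemma Z_invariant:
  assumes "u \<le> m" "(x, y) \<in> Z u" "g \<in> carrier G"
  shows "(\<phi> g x, \<phi> g y) \<in> Z u"
proof -
  obtain a b where ab: "a \<in> X" "b \<in> X" "Z u = {(\<phi> g a, \<phi> g b) | g. g \<in> carrier G}"
    using Z_orbit[OF assms(1)] .
  obtain h where h: "h \<in> carrier G" "x = \<phi> h a" "y = \<phi> h b"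
    using assms ab(3) by auto
  interpret group G by (rule is_group)
  have "\<phi> g x = \<phi> (g \<otimes>\<^bsub>G\<^esub> h) a" "\<phi> g y = \<phi> (g \<otimes>\<^bsub>G\<^esub> h) b"
    using composition_rule[of _ g h] ab h assms by simp_all
  then show ?thesis
    using ab(3) h assms(3) by auto
qed

lemma Z_invariant_iff:
  assumes "u \<le> m" "x \<in> X" "y \<in> X" "g \<in> carrier G"
  shows "(\<phi> g x, \<phi> g y) \<in> Z u \<longleftrightarrow> (x, y) \<in> Z u"
  using Z_invariant[OF assms(1) _ assms(4), of x y]
    Z_invariant[OF assms(1) _ inv_carrier[OF assms(4)], of "\<phi> g x" "\<phi> g y"] assms
  by (auto simp: action_inv)

lemma Z_nonempty: "u \<le> m \<Longrightarrow> Z u \<noteq> {}"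
  by (erule Z_orbit) (use monoid.one_closed[OF group.is_monoid[OF is_group]] in auto)

lemma Z_cover: "x \<in> X \<Longrightarrow> y \<in> X \<Longrightarrow> \<exists>u\<le>m. (x, y) \<in> Z u"
proof -
  assume xy: "x \<in> X" "y \<in> X"
  let ?O = "orbit G (\<lambda>g. map_prod (\<phi> g) (\<phi> g)) (x, y)"
  have "?O \<in> orbits G (X \<times> X) (\<lambda>g. map_prod (\<phi> g) (\<phi> g))"
    using xy by (auto simp: orbits_def)
  then have "?O \<in> Z ` {..m}"
    using orbital by (simp add: orbital_labelling_def bij_betw_def)
  then obtain u where "u \<le> m" "Z u = ?O"
    by auto
  moreover have "(x, y) \<in> ?O"
  proof -
    have "\<phi> \<one>\<^bsub>G\<^esub> x = x" "\<phi> \<one>\<^bsub>G\<^esub> y = y"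
      using xy id_eq_one by (metis restrict_apply')+
    moreover have "\<one>\<^bsub>G\<^esub> \<in> carrier G"
      by (rule monoid.one_closed[OF group.is_monoid[OF is_group]])
    ultimately show ?thesis
      unfolding orbit_def by (auto intro!: exI[of _ "\<one>\<^bsub>G\<^esub>"])
  qed
  ultimately show ?thesis
    by auto
qed

lemma Z_disjoint:
  assumes "u \<le> m" "u' \<le> m" "(x, y) \<in> Z u" "(x, y) \<in> Z u'"
  shows "u = u'"
proof -
  have sub: "Z a \<subseteq> Z b" if ab: "a \<le> m" "b \<le> m" "(x, y) \<in> Z a" "(x, y) \<in> Z b" for a b
  proof clarify
    fix x' y' assume "(x', y') \<in> Z a"
    then obtain g where "g \<in> carrier G" "\<phi> g x = x'" "\<phi> g y = y'"
      using Z_transitive[OF ab(1,3)] by blast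
    then show "(x', y') \<in> Z b"
      using Z_invariant[OF ab(2,4)] by auto
  qed
  then have "Z u = Z u'"
    using assms by blast
  then show ?thesis
    using orbital assms(1,2) by (auto simp: orbital_labelling_def bij_betw_def inj_on_def)
qed

lemma Z0: "Z 0 = Id_on X"
  using orbital by (simp add: orbital_labelling_def)

text \<open>Transitivity on \<open>X\<close> amounts to the diagonal being a single orbital, namely
  \<open>Z 0\<close>.\<close>

lemma transitive:
  assumes "x \<in> X" "y \<in> X"
  obtains g where "g \<in> carrier G" "\<phi> g x = y"
  using Z_transitive[of 0 x x y y] assms Z0 by auto

section \<open>Isotypic components and an adapted orthonormal basis\<close>

lemma W_submodule: "w \<le> m \<Longrightarrow> submodule G X \<phi> (W w)"
  and W_nonzero: "w \<le> m \<Longrightarrow> W w \<noteq> {0}"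
  using irred unfolding irreducible_labelling_def multiplicity_free_decomposition_def
    irreducible_submodule_def by simp_all

lemma W_orthogonal:
    "w \<le> m \<Longrightarrow> w' \<le> m \<Longrightarrow> w \<noteq> w' \<Longrightarrow> u \<in> W w \<Longrightarrow> v \<in> W w' \<Longrightarrow> cinner X u v = 0"
  and W0_invariant: "g \<in> carrier G \<Longrightarrow> v \<in> W 0 \<Longrightarrow> push X (\<phi> g) v = v"
  using irred unfolding irreducible_labelling_def by simp_all

lemma W_subspace: "w \<le> m \<Longrightarrow> cfun.subspace (W w)"
  and W_subset: "w \<le> m \<Longrightarrow> W w \<subseteq> V X"
  and W_push: "w \<le> m \<Longrightarrow> g \<in> carrier G \<Longrightarrow> v \<in> W w \<Longrightarrow> push X (\<phi> g) v \<in> W w"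
  using W_submodule[of w] unfolding submodule_def by simp_all

lemma W_decomposition:
  assumes "v \<in> V X"
  obtains f where "\<And>w. w \<le> m \<Longrightarrow> f w \<in> W w" "v = (\<Sum>w\<le>m. f w)"
proof -
  have "\<exists>f. f \<in> (\<Pi>\<^sub>E w\<in>{..m}. W w) \<and> v = (\<Sum>w\<le>m. f w)"
    using irred assms unfolding irreducible_labelling_def multiplicity_free_decomposition_def
    by (meson ex1_implies_ex)
  then show ?thesis
    using that by (auto simp: PiE_iff)
qed

text \<open>The normalized all-ones vector. Together with L_0 it forms the two-letter alphabet of
  the embedded Boolean algebras.\<close>

definition e0 :: "'x \<Rightarrow> complex" where
  "e0 = (\<lambda>x. if x \<in> X then complex_of_real (1 / sqrt (real (card X))) else 0)"

lemma W0_constant: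
  assumes "v \<in> W 0" "x \<in> X" "y \<in> X"
  shows "v x = v y"
proof -
  obtain g where g: "g \<in> carrier G" "\<phi> g x = y"
    using transitive[OF assms(2,3)] .
  have "push X (\<phi> g) v (\<phi> g x) = v x"
    using action_bij[OF g(1)] assms(2) by (intro push_apply) (simp_all add: bij_betw_def)
  then show ?thesis
    using W0_invariant[OF g(1) assms(1)] g(2) by simp
qed

lemma X_nonempty: "X \<noteq> {}"
proof
  assume "X = {}"
  then have "V X = {0}"
    by (auto simp: V_def fun_eq_iff)
  then show False
    using W_nonzero[of 0] W_subset[of 0] cfun.subspace_0[OF W_subspace[of 0]] by auto
qed

lemma card_X_pos: "0 < card X"
  using finX X_nonempty by (simp add: card_gt_0_iff)

lemma sum_e0: "(\<Sum>x\<in>X. e0 x) = complex_of_real (sqrt (real (card X)))"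
proof -
  have "(\<Sum>x\<in>X. e0 x) = complex_of_real (real (card X) * (1 / sqrt (real (card X))))"
    by (simp add: e0_def)
  also have "real (card X) * (1 / sqrt (real (card X))) = sqrt (real (card X))"
    by (simp add: real_div_sqrt)
  finally show ?thesis .
qed

lemma cinner_e0: "cinner X v e0 = (\<Sum>x\<in>X. v x) / complex_of_real (sqrt (real (card X)))"
  by (simp add: cinner_def e0_def sum_divide_distrib)

lemma e0_norm: "cinner X e0 e0 = 1"
  using card_X_pos unfolding cinner_e0 sum_e0 by simp

lemma e0_V: "e0 \<in> V X"
  by (simp add: e0_def V_def)

text \<open>Invariant vectors are constant by transitivity, and \<open>W 0\<close> is not
  zero.\<close>

lemma W0_eq: "W 0 = cfun.span {e0}"
proof -
  have mult: "v \<in> cfun.span {e0}" if v: "v \<in> W 0" for v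
  proof -
    obtain x where x: "x \<in> X"
      using X_nonempty by blast
    have "v = cscale (v x * complex_of_real (sqrt (real (card X)))) e0"
    proof
      fix y
      have "v y = (if y \<in> X then v x else 0)"
        using W0_constant[OF v x, of y] v W_subset[of 0] by (auto simp: V_def)
      then show "v y = cscale (v x * complex_of_real (sqrt (real (card X)))) e0 y"
        using card_X_pos by (simp add: cscale_def e0_def)
    qed
    then show ?thesis
      by (metis cfun.span_base cfun.span_scale insertI1)
  qed
  obtain v where v: "v \<in> W 0" "v \<noteq> 0"
    using W_nonzero[of 0] cfun.subspace_0[OF W_subspace[of 0]] by auto
  have "v \<in> cfun.span {e0}"
    using mult v by blast
  then obtain c where c: "v = cscale c e0"
    by (auto simp: cfun.span_singleton)
  then have "c \<noteq> 0"
    using v by (auto simp: cscale_def fun_eq_iff)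
  then have "e0 = cscale (1 / c) v"
    by (simp add: c cscale_def)
  then have "e0 \<in> W 0"
    using cfun.subspace_scale[OF W_subspace[of 0] v(1)] by (metis le0)
  then have "cfun.span {e0} \<subseteq> W 0"
    using cfun.span_minimal[OF _ W_subspace[of 0]] by blast
  then show ?thesis
    using mult by blast
qed

text \<open>Orthonormal bases of the components. For w = 0 the basis is fixed as \<open>e0\<close>,
  so that trivial positions of a pattern can be recognized by equality with
  \<open>e0\<close>.\<close>

definition K :: "nat \<Rightarrow> ('x \<Rightarrow> complex) set" where
  "K w = (if w = 0 then {e0} else SOME E. orthonormal X E \<and> E \<subseteq> W w \<and> cfun.span E = W w)"

lemma K:
  assumes "w \<le> m"
  shows "orthonormal X (K w)" "K w \<subseteq> W w" "cfun.span (K w) = W w"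
proof -
  have "orthonormal X (K w) \<and> K w \<subseteq> W w \<and> cfun.span (K w) = W w"
  proof (cases "w = 0")
    case True
    then show ?thesis
      using e0_norm e0_V W0_eq cfun.span_base[of e0 "{e0}"] by (simp add: K_def orthonormal_def)
  next
    case False
    have "\<exists>E. orthonormal X E \<and> E \<subseteq> W w \<and> cfun.span E = W w"
      by (rule orthonormal_basis_exists[OF finX W_subspace[OF assms] W_subset[OF assms]]) auto
    from someI_ex[OF this] show ?thesis
      using False by (simp add: K_def)
  qed
  then show "orthonormal X (K w)" "K w \<subseteq> W w" "cfun.span (K w) = W w"
    by auto
qed

lemma K_finite: "w \<le> m \<Longrightarrow> finite (K w)"
  using orthonormal_card[OF finX K(1)] by blast

lemma dim_W: "w \<le> m \<Longrightarrow> cfun.dim (W w) = card (K w)"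
  using cfun.dim_eq_card[of "K w" "W w"] K orthonormal_independent
  by (metis cfun.span_span)

lemma cinner_K:
  assumes "w \<le> m" "w' \<le> m" "e \<in> K w" "e' \<in> K w'"
  shows "cinner X e e' = (if e = e' then 1 else 0)"
proof (cases "w = w'")
  case True
  then show ?thesis
    using assms K(1)[of w] by (auto simp: orthonormal_def)
next
  case False
  then have "cinner X e e' = 0"
    using assms K(2) W_orthogonal by blast
  moreover have "cinner X e e = 1"
    using assms K(1)[of w] by (auto simp: orthonormal_def)
  ultimately show ?thesis
    by auto
qed

lemma K_disjoint:
  assumes "w \<le> m" "w' \<le> m" "e \<in> K w" "e \<in> K w'"
  shows "w = w'"
proof (rule ccontr)
  assume "w \<noteq> w'"
  then have "cinner X e e = 0"
    using assms K(2) W_orthogonal by blast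
  then show False
    using cinner_K[OF assms] by simp
qed

definition KK :: "('x \<Rightarrow> complex) set" where
  "KK = (\<Union>w\<in>{..m}. K w)"

definition wt :: "('x \<Rightarrow> complex) \<Rightarrow> nat" where
  "wt e = (THE w. w \<le> m \<and> e \<in> K w)"

lemma wt_eq: "w \<le> m \<Longrightarrow> e \<in> K w \<Longrightarrow> wt e = w"
  unfolding wt_def using K_disjoint by (intro the_equality) auto

lemma wt: "e \<in> KK \<Longrightarrow> wt e \<le> m" "e \<in> KK \<Longrightarrow> e \<in> K (wt e)"
  using wt_eq by (auto simp: KK_def)

lemma wt_eq_0: "e \<in> KK \<Longrightarrow> wt e = 0 \<longleftrightarrow> e = e0"
  using wt[of e] wt_eq[of 0 e0] by (auto simp: K_def)

lemma e0_KK: "e0 \<in> KK"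
  by (auto simp: KK_def K_def)

lemma KK_finite: "finite KK"
  using K_finite by (simp add: KK_def)

lemma KK_V: "e \<in> KK \<Longrightarrow> e \<in> V X"
  using K(2) W_subset by (fastforce simp: KK_def)

lemma cinner_KK: "e \<in> KK \<Longrightarrow> e' \<in> KK \<Longrightarrow> cinner X e e' = (if e = e' then 1 else 0)"
  using cinner_K by (auto simp: KK_def)

lemma KK_complete:
  assumes "x \<in> X"
  shows "(\<Sum>e\<in>KK. e x * cnj (e y)) = (if x = y then 1 else 0)"
proof (rule orthonormal_complete[OF finX _ _ assms])
  show "orthonormal X KK"
    using cinner_KK KK_V by (auto simp: orthonormal_def)
  show "V X \<subseteq> cfun.span KK"
  proof
    fix v assume "v \<in> V X"
    then obtain f where f: "\<And>w. w \<le> m \<Longrightarrow> f w \<in> W w" "v = (\<Sum>w\<le>m. f w)"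
      using W_decomposition by blast
    have "f w \<in> cfun.span KK" if "w \<le> m" for w
    proof -
      have "f w \<in> cfun.span (K w)"
        using f(1) K(3) that by blast
      then show ?thesis
        using cfun.span_mono[of "K w" KK] that by (auto simp: KK_def)
    qed
    then show "v \<in> cfun.span KK"
      unfolding f(2) by (intro cfun.span_sum) auto
  qed
qed

section \<open>Projection kernels and the eigenvalues of the orbitals\<close>

text \<open>The kernel of the orthogonal projection onto \<open>W w\<close>.\<close>

definition proj :: "nat \<Rightarrow> 'x \<Rightarrow> 'x \<Rightarrow> complex" where
  "proj w x y = (\<Sum>e\<in>K w. e x * cnj (e y))"

lemma proj_column: "w \<le> m \<Longrightarrow> (\<lambda>x. proj w x y) \<in> W w"
proof -
  assume w: "w \<le> m"
  have "(\<lambda>x. proj w x y) = (\<Sum>e\<in>K w. cscale (cnj (e y)) e)"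
    by (auto simp: proj_def sum_fun_app cscale_def fun_eq_iff mult.commute)
  moreover have "(\<Sum>e\<in>K w. cscale (cnj (e y)) e) \<in> W w"
    using K(2)[OF w] by (intro cfun.subspace_sum[OF W_subspace[OF w]] cfun.subspace_scale[OF W_subspace[OF w]]) auto
  ultimately show ?thesis
    by simp
qed

lemma proj_reproducing:
  assumes "w \<le> m" "v \<in> W w"
  shows "cinner X v (\<lambda>x. proj w x y) = v y"
proof -
  have "cinner X v (\<lambda>x. proj w x y) = (\<Sum>x\<in>X. \<Sum>e\<in>K w. v x * (cnj (e x) * e y))"
    by (simp add: cinner_def proj_def sum_distrib_left)
  also have "\<dots> = (\<Sum>e\<in>K w. cinner X v e * e y)"
    unfolding cinner_def sum_distrib_right by (subst sum.swap) (simp add: mult.assoc)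
  also have "\<dots> = (\<Sum>e\<in>K w. cscale (cinner X v e) e) y"
    by (simp add: sum_fun_app cscale_def)
  also have "\<dots> = v y"
    using orthonormal_expand[OF finX K(1)[OF assms(1)], of v] assms K(3) by simp
  finally show ?thesis .
qed

text \<open>The column of \<^const>\<open>proj\<close> at \<open>y\<close> is the unique element of \<open>W w\<close> representing evaluation
  at \<open>y\<close>, and this characterisation is \<open>G\<close>-invariant.\<close>

lemma proj_invariant:
  assumes w: "w \<le> m" and g: "g \<in> carrier G" and x: "x \<in> X" and y: "y \<in> X"
  shows "proj w (\<phi> g x) (\<phi> g y) = proj w x y"
proof -
  let ?q = "\<lambda>x. proj w x (\<phi> g y)"
  let ?p = "\<lambda>x. proj w x y"
  let ?p' = "push X (\<phi> (inv\<^bsub>G\<^esub> g)) ?q"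
  have inj: "inj_on (\<phi> h) X" if "h \<in> carrier G" for h
    using action_bij[OF that] by (simp add: bij_betw_def)
  have p': "?p' x = ?q (\<phi> g x)" if "x \<in> X" for x
    using push_apply[OF inj[OF inv_carrier[OF g]] action_in[OF g that], of ?q]
    by (simp add: action_inv[OF g that])
  have p'W: "?p' \<in> W w"
    using W_push[OF w inv_carrier[OF g] proj_column[OF w]] .
  have eq: "cinner X v ?p' = cinner X v ?p" if v: "v \<in> W w" for v
  proof -
    have "cinner X v ?p' = (\<Sum>x\<in>X. push X (\<phi> g) v (\<phi> g x) * cnj (?q (\<phi> g x)))"
      unfolding cinner_def by (intro sum.cong refl) (simp only: p' push_apply[OF inj[OF g]])
    also have "\<dots> = cinner X (push X (\<phi> g) v) ?q"
      unfolding cinner_def by (rule sum.reindex_bij_betw[OF action_bij[OF g]])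
    also have "\<dots> = push X (\<phi> g) v (\<phi> g y)"
      by (rule proj_reproducing[OF w W_push[OF w g v]])
    also have "\<dots> = v y"
      by (rule push_apply[OF inj[OF g] y])
    finally show ?thesis
      using proj_reproducing[OF w v] by simp
  qed
  have d: "?p' - ?p \<in> W w"
    using p'W proj_column[OF w] cfun.subspace_diff[OF W_subspace[OF w]] by blast
  have "cinner X (?p' - ?p) (?p' - ?p) = 0"
    using eq[OF d] by (subst cinner_diff_right) simp
  then have "?p' - ?p = 0"
    using cinner_self_eq_0[OF finX] d W_subset[OF w] by blast
  then have "?p' x = ?p x"
    by (metis eq_iff_diff_eq_0)
  then show ?thesis
    using p'[OF x] by simp
qed

lemma proj_apply:
  assumes "w \<le> m" "w' \<le> m" "e \<in> K w'"
  shows "(\<Sum>y\<in>X. proj w x y * e y) = (if w = w' then e x else 0)"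
proof -
  have "(\<Sum>y\<in>X. proj w x y * e y) = (\<Sum>e'\<in>K w. e' x * cinner X e e')"
    unfolding proj_def cinner_def sum_distrib_left sum_distrib_right
    by (subst sum.swap) (simp add: algebra_simps)
  also have "\<dots> = (\<Sum>e'\<in>K w. if e' = e then e x else 0)"
    using cinner_K assms by (intro sum.cong) auto
  also have "\<dots> = (if w = w' then e x else 0)"
  proof -
    have "e \<in> K w \<longleftrightarrow> w = w'"
      using K_disjoint[OF assms(1,2) _ assms(3)] assms(3) by metis
    then show ?thesis
      using K_finite[OF assms(1)] by (simp add: sum.delta)
  qed
  finally show ?thesis .
qed

lemma K_nonempty: "w \<le> m \<Longrightarrow> \<exists>e. e \<in> K w"
proof (rule ccontr)
  assume w: "w \<le> m" and "\<nexists>e. e \<in> K w"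
  then have "K w = {}"
    by auto
  then have "cfun.span (K w) = {0}"
    by (simp only: cfun.span_empty)
  then show False
    using K(3)[OF w] W_nonzero[OF w] by (simp only: simp_thms)
qed

text \<open>The \<open>m + 1\<close> projection kernels lie in the \<open>(m + 1)\<close>-dimensional space of \<open>G\<close>-invariant
  kernels on \<open>X \<times> X\<close>, so they span it and the orbital operators are combinations of them. This
  replaces Schur's lemma.\<close>

lemma orbital_eigenvalue_exists:
  assumes u: "u \<le> m"
  obtains c where "\<And>w e x. w \<le> m \<Longrightarrow> e \<in> K w \<Longrightarrow> x \<in> X \<Longrightarrow>
    (\<Sum>y | y \<in> X \<and> (x, y) \<in> Z u. e y) = c w * e x"
proof -
  define r where "r u = (SOME p. p \<in> Z u)" for u
  \<comment> \<open>An invariant kernel is determined by one value per orbital; \<open>A w\<close>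
    lists these values for \<open>proj w\<close>, so the kernels become vectors indexed by
    \<open>{..m}\<close>.\<close>
  define A where "A w = (\<lambda>u. if u \<le> m then proj w (fst (r u)) (snd (r u)) else 0)" for w
  have r: "(fst (r u), snd (r u)) \<in> Z u" if "u \<le> m" for u
    using Z_nonempty[OF that] unfolding r_def by (simp add: some_in_eq)
  have A: "proj w x y = A w u" if wu: "w \<le> m" "u \<le> m" "(x, y) \<in> Z u" for w u x y
  proof -
    obtain g where "g \<in> carrier G" "\<phi> g (fst (r u)) = x" "\<phi> g (snd (r u)) = y"
      using Z_transitive[OF wu(2) r[OF wu(2)] wu(3)] by blast
    then show ?thesis
      using proj_invariant[OF wu(1), of g "fst (r u)" "snd (r u)"] r[OF wu(2)] Z_subset[OF wu(2)] wu(2)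
      by (auto simp: A_def)
  qed
  have "\<exists>c. (ket u :: nat \<Rightarrow> complex) = (\<Sum>w\<in>{..m}. cscale (c w) (A w))"
  proof (rule independent_family_spans[where K = "{..m}"])
    fix c assume z: "(\<Sum>w\<in>{..m}. cscale (c w) (A w)) = 0"
    have z': "(\<Sum>w\<le>m. c w * proj w x y) = 0" if xy: "x \<in> X" "y \<in> X" for x y
    proof -
      obtain u where u: "u \<le> m" "(x, y) \<in> Z u"
        using Z_cover[OF xy] by blast
      have "(\<Sum>w\<le>m. c w * proj w x y) = (\<Sum>w\<in>{..m}. cscale (c w) (A w)) u"
        unfolding sum_fun_app cscale_def using A u by (intro sum.cong) auto
      then show ?thesis
        by (simp add: z)
    qed
    show "\<forall>w\<in>{..m}. c w = 0"
    proof
      fix w assume "w \<in> {..m}"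
      then have w: "w \<le> m" by simp
      obtain e where e: "e \<in> K w"
        using K_nonempty[OF w] by blast
      have "c w * e x = 0" if x: "x \<in> X" for x
      proof -
        \<comment> \<open>A vanishing combination of the kernels is applied to a basis vector of
          \<open>W w\<close>: each kernel acts as a projection, and only the term for w
          survives.\<close>
        have "c w * e x = (\<Sum>w'\<le>m. if w' = w then c w' * e x else 0)"
          using w by simp
        also have "\<dots> = (\<Sum>w'\<le>m. c w' * (\<Sum>y\<in>X. proj w' x y * e y))"
          by (intro sum.cong refl) (simp add: proj_apply[OF _ w e])
        also have "\<dots> = (\<Sum>y\<in>X. (\<Sum>w'\<le>m. c w' * proj w' x y) * e y)"
          unfolding sum_distrib_left sum_distrib_right mult.assoc by (rule sum.swap)
        also have "\<dots> = 0"
          using z'[OF x] by simp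
        finally show ?thesis .
      qed
      moreover have "\<exists>x\<in>X. e x \<noteq> 0"
      proof (rule ccontr)
        assume "\<not> (\<exists>x\<in>X. e x \<noteq> 0)"
        then have "cinner X e e = 0"
          by (simp add: cinner_def)
        then show False
          using cinner_K[OF w w e e] by simp
      qed
      ultimately show "c w = 0"
        by auto
    qed
  qed (auto simp: A_def V_def ket_def u)
  then obtain c where c: "(ket u :: nat \<Rightarrow> complex) = (\<Sum>w\<in>{..m}. cscale (c w) (A w))"
    by blast
  have ind: "(\<Sum>w\<le>m. c w * proj w x y) = (if (x, y) \<in> Z u then 1 else 0)" if xy: "x \<in> X" "y \<in> X" for x y
  proof -
    obtain u' where u': "u' \<le> m" "(x, y) \<in> Z u'"
      using Z_cover[OF xy] by blast
    have "(\<Sum>w\<le>m. c w * proj w x y) = (\<Sum>w\<in>{..m}. cscale (c w) (A w)) u'"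
      unfolding sum_fun_app cscale_def using A u' by (intro sum.cong) auto
    also have "\<dots> = (if u' = u then 1 else 0)"
      unfolding c[symmetric] by (simp add: ket_def)
    finally show ?thesis
      using Z_disjoint[OF u'(1) u u'(2)] u' by auto
  qed
  have "(\<Sum>y | y \<in> X \<and> (x, y) \<in> Z u. e y) = c w * e x" if w: "w \<le> m" and e: "e \<in> K w" and x: "x \<in> X" for w e x
  proof -
    have "(\<Sum>y | y \<in> X \<and> (x, y) \<in> Z u. e y) = (\<Sum>y\<in>X. (if (x, y) \<in> Z u then 1 else 0) * e y)"
      using finX by (simp add: sum.inter_filter if_distrib if_distribR cong: if_cong)
    also have "\<dots> = (\<Sum>y\<in>X. (\<Sum>w'\<le>m. c w' * proj w' x y) * e y)"
      using ind[OF x] by (intro sum.cong) auto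
    also have "\<dots> = (\<Sum>w'\<le>m. c w' * (\<Sum>y\<in>X. proj w' x y * e y))"
      unfolding sum_distrib_left sum_distrib_right mult.assoc by (rule sum.swap)
    also have "\<dots> = (\<Sum>w'\<le>m. if w' = w then c w' * e x else 0)"
      by (intro sum.cong refl) (simp add: proj_apply[OF _ w e])
    also have "\<dots> = c w * e x"
      using w by simp
    finally show ?thesis .
  qed
  then show ?thesis
    using that by blast
qed

text \<open>The eigenvalue equation extends linearly from \<open>K w\<close> to \<open>W w\<close>,
  and a nonzero basis vector shows that the scalar is unique. This resolves the \<open>THE\<close>
  in \<open>lam\<close>.\<close>

lemma orbital_eigenvalue:
  assumes u: "u \<le> m" and w: "w \<le> m" and e: "e \<in> K w" and x: "x \<in> X"
  shows "(\<Sum>y | y \<in> X \<and> (x, y) \<in> Z u. e y) = lam X Z W u w * e x"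
proof -
  obtain c where c: "\<And>w e x. w \<le> m \<Longrightarrow> e \<in> K w \<Longrightarrow> x \<in> X \<Longrightarrow>
      (\<Sum>y | y \<in> X \<and> (x, y) \<in> Z u. e y) = c w * e x"
    using orbital_eigenvalue_exists[OF u] by blast
  have on_K: "orbital_op X (Z u) e = cscale (c w) e" if "e \<in> K w" for e
  proof
    fix x
    show "orbital_op X (Z u) e x = cscale (c w) e x"
    proof (cases "x \<in> X")
      case True
      then show ?thesis
        using c[OF w that True] by (simp add: orbital_op_def cscale_def)
    next
      case False
      then have "{y. y \<in> X \<and> (x, y) \<in> Z u} = {}" and "e x = 0"
        using Z_subset[OF u] KK_V[of e] that w by (auto simp: KK_def V_def)
      then show ?thesis
        unfolding orbital_op_def cscale_def by (simp only: sum.empty mult_zero_right)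
    qed
  qed
  have on_W: "orbital_op X (Z u) v = cscale (c w) v" if "v \<in> W w" for v
  proof -
    have "v = (\<Sum>e\<in>K w. cscale (cinner X v e) e)"
      using orthonormal_expand[OF finX K(1)[OF w]] that K(3)[OF w] by simp
    then have v: "v = (\<lambda>x. \<Sum>e\<in>K w. cinner X v e * e x)"
      by (simp add: fun_eq_iff sum_fun_app cscale_def)
    show ?thesis
    proof
      fix x
      have "orbital_op X (Z u) v x = (\<Sum>y | y \<in> X \<and> (x, y) \<in> Z u. \<Sum>e\<in>K w. cinner X v e * e y)"
        unfolding orbital_op_def by (subst v) simp
      also have "\<dots> = (\<Sum>e\<in>K w. cinner X v e * orbital_op X (Z u) e x)"
        unfolding orbital_op_def sum_distrib_left by (rule sum.swap)
      also have "\<dots> = c w * (\<Sum>e\<in>K w. cinner X v e * e x)"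
        by (simp add: on_K cscale_def sum_distrib_left algebra_simps)
      also have "\<dots> = cscale (c w) v x"
        by (subst (2) v) (simp add: cscale_def)
      finally show "orbital_op X (Z u) v x = cscale (c w) v x" .
    qed
  qed
  have "lam X Z W u w = c w"
    unfolding lam_def
  proof (rule the_equality)
    fix d assume d: "\<forall>v\<in>W w. orbital_op X (Z u) v = cscale d v"
    have "e \<in> W w"
      using e K(2)[OF w] by blast
    then have "cscale d e = cscale (c w) e"
      using d on_W by metis
    moreover have "e \<noteq> 0"
      using cinner_K[OF w w e e] by auto
    ultimately show "d = c w"
      by (simp add: cfun.scale_cancel_right)
  qed (use on_W in blast)
  then show ?thesis
    using c[OF w e x] by simp
qed

end

section \<open>Tensor products\<close>

lemma BX_iff: "a \<in> BX X n \<longleftrightarrow> length a = n \<and> (\<forall>i<n. a ! i \<in> insert None (Some ` X))"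
  by (auto simp: BX_def subset_iff set_conv_nth)

lemma finite_BX: "finite X \<Longrightarrow> finite (BX X n)"
  unfolding BX_def using finite_lists_length_eq[of "insert None (Some ` X)" n]
  by (simp add: conj_commute)

lemma supp_subset: "a \<in> BX X n \<Longrightarrow> supp a \<subseteq> {..<n}"
  by (auto simp: supp_def BX_def)

lemma finite_supp [simp]: "finite (supp a)"
  by (simp add: supp_def)

lemma the_in_X: "a \<in> BX X n \<Longrightarrow> i \<in> supp a \<Longrightarrow> the (a ! i) \<in> X"
  by (auto simp: supp_def BX_iff)

text \<open>Distributivity over the positions of a word; every later factorization into one-position
  sums comes from here.\<close>

lemma sum_BX_prod:
  fixes h :: "nat \<Rightarrow> 'x option \<Rightarrow> 'c::comm_semiring_1"
  assumes "finite X"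
  shows "(\<Sum>a\<in>BX X n. \<Prod>i<n. h i (a ! i)) = (\<Prod>i<n. h i None + (\<Sum>x\<in>X. h i (Some x)))"
proof -
  let ?Y = "insert None (Some ` X)"
  have "(\<Sum>a\<in>BX X n. \<Prod>i<n. h i (a ! i)) = (\<Sum>f\<in>{..<n} \<rightarrow>\<^sub>E ?Y. \<Prod>i<n. h i (f i))"
  proof (rule sum.reindex_bij_witness[of _ "\<lambda>f. map f [0..<n]" "\<lambda>a. restrict (nth a) {..<n}"])
    fix a assume "a \<in> BX X n"
    then show "map (restrict (nth a) {..<n}) [0..<n] = a"
      by (intro nth_equalityI) (auto simp: BX_iff)
  qed (auto simp: BX_iff PiE_iff extensional_def fun_eq_iff)
  also have "\<dots> = (\<Prod>i<n. \<Sum>y\<in>?Y. h i y)"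
    using assms by (intro prod_sum_PiE[symmetric]) auto
  also have "\<dots> = (\<Prod>i<n. h i None + (\<Sum>x\<in>X. h i (Some x)))"
    using assms by (simp add: sum.reindex)
  finally show ?thesis .
qed

definition slot :: "bool \<Rightarrow> ('x \<Rightarrow> complex) \<Rightarrow> 'x option \<Rightarrow> complex" where
  "slot b f y = (case y of None \<Rightarrow> if b then 0 else 1 | Some x \<Rightarrow> if b then f x else 0)"

lemma slot_simps [simp]:
  "slot b f None = (if b then 0 else 1)" "slot b f (Some x) = (if b then f x else 0)"
  by (simp_all add: slot_def)

text \<open>The pure tensor with factor \<open>g i\<close> at the positions of \<open>A\<close> and
  the basis vector of L_0 elsewhere.\<close>

definition tens :: "'x set \<Rightarrow> nat \<Rightarrow> (nat \<Rightarrow> 'x \<Rightarrow> complex) \<Rightarrow> nat set \<Rightarrow> 'x option list \<Rightarrow> complex" where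
  "tens X n g A a = (if a \<in> BX X n then \<Prod>i<n. slot (i \<in> A) (g i) (a ! i) else 0)"

lemma tens_eq:
  assumes a: "a \<in> BX X n" and A: "A \<subseteq> {..<n}"
  shows "tens X n g A a = (if supp a = A then \<Prod>i\<in>A. g i (the (a ! i)) else 0)"
proof (cases "supp a = A")
  case True
  have "(\<Prod>i<n. slot (i \<in> A) (g i) (a ! i)) = (\<Prod>i<n. if i \<in> A then g i (the (a ! i)) else 1)"
    using True a by (intro prod.cong) (auto simp: supp_def BX_iff)
  also have "\<dots> = (\<Prod>i\<in>A. g i (the (a ! i)))"
    using A by (simp add: prod.If_cases Int_absorb1)
  finally show ?thesis
    using a True by (simp add: tens_def)
next
  case False
  then obtain i where i: "i < n" "(i \<in> supp a) \<noteq> (i \<in> A)"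
    using A supp_subset[OF a] by auto
  then have "slot (i \<in> A) (g i) (a ! i) = 0"
    using a by (auto simp: supp_def BX_iff split: option.splits)
  then have "(\<Prod>i<n. slot (i \<in> A) (g i) (a ! i)) = 0"
    using i by (intro prod_zero) auto
  then show ?thesis
    using False by (simp add: tens_def)
qed

text \<open>The entry of a conjugated matrix at the columns \<open>u\<close> and \<open>v\<close>:
  conjugate linear in \<open>u\<close>, linear in \<open>v\<close>.\<close>

definition mform :: "'a set \<Rightarrow> ('a \<Rightarrow> complex) \<Rightarrow> ('a \<Rightarrow> 'a \<Rightarrow> complex) \<Rightarrow> ('a \<Rightarrow> complex) \<Rightarrow> complex" where
  "mform S u M v = (\<Sum>x\<in>S. \<Sum>y\<in>S. cnj (u x) * M x y * v y)"

lemma mform_sum_left: "mform S (\<Sum>i\<in>I. cscale (c i) (f i)) M v = (\<Sum>i\<in>I. cnj (c i) * mform S (f i) M v)"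
proof -
  have "mform S (\<Sum>i\<in>I. cscale (c i) (f i)) M v =
      (\<Sum>x\<in>S. \<Sum>y\<in>S. \<Sum>i\<in>I. cnj (c i) * (cnj (f i x) * M x y * v y))"
    by (simp add: mform_def sum_fun_app cscale_def sum_distrib_right sum_distrib_left algebra_simps)
  also have "\<dots> = (\<Sum>x\<in>S. \<Sum>i\<in>I. \<Sum>y\<in>S. cnj (c i) * (cnj (f i x) * M x y * v y))"
    by (intro sum.cong refl sum.swap)
  also have "\<dots> = (\<Sum>i\<in>I. \<Sum>x\<in>S. \<Sum>y\<in>S. cnj (c i) * (cnj (f i x) * M x y * v y))"
    by (rule sum.swap)
  finally show ?thesis
    by (simp add: mform_def sum_distrib_left)
qed

lemma mform_sum_right: "mform S u M (\<Sum>i\<in>I. cscale (c i) (f i)) = (\<Sum>i\<in>I. c i * mform S u M (f i))"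
proof -
  have "mform S u M (\<Sum>i\<in>I. cscale (c i) (f i)) =
      (\<Sum>x\<in>S. \<Sum>y\<in>S. \<Sum>i\<in>I. c i * (cnj (u x) * M x y * f i y))"
    by (simp add: mform_def sum_fun_app cscale_def sum_distrib_left algebra_simps)
  also have "\<dots> = (\<Sum>x\<in>S. \<Sum>i\<in>I. \<Sum>y\<in>S. c i * (cnj (u x) * M x y * f i y))"
    by (intro sum.cong refl sum.swap)
  also have "\<dots> = (\<Sum>i\<in>I. \<Sum>x\<in>S. \<Sum>y\<in>S. c i * (cnj (u x) * M x y * f i y))"
    by (rule sum.swap)
  finally show ?thesis
    by (simp add: mform_def sum_distrib_left)
qed

section \<open>Orbit matrices evaluated on pure tensors\<close>

context multiplicity_free_action
begin

text \<open>The positions that carry nontrivial basis vectors. At the other positions the value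
  \<open>e0\<close> of the pattern leaves the choice between \<open>e0\<close> and L_0 open.\<close>

definition S :: "nat \<Rightarrow> (nat \<Rightarrow> 'x \<Rightarrow> complex) \<Rightarrow> nat set" where
  "S n g = {i\<in>{..<n}. g i \<noteq> e0}"

abbreviation patterns :: "nat \<Rightarrow> (nat \<Rightarrow> 'x \<Rightarrow> complex) set" where
  "patterns n \<equiv> {..<n} \<rightarrow>\<^sub>E KK"

lemma S_subset: "S n g \<subseteq> {..<n}"
  by (auto simp: S_def)

lemma finite_S [simp]: "finite (S n g)"
  by (simp add: S_def)

lemma pattern_KK: "g \<in> patterns n \<Longrightarrow> i < n \<Longrightarrow> g i \<in> KK"
  by auto

lemma sum_KK: "e \<in> KK \<Longrightarrow> (\<Sum>x\<in>X. e x) = (if e = e0 then complex_of_real (sqrt (real (card X))) else 0)"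
  using cinner_KK[OF _ e0_KK, of e] sum_e0 card_X_pos by (auto simp: cinner_e0)

text \<open>Outside \<open>A\<close> both patterns have the value \<open>e0\<close>, because
  \<open>A\<close> contains their nontrivial positions. Thus a tensor determines its pattern even
  where it has the factor L_0.\<close>

lemma patterns_eqI:
  assumes "g \<in> patterns n" "g' \<in> patterns n" "S n g \<subseteq> A" "S n g' \<subseteq> A"
    "\<And>i. i \<in> A \<Longrightarrow> i < n \<Longrightarrow> g i = g' i"
  shows "g = g'"
proof (rule PiE_ext[OF assms(1,2)])
  fix i assume "i \<in> {..<n}"
  then show "g i = g' i"
    using assms(3-5) by (cases "i \<in> A") (fastforce simp: S_def)+
qed

lemma cinner_tens:
  assumes g: "g \<in> patterns n" and g': "g' \<in> patterns n"
    and A: "S n g \<subseteq> A" "A \<subseteq> {..<n}" and A': "S n g' \<subseteq> A'" "A' \<subseteq> {..<n}"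
  shows "cinner (BX X n) (tens X n g A) (tens X n g' A') = (if g = g' \<and> A = A' then 1 else 0)"
proof -
  let ?h = "\<lambda>i y. slot (i \<in> A) (g i) y * cnj (slot (i \<in> A') (g' i) y)"
  have "cinner (BX X n) (tens X n g A) (tens X n g' A') = (\<Sum>a\<in>BX X n. \<Prod>i<n. ?h i (a ! i))"
    by (simp add: cinner_def tens_def prod.distrib)
  also have "\<dots> = (\<Prod>i<n. ?h i None + (\<Sum>x\<in>X. ?h i (Some x)))"
    by (rule sum_BX_prod[OF finX])
  also have "\<dots> = (\<Prod>i<n. if (i \<in> A) = (i \<in> A') \<and> (i \<in> A \<longrightarrow> g i = g' i) then 1 else 0)"
  proof (intro prod.cong refl)
    fix i assume "i \<in> {..<n}"
    then have "cinner X (g i) (g' i) = (if g i = g' i then 1 else 0)"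
      using g g' by (intro cinner_KK) auto
    then show "?h i None + (\<Sum>x\<in>X. ?h i (Some x)) =
        (if (i \<in> A) = (i \<in> A') \<and> (i \<in> A \<longrightarrow> g i = g' i) then 1 else 0)"
      by (auto simp: cinner_def)
  qed
  also have "\<dots> = (if \<forall>i<n. (i \<in> A) = (i \<in> A') \<and> (i \<in> A \<longrightarrow> g i = g' i) then 1 else 0)"
    by (auto intro: prod_zero)
  also have "(\<forall>i<n. (i \<in> A) = (i \<in> A') \<and> (i \<in> A \<longrightarrow> g i = g' i)) \<longleftrightarrow> g = g' \<and> A = A'"
  proof
    assume *: "\<forall>i<n. (i \<in> A) = (i \<in> A') \<and> (i \<in> A \<longrightarrow> g i = g' i)"
    then have "A = A'"
      using A A' by auto
    then show "g = g' \<and> A = A'"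
      using patterns_eqI[OF g g', of A] A A' * by auto
  qed auto
  finally show ?thesis .
qed

text \<open>Assignments of one orbital to each position of \<open>D\<close>, with multiplicities
  prescribed by \<open>l\<close>.\<close>

definition labellings :: "nat set \<Rightarrow> nat list \<Rightarrow> (nat \<Rightarrow> nat) set" where
  "labellings D l = {c \<in> D \<rightarrow>\<^sub>E {..m}. \<forall>u\<le>m. card {i\<in>D. c i = u} = l ! u}"

text \<open>The orbit type constrains all common positions at once. Summing over labellings replaces
  it by products of conditions at single positions; at most one labelling contributes, the one
  naming the true orbital at each position.\<close>

lemma orbit_type_indicator:
  assumes a: "a \<in> BX X n" and b: "b \<in> BX X n" and l: "length l = Suc m"
  shows "(if orbit_type m Z a b = l then 1 else 0 :: complex) =
    (\<Sum>c\<in>labellings (supp a \<inter> supp b) l.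
       \<Prod>i\<in>supp a \<inter> supp b. if (the (a ! i), the (b ! i)) \<in> Z (c i) then 1 else 0)"
proof -
  let ?D = "supp a \<inter> supp b"
  define z where "z i = (SOME u. u \<le> m \<and> (the (a ! i), the (b ! i)) \<in> Z u)" for i
  define c0 where "c0 = restrict z ?D"
  have z: "z i \<le> m \<and> (the (a ! i), the (b ! i)) \<in> Z (z i)" if "i \<in> ?D" for i
    unfolding z_def
    using someI_ex[OF Z_cover[OF the_in_X[OF a] the_in_X[OF b], of i i]] that by auto
  have uniq: "(the (a ! i), the (b ! i)) \<in> Z u \<longleftrightarrow> u = z i" if "i \<in> ?D" "u \<le> m" for i u
    using z[OF that(1)] Z_disjoint that by auto
  have c0: "c0 \<in> ?D \<rightarrow>\<^sub>E {..m}"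
    using z by (auto simp: c0_def)
  have fin: "finite (labellings ?D l)"
    by (rule finite_subset[OF _ finite_PiE[of ?D "\<lambda>_. {..m}"]]) (auto simp: labellings_def)
  have "(\<Sum>c\<in>labellings ?D l. \<Prod>i\<in>?D. if (the (a ! i), the (b ! i)) \<in> Z (c i) then 1 else 0) =
      (\<Sum>c\<in>labellings ?D l. if c = c0 then 1 else 0 :: complex)"
  proof (intro sum.cong refl)
    fix c assume "c \<in> labellings ?D l"
    then have c: "c \<in> ?D \<rightarrow>\<^sub>E {..m}"
      by (simp add: labellings_def)
    have "(\<Prod>i\<in>?D. if (the (a ! i), the (b ! i)) \<in> Z (c i) then 1 else 0) =
        (if \<forall>i\<in>?D. c i = z i then 1 else 0 :: complex)"
    proof (cases "\<forall>i\<in>?D. c i = z i")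
      case True
      then show ?thesis
        using z by (auto intro!: prod.neutral)
    next
      case False
      then obtain i where i: "i \<in> ?D" "c i \<noteq> z i"
        by blast
      then have "(the (a ! i), the (b ! i)) \<notin> Z (c i)"
        using uniq[OF i(1), of "c i"] c by auto
      then show ?thesis
        using i(1) False by (auto intro!: prod_zero bexI[of _ i])
    qed
    also have "(\<forall>i\<in>?D. c i = z i) \<longleftrightarrow> c = c0"
      using PiE_ext[OF c c0] by (auto simp: c0_def)
    finally show "(\<Prod>i\<in>?D. if (the (a ! i), the (b ! i)) \<in> Z (c i) then 1 else 0) =
        (if c = c0 then 1 else 0 :: complex)" .
  qed
  also have "\<dots> = (if c0 \<in> labellings ?D l then 1 else 0)"
    using fin by simp
  also have "c0 \<in> labellings ?D l \<longleftrightarrow> orbit_type m Z a b = l"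
  proof -
    have "card {i\<in>?D. c0 i = u} = orbit_type m Z a b ! u" if "u \<le> m" for u
    proof -
      have "{i\<in>?D. c0 i = u} = {i\<in>?D. (the (a ! i), the (b ! i)) \<in> Z u}"
        using uniq[OF _ that] by (auto simp: c0_def)
      then show ?thesis
        using that by (simp add: orbit_type_def nth_append less_Suc_eq_le del: upt_Suc)
    qed
    then have "c0 \<in> labellings ?D l \<longleftrightarrow> (\<forall>u<Suc m. orbit_type m Z a b ! u = l ! u)"
      using c0 by (auto simp: labellings_def less_Suc_eq_le)
    then show ?thesis
      using l by (auto simp: list_eq_iff_nth_eq orbit_type_def simp del: upt_Suc)
  qed
  finally show ?thesis ..
qed

text \<open>The orbital multiplies \<open>e\<close> by its eigenvalue, and orthonormality decides
  the remaining inner product.\<close>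

lemma orbit_pairing:
  assumes e: "e \<in> KK" and e': "e' \<in> KK" and u: "u \<le> m"
  shows "(\<Sum>x\<in>X. \<Sum>y\<in>X. cnj (e' x) * e y * (if (x, y) \<in> Z u then 1 else 0)) =
    (if e = e' then lam X Z W u (wt e) else 0)"
proof -
  have "(\<Sum>y\<in>X. cnj (e' x) * e y * (if (x, y) \<in> Z u then 1 else 0)) =
      lam X Z W u (wt e) * (e x * cnj (e' x))" if "x \<in> X" for x
  proof -
    have "(\<Sum>y\<in>X. cnj (e' x) * e y * (if (x, y) \<in> Z u then 1 else 0)) =
        cnj (e' x) * (\<Sum>y | y \<in> X \<and> (x, y) \<in> Z u. e y)"
      using finX by (simp add: sum_distrib_left mult.assoc sum.inter_filter if_distrib cong: if_cong)
    then show ?thesis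
      using orbital_eigenvalue[OF u wt[OF e] that] by simp
  qed
  then have "(\<Sum>x\<in>X. \<Sum>y\<in>X. cnj (e' x) * e y * (if (x, y) \<in> Z u then 1 else 0)) =
      lam X Z W u (wt e) * cinner X e e'"
    by (simp add: cinner_def sum_distrib_left)
  then show ?thesis
    using cinner_KK[OF e e'] by simp
qed

text \<open>For equal patterns, a position contributes an orbital eigenvalue where both tensors have
  a letter, sqrt |X| (the sum of the entries of \<open>e0\<close>) where exactly one has, and 1
  where neither has. Summing the eigenvalue products over all labellings gives
  \<open>Lambda\<close>.\<close>

lemma mform_orbit_matrix_tens:
  assumes g: "g \<in> patterns n" and g': "g' \<in> patterns n"
    and A: "S n g \<subseteq> A" "A \<subseteq> {..<n}" and A': "S n g' \<subseteq> A'" "A' \<subseteq> {..<n}"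
    and l: "length l = Suc m" and q: "length q = Suc m"
    and qv: "\<And>v. v \<le> m \<Longrightarrow> q ! v = int (card {i \<in> A' \<inter> A. wt (g i) = v})"
  shows "mform (BX X n) (tens X n g' A') (orbit_matrix X m Z n i j t l) (tens X n g A) =
    (if g = g' \<and> card A' = i \<and> card A = j \<and> card (A' \<inter> A) = t
     then complex_of_real (sqrt (real (card X))) ^ (card (A' - A) + card (A - A')) *
       Lambda m (lam X Z W) (map int l) q
     else 0)"
proof -
  define D where "D = A' \<inter> A"
  let ?r = "complex_of_real (sqrt (real (card X)))"
  let ?B = "BX X n"
  have finD: "finite D"
    by (rule finite_subset[of _ "{..<n}"]) (use A in \<open>auto simp: D_def\<close>)
  have Dn: "D \<subseteq> {..<n}"
    using A by (auto simp: D_def)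
  define ok where "ok \<longleftrightarrow> card A' = i \<and> card A = j \<and> card D = t"
  define F where "F c = (\<lambda>i y y'. cnj (slot (i \<in> A') (g' i) y) * slot (i \<in> A) (g i) y' *
      (if i \<in> D then if (the y, the y') \<in> Z (c i) then 1 else 0 else 1))" for c :: "nat \<Rightarrow> nat"
  have entry: "cnj (tens X n g' A' a) * orbit_matrix X m Z n i j t l a b * tens X n g A b =
      (\<Sum>c\<in>labellings D l. if ok then \<Prod>i<n. F c i (a ! i) (b ! i) else 0)"
    if a: "a \<in> ?B" and b: "b \<in> ?B" for a b
  proof (cases "supp a = A' \<and> supp b = A")
    case True
    have "(\<Prod>i\<in>D. if (the (a ! i), the (b ! i)) \<in> Z (c i) then 1 else 0) =
        (\<Prod>i<n. if i \<in> D then if (the (a ! i), the (b ! i)) \<in> Z (c i) then 1 else 0 else 1 :: complex)" for c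
      using Dn by (simp add: prod.If_cases Int_absorb1)
    then have "(if orbit_type m Z a b = l then 1 else 0) = (\<Sum>c\<in>labellings D l.
        \<Prod>i<n. if i \<in> D then if (the (a ! i), the (b ! i)) \<in> Z (c i) then 1 else 0 else 1 :: complex)"
      using orbit_type_indicator[OF a b l] True by (simp only: D_def)
    moreover have "orbit_matrix X m Z n i j t l a b =
        (if ok then if orbit_type m Z a b = l then 1 else 0 else 0)"
      using a b True by (simp add: orbit_matrix_def ok_def D_def)
    ultimately have "orbit_matrix X m Z n i j t l a b = (\<Sum>c\<in>labellings D l. if ok then
        (\<Prod>i<n. if i \<in> D then if (the (a ! i), the (b ! i)) \<in> Z (c i) then 1 else 0 else 1) else 0)"
      by simp
    then show ?thesis
      using a b by (cases ok)
        (simp_all add: tens_def F_def prod.distrib sum_distrib_left sum_distrib_right algebra_simps)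
  next
    case False
    then have z: "tens X n g' A' a = 0 \<or> tens X n g A b = 0"
      using tens_eq[OF a A'(2)] tens_eq[OF b A(2)] by auto
    have p: "(\<Prod>i<n. F c i (a ! i) (b ! i)) = cnj (tens X n g' A' a) * tens X n g A b *
       (\<Prod>i<n. if i \<in> D then if (the (a ! i), the (b ! i)) \<in> Z (c i) then 1 else 0 else 1)" for c
      using a b by (simp add: tens_def F_def prod.distrib)
    have "(\<Prod>i<n. F c i (a ! i) (b ! i)) = 0" for c
      unfolding p using z by (elim disjE) simp_all
    then have "(\<Sum>c\<in>labellings D l. if ok then \<Prod>i<n. F c i (a ! i) (b ! i) else 0) = 0"
      by (simp only: if_cancel sum.neutral_const)
    then show ?thesis
      using z by auto
  qed
  have "mform ?B (tens X n g' A') (orbit_matrix X m Z n i j t l) (tens X n g A) =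
      (\<Sum>a\<in>?B. \<Sum>b\<in>?B. \<Sum>c\<in>labellings D l. if ok then \<Prod>i<n. F c i (a ! i) (b ! i) else 0)"
    unfolding mform_def by (intro sum.cong refl entry)
  also have "\<dots> = (\<Sum>a\<in>?B. \<Sum>c\<in>labellings D l. \<Sum>b\<in>?B. if ok then \<Prod>i<n. F c i (a ! i) (b ! i) else 0)"
    by (intro sum.cong refl sum.swap)
  also have "\<dots> = (\<Sum>c\<in>labellings D l. \<Sum>a\<in>?B. \<Sum>b\<in>?B. if ok then \<Prod>i<n. F c i (a ! i) (b ! i) else 0)"
    by (rule sum.swap)
  also have "\<dots> = (\<Sum>c\<in>labellings D l. if ok \<and> g = g' then ?r ^ (card (A' - A) + card (A - A')) *
      (\<Prod>i\<in>D. lam X Z W (c i) (wt (g i))) else 0)"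
  proof (intro sum.cong refl)
    fix c assume "c \<in> labellings D l"
    then have c: "c i \<le> m" if "i \<in> D" for i
      using that by (auto simp: labellings_def)
    let ?val = "\<lambda>i. if i \<in> D then if g i = g' i then lam X Z W (c i) (wt (g i)) else 0
        else if i \<in> A' then if g' i = e0 then ?r else 0
        else if i \<in> A then if g i = e0 then ?r else 0 else 1"
    have pos: "(F c i None None + (\<Sum>y\<in>X. F c i None (Some y))) +
        (\<Sum>x\<in>X. F c i (Some x) None + (\<Sum>y\<in>X. F c i (Some x) (Some y))) = ?val i" if "i < n" for i
    proof -
      have gi: "g i \<in> KK" and gi': "g' i \<in> KK"
        using g g' that by auto
      have s': "(\<Sum>x\<in>X. cnj (g' i x)) = (if g' i = e0 then ?r else 0)"
        using sum_KK[OF gi'] by (simp flip: cnj_sum)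
      show ?thesis
        using orbit_pairing[OF gi gi' c, of i] sum_KK[OF gi] s'
        by (auto simp: F_def D_def)
    qed
    have "(\<Sum>a\<in>?B. \<Sum>b\<in>?B. \<Prod>i<n. F c i (a ! i) (b ! i)) =
        (\<Sum>a\<in>?B. \<Prod>i<n. F c i (a ! i) None + (\<Sum>y\<in>X. F c i (a ! i) (Some y)))"
      by (intro sum.cong refl sum_BX_prod finX)
    also have "\<dots> = (\<Prod>i<n. (F c i None None + (\<Sum>y\<in>X. F c i None (Some y))) +
        (\<Sum>x\<in>X. F c i (Some x) None + (\<Sum>y\<in>X. F c i (Some x) (Some y))))"
      by (rule sum_BX_prod[OF finX])
    also have "\<dots> = (\<Prod>i<n. ?val i)"
      using pos by (intro prod.cong) auto
    also have "\<dots> = (if g = g' then ?r ^ (card (A' - A) + card (A - A')) *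
      (\<Prod>i\<in>D. lam X Z W (c i) (wt (g i))) else 0)"
    proof (cases "g = g'")
      case True
      have val: "?val i = (if i \<in> D then lam X Z W (c i) (wt (g i)) else 1) *
          (if i \<in> A' - A then ?r else 1) * (if i \<in> A - A' then ?r else 1)" if "i < n" for i
        using True A A' that by (auto simp: D_def S_def)
      have "(\<Prod>i<n. ?val i) = (\<Prod>i<n. (if i \<in> D then lam X Z W (c i) (wt (g i)) else 1)) *
          (\<Prod>i<n. if i \<in> A' - A then ?r else 1) * (\<Prod>i<n. if i \<in> A - A' then ?r else 1)"
        unfolding prod.distrib[symmetric] using val by (intro prod.cong) auto
      also have "(\<Prod>i<n. (if i \<in> D then lam X Z W (c i) (wt (g i)) else 1)) =
          (\<Prod>i\<in>D. lam X Z W (c i) (wt (g i)))"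
        using Dn by (simp add: prod.If_cases Int_absorb1)
      also have "(\<Prod>i<n. if i \<in> A' - A then ?r else 1) = ?r ^ card (A' - A)"
      proof -
        have "{..<n} \<inter> {i. i \<in> A' - A} = A' - A"
          using A' by auto
        then show ?thesis
          by (simp add: prod.If_cases)
      qed
      also have "(\<Prod>i<n. if i \<in> A - A' then ?r else 1) = ?r ^ card (A - A')"
      proof -
        have "{..<n} \<inter> {i. i \<in> A - A'} = A - A'"
          using A by auto
        then show ?thesis
          by (simp add: prod.If_cases)
      qed
      finally show ?thesis
        using True by (simp add: power_add algebra_simps)
    next
      case False
      \<comment> \<open>If both tensors have a letter there, the pairing of different basis vectors
        is zero. If only one has, the other pattern is \<open>e0\<close> at this position, so the
        vector present is nontrivial and its entries sum to zero.\<close>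
      obtain i where i: "i < n" "g i \<noteq> g' i"
        using False PiE_ext[OF g g'] by auto
      then have "?val i = 0"
        using A A' by (auto simp: D_def S_def)
      moreover have "i \<in> {..<n}"
        using i by simp
      ultimately have "(\<Prod>i<n. ?val i) = 0"
        by (intro prod_zero finite_lessThan bexI[of _ i])
      then show ?thesis
        using False by simp
    qed
    finally show "(\<Sum>a\<in>?B. \<Sum>b\<in>?B. if ok then \<Prod>i<n. F c i (a ! i) (b ! i) else 0) =
        (if ok \<and> g = g' then ?r ^ (card (A' - A) + card (A - A')) *
      (\<Prod>i\<in>D. lam X Z W (c i) (wt (g i))) else 0)"
      by (cases ok) simp_all
  qed
  also have "\<dots> = (if ok \<and> g = g' then ?r ^ (card (A' - A) + card (A - A')) *
      (\<Sum>c\<in>labellings D l. \<Prod>i\<in>D. lam X Z W (c i) (wt (g i))) else 0)"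
    by (cases "ok \<and> g = g'")
      (simp_all only: if_True if_False simp_thms sum_distrib_left sum.neutral_const)
  also have "(\<Sum>c\<in>labellings D l. \<Prod>i\<in>D. lam X Z W (c i) (wt (g i))) =
      Lambda m (lam X Z W) (map int l) q"
    unfolding labellings_def
  proof (rule sum_functions_eq_Lambda[OF finD])
    show "(\<lambda>i. wt (g i)) ` D \<subseteq> {..m}"
      using g Dn wt(1) by fastforce
  qed (use l q qv in \<open>auto simp: D_def\<close>)
  finally show ?thesis
    unfolding ok_def D_def by (simp add: conj_ac)
qed

end

section \<open>Embedded Boolean algebras\<close>

context multiplicity_free_action
begin

abbreviation rest :: "nat \<Rightarrow> (nat \<Rightarrow> 'x \<Rightarrow> complex) \<Rightarrow> nat set" where
  "rest n g \<equiv> {..<n} - S n g"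

text \<open>Isometric embedding of the Boolean algebra on the free positions: the chosen subset is
  filled with \<open>e0\<close>, its complement among the free positions with L_0.\<close>

definition lift :: "nat \<Rightarrow> (nat \<Rightarrow> 'x \<Rightarrow> complex) \<Rightarrow> (nat set \<Rightarrow> complex) \<Rightarrow> 'x option list \<Rightarrow> complex" where
  "lift n g y = (\<Sum>A\<in>Pow (rest n g). cscale (y A) (tens X n g (A \<union> S n g)))"

lemma finite_rest [simp]: "finite (rest n g)"
  by simp

lemma card_S_le: "card (S n g) \<le> n"
  using card_mono[OF _ S_subset, of n g] by simp

lemma card_rest: "card (rest n g) = n - card (S n g)"
  using card_Diff_subset[OF finite_S S_subset[of n g]] by simp

lemma lift_scale: "lift n g (cscale c y) = cscale c (lift n g y)"
  unfolding lift_def cfun.scale_sum_right by (simp add: cscale_def mult.assoc)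

lemma lift_eq:
  assumes "b \<in> BX X n"
  shows "lift n g y b =
    (if S n g \<subseteq> supp b then y (supp b - S n g) * (\<Prod>i\<in>supp b. g i (the (b ! i))) else 0)"
proof -
  have "lift n g y b = (\<Sum>A\<in>Pow (rest n g). y A * (if supp b = A \<union> S n g then \<Prod>i\<in>supp b. g i (the (b ! i)) else 0))"
    unfolding lift_def sum_fun_app cscale_def
    using S_subset by (intro sum.cong refl) (subst tens_eq[OF assms], auto)
  also have "\<dots> = (\<Sum>A\<in>Pow (rest n g). if A = supp b - S n g then
      (if S n g \<subseteq> supp b then y (supp b - S n g) * (\<Prod>i\<in>supp b. g i (the (b ! i))) else 0) else 0)"
  proof (intro sum.cong refl)
    fix A assume "A \<in> Pow (rest n g)"
    then have "supp b = A \<union> S n g \<longleftrightarrow> A = supp b - S n g \<and> S n g \<subseteq> supp b"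
      by auto
    then show "y A * (if supp b = A \<union> S n g then \<Prod>i\<in>supp b. g i (the (b ! i)) else 0) = (if A = supp b - S n g then
      (if S n g \<subseteq> supp b then y (supp b - S n g) * (\<Prod>i\<in>supp b. g i (the (b ! i))) else 0) else 0)"
      by auto
  qed
  also have "\<dots> = (if S n g \<subseteq> supp b then y (supp b - S n g) * (\<Prod>i\<in>supp b. g i (the (b ! i))) else 0)"
  proof -
    have "supp b - S n g \<in> Pow (rest n g)"
      using supp_subset[OF assms] by auto
    then show ?thesis
      by (simp add: sum.delta)
  qed
  finally show ?thesis .
qed

lemma lift_outside: "b \<notin> BX X n \<Longrightarrow> lift n g y b = 0"
  by (simp add: lift_def sum_fun_app cscale_def tens_def)

lemma lift_level:
  assumes "y \<in> V (level (rest n g) a)"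
  shows "lift n g y \<in> V {b \<in> BX X n. rk b = a + card (S n g)}"
  unfolding V_def
proof (intro CollectI allI impI)
  fix b assume b: "b \<notin> {b \<in> BX X n. rk b = a + card (S n g)}"
  show "lift n g y b = 0"
  proof (cases "b \<in> BX X n \<and> S n g \<subseteq> supp b")
    case True
    then have "card (supp b - S n g) \<noteq> a"
      using b card_mono[OF finite_supp, of "S n g" b] by (auto simp: card_Diff_subset rk_def)
    then have "y (supp b - S n g) = 0"
      using assms by (auto simp: V_def level_def)
    then show ?thesis
      using True lift_eq by auto
  next
    case False
    then show ?thesis
      using lift_eq[of b n g y] lift_outside[of b n g y] by (cases "b \<in> BX X n") auto
  qed
qed

lemma lift_in_V: "lift n g y \<in> V (BX X n)"
  using lift_outside by (simp add: V_def)

lemma cinner_lift: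
  assumes g: "g \<in> patterns n" and g': "g' \<in> patterns n"
  shows "cinner (BX X n) (lift n g y) (lift n g' y') =
    (if g = g' then cinner (Pow (rest n g)) y y' else 0)"
proof -
  have "cinner (BX X n) (lift n g y) (lift n g' y') =
      (\<Sum>A\<in>Pow (rest n g). \<Sum>A'\<in>Pow (rest n g'). y A * cnj (y' A') *
        (if g = g' \<and> A \<union> S n g = A' \<union> S n g' then 1 else 0))"
  proof -
    have "cinner (BX X n) (lift n g y) (lift n g' y') =
        (\<Sum>A\<in>Pow (rest n g). y A * (\<Sum>A'\<in>Pow (rest n g'). cnj (y' A') *
          cinner (BX X n) (tens X n g (A \<union> S n g)) (tens X n g' (A' \<union> S n g'))))"
      unfolding lift_def[of n g y] cinner_sum_left cinner_scale_left
      unfolding lift_def[of n g' y'] cinner_sum_right cinner_scale_right ..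
    then show ?thesis
      unfolding sum_distrib_left mult.assoc[symmetric]
      using S_subset by (simp cong: sum.cong) (intro sum.cong refl, subst cinner_tens[OF g g'], auto)
  qed
  also have "\<dots> = (if g = g' then (\<Sum>A\<in>Pow (rest n g). \<Sum>A'\<in>Pow (rest n g). if A' = A then y A * cnj (y' A') else 0) else 0)"
  proof (cases "g = g'")
    case True
    have "A \<union> S n g = A' \<union> S n g \<longleftrightarrow> A' = A" if "A \<in> Pow (rest n g)" "A' \<in> Pow (rest n g)" for A A'
      using that by auto
    then show ?thesis
      using True by (auto intro!: sum.cong) (simp add: if_distrib cong: if_cong)
  qed simp
  also have "\<dots> = (if g = g' then cinner (Pow (rest n g)) y y' else 0)"
    by (simp add: cinner_def)
  finally show ?thesis .
qed

text \<open>The composition p of the index (k, s, p). The trivial component is left out, so the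
  count for component w stands at list position w - 1.\<close>

definition type_counts :: "nat \<Rightarrow> (nat \<Rightarrow> 'x \<Rightarrow> complex) \<Rightarrow> nat list" where
  "type_counts n g = map (\<lambda>w. card {i\<in>{..<n}. wt (g i) = w}) [1..<Suc m]"

text \<open>On an embedded Boolean algebra an orbit matrix acts as a multiple of a subset matrix.
  The s nontrivial positions are filled in both words, which shifts \<open>i\<close>,
  \<open>j\<close> and \<open>t\<close> by s and leaves t - s trivial common positions, the first
  column sum of \<open>Lambda\<close>.\<close>

lemma mform_orbit_matrix_lift:
  assumes g: "g \<in> patterns n" and g': "g' \<in> patterns n" and l: "length l = Suc m"
  defines "s \<equiv> card (S n g)"
  shows "mform (BX X n) (lift n g' y') (orbit_matrix X m Z n i j t l) (lift n g y) =
    (if g = g' \<and> s \<le> i \<and> s \<le> j \<and> s \<le> t \<and> t \<le> i \<and> t \<le> j then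
       complex_of_real (sqrt (real (card X))) ^ (i - t + (j - t)) *
       Lambda m (lam X Z W) (map int l) ((int t - int s) # map int (type_counts n g)) *
       cinner (Pow (rest n g)) (subset_op (rest n g) (i - s) (j - s) (t - s) y) y'
     else 0)"
proof -
  let ?B = "BX X n" and ?M = "orbit_matrix X m Z n i j t l"
  let ?q = "(int t - int s) # map int (type_counts n g)"
  let ?c = "complex_of_real (sqrt (real (card X))) ^ (i - t + (j - t)) *
       Lambda m (lam X Z W) (map int l) ?q"
  have expand: "mform ?B (lift n g' y') ?M (lift n g y) =
      (\<Sum>A'\<in>Pow (rest n g'). cnj (y' A') * (\<Sum>A\<in>Pow (rest n g). y A *
        mform ?B (tens X n g' (A' \<union> S n g')) ?M (tens X n g (A \<union> S n g))))"
    unfolding lift_def[of n g' y'] mform_sum_left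
    unfolding lift_def[of n g y] mform_sum_right ..
  show ?thesis
  proof (cases "g = g'")
    case False
    have "mform ?B (tens X n g' (A' \<union> S n g')) ?M (tens X n g (A \<union> S n g)) = 0"
      if "A' \<in> Pow (rest n g')" "A \<in> Pow (rest n g)" for A A'
      using that False S_subset
      by (subst mform_orbit_matrix_tens[OF g g' _ _ _ _ l,
            of _ _ "map (\<lambda>v. int (card {i \<in> (A' \<union> S n g') \<inter> (A \<union> S n g). wt (g i) = v})) [0..<Suc m]"])
        (auto simp: nth_append simp del: upt_Suc)
    then show ?thesis
      unfolding expand using False by simp
  next
    case True
    let ?T = "rest n g"
    let ?ok = "s \<le> i \<and> s \<le> j \<and> s \<le> t \<and> t \<le> i \<and> t \<le> j"
    have elem: "mform ?B (tens X n g (A' \<union> S n g)) ?M (tens X n g (A \<union> S n g)) =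
        (if ?ok \<and> A' \<in> level ?T (i - s) \<and> A \<in> level ?T (j - s) \<and> card (A' \<inter> A) = t - s then ?c else 0)"
      if A': "A' \<in> Pow ?T" and A: "A \<in> Pow ?T" for A A'
    proof -
      let ?D = "(A' \<union> S n g) \<inter> (A \<union> S n g)"
      let ?q' = "map (\<lambda>v. int (card {i \<in> ?D. wt (g i) = v})) [0..<Suc m]"
      have fin: "finite A" "finite A'"
        using finite_subset[OF PowD[OF A]] finite_subset[OF PowD[OF A']] by simp_all
      have dis: "A \<inter> S n g = {}" "A' \<inter> S n g = {}" "(A' \<inter> A) \<inter> S n g = {}"
        using A A' by auto
      have D: "?D = (A' \<inter> A) \<union> S n g"
        by auto
      have cards: "card (A' \<union> S n g) = card A' + s" "card (A \<union> S n g) = card A + s"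
        "card ?D = card (A' \<inter> A) + s"
        unfolding D s_def using fin dis by (simp_all add: card_Un_disjoint)
      have diffs: "A' \<union> S n g - (A \<union> S n g) = A' - A" "A \<union> S n g - (A' \<union> S n g) = A - A'"
        using A A' by auto
      have dc: "card (A' - A) + card (A' \<inter> A) = card A'" "card (A - A') + card (A' \<inter> A) = card A"
        using fin card_Int_Diff[of A' A] card_Int_Diff[of A A'] by (simp_all add: Int_commute)
      \<comment> \<open>Column sums of \<open>Lambda\<close>: the trivial common positions are those
        of A' \<inter> A, whereas every nontrivial position is common, so that the other counts
        depend on the pattern alone.\<close>
      have q: "?q' = ?q" if t: "card ?D = t"
      proof (rule nth_equalityI)
        fix v assume "v < length ?q'"
        then have v: "v \<le> m"
          by (simp del: upt_Suc)
        have Dn: "?D \<subseteq> {..<n}"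
          using A A' S_subset[of n g] by auto
        have wt0: "wt (g i) = 0 \<longleftrightarrow> i \<notin> S n g" if "i < n" for i
          using wt_eq_0[OF pattern_KK[OF g that]] that by (simp add: S_def)
        show "?q' ! v = ?q ! v"
        proof (cases v)
          case 0
          have "{i \<in> ?D. wt (g i) = 0} = A' \<inter> A"
            using wt0 Dn A A' by auto
          then have "?q' ! v = int (card (A' \<inter> A))"
            using v 0 by (simp add: nth_append del: upt_Suc)
          then show ?thesis
            using 0 cards(3) t by simp
        next
          case (Suc w)
          have "i \<in> S n g" if "i < n" "wt (g i) = v" for i
            using wt0[OF that(1)] that(2) Suc by auto
          then have "{i \<in> ?D. wt (g i) = v} = {i\<in>{..<n}. wt (g i) = v}"
            using Dn by auto
          then have "?q' ! v = int (card {i\<in>{..<n}. wt (g i) = v})"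
            using v by (simp add: nth_append del: upt_Suc)
          also have "\<dots> = ?q ! v"
            using v Suc by (simp add: type_counts_def del: upt_Suc)
          finally show ?thesis .
        qed
      qed (simp add: type_counts_def del: upt_Suc)
      have "mform ?B (tens X n g (A' \<union> S n g)) ?M (tens X n g (A \<union> S n g)) =
          (if g = g \<and> card (A' \<union> S n g) = i \<and> card (A \<union> S n g) = j \<and> card ?D = t
           then complex_of_real (sqrt (real (card X))) ^
             (card (A' \<union> S n g - (A \<union> S n g)) + card (A \<union> S n g - (A' \<union> S n g))) *
             Lambda m (lam X Z W) (map int l) ?q'
           else 0)"
        using A A' S_subset
        by (intro mform_orbit_matrix_tens[OF g g _ _ _ _ l]) (auto simp: nth_append simp del: upt_Suc)
      also have "\<dots> = (if card (A' \<union> S n g) = i \<and> card (A \<union> S n g) = j \<and> card ?D = t then ?c else 0)"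
      proof (cases "card (A' \<union> S n g) = i \<and> card (A \<union> S n g) = j \<and> card ?D = t")
        case True
        then have "card (A' - A) = i - t" "card (A - A') = j - t"
          using dc cards by auto
        then show ?thesis
          unfolding diffs using True q by simp
      qed auto
      also have "card (A' \<union> S n g) = i \<and> card (A \<union> S n g) = j \<and> card ?D = t \<longleftrightarrow>
          ?ok \<and> A' \<in> level ?T (i - s) \<and> A \<in> level ?T (j - s) \<and> card (A' \<inter> A) = t - s"
        unfolding cards level_def using A A' dc by auto
      finally show ?thesis .
    qed
    have "mform ?B (lift n g' y') ?M (lift n g y) =
        (\<Sum>A'\<in>Pow ?T. cnj (y' A') * (\<Sum>A\<in>Pow ?T. y A *
          (if ?ok \<and> A' \<in> level ?T (i - s) \<and> A \<in> level ?T (j - s) \<and> card (A' \<inter> A) = t - s then ?c else 0)))"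
      unfolding expand unfolding True[symmetric] by (intro sum.cong refl arg_cong2[where f = "(*)"] elem)
    also have "\<dots> = (if ?ok then ?c * cinner (Pow ?T) (subset_op ?T (i - s) (j - s) (t - s) y) y' else 0)"
    proof (cases ?ok)
      case ok: True
      have "(\<Sum>A\<in>Pow ?T. y A * (if ?ok \<and> A' \<in> level ?T (i - s) \<and> A \<in> level ?T (j - s) \<and> card (A' \<inter> A) = t - s then ?c else 0)) =
          ?c * subset_op ?T (i - s) (j - s) (t - s) y A'" if "A' \<in> Pow ?T" for A'
      proof (cases "A' \<in> level ?T (i - s)")
        case lev: True
        have "{A \<in> level ?T (j - s). card (A' \<inter> A) = t - s} =
            {A \<in> Pow ?T. A \<in> level ?T (j - s) \<and> card (A' \<inter> A) = t - s}"
          using level_subset by auto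
        then have "subset_op ?T (i - s) (j - s) (t - s) y A' =
            (\<Sum>A\<in>Pow ?T. if A \<in> level ?T (j - s) \<and> card (A' \<inter> A) = t - s then y A else 0)"
          using lev by (simp add: subset_op_def sum.inter_filter[symmetric] del: Pow_iff)
        then show ?thesis
          using ok lev by (auto simp: sum_distrib_left intro!: sum.cong)
      qed (simp add: subset_op_def)
      then show ?thesis
        using ok by (simp add: cinner_def sum_distrib_left algebra_simps)
    qed auto
    finally show ?thesis
      using True by (simp add: algebra_simps)
  qed
qed

text \<open>For a fixed pattern, Boolean completeness forces equal supports. The remaining sum over
  patterns with nontrivial positions inside the support is a product over positions: completeness of
  \<open>KK\<close> at a filled position, the single choice \<open>e0\<close> at an empty
  one.\<close>

lemma lift_kernel:
  assumes b: "b \<in> BX X n" and b': "b' \<in> BX X n"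
  shows "(\<Sum>g\<in>patterns n. \<Sum>(k, y, a)\<in>chain_index (rest n g).
      lift n g (chain_vec (rest n g) k y a) b * cnj (lift n g (chain_vec (rest n g) k y a) b')) =
    (if b = b' then 1 else 0)"
proof -
  let ?p = "\<lambda>g b. \<Prod>i\<in>supp b. g i (the (b ! i))"
  let ?P = "supp b"
  have inner: "(\<Sum>(k, y, a)\<in>chain_index (rest n g).
      lift n g (chain_vec (rest n g) k y a) b * cnj (lift n g (chain_vec (rest n g) k y a) b')) =
      (if S n g \<subseteq> ?P \<and> ?P = supp b' then ?p g b * cnj (?p g b') else 0)" for g
  proof (cases "S n g \<subseteq> ?P \<and> S n g \<subseteq> supp b'")
    case True
    have "(\<Sum>(k, y, a)\<in>chain_index (rest n g).
      lift n g (chain_vec (rest n g) k y a) b * cnj (lift n g (chain_vec (rest n g) k y a) b')) =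
      (?p g b * cnj (?p g b')) * (\<Sum>(k, y, a)\<in>chain_index (rest n g).
        chain_vec (rest n g) k y a (?P - S n g) * cnj (chain_vec (rest n g) k y a (supp b' - S n g)))"
      unfolding sum_distrib_left using True
      by (intro sum.cong refl) (auto simp: lift_eq[OF b] lift_eq[OF b'] algebra_simps)
    also have "\<dots> = (?p g b * cnj (?p g b')) * (if ?P - S n g = supp b' - S n g then 1 else 0)"
      using supp_subset[OF b] by (subst chain_vec_complete) auto
    also have "?P - S n g = supp b' - S n g \<longleftrightarrow> ?P = supp b'"
      using True by auto
    finally show ?thesis
      using True by simp
  next
    case False
    then have z: "lift n g y b * cnj (lift n g y b') = 0" for y
      by (auto simp: lift_eq[OF b] lift_eq[OF b'])
    have "(\<Sum>(k, y, a)\<in>chain_index (rest n g).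
        lift n g (chain_vec (rest n g) k y a) b * cnj (lift n g (chain_vec (rest n g) k y a) b')) = 0"
      by (rule sum.neutral, clarify) (rule z)
    then show ?thesis
      using False by auto
  qed
  show ?thesis
  proof (cases "?P = supp b'")
    case False
    then show ?thesis
      unfolding inner by auto
  next
    case True
    let ?F = "\<lambda>i. if i \<in> ?P then KK else {e0}"
    let ?f = "\<lambda>i e. if i \<in> ?P then e (the (b ! i)) * cnj (e (the (b' ! i))) else 1"
    have Pn: "?P \<subseteq> {..<n}"
      by (rule supp_subset[OF b])
    have fin: "finite (patterns n)"
      using KK_finite by (intro finite_PiE) auto
    have "(\<Sum>g\<in>patterns n. \<Sum>(k, y, a)\<in>chain_index (rest n g).
      lift n g (chain_vec (rest n g) k y a) b * cnj (lift n g (chain_vec (rest n g) k y a) b')) =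
      (\<Sum>g\<in>patterns n. if S n g \<subseteq> ?P then ?p g b * cnj (?p g b') else 0)"
      unfolding inner using True by simp
    also have "\<dots> = (\<Sum>g | g \<in> patterns n \<and> S n g \<subseteq> ?P. ?p g b * cnj (?p g b'))"
      by (rule sum.inter_filter[OF fin, symmetric])
    also have "{g. g \<in> patterns n \<and> S n g \<subseteq> ?P} = PiE {..<n} ?F"
    proof (intro equalityI subsetI)
      fix g assume "g \<in> {g. g \<in> patterns n \<and> S n g \<subseteq> ?P}"
      then have g: "g \<in> patterns n" "S n g \<subseteq> ?P"
        by simp_all
      show "g \<in> PiE {..<n} ?F"
      proof (rule PiE_I)
        fix i assume i: "i \<in> {..<n}"
        then show "g i \<in> ?F i"
          using g(2) pattern_KK[OF g(1), of i] by (cases "i \<in> ?P") (auto simp: S_def)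
      qed (use g(1) in auto)
    next
      fix g assume g: "g \<in> PiE {..<n} ?F"
      have "g i \<in> KK" if "i < n" for i
        using PiE_mem[OF g, of i] e0_KK that by (cases "i \<in> ?P") auto
      moreover have "i \<in> ?P" if "i \<in> S n g" for i
        using PiE_mem[OF g, of i] that by (cases "i \<in> ?P") (auto simp: S_def)
      ultimately show "g \<in> {g. g \<in> patterns n \<and> S n g \<subseteq> ?P}"
        using PiE_arb[OF g] by (auto simp: PiE_iff extensional_def)
    qed
    also have "(\<Sum>g\<in>PiE {..<n} ?F. ?p g b * cnj (?p g b')) = (\<Sum>g\<in>PiE {..<n} ?F. \<Prod>i<n. ?f i (g i))"
    proof (intro sum.cong refl)
      fix g
      have "(\<Prod>i<n. ?f i (g i)) = (\<Prod>i\<in>?P. g i (the (b ! i)) * cnj (g i (the (b' ! i))))"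
        using Pn by (simp add: prod.If_cases Int_absorb1)
      then show "?p g b * cnj (?p g b') = (\<Prod>i<n. ?f i (g i))"
        using True by (simp add: prod.distrib)
    qed
    also have "\<dots> = (\<Prod>i<n. \<Sum>e\<in>?F i. ?f i e)"
      using KK_finite by (intro prod_sum_PiE[symmetric]) auto
    also have "\<dots> = (\<Prod>i<n. if i \<in> ?P \<and> the (b ! i) \<noteq> the (b' ! i) then 0 else 1)"
    proof (intro prod.cong refl)
      fix i
      show "(\<Sum>e\<in>?F i. ?f i e) = (if i \<in> ?P \<and> the (b ! i) \<noteq> the (b' ! i) then 0 else 1)"
        by (cases "i \<in> ?P") (simp_all add: KK_complete[OF the_in_X[OF b]])
    qed
    also have "\<dots> = (if \<exists>i<n. i \<in> ?P \<and> the (b ! i) \<noteq> the (b' ! i) then 0 else 1)"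
      by (auto intro!: prod_zero prod.neutral)
    also have "(\<exists>i<n. i \<in> ?P \<and> the (b ! i) \<noteq> the (b' ! i)) \<longleftrightarrow> b \<noteq> b'"
    proof
      assume "b \<noteq> b'"
      then obtain i where i: "i < n" "b ! i \<noteq> b' ! i"
        using b b' nth_equalityI[of b b'] by (auto simp: BX_iff)
      then have "i \<in> ?P"
        using True b b' by (auto simp: supp_def BX_iff)
      then show "\<exists>i<n. i \<in> ?P \<and> the (b ! i) \<noteq> the (b' ! i)"
        using i True by (metis (mono_tags, lifting) mem_Collect_eq option.expand supp_def)
    qed auto
    finally show ?thesis
      by simp
  qed
qed

end

section \<open>The up operator on the embedded Boolean algebras\<close>

lemma BX_le_eqI:
  assumes "BX_le a b" "length a = length b" "supp a = supp b"
  shows "a = b"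
proof (rule nth_equalityI)
  fix i assume i: "i < length a"
  show "a ! i = b ! i"
  proof (cases "i \<in> supp a")
    case True
    then show ?thesis
      using assms(1) by (simp add: BX_le_def)
  next
    case False
    then have "i \<notin> supp b"
      by (simp add: assms(3))
    then show ?thesis
      using False i assms(2) by (simp add: supp_def)
  qed
qed (rule assms(2))

lemma BX_update_None: "b \<in> BX X n \<Longrightarrow> b[i := None] \<in> BX X n"
  using set_update_subset_insert[of b i None] by (auto simp: BX_def)

lemma supp_update_None: "supp (b[i := None]) = supp b - {i}"
  by (cases "i < length b") (auto simp: supp_def nth_list_update split: if_splits)

lemma update_None_neq: "i \<in> supp b \<Longrightarrow> b[i := None] \<noteq> b"
  by (metis (mono_tags, lifting) mem_Collect_eq nth_list_update_eq supp_def)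

text \<open>If a lies strictly below \<open>b\<close>, erasing a letter of \<open>b\<close> outside
  the support of a gives an element between the two. Hence covering relations erase exactly one
  letter.\<close>

lemma covers_BX_iff:
  assumes b: "b \<in> BX X n"
  shows "covers (BX X n) BX_le b a \<longleftrightarrow> (\<exists>i\<in>supp b. a = b[i := None])"
proof
  assume c: "covers (BX X n) BX_le b a"
  then have a: "a \<in> BX X n" "BX_le a b" "a \<noteq> b"
    by (auto simp: covers_def)
  have len: "length a = length b"
    using a b by (simp add: BX_iff)
  have "supp a \<noteq> supp b"
  proof
    assume s: "supp a = supp b"
    have "a = b"
      by (rule BX_le_eqI[OF a(2) len s])
    then show False
      using a by simp
  qed
  then obtain i where i: "i \<in> supp b" "i \<notin> supp a"
    using a(2) by (auto simp: BX_le_def)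
  have il: "i < length b"
    using i by (simp add: supp_def)
  let ?z = "b[i := None]"
  have "?z \<in> BX X n"
    by (rule BX_update_None[OF b])
  moreover have "BX_le a ?z"
    using a(2) i by (auto simp: BX_le_def supp_update_None nth_list_update il)
  moreover have "BX_le ?z b"
    by (auto simp: BX_le_def supp_update_None nth_list_update il)
  moreover have "?z \<noteq> b"
    by (rule update_None_neq[OF i(1)])
  ultimately have "a = ?z"
    using c by (auto simp: covers_def)
  then show "\<exists>i\<in>supp b. a = b[i := None]"
    using i by blast
next
  assume "\<exists>i\<in>supp b. a = b[i := None]"
  then obtain i where i: "i \<in> supp b" and a: "a = b[i := None]"
    by blast
  have il: "i < length b"
    using i by (simp add: supp_def)
  have aB: "a \<in> BX X n"
    unfolding a by (rule BX_update_None[OF b])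
  have ab: "BX_le a b" "a \<noteq> b"
    unfolding a using update_None_neq[OF i]
    by (auto simp: BX_le_def supp_update_None nth_list_update il)
  moreover have "z = a \<or> z = b" if z: "z \<in> BX X n" "BX_le a z" "BX_le z b" for z
  proof -
    have len: "length z = length b" "length a = length z"
      using z b aB by (simp_all add: BX_iff)
    have "supp z = supp a \<or> supp z = supp b"
      using z(2,3) supp_update_None[of b i] unfolding a BX_le_def by auto
    then show ?thesis
    proof
      assume s: "supp z = supp a"
      have "z = a"
        using BX_le_eqI[OF z(2) len(2) s[symmetric]] by simp
      then show ?thesis ..
    next
      assume s: "supp z = supp b"
      have "z = b"
        by (rule BX_le_eqI[OF z(3) len(1) s])
      then show ?thesis ..
    qed
  qed
  ultimately show "covers (BX X n) BX_le b a"
    using aB b by (auto simp: covers_def)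
qed

lemma up_BX:
  assumes b: "b \<in> BX X n"
  shows "up (BX X n) BX_le v b = (\<Sum>i\<in>supp b. v (b[i := None]))"
proof -
  have "{a. a \<in> BX X n \<and> covers (BX X n) BX_le b a} = (\<lambda>i. b[i := None]) ` supp b"
    using covers_BX_iff[OF b] by (auto simp: covers_def)
  moreover have "inj_on (\<lambda>i. b[i := None]) (supp b)"
  proof (rule inj_onI)
    fix i j assume "i \<in> supp b" "j \<in> supp b" "b[i := None] = b[j := None]"
    moreover from this have "supp b - {i} = supp b - {j}"
      by (metis supp_update_None)
    ultimately show "i = j"
      by auto
  qed
  ultimately show ?thesis
    by (simp add: up_def sum.reindex)
qed

context multiplicity_free_action
begin

text \<open>Erasing a letter at a free position removes an entry 1 / sqrt |X| of \<open>e0\<close>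
  from the product, hence the factor sqrt |X|. Erasing one at a nontrivial position gives a word on
  which the lift vanishes.\<close>

lemma up_lift:
  "up (BX X n) BX_le (lift n g y) =
    cscale (complex_of_real (sqrt (real (card X)))) (lift n g (raise (rest n g) y))"
proof
  fix b
  let ?r = "complex_of_real (sqrt (real (card X)))"
  let ?p = "\<lambda>b. \<Prod>i\<in>supp b. g i (the (b ! i))"
  show "up (BX X n) BX_le (lift n g y) b = cscale ?r (lift n g (raise (rest n g) y)) b"
  proof (cases "b \<in> BX X n")
    case False
    then show ?thesis
      by (simp add: up_def covers_def cscale_def lift_outside)
  next
    case b: True
    have up_term: "lift n g y (b[i := None]) = (if S n g \<subseteq> supp b \<and> i \<notin> S n g then
        ?r * ?p b * y (supp b - S n g - {i}) else 0)" if i: "i \<in> supp b" for i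
    proof -
      have bi: "b[i := None] \<in> BX X n"
        by (rule BX_update_None[OF b])
      have pr: "?p (b[i := None]) = (\<Prod>q\<in>supp b - {i}. g q (the (b ! q)))"
        unfolding supp_update_None by (intro prod.cong) auto
      have "?r * ?p b = ?p (b[i := None])" if "i \<notin> S n g"
      proof -
        have "g i = e0"
          using that i supp_subset[OF b] by (auto simp: S_def)
        then have "g i (the (b ! i)) = complex_of_real (1 / sqrt (real (card X)))"
          using the_in_X[OF b i] by (simp add: e0_def)
        then have "?r * g i (the (b ! i)) = 1"
          using card_X_pos by simp
        moreover have "?p b = g i (the (b ! i)) * (\<Prod>q\<in>supp b - {i}. g q (the (b ! q)))"
          using i by (intro prod.remove) auto
        ultimately show ?thesis
          unfolding pr by (metis mult.assoc mult_1)
      qed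
      moreover have "supp (b[i := None]) - S n g = supp b - S n g - {i}"
        unfolding supp_update_None by auto
      moreover have "S n g \<subseteq> supp (b[i := None]) \<longleftrightarrow> S n g \<subseteq> supp b \<and> i \<notin> S n g"
        unfolding supp_update_None by auto
      ultimately show ?thesis
        unfolding lift_eq[OF bi] by (simp add: mult.commute)
    qed
    have "up (BX X n) BX_le (lift n g y) b = (\<Sum>i\<in>supp b. if S n g \<subseteq> supp b \<and> i \<notin> S n g then
        ?r * ?p b * y (supp b - S n g - {i}) else 0)"
      unfolding up_BX[OF b] using up_term by (intro sum.cong) auto
    also have "\<dots> = (if S n g \<subseteq> supp b then \<Sum>i\<in>supp b - S n g. ?r * ?p b * y (supp b - S n g - {i}) else 0)"
      by (auto simp: sum.If_cases Diff_eq Collect_neg_eq intro!: sum.mono_neutral_cong_right)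
    also have "\<dots> = cscale ?r (lift n g (raise (rest n g) y)) b"
    proof -
      have "supp b - S n g \<subseteq> rest n g"
        using supp_subset[OF b] by auto
      then have "raise (rest n g) y (supp b - S n g) = (\<Sum>i\<in>supp b - S n g. y (supp b - S n g - {i}))"
        by (rule raise_apply)
      then show ?thesis
        unfolding cscale_def lift_eq[OF b] by (simp add: sum_distrib_left algebra_simps)
    qed
    finally show ?thesis .
  qed
qed

end

section \<open>The commutant of the wreath product\<close>

context multiplicity_free_action
begin

abbreviation wact :: "nat \<Rightarrow> (nat \<Rightarrow> 'g) \<times> (nat \<Rightarrow> nat) \<Rightarrow> 'x option list \<Rightarrow> 'x option list" where
  "wact n h \<equiv> wreath_act \<phi> n h"

lemma wreathE:
  assumes "h \<in> wreath G n"
  obtains g \<pi> where "h = (g, \<pi>)" "\<And>i. i < n \<Longrightarrow> g i \<in> carrier G" "\<pi> permutes {..<n}"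
  using assms by (auto simp: wreath_def)

lemma wact_nth:
  assumes "\<pi> permutes {..<n}" "i < n"
  shows "wact n (g, \<pi>) a ! \<pi> i = map_option (\<phi> (g (\<pi> i))) (a ! i)"
proof -
  have "\<pi> i < n"
    using permutes_in_image[OF assms(1), of i] assms(2) by simp
  moreover have "inv_into UNIV \<pi> (\<pi> i) = i"
    using permutes_inverses(2)[OF assms(1)] .
  ultimately show ?thesis
    by simp
qed

lemma wact_length: "length (wact n h a) = n"
  by (cases h) simp

lemma list_eq_permutesI:
  assumes "\<pi> permutes {..<n}" "length a = n" "length b = n" "\<And>i. i < n \<Longrightarrow> a ! \<pi> i = b ! \<pi> i"
  shows "a = b"
proof (rule nth_equalityI)
  fix q assume "q < length a"
  then have q: "q \<in> {..<n}"
    using assms(2) by simp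
  then have "inv_into UNIV \<pi> q < n"
    using permutes_in_image[OF permutes_inv[OF assms(1)], of q] by simp
  then show "a ! q = b ! q"
    using assms(4)[of "inv_into UNIV \<pi> q"] permutes_inverses(1)[OF assms(1), of q] by simp
qed (simp add: assms)

lemma wact_BX:
  assumes h: "h \<in> wreath G n" and a: "a \<in> BX X n"
  shows "wact n h a \<in> BX X n"
proof -
  obtain g \<pi> where g: "h = (g, \<pi>)" "\<And>i. i < n \<Longrightarrow> g i \<in> carrier G" "\<pi> permutes {..<n}"
    using wreathE[OF h] by blast
  have "wact n h a ! q \<in> insert None (Some ` X)" if "q < n" for q
  proof -
    have "inv_into UNIV \<pi> q < n"
      using permutes_in_image[OF permutes_inv[OF g(3)], of q] that by simp
    then have "a ! inv_into UNIV \<pi> q \<in> insert None (Some ` X)"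
      using a by (simp add: BX_iff)
    then show ?thesis
      using that g(2)[OF that] action_in by (auto simp: g(1))
  qed
  then show ?thesis
    by (simp add: BX_iff wact_length)
qed

lemma map_option_action_inj:
  assumes "g \<in> carrier G" "y \<in> insert None (Some ` X)" "y' \<in> insert None (Some ` X)"
    "map_option (\<phi> g) y = map_option (\<phi> g) y'"
  shows "y = y'"
  using assms(2-4) inj_onD[OF inj_prop[OF assms(1)]] by (cases y; cases y') auto

lemma wact_inj:
  assumes h: "h \<in> wreath G n"
  shows "inj_on (wact n h) (BX X n)"
proof (rule inj_onI)
  fix a b assume a: "a \<in> BX X n" and b: "b \<in> BX X n" and eq: "wact n h a = wact n h b"
  obtain g \<pi> where g: "h = (g, \<pi>)" "\<And>i. i < n \<Longrightarrow> g i \<in> carrier G" "\<pi> permutes {..<n}"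
    using wreathE[OF h] by blast
  show "a = b"
  proof (rule nth_equalityI)
    fix i assume "i < length a"
    then have i: "i < n"
      using a by (simp add: BX_iff)
    have "\<pi> i < n"
      using permutes_in_image[OF g(3), of i] i by simp
    moreover have "map_option (\<phi> (g (\<pi> i))) (a ! i) = map_option (\<phi> (g (\<pi> i))) (b ! i)"
      using eq wact_nth[OF g(3) i] unfolding g(1) by metis
    ultimately show "a ! i = b ! i"
      using map_option_action_inj[OF g(2)] a b i by (metis BX_iff)
  qed (use a b in \<open>simp add: BX_iff\<close>)
qed

lemma wact_bij:
  assumes "h \<in> wreath G n"
  shows "bij_betw (wact n h) (BX X n) (BX X n)"
  unfolding bij_betw_def
  using wact_inj[OF assms] wact_BX[OF assms] finite_BX[OF finX]
  by (metis endo_inj_surj image_subsetI)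

lemma wact_supp:
  assumes \<pi>: "\<pi> permutes {..<n}" and a: "a \<in> BX X n"
  shows "supp (wact n (g, \<pi>) a) = \<pi> ` supp a"
proof (intro equalityI subsetI)
  fix q assume "q \<in> supp (wact n (g, \<pi>) a)"
  then have q: "q < n" "wact n (g, \<pi>) a ! q \<noteq> None"
    using wact_length[of n "(g, \<pi>)" a] by (auto simp: supp_def)
  have i: "inv_into UNIV \<pi> q < n"
    using permutes_in_image[OF permutes_inv[OF \<pi>], of q] q(1) by simp
  have qi: "\<pi> (inv_into UNIV \<pi> q) = q"
    using permutes_inverses(1)[OF \<pi>] .
  have "a ! inv_into UNIV \<pi> q \<noteq> None"
    using wact_nth[OF \<pi> i, of g a] q(2) unfolding qi by auto
  then have "inv_into UNIV \<pi> q \<in> supp a"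
    using i a by (simp add: supp_def BX_iff)
  then show "q \<in> \<pi> ` supp a"
    using qi by (metis image_eqI)
next
  fix q assume "q \<in> \<pi> ` supp a"
  then obtain i where i: "q = \<pi> i" "i \<in> supp a"
    by blast
  then have "i < n" "a ! i \<noteq> None"
    using a by (auto simp: supp_def BX_iff)
  moreover from this have "\<pi> i < n"
    using permutes_in_image[OF \<pi>, of i] by simp
  ultimately show "q \<in> supp (wact n (g, \<pi>) a)"
    using wact_nth[OF \<pi>, of i g a] wact_length[of n "(g, \<pi>)" a] i(1)
    by (simp add: supp_def del: wreath_act.simps)
qed

section \<open>Orbits of the wreath product on pairs of words\<close>

text \<open>The index of the orbit matrix that has a 1 at this pair. By
  \<open>pair_type_wact\<close> and \<open>pair_type_transitive\<close> it is a complete invariant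
  of the orbits on pairs.\<close>

definition pair_type :: "'x option list \<Rightarrow> 'x option list \<Rightarrow> nat \<times> nat \<times> nat \<times> nat list" where
  "pair_type a b = (card (supp a), card (supp b), card (supp a \<inter> supp b), orbit_type m Z a b)"

lemma orbit_type_nth:
  "u \<le> m \<Longrightarrow> orbit_type m Z a b ! u =
    card {i \<in> supp a \<inter> supp b. (the (a ! i), the (b ! i)) \<in> Z u}"
  by (simp add: orbit_type_def nth_append less_Suc_eq_le del: upt_Suc)

lemma orbit_type_length: "length (orbit_type m Z a b) = Suc m"
  by (simp add: orbit_type_def)

lemma orbit_matrix_eq:
  "orbit_matrix X m Z n i j t l a b =
    (if a \<in> BX X n \<and> b \<in> BX X n \<and> pair_type a b = (i, j, t, l) then 1 else 0)"
  by (simp add: orbit_matrix_def pair_type_def)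

lemma pair_type_wact:
  assumes h: "h \<in> wreath G n" and a: "a \<in> BX X n" and b: "b \<in> BX X n"
  shows "pair_type (wact n h a) (wact n h b) = pair_type a b"
proof -
  obtain g \<pi> where g: "h = (g, \<pi>)" "\<And>i. i < n \<Longrightarrow> g i \<in> carrier G" "\<pi> permutes {..<n}"
    using wreathE[OF h] by blast
  have inj: "inj \<pi>"
    using permutes_inj[OF g(3)] .
  have sa: "supp (wact n h a) = \<pi> ` supp a" and sb: "supp (wact n h b) = \<pi> ` supp b"
    using wact_supp[OF g(3)] a b unfolding g(1) by auto
  have int: "supp (wact n h a) \<inter> supp (wact n h b) = \<pi> ` (supp a \<inter> supp b)"
    unfolding sa sb using inj by (simp add: image_Int)
  have card: "card (\<pi> ` A) = card A" for A
    by (rule card_image) (use inj in \<open>auto intro: inj_on_subset\<close>)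
  have "orbit_type m Z (wact n h a) (wact n h b) = orbit_type m Z a b"
  proof (rule nth_equalityI)
    fix u assume "u < length (orbit_type m Z (wact n h a) (wact n h b))"
    then have u: "u \<le> m"
      by (simp add: orbit_type_length)
    have "{i \<in> supp (wact n h a) \<inter> supp (wact n h b). (the (wact n h a ! i), the (wact n h b ! i)) \<in> Z u} =
        \<pi> ` {i \<in> supp a \<inter> supp b. (the (a ! i), the (b ! i)) \<in> Z u}"
    proof -
      have "(the (wact n h a ! \<pi> i), the (wact n h b ! \<pi> i)) \<in> Z u \<longleftrightarrow> (the (a ! i), the (b ! i)) \<in> Z u"
        if i: "i \<in> supp a \<inter> supp b" for i
      proof -
        have "i < n"
          using i supp_subset[OF a] by auto
        then have "\<pi> i < n"
          using permutes_in_image[OF g(3), of i] by simp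
        have ai: "a ! i = Some (the (a ! i))" and bi: "b ! i = Some (the (b ! i))"
          using i by (auto simp: supp_def)
        have "the (wact n h a ! \<pi> i) = \<phi> (g (\<pi> i)) (the (a ! i))"
          "the (wact n h b ! \<pi> i) = \<phi> (g (\<pi> i)) (the (b ! i))"
          unfolding g(1) wact_nth[OF g(3) \<open>i < n\<close>] using ai bi by (metis option.map_sel option.discI)+
        then show ?thesis
          using Z_invariant_iff[OF u the_in_X[OF a] the_in_X[OF b] g(2)[OF \<open>\<pi> i < n\<close>], of i i] i by simp
      qed
      then show ?thesis
        unfolding int by blast
    qed
    then show "orbit_type m Z (wact n h a) (wact n h b) ! u = orbit_type m Z a b ! u"
      using card by (simp add: orbit_type_nth[OF u])
  qed (simp add: orbit_type_length)
  then show ?thesis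
    unfolding pair_type_def int using card by (simp add: sa sb)
qed

text \<open>The values above \<open>m\<close> record which of the two letters is \<open>L_0\<close>.\<close>

definition pos_type :: "'x option list \<Rightarrow> 'x option list \<Rightarrow> nat \<Rightarrow> nat" where
  "pos_type a b i = (if i \<in> supp a \<inter> supp b then SOME u. u \<le> m \<and> (the (a ! i), the (b ! i)) \<in> Z u
     else if i \<in> supp a then m + 1 else if i \<in> supp b then m + 2 else m + 3)"

lemma pos_type_le:
  assumes a: "a \<in> BX X n" and b: "b \<in> BX X n" and u: "u \<le> m"
  shows "pos_type a b i = u \<longleftrightarrow> i \<in> supp a \<inter> supp b \<and> (the (a ! i), the (b ! i)) \<in> Z u"
proof (cases "i \<in> supp a \<inter> supp b")
  case True
  let ?P = "\<lambda>u. u \<le> m \<and> (the (a ! i), the (b ! i)) \<in> Z u"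
  have "?P (SOME u. ?P u)"
    using someI_ex[OF Z_cover[OF the_in_X[OF a] the_in_X[OF b], of i i]] True by auto
  then show ?thesis
    using True u Z_disjoint by (auto simp: pos_type_def)
next
  case False
  then show ?thesis
    using u by (auto simp: pos_type_def)
qed

lemma pos_type_bound:
  assumes a: "a \<in> BX X n" and b: "b \<in> BX X n"
  shows "pos_type a b i \<le> m \<longleftrightarrow> i \<in> supp a \<inter> supp b"
  using pos_type_le[OF a b, of "pos_type a b i"]
  by (cases "i \<in> supp a \<inter> supp b")
    (use someI_ex[OF Z_cover[OF the_in_X[OF a] the_in_X[OF b], of i i]] in \<open>auto simp: pos_type_def\<close>)

lemma pos_type_gt:
  assumes a: "a \<in> BX X n" and b: "b \<in> BX X n"
  shows "pos_type a b i = m + 1 \<longleftrightarrow> i \<in> supp a - supp b"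
    "pos_type a b i = m + 2 \<longleftrightarrow> i \<in> supp b - supp a"
    "pos_type a b i = m + 3 \<longleftrightarrow> i \<notin> supp a \<union> supp b"
    "pos_type a b i \<le> m + 3"
  using pos_type_bound[OF a b, of i] by (cases "i \<in> supp a \<inter> supp b"; auto simp: pos_type_def)+

text \<open>The pair type fixes how often each position type occurs; this is what is required to
  match two pairs by a permutation of the positions.\<close>

lemma card_pos_type:
  assumes a: "a \<in> BX X n" and b: "b \<in> BX X n" and eq: "pair_type a b = (i, j, t, l)"
  shows "card {q\<in>{..<n}. pos_type a b q = x} =
    (if x \<le> m then l ! x else if x = m + 1 then i - t else if x = m + 2 then j - t
     else if x = m + 3 then n - (i + j - t) else 0)"
proof -
  have c: "card (supp a) = i" "card (supp b) = j" "card (supp a \<inter> supp b) = t" "orbit_type m Z a b = l"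
    using eq by (auto simp: pair_type_def)
  have sub: "supp a \<subseteq> {..<n}" "supp b \<subseteq> {..<n}"
    using supp_subset a b by auto
  consider "x \<le> m" | "x = m + 1" | "x = m + 2" | "x = m + 3" | "x > m + 3"
    by linarith
  then show ?thesis
  proof cases
    case 1
    then have "{q\<in>{..<n}. pos_type a b q = x} =
        {q \<in> supp a \<inter> supp b. (the (a ! q), the (b ! q)) \<in> Z x}"
      using pos_type_le[OF a b 1] sub by auto
    then show ?thesis
      using 1 orbit_type_nth[OF 1, of a b] c by simp
  next
    case 2
    then have "{q\<in>{..<n}. pos_type a b q = x} = supp a - supp b"
      using pos_type_gt(1)[OF a b] sub by auto
    then show ?thesis
      using 2 c card_Diff_subset_Int[of "supp a" "supp b"] by simp
  next
    case 3
    then have "{q\<in>{..<n}. pos_type a b q = x} = supp b - supp a"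
      using pos_type_gt(2)[OF a b] sub by auto
    then show ?thesis
      using 3 c card_Diff_subset_Int[of "supp b" "supp a"] by (simp add: Int_commute)
  next
    case 4
    then have "{q\<in>{..<n}. pos_type a b q = x} = {..<n} - (supp a \<union> supp b)"
      using pos_type_gt(3)[OF a b] by auto
    moreover have "card (supp a \<union> supp b) = i + j - t"
      using c card_Un_Int[of "supp a" "supp b"] by simp
    ultimately show ?thesis
      using 4 sub card_Diff_subset[of "supp a \<union> supp b" "{..<n}"] by simp
  next
    case 5
    then have "pos_type a b q \<noteq> x" for q
      using pos_type_gt(4)[OF a b, of q] by auto
    then show ?thesis
      using 5 by simp
  qed
qed

text \<open>Equal multisets of position types give a permutation matching them. A suitable group
  element at each position then comes from the common orbital if both words have a letter, from
  transitivity if one has, and is the identity if neither has.\<close>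

lemma pair_type_transitive:
  assumes a: "a \<in> BX X n" and b: "b \<in> BX X n" and a': "a' \<in> BX X n" and b': "b' \<in> BX X n"
    and eq: "pair_type a b = pair_type a' b'"
  obtains h where "h \<in> wreath G n" "wact n h a = a'" "wact n h b = b'"
proof -
  obtain i j t l where p: "pair_type a b = (i, j, t, l)"
    by (cases "pair_type a b") auto
  have "image_mset (pos_type a b) (mset_set {..<n}) = image_mset (pos_type a' b') (mset_set {..<n})"
  proof (rule multiset_eqI)
    fix x
    have *: "count (image_mset f (mset_set {..<n})) x = card {q\<in>{..<n}. f q = x}" for f :: "nat \<Rightarrow> nat"
      by (simp add: count_image_mset vimage_def Int_def conj_commute)
    show "count (image_mset (pos_type a b) (mset_set {..<n})) x =
        count (image_mset (pos_type a' b') (mset_set {..<n})) x"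
      unfolding * card_pos_type[OF a b p] card_pos_type[OF a' b' p[unfolded eq]] ..
  qed
  then obtain \<pi> where \<pi>: "\<pi> permutes {..<n}" "\<forall>q\<in>{..<n}. pos_type a b q = pos_type a' b' (\<pi> q)"
    using image_mset_eq_implies_permutes[of "{..<n}" "pos_type a b" "pos_type a' b'"] by auto
  have ex: "\<exists>\<gamma>. \<gamma> \<in> carrier G \<and> map_option (\<phi> \<gamma>) (a ! q) = a' ! \<pi> q \<and> map_option (\<phi> \<gamma>) (b ! q) = b' ! \<pi> q"
    if q: "q < n" for q
  proof -
    have ty: "pos_type a b q = pos_type a' b' (\<pi> q)"
      using \<pi>(2) q by simp
    have \<pi>q: "\<pi> q < n"
      using permutes_in_image[OF \<pi>(1), of q] q by simp
    have some: "c ! q = Some (the (c ! q))" if "q \<in> supp c" for c :: "'x option list" and q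
      using that by (auto simp: supp_def)
    have none: "c ! q = None" if "q \<notin> supp c" "q < n" "c \<in> BX X n" for c :: "'x option list" and q
      using that by (auto simp: supp_def BX_iff)
    consider "pos_type a b q \<le> m" | "pos_type a b q = m + 1" | "pos_type a b q = m + 2" | "pos_type a b q = m + 3"
      using pos_type_gt(4)[OF a b, of q] by linarith
    then show ?thesis
    proof cases
      case 1
      then have s: "q \<in> supp a" "q \<in> supp b" "(the (a ! q), the (b ! q)) \<in> Z (pos_type a b q)"
        using pos_type_le[OF a b 1] by auto
      have s': "\<pi> q \<in> supp a'" "\<pi> q \<in> supp b'" "(the (a' ! \<pi> q), the (b' ! \<pi> q)) \<in> Z (pos_type a b q)"
        using pos_type_le[OF a' b' 1, of "\<pi> q"] ty by auto
      obtain \<gamma> where "\<gamma> \<in> carrier G" "\<phi> \<gamma> (the (a ! q)) = the (a' ! \<pi> q)" "\<phi> \<gamma> (the (b ! q)) = the (b' ! \<pi> q)"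
        using Z_transitive[OF 1 s(3) s'(3)] by blast
      then show ?thesis
        using some[OF s(1)] some[OF s(2)] some[OF s'(1)] some[OF s'(2)]
        by (metis option.simps(9))
    next
      case 2
      then have s: "q \<in> supp a" "q \<notin> supp b" "\<pi> q \<in> supp a'" "\<pi> q \<notin> supp b'"
        using pos_type_gt(1)[OF a b, of q] pos_type_gt(1)[OF a' b', of "\<pi> q"] ty by auto
      obtain \<gamma> where "\<gamma> \<in> carrier G" "\<phi> \<gamma> (the (a ! q)) = the (a' ! \<pi> q)"
        using transitive[OF the_in_X[OF a s(1)] the_in_X[OF a' s(3)]] by blast
      then show ?thesis
        using some[OF s(1)] none[OF s(2) q b] some[OF s(3)] none[OF s(4) \<pi>q b']
        by (metis option.simps(8,9))
    next
      case 3
      then have s: "q \<in> supp b" "q \<notin> supp a" "\<pi> q \<in> supp b'" "\<pi> q \<notin> supp a'"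
        using pos_type_gt(2)[OF a b, of q] pos_type_gt(2)[OF a' b', of "\<pi> q"] ty by auto
      obtain \<gamma> where "\<gamma> \<in> carrier G" "\<phi> \<gamma> (the (b ! q)) = the (b' ! \<pi> q)"
        using transitive[OF the_in_X[OF b s(1)] the_in_X[OF b' s(3)]] by blast
      then show ?thesis
        using some[OF s(1)] none[OF s(2) q a] some[OF s(3)] none[OF s(4) \<pi>q a']
        by (metis option.simps(8,9))
    next
      case 4
      then have s: "q \<notin> supp a" "q \<notin> supp b" "\<pi> q \<notin> supp a'" "\<pi> q \<notin> supp b'"
        using pos_type_gt(3)[OF a b, of q] pos_type_gt(3)[OF a' b', of "\<pi> q"] ty by auto
      have "\<one>\<^bsub>G\<^esub> \<in> carrier G"
        by (rule monoid.one_closed[OF group.is_monoid[OF is_group]])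
      then show ?thesis
        using none[OF s(1) q a] none[OF s(2) q b] none[OF s(3) \<pi>q a'] none[OF s(4) \<pi>q b'] by auto
    qed
  qed
  define \<gamma> where "\<gamma> q = (SOME \<gamma>. \<gamma> \<in> carrier G \<and> map_option (\<phi> \<gamma>) (a ! q) = a' ! \<pi> q \<and>
      map_option (\<phi> \<gamma>) (b ! q) = b' ! \<pi> q)" for q
  have \<gamma>: "\<gamma> q \<in> carrier G" "map_option (\<phi> (\<gamma> q)) (a ! q) = a' ! \<pi> q"
    "map_option (\<phi> (\<gamma> q)) (b ! q) = b' ! \<pi> q" if "q < n" for q
    using someI_ex[OF ex[OF that]] unfolding \<gamma>_def by auto
  \<comment> \<open>The wreath action applies its group element at the target position, hence the
    reindexing by the inverse of \<pi>.\<close>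
  define g where "g = restrict (\<lambda>q. \<gamma> (inv_into UNIV \<pi> q)) {..<n}"
  have g: "g (\<pi> q) = \<gamma> q" if "q < n" for q
    using permutes_in_image[OF \<pi>(1), of q] permutes_inverses(2)[OF \<pi>(1), of q] that by (simp add: g_def)
  have "(g, \<pi>) \<in> wreath G n"
    using \<gamma>(1) permutes_in_image[OF permutes_inv[OF \<pi>(1)]] \<pi>(1) by (auto simp: wreath_def g_def)
  moreover have "wact n (g, \<pi>) a = a'"
  proof (rule list_eq_permutesI[OF \<pi>(1) wact_length])
    fix q assume "q < n"
    then show "wact n (g, \<pi>) a ! \<pi> q = a' ! \<pi> q"
      unfolding wact_nth[OF \<pi>(1) \<open>q < n\<close>] by (simp only: g \<gamma>)
  qed (use a' in \<open>simp add: BX_iff\<close>)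
  moreover have "wact n (g, \<pi>) b = b'"
  proof (rule list_eq_permutesI[OF \<pi>(1) wact_length])
    fix q assume "q < n"
    then show "wact n (g, \<pi>) b ! \<pi> q = b' ! \<pi> q"
      unfolding wact_nth[OF \<pi>(1) \<open>q < n\<close>] by (simp only: g \<gamma>)
  qed (use b' in \<open>simp add: BX_iff\<close>)
  ultimately show ?thesis
    using that by blast
qed

section \<open>The orbit matrices span the commutant\<close>

lemma push_ket:
  assumes "inj_on \<sigma> S'" "\<sigma> ` S' \<subseteq> S'" "x \<in> S'"
  shows "push S' \<sigma> (ket x) = ket (\<sigma> x)"
proof
  fix y
  show "push S' \<sigma> (ket x) y = ket (\<sigma> x) y"
  proof (cases "y \<in> \<sigma> ` S'")
    case True
    then obtain x' where "x' \<in> S'" "y = \<sigma> x'"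
      by blast
    then show ?thesis
      using push_apply[OF assms(1), of x' "ket x"] assms by (auto simp: ket_def inj_on_def)
  next
    case False
    then have "{x' \<in> S'. \<sigma> x' = y} = {}"
      by auto
    then show ?thesis
      using False assms(3) unfolding push_def by (auto simp only: sum.empty ket_def split: if_splits)
  qed
qed

text \<open>Testing equivariance on the vectors \<open>ket b\<close> turns it into invariance of the
  entries. Conversely, an invariant matrix is read as an operator by summing over its columns, and
  the sum is reindexed by the action.\<close>

lemma AX_iff:
  "M \<in> AX G X \<phi> n \<longleftrightarrow> M \<in> mats (BX X n) (BX X n) \<and>
    (\<forall>h\<in>wreath G n. \<forall>a\<in>BX X n. \<forall>b\<in>BX X n. M (wact n h a) (wact n h b) = M a b)"
proof
  let ?B = "BX X n"
  assume "M \<in> AX G X \<phi> n"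
  then obtain f where f: "f \<in> equivariant_endos G X \<phi> n" and M: "M = matrix_of_op ?B f"
    by (auto simp: AX_def)
  have "M (wact n h a) (wact n h b) = M a b" if h: "h \<in> wreath G n" and a: "a \<in> ?B" and b: "b \<in> ?B" for h a b
  proof -
    have sub: "wact n h ` ?B \<subseteq> ?B"
      using wact_BX[OF h] by blast
    have "f (push ?B (wact n h) (ket b)) = push ?B (wact n h) (f (ket b))"
      using f h b by (simp add: equivariant_endos_def)
    then have "f (ket (wact n h b)) = push ?B (wact n h) (f (ket b))"
      unfolding push_ket[OF wact_inj[OF h] sub b] .
    then have "f (ket (wact n h b)) (wact n h a) = f (ket b) a"
      using push_apply[OF wact_inj[OF h] a, of "f (ket b)"] by simp
    then show ?thesis
      using wact_BX[OF h] a b by (simp add: M matrix_of_op_def)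
  qed
  moreover have "M \<in> mats ?B ?B"
    by (auto simp: M matrix_of_op_def mats_def)
  ultimately show "M \<in> mats ?B ?B \<and>
      (\<forall>h\<in>wreath G n. \<forall>a\<in>?B. \<forall>b\<in>?B. M (wact n h a) (wact n h b) = M a b)"
    by blast
next
  let ?B = "BX X n"
  assume "M \<in> mats ?B ?B \<and> (\<forall>h\<in>wreath G n. \<forall>a\<in>?B. \<forall>b\<in>?B. M (wact n h a) (wact n h b) = M a b)"
  then have M: "M \<in> mats ?B ?B"
    and inv: "\<And>h a b. h \<in> wreath G n \<Longrightarrow> a \<in> ?B \<Longrightarrow> b \<in> ?B \<Longrightarrow> M (wact n h a) (wact n h b) = M a b"
    by blast+
  have M0: "M a b = 0" if "a \<notin> ?B \<or> b \<notin> ?B" for a b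
    using M that by (auto simp: mats_def)
  define f where "f v = (\<lambda>a. \<Sum>b\<in>?B. M a b * v b)" for v :: "'x option list \<Rightarrow> complex"
  have lin: "Vector_Spaces.linear cscale cscale f"
    by unfold_locales (auto simp: f_def fun_eq_iff cscale_def algebra_simps sum.distrib sum_distrib_left)
  have fV: "f v \<in> V ?B" for v
    using M0 by (simp add: f_def V_def)
  have "f (push ?B (wact n h) v) = push ?B (wact n h) (f v)" if h: "h \<in> wreath G n" for h v
  proof
    fix a
    show "f (push ?B (wact n h) v) a = push ?B (wact n h) (f v) a"
    proof (cases "a \<in> ?B")
      case True
      then obtain a0 where a0: "a0 \<in> ?B" "a = wact n h a0"
        using wact_bij[OF h] by (auto simp: bij_betw_def)
      have "f (push ?B (wact n h) v) a = (\<Sum>b\<in>?B. M a (wact n h b) * push ?B (wact n h) v (wact n h b))"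
        unfolding f_def by (rule sum.reindex_bij_betw[OF wact_bij[OF h], symmetric])
      also have "\<dots> = (\<Sum>b\<in>?B. M a0 b * v b)"
        unfolding a0(2) by (intro sum.cong refl) (simp only: inv[OF h a0(1)] push_apply[OF wact_inj[OF h]])
      also have "\<dots> = push ?B (wact n h) (f v) a"
        unfolding a0(2) push_apply[OF wact_inj[OF h] a0(1)] by (simp add: f_def)
      finally show ?thesis .
    next
      case False
      then have "push ?B (wact n h) (f v) a = 0"
        using push_in_V[of "wact n h" ?B "f v"] wact_BX[OF h] by (auto simp: V_def)
      then show ?thesis
        using False M0 by (simp add: f_def)
    qed
  qed
  then have "f \<in> equivariant_endos G X \<phi> n"
    using lin fV by (auto simp: equivariant_endos_def)
  moreover have "M = matrix_of_op ?B f"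
  proof (intro ext)
    fix a b
    show "M a b = matrix_of_op ?B f a b"
      using M0 finite_BX[OF finX, of n]
      by (auto simp: matrix_of_op_def f_def ket_def if_distrib cong: if_cong)
  qed
  ultimately show "M \<in> AX G X \<phi> n"
    by (auto simp: AX_def)
qed

abbreviation omat :: "nat \<Rightarrow> nat \<times> nat \<times> nat \<times> nat list \<Rightarrow> 'x option list \<Rightarrow> 'x option list \<Rightarrow> complex" where
  "omat n \<equiv> \<lambda>(i, j, t, l). orbit_matrix X m Z n i j t l"

lemma omat_eq: "omat n \<mu> a b = (if a \<in> BX X n \<and> b \<in> BX X n \<and> pair_type a b = \<mu> then 1 else 0)"
  by (cases \<mu>) (simp add: orbit_matrix_eq)

lemma orbit_type_sum:
  assumes a: "a \<in> BX X n" and b: "b \<in> BX X n"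
  shows "sum_list (orbit_type m Z a b) = card (supp a \<inter> supp b)"
proof -
  have "sum_list (orbit_type m Z a b) = (\<Sum>u<Suc m. orbit_type m Z a b ! u)"
    unfolding sum_list_sum_nth orbit_type_length by (simp add: atLeast0LessThan)
  also have "\<dots> = (\<Sum>u\<in>{..m}. \<Sum>i\<in>{i \<in> supp a \<inter> supp b. pos_type a b i = u}. 1)"
    unfolding lessThan_Suc_atMost
    by (intro sum.cong refl) (auto simp: orbit_type_nth pos_type_le[OF a b] intro!: arg_cong[where f = card])
  also have "\<dots> = (\<Sum>i\<in>supp a \<inter> supp b. 1)"
    by (rule sum.group) (use pos_type_bound[OF a b] in auto)
  finally show ?thesis
    by simp
qed

lemma pair_type_IX:
  assumes a: "a \<in> BX X n" and b: "b \<in> BX X n"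
  shows "pair_type a b \<in> IX m n"
proof -
  have "card (supp a \<inter> supp b) \<le> card (supp a)" "card (supp a \<inter> supp b) \<le> card (supp b)"
    by (auto intro: card_mono)
  moreover have "card (supp a \<union> supp b) \<le> n"
    using card_mono[of "{..<n}" "supp a \<union> supp b"] supp_subset a b by auto
  moreover have "card (supp a) + card (supp b) = card (supp a \<union> supp b) + card (supp a \<inter> supp b)"
    by (rule card_Un_Int) auto
  ultimately show ?thesis
    using orbit_type_sum[OF a b] by (auto simp: IX_def pair_type_def compositions_def orbit_type_length)
qed

lemma finite_IX: "finite (IX m n)"
proof -
  have "IX m n \<subseteq> {..n} \<times> {..n} \<times> {..n} \<times> {l. set l \<subseteq> {..n} \<and> length l = Suc m}"
  proof
    fix \<mu> assume "\<mu> \<in> IX m n"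
    then obtain i j t l where \<mu>: "\<mu> = (i, j, t, l)" and
      le: "t \<le> i" "t \<le> j" "i + j - t \<le> n" and l: "length l = Suc m" "sum_list l = t"
      by (auto simp: IX_def compositions_def)
    have "x \<le> n" if "x \<in> set l" for x
      using member_le_sum_list[OF that] l le by linarith
    then show "\<mu> \<in> {..n} \<times> {..n} \<times> {..n} \<times> {l. set l \<subseteq> {..n} \<and> length l = Suc m}"
      using le l \<mu> by auto
  qed
  moreover have "finite ({..n} \<times> {..n} \<times> {..n} \<times> {l. set l \<subseteq> {..n} \<and> length l = Suc m})"
    using finite_lists_length_eq[of "{..n}" "Suc m"] by simp
  ultimately show ?thesis
    by (rule finite_subset)
qed

lemma omat_AX: "omat n \<mu> \<in> AX G X \<phi> n"
  unfolding AX_iff using pair_type_wact wact_BX by (auto simp: omat_eq mats_def)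

text \<open>An invariant matrix is constant on pairs of equal type, by transitivity on such pairs;
  its coefficients are the values at chosen representatives.\<close>

lemma AX_eq_span:
  "M \<in> AX G X \<phi> n \<longleftrightarrow> (\<exists>c. M = (\<lambda>a b. \<Sum>\<mu>\<in>IX m n. c \<mu> * omat n \<mu> a b))"
proof
  let ?B = "BX X n"
  assume M: "M \<in> AX G X \<phi> n"
  define c where "c \<mu> = (let p = SOME p. fst p \<in> ?B \<and> snd p \<in> ?B \<and> pair_type (fst p) (snd p) = \<mu>
    in M (fst p) (snd p))" for \<mu>
  have c: "c (pair_type a b) = M a b" if ab: "a \<in> ?B" "b \<in> ?B" for a b
  proof -
    let ?P = "\<lambda>p. fst p \<in> ?B \<and> snd p \<in> ?B \<and> pair_type (fst p) (snd p) = pair_type a b"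
    define p where "p = (SOME p. ?P p)"
    have "?P p"
      unfolding p_def by (rule someI[of ?P "(a, b)"]) (use ab in simp)
    then obtain h where "h \<in> wreath G n" "wact n h (fst p) = a" "wact n h (snd p) = b"
      using pair_type_transitive[of "fst p" n "snd p" a b] ab by metis
    then have "M (fst p) (snd p) = M a b"
      using M \<open>?P p\<close> unfolding AX_iff by metis
    then show ?thesis
      by (simp add: c_def p_def Let_def)
  qed
  have "M a b = (\<Sum>\<mu>\<in>IX m n. c \<mu> * omat n \<mu> a b)" for a b
  proof (cases "a \<in> ?B \<and> b \<in> ?B")
    case True
    then have "(\<Sum>\<mu>\<in>IX m n. c \<mu> * omat n \<mu> a b) = (\<Sum>\<mu>\<in>IX m n. if \<mu> = pair_type a b then c \<mu> else 0)"
      by (intro sum.cong refl) (auto simp: omat_eq)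
    then show ?thesis
      using True finite_IX pair_type_IX[of a n b] c by simp
  next
    case False
    then show ?thesis
      using M by (auto simp: AX_iff mats_def omat_eq)
  qed
  then show "\<exists>c. M = (\<lambda>a b. \<Sum>\<mu>\<in>IX m n. c \<mu> * omat n \<mu> a b)"
    by (intro exI[of _ c] ext) simp
next
  assume "\<exists>c. M = (\<lambda>a b. \<Sum>\<mu>\<in>IX m n. c \<mu> * omat n \<mu> a b)"
  then obtain c where c: "M = (\<lambda>a b. \<Sum>\<mu>\<in>IX m n. c \<mu> * omat n \<mu> a b)"
    by blast
  show "M \<in> AX G X \<phi> n"
    unfolding AX_iff c using omat_AX[of n, unfolded AX_iff]
    by (auto simp: mats_def omat_eq pair_type_wact wact_BX)
qed

text \<open>Colour the positions with m + 4 colours: one per orbital, one for a letter in the first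
  word only, one for the second only, one for neither. Thus every orbit matrix indexed by
  \<open>IX\<close> is nonzero, which makes these matrices independent.\<close>

lemma pair_type_exists:
  assumes "\<mu> \<in> IX m n"
  obtains a b where "a \<in> BX X n" "b \<in> BX X n" "pair_type a b = \<mu>"
proof -
  obtain i j t l where \<mu>: "\<mu> = (i, j, t, l)" and
      le: "t \<le> i" "t \<le> j" "i + j - t \<le> n" and l: "length l = Suc m" "sum_list l = t"
    using assms by (auto simp: IX_def compositions_def)
  define L where "L u = (if u \<le> m then l ! u else if u = m + 1 then i - t else if u = m + 2 then j - t
     else n - (i + j - t))" for u
  have lsum: "(\<Sum>u\<le>m. l ! u) = t"
    using l by (simp add: sum_list_sum_nth atLeast0LessThan lessThan_Suc_atMost)
  have "(\<Sum>u\<le>m + 3. L u) = card {..<n}"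
  proof -
    have "(\<Sum>u\<le>m. L u) = t"
      using lsum by (simp add: L_def)
    then have "(\<Sum>u\<le>m + 3. L u) = t + (i - t) + (j - t) + (n - (i + j - t))"
      by (simp add: numeral_3_eq_3 L_def)
    then show ?thesis
      using le by simp
  qed
  then obtain c where c: "c \<in> {..<n} \<rightarrow>\<^sub>E {..m + 3}" "\<And>u. u \<in> {..m + 3} \<Longrightarrow> card {q\<in>{..<n}. c q = u} = L u"
    using functions_with_counts_exist[of "{..<n}" "{..m + 3}" L] by auto
  obtain x where x: "x \<in> X"
    using X_nonempty by blast
  define r where "r u = (SOME p. p \<in> Z u)" for u
  have r: "(fst (r u), snd (r u)) \<in> Z u" if "u \<le> m" for u
    using Z_nonempty[OF that] unfolding r_def by (simp add: some_in_eq)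
  have rX: "fst (r u) \<in> X" "snd (r u) \<in> X" if "u \<le> m" for u
    using r[OF that] Z_subset[OF that] by auto
  define a where "a = map (\<lambda>q. if c q \<le> m then Some (fst (r (c q))) else if c q = m + 1 then Some x else None) [0..<n]"
  define b where "b = map (\<lambda>q. if c q \<le> m then Some (snd (r (c q))) else if c q = m + 2 then Some x else None) [0..<n]"
  have a: "a \<in> BX X n" and b: "b \<in> BX X n"
    using rX x by (auto simp: BX_iff a_def b_def)
  have sa: "supp a = {q\<in>{..<n}. c q \<le> m \<or> c q = m + 1}" and sb: "supp b = {q\<in>{..<n}. c q \<le> m \<or> c q = m + 2}"
    by (auto simp: supp_def a_def b_def split: if_splits)
  have sab: "supp a \<inter> supp b = {q\<in>{..<n}. c q \<le> m}"
    unfolding sa sb by auto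
  have ct: "card {q\<in>{..<n}. c q \<le> m} = t"
  proof -
    have "card {q\<in>{..<n}. c q \<le> m} = (\<Sum>q\<in>{q\<in>{..<n}. c q \<le> m}. 1)"
      by simp
    also have "\<dots> = (\<Sum>u\<in>{..m}. \<Sum>q\<in>{q\<in>{q\<in>{..<n}. c q \<le> m}. c q = u}. 1)"
      by (rule sum.group[symmetric]) auto
    also have "\<dots> = (\<Sum>u\<le>m. L u)"
    proof (intro sum.cong refl)
      fix u assume u: "u \<in> {..m}"
      then have "{q\<in>{q\<in>{..<n}. c q \<le> m}. c q = u} = {q\<in>{..<n}. c q = u}"
        by auto
      then show "(\<Sum>q\<in>{q\<in>{q\<in>{..<n}. c q \<le> m}. c q = u}. 1) = L u"
        using c(2)[of u] u by simp
    qed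
    finally show ?thesis
      using lsum by (simp add: L_def)
  qed
  have ci: "card (supp a) = i"
  proof -
    have "supp a = {q\<in>{..<n}. c q \<le> m} \<union> {q\<in>{..<n}. c q = m + 1}"
      unfolding sa by auto
    moreover have "card ({q\<in>{..<n}. c q \<le> m} \<union> {q\<in>{..<n}. c q = m + 1}) = card {q\<in>{..<n}. c q \<le> m} + card {q\<in>{..<n}. c q = m + 1}"
      by (rule card_Un_disjoint) auto
    ultimately show ?thesis
      using ct c(2)[of "m + 1"] le by (simp add: L_def)
  qed
  have cj: "card (supp b) = j"
  proof -
    have "supp b = {q\<in>{..<n}. c q \<le> m} \<union> {q\<in>{..<n}. c q = m + 2}"
      unfolding sb by auto
    moreover have "card ({q\<in>{..<n}. c q \<le> m} \<union> {q\<in>{..<n}. c q = m + 2}) = card {q\<in>{..<n}. c q \<le> m} + card {q\<in>{..<n}. c q = m + 2}"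
      by (rule card_Un_disjoint) auto
    ultimately show ?thesis
      using ct c(2)[of "m + 2"] le by (simp add: L_def)
  qed
  have "orbit_type m Z a b = l"
  proof (rule nth_equalityI)
    fix u assume "u < length (orbit_type m Z a b)"
    then have u: "u \<le> m"
      by (simp add: orbit_type_length)
    have "{q \<in> supp a \<inter> supp b. (the (a ! q), the (b ! q)) \<in> Z u} = {q\<in>{..<n}. c q = u}"
    proof -
      have "(the (a ! q), the (b ! q)) \<in> Z u \<longleftrightarrow> c q = u" if "q < n" "c q \<le> m" for q
        using that r[OF that(2)] Z_disjoint[OF that(2) u, of "fst (r (c q))" "snd (r (c q))"] by (auto simp: a_def b_def)
      then show ?thesis
        unfolding sab using u by auto
    qed
    then show "orbit_type m Z a b ! u = l ! u"
      using c(2)[of u] u by (simp add: orbit_type_nth[OF u] L_def)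
  qed (simp add: orbit_type_length l)
  then show ?thesis
    using that[OF a b] ci cj ct sab \<mu> by (simp add: pair_type_def)
qed

end

section \<open>Jordan chains and matrix entries\<close>

text \<open>A column of natural numbers cannot have a negative sum. This covers t < s, where the
  first column sum is t - s.\<close>

lemma Lambda_negative: "a < 0 \<Longrightarrow> Lambda m ev l (a # p) = 0"
proof -
  assume a: "a < 0"
  have "r \<notin> contingency m l (a # p)" for r
  proof
    assume "r \<in> contingency m l (a # p)"
    then have "int (\<Sum>u\<le>m. r u 0) = (a # p) ! 0"
      unfolding contingency_def by blast
    then show False
      using a by (metis nth_Cons_0 not_less of_nat_0_le_iff)
  qed
  then have "contingency m l (a # p) = {}"
    by blast
  then show ?thesis
    by (simp add: Lambda_def)
qed

lemma normalize_vec_scale: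
  assumes "finite S" "v \<in> V S" "cinner S v v = 1" "0 < c"
  shows "normalize_vec S (cscale (complex_of_real c) v) = v"
proof -
  let ?L = "L2_set (\<lambda>x. cmod (v x)) S"
  have "complex_of_real (?L\<^sup>2) = complex_of_real 1"
    using assms(3) by (simp only: cinner_self_L2 of_real_1)
  then have "?L = 1"
    using L2_set_nonneg[of "\<lambda>x. cmod (v x)" S] by (simp add: power2_eq_1_iff del: of_real_power)
  moreover have "L2_set (\<lambda>x. cmod (cscale (complex_of_real c) v x)) S = c * ?L"
    using assms(4) by (simp add: cscale_def norm_mult L2_set_right_distrib)
  ultimately show ?thesis
    using assms(4) by (simp add: normalize_vec_def cscale_def flip: of_real_mult mult.assoc)
qed

context multiplicity_free_action
begin

text \<open>One label for each Jordan chain: a pattern and a primitive basis vector on its free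
  positions.\<close>

definition Theta :: "nat \<Rightarrow> ((nat \<Rightarrow> 'x \<Rightarrow> complex) \<times> nat \<times> (nat set \<Rightarrow> complex)) set" where
  "Theta n = {(g, k, y). g \<in> patterns n \<and> y \<in> primitive_basis (rest n g) k}"

text \<open>The class (k, s, p) of a chain. The Boolean rank is increased by the number s of
  nontrivial letters.\<close>

definition cidx :: "nat \<Rightarrow> (nat \<Rightarrow> 'x \<Rightarrow> complex) \<times> nat \<times> (nat set \<Rightarrow> complex) \<Rightarrow> nat \<times> nat \<times> nat list" where
  "cidx n = (\<lambda>(g, k, y). (k + card (S n g), card (S n g), type_counts n g))"

definition ranks :: "nat \<Rightarrow> nat \<times> nat \<times> nat list \<Rightarrow> nat set" where
  "ranks n = (\<lambda>(k, s, p). {k..n + s - k})"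

text \<open>The index \<open>a\<close> is the rank in \<open>BX X n\<close>; the Boolean rank is
  smaller by the number of nontrivial letters.\<close>

definition uvec :: "nat \<Rightarrow> (nat \<Rightarrow> 'x \<Rightarrow> complex) \<times> nat \<times> (nat set \<Rightarrow> complex) \<Rightarrow> nat \<Rightarrow> 'x option list \<Rightarrow> complex" where
  "uvec n = (\<lambda>(g, k, y) a. lift n g (chain_vec (rest n g) k y (a - card (S n g))))"

text \<open>Each application of the up operator to a lifted vector produces one factor sqrt |X|.
  With these powers the sequence is a genuine chain.\<close>

definition raw :: "nat \<Rightarrow> (nat \<Rightarrow> 'x \<Rightarrow> complex) \<times> nat \<times> (nat set \<Rightarrow> complex) \<Rightarrow> nat \<Rightarrow> 'x option list \<Rightarrow> complex" where
  "raw n = (\<lambda>(g, k, y) r. cscale (complex_of_real (sqrt (real (card X)) ^ r))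
     (lift n g ((raise (rest n g) ^^ r) y)))"

definition chain :: "nat \<Rightarrow> (nat \<Rightarrow> 'x \<Rightarrow> complex) \<times> nat \<times> (nat set \<Rightarrow> complex) \<Rightarrow> ('x option list \<Rightarrow> complex) list" where
  "chain n \<theta> = map (raw n \<theta>) [0..<card (ranks n (cidx n \<theta>))]"

definition unit_index :: "nat \<Rightarrow> (((nat \<Rightarrow> 'x \<Rightarrow> complex) \<times> nat \<times> (nat set \<Rightarrow> complex)) \<times> nat) set" where
  "unit_index n = (SIGMA \<theta>:Theta n. ranks n (cidx n \<theta>))"

lemma ThetaE:
  assumes "\<theta> \<in> Theta n"
  obtains g k y where "\<theta> = (g, k, y)" "g \<in> patterns n" "y \<in> primitive_basis (rest n g) k"
    "y \<in> primitive (rest n g) k" "2 * k + card (S n g) \<le> n"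
proof -
  obtain g k y where \<theta>: "\<theta> = (g, k, y)" "g \<in> patterns n" "y \<in> primitive_basis (rest n g) k"
    using assms by (auto simp: Theta_def)
  have "2 * k \<le> card (rest n g)"
    using primitive_basis_rank[OF finite_rest \<theta>(3)] .
  then have "2 * k + card (S n g) \<le> n"
    using card_S_le[of n g] unfolding card_rest by linarith
  then show ?thesis
    using that \<theta> primitive_basis(2)[OF finite_rest] by blast
qed

lemma type_counts_length: "length (type_counts n g) = m"
  by (simp add: type_counts_def)

lemma sum_type_counts:
  assumes "g \<in> patterns n"
  shows "sum_list (type_counts n g) = card (S n g)"
proof -
  have "sum_list (type_counts n g) = (\<Sum>w\<in>{1..m}. \<Sum>i\<in>{i\<in>S n g. wt (g i) = w}. 1)"
  proof -
    have "{i\<in>{..<n}. wt (g i) = w} = {i\<in>S n g. wt (g i) = w}" if "w \<in> {1..m}" for w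
      using that wt_eq_0[OF e0_KK] by (auto simp: S_def)
    moreover have "set [1..<Suc m] = {1..m}"
      by auto
    ultimately show ?thesis
      unfolding type_counts_def by (subst sum.distinct_set_conv_list[symmetric]) (auto intro!: sum.cong)
  qed
  also have "\<dots> = (\<Sum>i\<in>S n g. 1)"
  proof (rule sum.group)
    show "(\<lambda>i. wt (g i)) ` S n g \<subseteq> {1..m}"
    proof clarify
      fix i assume i: "i \<in> S n g"
      then have "g i \<in> KK" "g i \<noteq> e0"
        using assms by (auto simp: S_def)
      then show "wt (g i) \<in> {1..m}"
        using wt(1) wt_eq_0 by (auto simp: Suc_le_eq)
    qed
  qed auto
  finally show ?thesis
    by simp
qed

lemma cidx_JX:
  assumes "\<theta> \<in> Theta n"
  shows "cidx n \<theta> \<in> JX m n"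
proof -
  obtain g k y where \<theta>: "\<theta> = (g, k, y)" "g \<in> patterns n" "2 * k + card (S n g) \<le> n"
    using ThetaE[OF assms] by metis
  then show ?thesis
    using sum_type_counts[OF \<theta>(2)] by (auto simp: cidx_def JX_def compositions_def type_counts_length)
qed

lemma ranks_iff:
  assumes "\<theta> = (g, k, y)" "2 * k + card (S n g) \<le> n"
  shows "a \<in> ranks n (cidx n \<theta>) \<longleftrightarrow> k + card (S n g) \<le> a \<and> a \<le> n - k"
    "card (ranks n (cidx n \<theta>)) = Suc (card (rest n g) - 2 * k)"
  using assms card_S_le[of n g] unfolding card_rest by (auto simp: ranks_def cidx_def)

lemma unit_index_chain_index:
  assumes "\<theta> \<in> Theta n" "\<theta> = (g, k, y)"
  shows "a \<in> ranks n (cidx n \<theta>) \<longleftrightarrow> card (S n g) \<le> a \<and> (k, y, a - card (S n g)) \<in> chain_index (rest n g)"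
proof -
  have y: "y \<in> primitive_basis (rest n g) k" and k: "2 * k + card (S n g) \<le> n"
    using assms by (auto elim!: ThetaE)
  show ?thesis
    unfolding ranks_iff(1)[OF assms(2) k] chain_index_def card_rest using y k by auto
qed

lemma uvec_V: "uvec n \<theta> a \<in> V (BX X n)"
  by (cases \<theta>) (simp add: uvec_def lift_in_V)

lemma uvec_orthonormal: "orthonormal_family (BX X n) (unit_index n) (\<lambda>(\<theta>, a). uvec n \<theta> a)"
  unfolding orthonormal_family_def
proof (intro conjI ballI)
  fix p q assume "p \<in> unit_index n" "q \<in> unit_index n"
  then obtain \<theta> a \<theta>' b where p: "p = (\<theta>, a)" "\<theta> \<in> Theta n" "a \<in> ranks n (cidx n \<theta>)"
    and q: "q = (\<theta>', b)" "\<theta>' \<in> Theta n" "b \<in> ranks n (cidx n \<theta>')"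
    by (auto simp: unit_index_def)
  obtain g k y g' k' y' where \<theta>: "\<theta> = (g, k, y)" "\<theta>' = (g', k', y')"
    by (metis prod_cases3)
  have g: "g \<in> patterns n" "g' \<in> patterns n"
    using p q \<theta> by (auto simp: Theta_def)
  have a: "card (S n g) \<le> a" "(k, y, a - card (S n g)) \<in> chain_index (rest n g)"
    and b: "card (S n g') \<le> b" "(k', y', b - card (S n g')) \<in> chain_index (rest n g')"
    using p q unit_index_chain_index \<theta> by auto
  have "cinner (BX X n) (uvec n \<theta> a) (uvec n \<theta>' b) = (if p = q then 1 else 0)"
  proof (cases "g = g'")
    case True
    have "cinner (Pow (rest n g)) (chain_vec (rest n g) k y (a - card (S n g)))
        (chain_vec (rest n g) k' y' (b - card (S n g))) =
        (if (k, y, a - card (S n g)) = (k', y', b - card (S n g)) then 1 else 0)"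
      using chain_vec_orthonormal[OF finite_rest, of n g] a(2) b(2) True
      unfolding orthonormal_family_def by fastforce
    then show ?thesis
      using cinner_lift[OF g] True a b by (auto simp: uvec_def \<theta> p q)
  next
    case False
    then show ?thesis
      using cinner_lift[OF g] by (auto simp: uvec_def \<theta> p q)
  qed
  then show "cinner (BX X n) (case p of (\<theta>, a) \<Rightarrow> uvec n \<theta> a) (case q of (\<theta>, a) \<Rightarrow> uvec n \<theta> a) =
      (if p = q then 1 else 0)"
    by (simp add: p q)
qed (auto simp: uvec_V)

lemma cinner_uvec:
  assumes "(\<theta>, a) \<in> unit_index n" "(\<theta>', b) \<in> unit_index n"
  shows "cinner (BX X n) (uvec n \<theta> a) (uvec n \<theta>' b) = (if (\<theta>, a) = (\<theta>', b) then 1 else 0)"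
  using bspec[OF bspec[OF conjunct2[OF uvec_orthonormal[unfolded orthonormal_family_def]] assms(1)] assms(2)]
  by (simp only: prod.case)

lemma finite_unit_index: "finite (unit_index n)"
  by (rule orthonormal_family_finite[OF finite_BX[OF finX] uvec_orthonormal])

lemma uvec_kernel:
  assumes b: "b \<in> BX X n" and b': "b' \<in> BX X n"
  shows "(\<Sum>(\<theta>, a)\<in>unit_index n. uvec n \<theta> a b * cnj (uvec n \<theta> a b')) = (if b = b' then 1 else 0)"
proof -
  have finP: "finite (patterns n)"
    using KK_finite by (intro finite_PiE) auto
  have finC: "finite (chain_index (rest n g))" for g
    by (rule orthonormal_family_finite[OF _ chain_vec_orthonormal[OF finite_rest]]) simp
  let ?h = "\<lambda>g (k, y, a). lift n g (chain_vec (rest n g) k y a) b * cnj (lift n g (chain_vec (rest n g) k y a) b')"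
  have "(\<Sum>(\<theta>, a)\<in>unit_index n. uvec n \<theta> a b * cnj (uvec n \<theta> a b')) =
      (\<Sum>(g, c)\<in>(SIGMA g:patterns n. chain_index (rest n g)). ?h g c)"
  proof (rule sum.reindex_bij_witness[of _ "\<lambda>(g, (k, y, a)). ((g, k, y), a + card (S n g))"
        "\<lambda>((g, k, y), a). (g, (k, y, a - card (S n g)))"])
    fix p assume p: "p \<in> unit_index n"
    obtain g k y a where pe: "p = ((g, k, y), a)"
      by (metis prod_cases3 surj_pair)
    have \<theta>: "(g, k, y) \<in> Theta n" "a \<in> ranks n (cidx n (g, k, y))"
      using p pe by (auto simp: unit_index_def)
    have c: "card (S n g) \<le> a" "(k, y, a - card (S n g)) \<in> chain_index (rest n g)"
      using unit_index_chain_index[OF \<theta>(1) refl] \<theta>(2) by auto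
    show "(case (case p of (x, xa) \<Rightarrow> (case x of (g, k, y) \<Rightarrow> \<lambda>a. (g, k, y, a - card (S n g))) xa)
        of (g, k, y, a) \<Rightarrow> ((g, k, y), a + card (S n g))) = p"
      using c pe by simp
    show "(case p of (x, xa) \<Rightarrow> (case x of (g, k, y) \<Rightarrow> \<lambda>a. (g, k, y, a - card (S n g))) xa)
        \<in> (SIGMA g:patterns n. chain_index (rest n g))"
      using c \<theta> pe by (simp add: Theta_def)
    show "(case case p of (x, xa) \<Rightarrow> (case x of (g, k, y) \<Rightarrow> \<lambda>a. (g, k, y, a - card (S n g))) xa of
        (g, c) \<Rightarrow> ?h g c) = (case p of (\<theta>, a) \<Rightarrow> uvec n \<theta> a b * cnj (uvec n \<theta> a b'))"
      using pe by (simp add: uvec_def)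
  next
    fix p assume p: "p \<in> (SIGMA g:patterns n. chain_index (rest n g))"
    obtain g k y a where pe: "p = (g, (k, y, a))"
      by (metis prod_cases3 surj_pair)
    have g: "g \<in> patterns n" and c: "(k, y, a) \<in> chain_index (rest n g)"
      using p pe by auto
    have \<theta>: "(g, k, y) \<in> Theta n"
      using g c by (simp add: Theta_def chain_index_def)
    show "(case case p of (g, k, y, a) \<Rightarrow> ((g, k, y), a + card (S n g)) of
        (x, xa) \<Rightarrow> (case x of (g, k, y) \<Rightarrow> \<lambda>a. (g, k, y, a - card (S n g))) xa) = p"
      by (simp add: pe)
    show "(case p of (g, k, y, a) \<Rightarrow> ((g, k, y), a + card (S n g))) \<in> unit_index n"
      using unit_index_chain_index[OF \<theta> refl, of "a + card (S n g)"] c \<theta> by (simp add: pe unit_index_def)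
  qed
  also have "\<dots> = (\<Sum>g\<in>patterns n. \<Sum>c\<in>chain_index (rest n g). ?h g c)"
    using finP finC by (intro sum.Sigma[symmetric]) auto
  also have "\<dots> = (if b = b' then 1 else 0)"
    by (rule lift_kernel[OF b b'])
  finally show ?thesis .
qed

text \<open>The matrix entries predicted by part (iv).\<close>

definition block_entry :: "nat \<Rightarrow> nat \<times> nat \<times> nat \<times> nat list \<Rightarrow> nat \<times> nat \<times> nat list \<Rightarrow> nat \<Rightarrow> nat \<Rightarrow> complex" where
  "block_entry n = (\<lambda>(i, j, t, l) (k, s, p).
    if k \<le> i \<and> i \<le> n + s - k \<and> k \<le> j \<and> j \<le> n + s - k
    then (\<lambda>a b. complex_of_real
            (1 / sqrt (real ((n + s - 2 * k) choose (i - k))) *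
             (1 / sqrt (real ((n + s - 2 * k) choose (j - k))))) *
           alpha X m (lam X Z W) n t l p i j k s * unit_matrix i j a b)
    else 0)"

text \<open>Insert the action on Boolean chains into the form on lifted vectors. The Boolean algebra
  has rank n - s and all its ranks are shifted by s, which explains the shifted arguments of
  \<open>beta\<close> in \<open>alpha\<close>.\<close>

lemma mform_omat_uvec:
  assumes \<mu>: "\<mu> \<in> IX m n" and p: "(\<theta>, a) \<in> unit_index n" and q: "(\<theta>', b) \<in> unit_index n"
  shows "mform (BX X n) (uvec n \<theta> a) (omat n \<mu>) (uvec n \<theta>' b) =
    (if \<theta> = \<theta>' then block_entry n \<mu> (cidx n \<theta>) a b else 0)"
proof -
  obtain i j t l where \<mu>e: "\<mu> = (i, j, t, l)" and t: "t \<le> i" "t \<le> j" and l: "length l = Suc m"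
    using \<mu> by (auto simp: IX_def compositions_def)
  have \<theta>in: "\<theta> \<in> Theta n" "\<theta>' \<in> Theta n" and ab: "a \<in> ranks n (cidx n \<theta>)" "b \<in> ranks n (cidx n \<theta>')"
    using p q by (auto simp: unit_index_def)
  obtain g' k' y' where \<theta>: "\<theta> = (g', k', y')" and g': "g' \<in> patterns n"
    using ThetaE[OF \<theta>in(1)] by metis
  obtain g k y where \<theta>': "\<theta>' = (g, k, y)" and g: "g \<in> patterns n" and y: "y \<in> primitive (rest n g) k"
    and k: "2 * k + card (S n g) \<le> n"
    using ThetaE[OF \<theta>in(2)] by metis
  define s where "s = card (S n g)"
  let ?T = "rest n g"
  let ?r = "complex_of_real (sqrt (real (card X)))"
  let ?Lam = "Lambda m (lam X Z W) (map int l) ((int t - int s) # map int (type_counts n g))"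
  have N: "card ?T = n - s"
    by (simp add: card_rest s_def)
  have sn: "s \<le> n"
    using card_S_le by (simp add: s_def)
  have k2: "2 * k \<le> card ?T"
    using k unfolding N by (simp add: s_def)
  have lhs: "mform (BX X n) (uvec n \<theta> a) (omat n \<mu>) (uvec n \<theta>' b) =
    (if g = g' \<and> s \<le> i \<and> s \<le> j \<and> s \<le> t then ?r ^ (i - t + (j - t)) * ?Lam *
       cinner (Pow ?T) (subset_op ?T (i - s) (j - s) (t - s) (chain_vec ?T k y (b - s)))
         (chain_vec (rest n g') k' y' (a - card (S n g')))
     else 0)"
    using mform_orbit_matrix_lift[OF g g' l, of "chain_vec (rest n g') k' y' (a - card (S n g'))" i j t
        "chain_vec ?T k y (b - card (S n g))"] t
    unfolding s_def uvec_def \<theta> \<theta>' \<mu>e prod.case by (simp only: simp_thms)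
  show ?thesis
  proof (cases "g = g'")
    case False
    then show ?thesis
      unfolding lhs by (simp add: \<theta> \<theta>')
  next
    case gg: True
    have a: "s \<le> a" "(k', y', a - s) \<in> chain_index ?T"
      using unit_index_chain_index[OF \<theta>in(1) \<theta>] ab(1) gg by (auto simp: s_def)
    have b: "s \<le> b" "(k, y, b - s) \<in> chain_index ?T"
      using unit_index_chain_index[OF \<theta>in(2) \<theta>'] ab(2) by (auto simp: s_def)
    have cidx: "cidx n \<theta> = (k' + s, s, type_counts n g)"
      by (simp add: cidx_def \<theta> gg s_def)
    \<comment> \<open>For t < s both sides contain the zero factor \<open>Lambda\<close>; for b
      different from j the subset matrix kills a vector of the wrong level.\<close>
    consider "t < s" | "s \<le> t" "b \<noteq> j" | "s \<le> t" "b = j"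
      by linarith
    then show ?thesis
    proof cases
      case 1
      then have "?Lam = 0"
        by (intro Lambda_negative) simp
      then have "alpha X m (lam X Z W) n t l (type_counts n g) i j (k' + s) s = 0"
        by (simp add: alpha_def)
      then have "block_entry n \<mu> (cidx n \<theta>) a b = 0"
        by (simp add: block_entry_def cidx \<mu>e)
      then show ?thesis
        using 1 unfolding lhs by auto
    next
      case 2
      have "subset_op ?T (i - s) (j - s) (t - s) (chain_vec ?T k y (b - s)) = 0"
      proof (rule subset_op_other_level)
        show "chain_vec ?T k y (b - s) \<in> V (level ?T (b - s))"
          by (rule chain_vec_index_level[OF finite_rest b(2)])
        show "b - s \<noteq> j - s"
          using 2 t b(1) by auto
      qed
      moreover have "block_entry n \<mu> (cidx n \<theta>) a b = 0"
        using 2 by (simp add: block_entry_def cidx \<mu>e unit_matrix_def)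
      ultimately show ?thesis
        unfolding lhs by (simp only: cinner_zero_left mult_zero_right if_cancel)
    next
      case 3
      have bj: "k \<le> j - s" "j - s \<le> card ?T - k"
        using b(2) 3(2) by (auto simp: chain_index_def)
      have si: "s \<le> i" "s \<le> j"
        using 3 t by auto
      let ?c = "complex_of_real (1 / sqrt (real ((card ?T - 2 * k) choose (i - s - k))) *
                 (1 / sqrt (real ((card ?T - 2 * k) choose (j - s - k))))) *
               beta (int (card ?T)) (int (t - s)) (int (i - s)) (int (j - s)) (int k)"
      have op: "cinner (Pow ?T) (subset_op ?T (i - s) (j - s) (t - s) (chain_vec ?T k y (b - s)))
          (chain_vec ?T k' y' (a - s)) =
          (if k \<le> i - s \<and> i - s \<le> card ?T - k then
            ?c * (if (k, y, i - s) = (k', y', a - s) then 1 else 0) else 0)"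
      proof (cases "k \<le> i - s \<and> i - s \<le> card ?T - k")
        case True
        then have "(k, y, i - s) \<in> chain_index ?T"
          using b(2) by (simp add: chain_index_def)
        then have "cinner (Pow ?T) (chain_vec ?T k y (i - s)) (chain_vec ?T k' y' (a - s)) =
            (if (k, y, i - s) = (k', y', a - s) then 1 else 0)"
          using chain_vec_orthonormal[OF finite_rest, of n g] a(2)
          unfolding orthonormal_family_def by fastforce
        then show ?thesis
          unfolding 3(2) subset_op_chain_vec[OF finite_rest y k2 bj]
          using True by (simp only: if_True simp_thms cinner_scale_left)
      next
        case False
        then show ?thesis
          unfolding 3(2) subset_op_chain_vec[OF finite_rest y k2 bj]
          by (simp only: if_False cinner_zero_left)
      qed
      have Tg: "rest n g' = ?T" "card (S n g') = s"
        unfolding s_def gg by (rule refl)+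
      have lhs': "mform (BX X n) (uvec n \<theta> a) (omat n \<mu>) (uvec n \<theta>' b) = ?r ^ (i - t + (j - t)) * ?Lam *
          (if k \<le> i - s \<and> i - s \<le> card ?T - k then
            ?c * (if (k, y, i - s) = (k', y', a - s) then 1 else 0) else 0)"
        unfolding lhs Tg op using gg si 3(1) by (simp only: simp_thms if_True)
      show ?thesis
      proof (cases "\<theta> = \<theta>'")
        case False
        then have neq: "(k, y, i - s) \<noteq> (k', y', a - s)"
          using \<theta> \<theta>' gg by auto
        show ?thesis
          unfolding lhs' if_not_P[OF neq] if_not_P[OF False] by simp
      next
        case True
        then have kk: "k' = k" "y' = y"
          using \<theta> \<theta>' by auto
        have ia: "(k, y, i - s) = (k', y', a - s) \<longleftrightarrow> a = i"
          using kk a(1) si by auto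
        have cond: "k \<le> i - s \<and> i - s \<le> card ?T - k \<longleftrightarrow>
            k' + s \<le> i \<and> i \<le> n + s - (k' + s) \<and> k' + s \<le> j \<and> j \<le> n + s - (k' + s)"
          using bj si sn k2 unfolding N kk by auto
        have e: "card ?T - 2 * k = n + s - 2 * (k' + s)" "i - s - k = i - (k' + s)" "j - s - k = j - (k' + s)"
          using sn k2 unfolding N kk by auto
        have ints: "int (card ?T) = int n - int s" "int (t - s) = int t - int s" "int (i - s) = int i - int s"
          "int (j - s) = int j - int s" "int k = int (k' + s) - int s"
          using 3(1) si sn unfolding N kk by auto
        \<comment> \<open>The (i - t) + (j - t) positions filled in one word only give a factor sqrt
          |X| each; together this is the power (i + j) / 2 - t of |X|.\<close>
        have pw: "complex_of_real (real (card X) powr ((real i + real j) / 2 - real t)) = ?r ^ (i - t + (j - t))"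
        proof -
          have e: "(real i + real j) / 2 - real t = real (i - t + (j - t)) / 2"
            using t by (simp add: of_nat_diff field_simps)
          have "real (card X) powr ((real i + real j) / 2 - real t) =
              sqrt (real (card X)) ^ (i - t + (j - t))"
            unfolding e using card_X_pos by (simp add: powr_half_sqrt_powr powr_realpow real_sqrt_power del: of_nat_add)
          then show ?thesis
            by simp
        qed
        have "block_entry n \<mu> (cidx n \<theta>) a b =
            (if k \<le> i - s \<and> i - s \<le> card ?T - k then ?r ^ (i - t + (j - t)) * ?Lam *
              (?c * (if a = i then 1 else 0)) else 0)"
          unfolding cond block_entry_def cidx \<mu>e alpha_def unit_matrix_def e ints prod.case
          unfolding pw using 3(2) by (simp add: mult.assoc mult.left_commute mult.commute)
        then show ?thesis
          using True unfolding lhs' ia by simp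
      qed
    qed
  qed
qed

end

section \<open>The Jordan basis\<close>

lemma up_scale: "up P leq (cscale c v) = cscale c (up P leq v)"
  by (simp add: up_def cscale_def sum_distrib_left)

lemma homogeneous_vrank: "homogeneous P r i v \<Longrightarrow> vrank P r v = i"
proof -
  assume h: "homogeneous P r i v"
  have "j = i" if "homogeneous P r j v" for j
  proof -
    obtain x where "v x \<noteq> 0"
      using h by (auto simp: homogeneous_def fun_eq_iff)
    then show ?thesis
      using h that by (auto simp: homogeneous_def V_def)
  qed
  then show ?thesis
    unfolding vrank_def using h by (intro the_equality)
qed

context multiplicity_free_action
begin

definition Chains :: "nat \<Rightarrow> nat \<times> nat \<times> nat list \<Rightarrow> ('x option list \<Rightarrow> complex) list set" where
  "Chains n q = chain n ` {\<theta> \<in> Theta n. cidx n \<theta> = q}"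

definition JB :: "nat \<Rightarrow> ('x option list \<Rightarrow> complex) set" where
  "JB n = (\<Union>q\<in>JX m n. chain_union (Chains n q))"

text \<open>The normalized basis described directly by unit vectors; \<open>normalize_JB\<close>
  shows that it comes from \<open>JB\<close>.\<close>

definition UB :: "nat \<Rightarrow> ('x option list \<Rightarrow> complex) set" where
  "UB n = (\<lambda>(\<theta>, a). uvec n \<theta> a) ` unit_index n"

lemma lift_zero: "lift n g 0 = 0"
  using lift_scale[of n g 0 0] by (simp only: cfun.scale_zero_left)

text \<open>The factor is sqrt |X|^r times the norm of the Boolean chain vector. Its positivity, and
  not only that it is nonzero, makes normalization return \<open>uvec\<close> exactly.\<close>

lemma raw_uvec:
  assumes "\<theta> \<in> Theta n" "cidx n \<theta> = (k, s, p)" "r < card (ranks n (k, s, p))"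
  obtains c where "0 < c" "raw n \<theta> r = cscale (complex_of_real c) (uvec n \<theta> (k + r))"
proof -
  obtain g k0 y where \<theta>: "\<theta> = (g, k0, y)" "2 * k0 + card (S n g) \<le> n"
    using ThetaE[OF assms(1)] by metis
  have k: "k = k0 + card (S n g)" "s = card (S n g)"
    using assms(2) by (auto simp: cidx_def \<theta>)
  have r: "r \<le> card (rest n g) - 2 * k0"
    using assms(3) ranks_iff(2)[OF \<theta>] unfolding assms(2) by simp
  let ?T = "rest n g"
  let ?d = "sqrt (real (chain_norm2 (card ?T) k0 r))"
  have d: "0 < ?d"
    using chain_norm2_pos[OF r] by simp
  have "raw n \<theta> r = cscale (complex_of_real (sqrt (real (card X)) ^ r * ?d)) (uvec n \<theta> (k + r))"
  proof -
    have e: "k + r - card (S n g) = k0 + r" "k0 + r - k0 = r"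
      by (simp_all add: k)
    have "sqrt (real (card X)) ^ r * ?d * (1 / ?d) = sqrt (real (card X)) ^ r"
      using d by simp
    then show ?thesis
      by (simp only: raw_def uvec_def \<theta> prod.case e chain_vec_def lift_scale cfun.scale_scale
          of_real_mult[symmetric])
  qed
  moreover have "0 < sqrt (real (card X)) ^ r * ?d"
    using d card_X_pos by simp
  ultimately show ?thesis
    using that by blast
qed

lemma uvec_norm:
  assumes "\<theta> \<in> Theta n" "a \<in> ranks n (cidx n \<theta>)"
  shows "cinner (BX X n) (uvec n \<theta> a) (uvec n \<theta> a) = 1"
  using cinner_uvec[of \<theta> a n \<theta> a] assms by (simp add: unit_index_def)

lemma ranks_index:
  assumes "\<theta> \<in> Theta n" "cidx n \<theta> = (k, s, p)"
  shows "k + r \<in> ranks n (k, s, p) \<longleftrightarrow> r < card (ranks n (k, s, p))"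
  using cidx_JX[OF assms(1)] unfolding assms(2) by (auto simp: ranks_def JX_def)

lemma raw_normalize:
  assumes "\<theta> \<in> Theta n" "cidx n \<theta> = (k, s, p)" "r < card (ranks n (k, s, p))"
  shows "normalize_vec (BX X n) (raw n \<theta> r) = uvec n \<theta> (k + r)"
proof -
  obtain c where "0 < c" "raw n \<theta> r = cscale (complex_of_real c) (uvec n \<theta> (k + r))"
    using raw_uvec[OF assms] .
  moreover have "cinner (BX X n) (uvec n \<theta> (k + r)) (uvec n \<theta> (k + r)) = 1"
    using uvec_norm[OF assms(1)] ranks_index[OF assms(1,2)] assms by simp
  ultimately show ?thesis
    using normalize_vec_scale[OF finite_BX[OF finX] uvec_V] by metis
qed

lemma chain_nth: "r < card (ranks n (cidx n \<theta>)) \<Longrightarrow> chain n \<theta> ! r = raw n \<theta> r"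
  by (simp add: chain_def)

lemma chain_length: "length (chain n \<theta>) = card (ranks n (cidx n \<theta>))"
  by (simp add: chain_def)

lemma set_chain: "set (chain n \<theta>) = raw n \<theta> ` {..<card (ranks n (cidx n \<theta>))}"
  by (auto simp: chain_def)

lemma chain_normalize:
  assumes "\<theta> \<in> Theta n" "cidx n \<theta> = (k, s, p)" "a \<in> {k..n + s - k}"
  shows "normalize_vec (BX X n) (chain n \<theta> ! (a - k)) = uvec n \<theta> a"
proof -
  have "a - k < card (ranks n (k, s, p))"
    using ranks_index[OF assms(1,2), of "a - k"] assms(3) by (simp add: ranks_def)
  then show ?thesis
    using raw_normalize[OF assms(1,2), of "a - k"] chain_nth[of "a - k" n \<theta>] assms by simp
qed

lemma normalize_set_chain:
  assumes "\<theta> \<in> Theta n"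
  shows "normalize_vec (BX X n) ` set (chain n \<theta>) = uvec n \<theta> ` ranks n (cidx n \<theta>)"
proof -
  obtain k s p where q: "cidx n \<theta> = (k, s, p)"
    by (metis prod_cases3)
  have "normalize_vec (BX X n) ` set (chain n \<theta>) = (\<lambda>r. uvec n \<theta> (k + r)) ` {..<card (ranks n (k, s, p))}"
    unfolding set_chain q image_image using raw_normalize[OF assms q] by (intro image_cong) auto
  also have "\<dots> = uvec n \<theta> ` ((+) k ` {..<card (ranks n (k, s, p))})"
    by (simp add: image_image)
  also have "(+) k ` {..<card (ranks n (k, s, p))} = ranks n (k, s, p)"
  proof (intro equalityI subsetI)
    fix a assume a: "a \<in> ranks n (k, s, p)"
    then have "a = k + (a - k)"
      by (simp add: ranks_def)
    moreover have "a - k < card (ranks n (k, s, p))"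
      using ranks_index[OF assms q, of "a - k"] a by (simp add: ranks_def)
    ultimately show "a \<in> (+) k ` {..<card (ranks n (k, s, p))}"
      by blast
  qed (use ranks_index[OF assms q] in auto)
  finally show ?thesis
    by (simp add: q)
qed

lemma uvec_inj:
  assumes "(\<theta>, a) \<in> unit_index n" "(\<theta>', b) \<in> unit_index n" "uvec n \<theta> a = uvec n \<theta>' b"
  shows "\<theta> = \<theta>'" "a = b"
  using orthonormal_family_image(1)[OF uvec_orthonormal[of n]] assms by (auto simp: inj_on_def)

text \<open>Normalization sends both vectors into an orthonormal family, whose members determine
  their labels. This yields disjoint chains and permits counting chains by labels.\<close>

lemma raw_inj:
  assumes "\<theta> \<in> Theta n" "r < card (ranks n (cidx n \<theta>))" "\<theta>' \<in> Theta n" "r' < card (ranks n (cidx n \<theta>'))"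
    and "raw n \<theta> r = raw n \<theta>' r'"
  shows "\<theta> = \<theta>'"
proof -
  obtain k s p k' s' p' where q: "cidx n \<theta> = (k, s, p)" "cidx n \<theta>' = (k', s', p')"
    by (metis prod_cases3)
  have "uvec n \<theta> (k + r) = uvec n \<theta>' (k' + r')"
    using raw_normalize[OF assms(1) q(1)] raw_normalize[OF assms(3) q(2)] assms q by metis
  then show ?thesis
    using uvec_inj(1)[of \<theta> "k + r" n \<theta>' "k' + r'"] assms q ranks_index[OF assms(1) q(1)]
      ranks_index[OF assms(3) q(2)] by (simp add: unit_index_def)
qed

lemma chain_disjoint:
  assumes "\<theta> \<in> Theta n" "\<theta>' \<in> Theta n" "v \<in> set (chain n \<theta>)" "v \<in> set (chain n \<theta>')"
  shows "\<theta> = \<theta>'"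
  using assms raw_inj[OF assms(1) _ assms(2)] unfolding set_chain by auto

lemma ranks_nonempty:
  assumes "\<theta> \<in> Theta n"
  shows "0 < card (ranks n (cidx n \<theta>))"
  using ThetaE[OF assms] ranks_iff(2) by (metis zero_less_Suc)

lemma chain_inj: "inj_on (chain n) (Theta n)"
proof (rule inj_onI)
  fix \<theta> \<theta>' assume \<theta>: "\<theta> \<in> Theta n" "\<theta>' \<in> Theta n" "chain n \<theta> = chain n \<theta>'"
  have "raw n \<theta> 0 \<in> set (chain n \<theta>)"
    using ranks_nonempty[OF \<theta>(1)] unfolding set_chain by blast
  then show "\<theta> = \<theta>'"
    using chain_disjoint[OF \<theta>(1,2)] \<theta>(3) by metis
qed

lemma raw_homogeneous:
  assumes \<theta>: "\<theta> \<in> Theta n" "cidx n \<theta> = (k, s, p)" "r < card (ranks n (k, s, p))"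
  shows "homogeneous (BX X n) rk (k + r) (raw n \<theta> r)"
proof -
  obtain g k0 y where \<theta>e: "\<theta> = (g, k0, y)" "y \<in> primitive (rest n g) k0"
    using ThetaE[OF \<theta>(1)] by metis
  have k: "k = k0 + card (S n g)"
    using \<theta>(2) by (auto simp: cidx_def \<theta>e)
  obtain c where c: "0 < c" "raw n \<theta> r = cscale (complex_of_real c) (uvec n \<theta> (k + r))"
    using raw_uvec[OF \<theta>] .
  have "cinner (BX X n) (uvec n \<theta> (k + r)) (uvec n \<theta> (k + r)) = 1"
    using uvec_norm[OF \<theta>(1)] ranks_index[OF \<theta>(1,2)] \<theta> by simp
  then have "uvec n \<theta> (k + r) \<noteq> 0"
    by auto
  then have "raw n \<theta> r \<noteq> 0"
    unfolding c(2) using c(1) by (simp only: cfun.scale_eq_0_iff of_real_eq_0_iff) simp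
  moreover have "(raise (rest n g) ^^ r) y \<in> V (level (rest n g) (k0 + r))"
    using \<theta>e(2) by (intro raise_pow_level) (auto simp: primitive_def)
  then have "lift n g ((raise (rest n g) ^^ r) y) \<in> V {b \<in> BX X n. rk b = k + r}"
    using lift_level[of "(raise (rest n g) ^^ r) y" n g "k0 + r"] by (simp add: k ac_simps)
  then have "raw n \<theta> r \<in> V {b \<in> BX X n. rk b = k + r}"
    unfolding raw_def \<theta>e prod.case by (rule cfun.subspace_scale[OF V_subspace])
  ultimately show ?thesis
    by (simp add: homogeneous_def)
qed

lemma up_raw: "up (BX X n) BX_le (raw n \<theta> r) = raw n \<theta> (Suc r)"
  by (cases \<theta>) (simp add: raw_def up_scale up_lift cfun.scale_scale mult.commute)

lemma raw_end:
  assumes "\<theta> \<in> Theta n"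
  shows "raw n \<theta> (card (ranks n (cidx n \<theta>))) = 0"
proof -
  obtain g k y where \<theta>: "\<theta> = (g, k, y)" "2 * k + card (S n g) \<le> n" and y: "y \<in> primitive (rest n g) k"
    using ThetaE[OF assms] by metis
  have "2 * k \<le> card (rest n g)"
    using \<theta>(2) unfolding card_rest by linarith
  then have "(raise (rest n g) ^^ card (ranks n (cidx n \<theta>))) y = 0"
    unfolding ranks_iff(2)[OF \<theta>] by (intro raise_pow_eq_0[OF finite_rest y]) auto
  then show ?thesis
    unfolding raw_def using \<theta>(1) by (simp only: prod.case lift_zero cfun.scale_zero_right)
qed

text \<open>The Boolean chain is symmetric about half of n - s, and the shift by s makes the first
  and last ranks add up to n + s. Thus the excess over symmetry is s.\<close>

lemma chain_semisymmetric:
  assumes \<theta>: "\<theta> \<in> Theta n" "cidx n \<theta> = (k, s, p)"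
  shows "semisymmetric_chain (BX X n) BX_le rk n (chain n \<theta>)"
    "vrank (BX X n) rk (hd (chain n \<theta>)) = k"
    "vrank (BX X n) rk (last (chain n \<theta>)) = n + s - k"
proof -
  let ?L = "card (ranks n (k, s, p))"
  have L: "0 < ?L" "length (chain n \<theta>) = ?L"
    using ranks_nonempty[OF \<theta>(1)] \<theta>(2) chain_length by auto
  have Lk: "?L = Suc (n + s - k - k)" "k \<le> n + s - k"
    using cidx_JX[OF \<theta>(1)] unfolding \<theta>(2) by (auto simp: ranks_def JX_def)
  have ne: "chain n \<theta> \<noteq> []"
    using L by auto
  have nth: "chain n \<theta> ! r = raw n \<theta> r" if "r < ?L" for r
    using chain_nth[of r n \<theta>] that \<theta>(2) by simp
  have hd: "hd (chain n \<theta>) = raw n \<theta> 0"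
    using nth[of 0] L ne by (simp add: hd_conv_nth)
  have last: "last (chain n \<theta>) = raw n \<theta> (?L - 1)"
    using nth[of "?L - 1"] L ne by (simp add: last_conv_nth)
  show vhd: "vrank (BX X n) rk (hd (chain n \<theta>)) = k"
    unfolding hd using homogeneous_vrank[OF raw_homogeneous[OF \<theta> L(1)]] by simp
  have "k + (?L - 1) = n + s - k"
    using Lk by simp
  then show vlast: "vrank (BX X n) rk (last (chain n \<theta>)) = n + s - k"
    unfolding last using homogeneous_vrank[OF raw_homogeneous[OF \<theta>, of "?L - 1"]] L(1) by simp
  have "jordan_chain (BX X n) BX_le rk (chain n \<theta>)"
    unfolding jordan_chain_def
  proof (intro conjI ne ballI allI impI)
    fix v assume "v \<in> set (chain n \<theta>)"
    then show "\<exists>i. homogeneous (BX X n) rk i v"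
      unfolding set_chain using raw_homogeneous[OF \<theta>] \<theta>(2) by auto
  next
    fix q assume "Suc q < length (chain n \<theta>)"
    then show "up (BX X n) BX_le (chain n \<theta> ! q) = chain n \<theta> ! Suc q"
      using nth L up_raw by simp
  next
    show "up (BX X n) BX_le (last (chain n \<theta>)) = 0"
      unfolding last up_raw using raw_end[OF \<theta>(1)] L(1) \<theta>(2) by simp
  qed
  moreover have "n \<le> k + (n + s - k)"
    using Lk by simp
  ultimately show "semisymmetric_chain (BX X n) BX_le rk n (chain n \<theta>)"
    unfolding semisymmetric_chain_def vhd vlast by simp
qed

lemma JB_eq: "JB n = (\<Union>\<theta>\<in>Theta n. set (chain n \<theta>))"
proof (intro equalityI subsetI)
  fix v assume "v \<in> (\<Union>\<theta>\<in>Theta n. set (chain n \<theta>))"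
  then obtain \<theta> where \<theta>: "\<theta> \<in> Theta n" "v \<in> set (chain n \<theta>)"
    by blast
  have "\<theta> \<in> {\<theta>' \<in> Theta n. cidx n \<theta>' = cidx n \<theta>}"
    using \<theta>(1) by simp
  then show "v \<in> JB n"
    unfolding JB_def chain_union_def Chains_def
    using \<theta>(2) by (intro UN_I[OF cidx_JX[OF \<theta>(1)]] UN_I[of "chain n \<theta>"] imageI)
qed (auto simp: JB_def chain_union_def Chains_def)

lemma chain_in_Chains: "\<theta> \<in> Theta n \<Longrightarrow> chain n \<theta> \<in> Chains n (cidx n \<theta>)"
  by (auto simp: Chains_def)

lemma JB_raw: "v \<in> JB n \<longleftrightarrow> (\<exists>\<theta>\<in>Theta n. \<exists>r<card (ranks n (cidx n \<theta>)). v = raw n \<theta> r)"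
  by (auto simp: JB_eq set_chain)

lemma normalize_JB: "normalize_vec (BX X n) ` JB n = UB n"
proof -
  have "normalize_vec (BX X n) ` JB n = (\<Union>\<theta>\<in>Theta n. uvec n \<theta> ` ranks n (cidx n \<theta>))"
    unfolding JB_eq image_UN by (intro SUP_cong refl normalize_set_chain)
  also have "\<dots> = UB n"
    unfolding UB_def unit_index_def by force
  finally show ?thesis .
qed

lemma JB_uvec:
  assumes "v \<in> JB n"
  obtains c \<theta> a where "0 < c" "(\<theta>, a) \<in> unit_index n" "v = cscale (complex_of_real c) (uvec n \<theta> a)"
proof -
  obtain \<theta> r where \<theta>: "\<theta> \<in> Theta n" "r < card (ranks n (cidx n \<theta>))" "v = raw n \<theta> r"
    using assms JB_raw by blast
  obtain k s p where q: "cidx n \<theta> = (k, s, p)"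
    by (metis prod_cases3)
  obtain c where "0 < c" "raw n \<theta> r = cscale (complex_of_real c) (uvec n \<theta> (k + r))"
    using raw_uvec[OF \<theta>(1) q] \<theta>(2) q by metis
  moreover have "(\<theta>, k + r) \<in> unit_index n"
    using ranks_index[OF \<theta>(1) q, of r] \<theta>(1,2) q by (simp add: unit_index_def)
  ultimately show ?thesis
    using that \<theta>(3) by blast
qed

lemma uvec_span_JB:
  assumes "(\<theta>, a) \<in> unit_index n"
  shows "uvec n \<theta> a \<in> cfun.span (JB n)"
proof -
  have \<theta>: "\<theta> \<in> Theta n" "a \<in> ranks n (cidx n \<theta>)"
    using assms by (auto simp: unit_index_def)
  have "uvec n \<theta> a \<in> normalize_vec (BX X n) ` set (chain n \<theta>)"
    using normalize_set_chain[OF \<theta>(1)] \<theta>(2) by blast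
  then obtain v where v: "v \<in> set (chain n \<theta>)" "uvec n \<theta> a = normalize_vec (BX X n) v"
    by blast
  have "v \<in> JB n"
    using v(1) \<theta>(1) by (auto simp: JB_eq)
  then show ?thesis
    unfolding v(2) normalize_vec_def by (intro cfun.span_scale cfun.span_base)
qed

lemma JB_orthogonal:
  assumes "u \<in> JB n" "v \<in> JB n"
  shows "cinner (BX X n) u v = 0 \<longleftrightarrow> u \<noteq> v"
proof -
  obtain \<theta> r \<theta>' r' where \<theta>: "\<theta> \<in> Theta n" "r < card (ranks n (cidx n \<theta>))" "u = raw n \<theta> r"
    and \<theta>': "\<theta>' \<in> Theta n" "r' < card (ranks n (cidx n \<theta>'))" "v = raw n \<theta>' r'"
    using assms JB_raw by blast
  obtain k s p k' s' p' where q: "cidx n \<theta> = (k, s, p)" "cidx n \<theta>' = (k', s', p')"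
    by (metis prod_cases3)
  obtain c where c: "0 < c" "u = cscale (complex_of_real c) (uvec n \<theta> (k + r))"
    using raw_uvec[OF \<theta>(1) q(1)] \<theta>(2,3) q by metis
  obtain c' where c': "0 < c'" "v = cscale (complex_of_real c') (uvec n \<theta>' (k' + r'))"
    using raw_uvec[OF \<theta>'(1) q(2)] \<theta>'(2,3) q by metis
  have i: "(\<theta>, k + r) \<in> unit_index n" "(\<theta>', k' + r') \<in> unit_index n"
    using ranks_index[OF \<theta>(1) q(1), of r] ranks_index[OF \<theta>'(1) q(2), of r'] \<theta> \<theta>' q
    by (simp_all add: unit_index_def)
  have "cinner (BX X n) (uvec n \<theta> (k + r)) (uvec n \<theta>' (k' + r')) =
      (if \<theta> = \<theta>' \<and> k + r = k' + r' then 1 else 0)"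
    using cinner_uvec[OF i] by simp
  then have "cinner (BX X n) u v = 0 \<longleftrightarrow> \<not> (\<theta> = \<theta>' \<and> k + r = k' + r')"
    unfolding c c' cinner_scale_left cinner_scale_right using c(1) c'(1) by simp
  also have "\<theta> = \<theta>' \<and> k + r = k' + r' \<longleftrightarrow> u = v"
  proof
    assume uv: "u = v"
    have "uvec n \<theta> (k + r) = uvec n \<theta>' (k' + r')"
      using raw_normalize[OF \<theta>(1) q(1)] raw_normalize[OF \<theta>'(1) q(2)] \<theta> \<theta>' q uv by metis
    then show "\<theta> = \<theta>' \<and> k + r = k' + r'"
      using uvec_inj[OF i] by simp
  qed (use q \<theta> \<theta>' in auto)
  finally show ?thesis .
qed

lemma JB_span: "cfun.span (JB n) = V (BX X n)"
proof
  have "JB n \<subseteq> V (BX X n)"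
    using JB_uvec cfun.subspace_scale[OF V_subspace uvec_V] by (metis subsetI)
  then show "cfun.span (JB n) \<subseteq> V (BX X n)"
    by (rule cfun.span_minimal[OF _ V_subspace])
  show "V (BX X n) \<subseteq> cfun.span (JB n)"
  proof
    fix v assume v: "v \<in> V (BX X n)"
    have fin: "finite (BX X n)"
      by (rule finite_BX[OF finX])
    have "ket b \<in> cfun.span (JB n)" if b: "b \<in> BX X n" for b
    proof -
      \<comment> \<open>Reading the completeness kernel in its first argument gives the expansion of
        \<open>ket b\<close>.\<close>
      have "ket b = (\<Sum>p\<in>unit_index n. cscale (cnj (uvec n (fst p) (snd p) b)) (uvec n (fst p) (snd p)))"
      proof
        fix x
        show "ket b x = (\<Sum>p\<in>unit_index n. cscale (cnj (uvec n (fst p) (snd p) b)) (uvec n (fst p) (snd p))) x"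
        proof (cases "x \<in> BX X n")
          case True
          then show ?thesis
            using uvec_kernel[OF True b]
            by (simp add: sum_fun_app cscale_def ket_def split_beta mult.commute)
        next
          case False
          then show ?thesis
            using b uvec_V[of n] by (auto simp: sum_fun_app cscale_def ket_def V_def)
        qed
      qed
      moreover have "(\<Sum>p\<in>unit_index n. cscale (cnj (uvec n (fst p) (snd p) b)) (uvec n (fst p) (snd p)))
          \<in> cfun.span (JB n)"
        by (intro cfun.span_sum cfun.span_scale uvec_span_JB) simp
      ultimately show ?thesis
        by simp
    qed
    then have "(\<Sum>b\<in>BX X n. cscale (v b) (ket b)) \<in> cfun.span (JB n)"
      by (intro cfun.span_sum cfun.span_scale)
    then show "v \<in> cfun.span (JB n)"
      using V_eq_sum_ket[OF fin v] by simp
  qed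
qed

theorem JB_basis: "orthogonal_semisymmetric_jordan_basis (BX X n) BX_le rk n (JB n)"
  unfolding orthogonal_semisymmetric_jordan_basis_def
proof (intro conjI)
  show "cfun.independent (JB n)"
    using JB_orthogonal by (intro orthogonal_independent[of _ "BX X n"]) auto
  show "cfun.span (JB n) = V (BX X n)"
    by (rule JB_span)
  show "\<forall>u\<in>JB n. \<forall>v\<in>JB n. u \<noteq> v \<longrightarrow> cinner (BX X n) u v = 0"
    using JB_orthogonal by blast
  show "\<exists>\<C>. (\<forall>c\<in>\<C>. semisymmetric_chain (BX X n) BX_le rk n c) \<and> disjoint_chains \<C> \<and> JB n = chain_union \<C>"
  proof (intro exI[of _ "chain n ` Theta n"] conjI)
    show "\<forall>c\<in>chain n ` Theta n. semisymmetric_chain (BX X n) BX_le rk n c"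
      using chain_semisymmetric(1) by (metis (no_types, lifting) imageE prod_cases3)
    show "disjoint_chains (chain n ` Theta n)"
      using chain_disjoint by (fastforce simp: disjoint_chains_def)
    show "JB n = chain_union (chain n ` Theta n)"
      by (auto simp: JB_eq chain_union_def)
  qed
qed

lemma Chains_disjoint: "disjoint_chains (Chains n q)"
  using chain_disjoint by (fastforce simp: disjoint_chains_def Chains_def)

lemma Chains_disjoint_family: "disjoint_family_on (\<lambda>q. chain_union (Chains n q)) (JX m n)"
  using chain_disjoint by (fastforce simp: disjoint_family_on_def chain_union_def Chains_def)

lemma finite_Theta: "finite (Theta n)"
proof -
  have "Theta n = fst ` unit_index n"
    using ranks_nonempty by (fastforce simp: unit_index_def card_gt_0_iff image_iff)
  then show ?thesis
    using finite_unit_index by simp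
qed

lemma Chains_finite: "finite (Chains n q)"
  using finite_Theta by (simp add: Chains_def)

section \<open>Counting the chains of each class\<close>

definition full_counts :: "nat \<Rightarrow> nat list \<Rightarrow> nat \<Rightarrow> nat" where
  "full_counts n p u = (if u = 0 then n - sum_list p else p ! (u - 1))"

lemma sum_full_counts:
  assumes "length p = m" "sum_list p \<le> n"
  shows "(\<Sum>u\<le>m. full_counts n p u) = n"
proof -
  have "(\<Sum>u\<le>m. full_counts n p u) = full_counts n p 0 + (\<Sum>u<m. full_counts n p (Suc u))"
    by (simp add: sum.atMost_shift)
  also have "(\<Sum>u<m. full_counts n p (Suc u)) = sum_list p"
    using assms by (simp add: full_counts_def sum_list_sum_nth atLeast0LessThan)
  finally show ?thesis
    using assms by (simp add: full_counts_def)
qed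

text \<open>Choose a component for every position, which gives the multinomial coefficient, and then
  a basis vector of that component. The trivial component offers only \<open>e0\<close> and drops
  out of the product.\<close>

lemma card_patterns_of_type:
  assumes p: "p \<in> compositions s m" and s: "s \<le> n"
  shows "int (card {g \<in> patterns n. type_counts n g = p}) =
    imultinom (int n) ((int n - int s) # map int p) * (\<Prod>w = 1..m. int (card (K w)) ^ (p ! (w - 1)))"
proof -
  have len: "length p = m" "sum_list p = s"
    using p by (auto simp: compositions_def)
  define l where "l = full_counts n p"
  have l_eq: "l u = (if u = 0 then n - s else p ! (u - 1))" for u
    using len by (simp add: l_def full_counts_def)
  have lsum: "(\<Sum>u\<le>m. l u) = n"
    unfolding l_def using len s by (intro sum_full_counts) auto
  define C where "C = {c \<in> {..<n} \<rightarrow>\<^sub>E {..m}. \<forall>u\<in>{..m}. card {i\<in>{..<n}. c i = u} = l u}"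
  have finC: "finite C"
    by (rule finite_subset[OF _ finite_PiE[of "{..<n}" "\<lambda>_. {..m}"]]) (auto simp: C_def)
  have cardC: "int (card C) = imultinom (int n) ((int n - int s) # map int p)"
  proof -
    have "card C = fact n div (\<Prod>u\<le>m. fact (l u))"
      unfolding C_def using card_functions_with_counts_div[of "{..<n}" "{..m}" l] lsum by simp
    moreover have "map (\<lambda>u. int (l u)) [0..<Suc m] = (int n - int s) # map int p"
      using len s by (intro nth_equalityI) (auto simp: l_eq nth_Cons' simp del: upt_Suc)
    ultimately show ?thesis
      using imultinom_upto[of "int n" l m] lsum by simp
  qed
  have card_l: "card {i\<in>{..<n}. wt (g i) = 0} + sum_list (type_counts n g) = n" if g: "g \<in> patterns n" for g
  proof -
    have "{i\<in>{..<n}. wt (g i) = 0} = rest n g"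
      using wt_eq_0[OF pattern_KK[OF g]] by (auto simp: S_def)
    then show ?thesis
      using card_rest[of n g] card_S_le[of n g] sum_type_counts[OF g] by simp
  qed
  have type: "type_counts n g = p \<longleftrightarrow> (\<forall>u\<in>{..m}. card {i\<in>{..<n}. wt (g i) = u} = l u)"
    if g: "g \<in> patterns n" for g
  proof
    assume t: "type_counts n g = p"
    show "\<forall>u\<in>{..m}. card {i\<in>{..<n}. wt (g i) = u} = l u"
    proof
      fix u assume u: "u \<in> {..m}"
      show "card {i\<in>{..<n}. wt (g i) = u} = l u"
      proof (cases u)
        case 0
        then show ?thesis
          using card_l[OF g] t len by (simp add: l_eq)
      next
        case (Suc v)
        then have "type_counts n g ! v = card {i\<in>{..<n}. wt (g i) = u}"
          using u by (simp add: type_counts_def del: upt_Suc)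
        then show ?thesis
          using t Suc by (simp add: l_eq)
      qed
    qed
  next
    assume *: "\<forall>u\<in>{..m}. card {i\<in>{..<n}. wt (g i) = u} = l u"
    show "type_counts n g = p"
    proof (rule nth_equalityI)
      fix v assume "v < length (type_counts n g)"
      then have "v < m"
        by (simp add: type_counts_length)
      then show "type_counts n g ! v = p ! v"
        using *[rule_format, of "Suc v"] by (simp add: type_counts_def l_eq del: upt_Suc)
    qed (simp add: type_counts_length len)
  qed
  have eq: "{g \<in> patterns n. type_counts n g = p} = (\<Union>c\<in>C. \<Pi>\<^sub>E i\<in>{..<n}. K (c i))"
  proof (intro equalityI subsetI)
    fix g assume "g \<in> {g \<in> patterns n. type_counts n g = p}"
    then have g: "g \<in> patterns n" "type_counts n g = p"
      by auto
    let ?c = "restrict (\<lambda>i. wt (g i)) {..<n}"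
    have "{i\<in>{..<n}. ?c i = u} = {i\<in>{..<n}. wt (g i) = u}" for u
      by auto
    moreover have "wt (g i) \<le> m" if "i < n" for i
      using wt(1)[OF pattern_KK[OF g(1) that]] .
    ultimately have "?c \<in> C"
      using type[OF g(1)] g by (auto simp: C_def)
    moreover have "g \<in> (\<Pi>\<^sub>E i\<in>{..<n}. K (?c i))"
      using g(1) wt(2) by (auto simp: PiE_iff)
    ultimately show "g \<in> (\<Union>c\<in>C. \<Pi>\<^sub>E i\<in>{..<n}. K (c i))"
      by blast
  next
    fix g assume "g \<in> (\<Union>c\<in>C. \<Pi>\<^sub>E i\<in>{..<n}. K (c i))"
    then obtain c where c: "c \<in> C" "g \<in> (\<Pi>\<^sub>E i\<in>{..<n}. K (c i))"
      by blast
    have cm: "c i \<le> m" if "i < n" for i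
      using c(1) that by (auto simp: C_def)
    have "g i \<in> KK" if "i < n" for i
      using PiE_mem[OF c(2), of i] cm[OF that] that by (auto simp: KK_def)
    then have g: "g \<in> patterns n"
      using c(2) by (simp add: PiE_iff)
    have w: "wt (g i) = c i" if "i < n" for i
      using wt_eq[OF cm[OF that]] c(2) that by auto
    have "{i\<in>{..<n}. wt (g i) = u} = {i\<in>{..<n}. c i = u}" for u
      using w by auto
    then show "g \<in> {g \<in> patterns n. type_counts n g = p}"
      using type[OF g] c(1) g by (simp add: C_def)
  qed
  have "card {g \<in> patterns n. type_counts n g = p} = (\<Sum>c\<in>C. card (\<Pi>\<^sub>E i\<in>{..<n}. K (c i)))"
    unfolding eq
  proof (rule card_UN_disjoint[OF finC])
    show "\<forall>c\<in>C. finite (\<Pi>\<^sub>E i\<in>{..<n}. K (c i))"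
      using K_finite by (auto intro!: finite_PiE simp: C_def)
    show "\<forall>c\<in>C. \<forall>c'\<in>C. c \<noteq> c' \<longrightarrow> (\<Pi>\<^sub>E i\<in>{..<n}. K (c i)) \<inter> (\<Pi>\<^sub>E i\<in>{..<n}. K (c' i)) = {}"
    proof (intro ballI impI)
      fix c c' assume c: "c \<in> C" "c' \<in> C" "c \<noteq> c'"
      then obtain i where i: "i < n" "c i \<noteq> c' i"
        using PiE_ext[of c "{..<n}" "\<lambda>_. {..m}" c'] by (auto simp: C_def)
      have "c i \<le> m" "c' i \<le> m"
        using c i by (auto simp: C_def)
      then have "K (c i) \<inter> K (c' i) = {}"
        using K_disjoint i(2) by blast
      then show "(\<Pi>\<^sub>E i\<in>{..<n}. K (c i)) \<inter> (\<Pi>\<^sub>E i\<in>{..<n}. K (c' i)) = {}"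
        using i(1) by (auto simp: PiE_iff)
    qed
  qed
  also have "\<dots> = (\<Sum>c\<in>C. \<Prod>w = 1..m. card (K w) ^ (p ! (w - 1)))"
  proof (intro sum.cong refl)
    fix c assume c: "c \<in> C"
    have "card (\<Pi>\<^sub>E i\<in>{..<n}. K (c i)) = (\<Prod>i<n. card (K (c i)))"
      by (rule card_PiE) simp
    also have "\<dots> = (\<Prod>u\<in>{..m}. \<Prod>i\<in>{i\<in>{..<n}. c i = u}. card (K (c i)))"
      using c by (intro prod.group[symmetric]) (auto simp: C_def)
    also have "\<dots> = (\<Prod>u\<in>{..m}. card (K u) ^ l u)"
    proof (intro prod.cong refl)
      fix u assume u: "u \<in> {..m}"
      have "(\<Prod>i\<in>{i\<in>{..<n}. c i = u}. card (K (c i))) = (\<Prod>i\<in>{i\<in>{..<n}. c i = u}. card (K u))"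
        by (rule prod.cong) auto
      then show "(\<Prod>i\<in>{i\<in>{..<n}. c i = u}. card (K (c i))) = card (K u) ^ l u"
        using c u by (simp add: C_def)
    qed
    also have "\<dots> = (\<Prod>w = 1..m. card (K w) ^ l w)"
    proof -
      have "{..m} = insert 0 {1..m}"
        by auto
      then show ?thesis
        by (simp add: K_def)
    qed
    also have "\<dots> = (\<Prod>w = 1..m. card (K w) ^ (p ! (w - 1)))"
      by (intro prod.cong) (auto simp: l_eq)
    finally show "card (\<Pi>\<^sub>E i\<in>{..<n}. K (c i)) = (\<Prod>w = 1..m. card (K w) ^ (p ! (w - 1)))" .
  qed
  finally show ?thesis
    using cardC by simp
qed

text \<open>Every pattern of type p has n - s free positions, so it contributes the same number of
  chains: the number of primitive basis vectors of rank k - s there.\<close>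

lemma card_Chains:
  assumes q: "(k, s, p) \<in> JX m n"
  shows "int (card (Chains n (k, s, p))) = mu m (\<lambda>w. cfun.dim (W w)) n k s p"
proof -
  have ks: "k \<le> n" "2 * k - n \<le> s" "s \<le> k" "p \<in> compositions s m"
    using q by (auto simp: JX_def)
  let ?G = "{g \<in> patterns n. type_counts n g = p}"
  have S: "card (S n g) = s" if "g \<in> ?G" for g
    using sum_type_counts[of g n] that ks(4) by (auto simp: compositions_def)
  have eq: "{\<theta> \<in> Theta n. cidx n \<theta> = (k, s, p)} =
      (\<lambda>(g, y). (g, k - s, y)) ` (SIGMA g:?G. primitive_basis (rest n g) (k - s))"
  proof (intro equalityI subsetI)
    fix \<theta> assume "\<theta> \<in> {\<theta> \<in> Theta n. cidx n \<theta> = (k, s, p)}"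
    then have \<theta>: "\<theta> \<in> Theta n" "cidx n \<theta> = (k, s, p)"
      by simp_all
    obtain g k0 y where e: "\<theta> = (g, k0, y)"
      by (metis prod_cases3)
    have "type_counts n g = p" "g \<in> patterns n" "y \<in> primitive_basis (rest n g) k0"
      and "k0 + s = k"
      using \<theta> unfolding e cidx_def Theta_def by simp_all
    moreover from this have "k0 = k - s"
      by linarith
    ultimately show "\<theta> \<in> (\<lambda>(g, y). (g, k - s, y)) ` (SIGMA g:?G. primitive_basis (rest n g) (k - s))"
      by (intro image_eqI[of _ _ "(g, y)"]) (simp_all add: e)
  next
    fix \<theta> assume "\<theta> \<in> (\<lambda>(g, y). (g, k - s, y)) ` (SIGMA g:?G. primitive_basis (rest n g) (k - s))"
    then show "\<theta> \<in> {\<theta> \<in> Theta n. cidx n \<theta> = (k, s, p)}"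
      using S ks(3) by (auto simp: Theta_def cidx_def)
  qed
  have finP: "finite (patterns n)"
    using KK_finite by (intro finite_PiE) auto
  have prim: "int (card (primitive_basis (rest n g) (k - s))) =
      ibinom (int n - int s) (int k - int s) - ibinom (int n - int s) (int k - int s - 1)" if g: "g \<in> ?G" for g
  proof -
    have N: "card (rest n g) = n - s"
      using S[OF g] card_rest by simp
    have "int (card (rest n g)) = int n - int s" "int (k - s) = int k - int s"
      using N ks by auto
    moreover have "2 * (k - s) \<le> card (rest n g)"
      unfolding N using ks by auto
    ultimately show ?thesis
      using card_primitive_basis[OF finite_rest, of "k - s" n g] by simp
  qed
  have "card (Chains n (k, s, p)) = card {\<theta> \<in> Theta n. cidx n \<theta> = (k, s, p)}"
    unfolding Chains_def by (rule card_image) (rule inj_on_subset[OF chain_inj], auto)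
  also have "\<dots> = card (SIGMA g:?G. primitive_basis (rest n g) (k - s))"
    unfolding eq by (rule card_image) (auto simp: inj_on_def)
  also have "\<dots> = (\<Sum>g\<in>?G. card (primitive_basis (rest n g) (k - s)))"
    using finP primitive_basis_finite[OF finite_rest] by (intro card_SigmaI) auto
  finally have "int (card (Chains n (k, s, p))) =
      (\<Sum>g\<in>?G. ibinom (int n - int s) (int k - int s) - ibinom (int n - int s) (int k - int s - 1))"
    using prim by simp
  also have "\<dots> = int (card ?G) *
      (ibinom (int n - int s) (int k - int s) - ibinom (int n - int s) (int k - int s - 1))"
    by simp
  finally show ?thesis
    using card_patterns_of_type[OF ks(4)] ks dim_W by (simp add: mu_def)
qed

text \<open>Every class contains a chain, so a block can be kept for it. The number of primitive
  vectors is positive because binomial coefficients grow strictly up to the middle.\<close>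

lemma Theta_exists:
  assumes q: "q \<in> JX m n"
  obtains \<theta> where "\<theta> \<in> Theta n" "cidx n \<theta> = q"
proof -
  obtain k s p where qe: "q = (k, s, p)" and ks: "k \<le> n" "2 * k - n \<le> s" "s \<le> k" "length p = m" "sum_list p = s"
    using q by (auto simp: JX_def compositions_def)
  have sn: "sum_list p \<le> n"
    using ks by simp
  let ?l = "full_counts n p"
  obtain c where c: "c \<in> {..<n} \<rightarrow>\<^sub>E {..m}" "\<And>u. u \<in> {..m} \<Longrightarrow> card {i\<in>{..<n}. c i = u} = ?l u"
    using functions_with_counts_exist[of "{..<n}" "{..m}" ?l] sum_full_counts[OF ks(4) sn] by auto
  define g where "g = restrict (\<lambda>i. SOME e. e \<in> K (c i)) {..<n}"
  have gK: "g i \<in> K (c i)" "c i \<le> m" if "i < n" for i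
    using someI_ex[OF K_nonempty, of "c i"] c(1) that by (auto simp: g_def)
  have "g i \<in> KK" if "i < n" for i
    using gK[OF that] by (auto simp: KK_def)
  then have g: "g \<in> patterns n"
    by (simp add: PiE_iff g_def)
  have w: "wt (g i) = c i" if "i < n" for i
    using wt_eq gK[OF that] by blast
  have t: "type_counts n g = p"
  proof (rule nth_equalityI)
    fix v assume "v < length (type_counts n g)"
    then have v: "v < m"
      by (simp add: type_counts_length)
    have "{i\<in>{..<n}. wt (g i) = Suc v} = {i\<in>{..<n}. c i = Suc v}"
      using w by auto
    then show "type_counts n g ! v = p ! v"
      using c(2)[of "Suc v"] v by (simp add: type_counts_def full_counts_def del: upt_Suc)
  qed (simp add: type_counts_length ks)
  have S: "card (S n g) = s"
    using sum_type_counts[OF g] t ks by simp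
  have N: "card (rest n g) = n - s"
    using S card_rest by simp
  have k2: "2 * (k - s) \<le> card (rest n g)"
    unfolding N using ks by auto
  have "0 < card (primitive_basis (rest n g) (k - s))"
  proof (cases "k - s")
    case 0
    then show ?thesis
      using card_primitive_basis[OF finite_rest, of 0 n g] by (simp add: ibinom_def)
  next
    case (Suc j)
    have "card (rest n g) choose j < card (rest n g) choose (k - s)"
      using Suc k2 by (intro binomial_strict_mono) auto
    moreover have "ibinom (int (card (rest n g))) (int (k - s)) = int (card (rest n g) choose (k - s))"
      "ibinom (int (card (rest n g))) (int (k - s) - 1) = int (card (rest n g) choose j)"
      using Suc by (auto simp: ibinom_def nat_add_distrib)
    ultimately show ?thesis
      using card_primitive_basis[OF finite_rest k2] by simp
  qed
  then obtain y where "y \<in> primitive_basis (rest n g) (k - s)"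
    by (metis card.empty equals0I less_irrefl)
  then show ?thesis
    using that[of "(g, k - s, y)"] g S t ks(3) qe by (simp add: Theta_def cidx_def)
qed

end

section \<open>The block diagonalization\<close>

lemma mform_sum_matrix:
  "mform S u (\<lambda>a b. \<Sum>\<mu>\<in>I. c \<mu> * M \<mu> a b) v = (\<Sum>\<mu>\<in>I. c \<mu> * mform S u (M \<mu>) v)"
proof -
  have "mform S u (\<lambda>a b. \<Sum>\<mu>\<in>I. c \<mu> * M \<mu> a b) v =
      (\<Sum>x\<in>S. \<Sum>y\<in>S. \<Sum>\<mu>\<in>I. c \<mu> * (cnj (u x) * M \<mu> x y * v y))"
    by (simp add: mform_def sum_distrib_left sum_distrib_right algebra_simps)
  also have "\<dots> = (\<Sum>x\<in>S. \<Sum>\<mu>\<in>I. \<Sum>y\<in>S. c \<mu> * (cnj (u x) * M \<mu> x y * v y))"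
    by (intro sum.cong refl sum.swap)
  also have "\<dots> = (\<Sum>\<mu>\<in>I. \<Sum>x\<in>S. \<Sum>y\<in>S. c \<mu> * (cnj (u x) * M \<mu> x y * v y))"
    by (rule sum.swap)
  finally show ?thesis
    by (simp add: mform_def sum_distrib_left)
qed

lemma mform_add: "mform S u (M + N) v = mform S u M v + mform S u N v"
  by (simp add: mform_def algebra_simps sum.distrib)

lemma mform_scale: "mform S u (\<lambda>x y. c * M x y) v = c * mform S u M v"
  by (simp add: mform_def sum_distrib_left algebra_simps)

lemma mform_adj: "mform S u (adj M) v = cnj (mform S v M u)"
proof -
  have "mform S u (adj M) v = (\<Sum>x\<in>S. \<Sum>y\<in>S. cnj (cnj (v y) * M y x * u x))"
    by (simp add: mform_def adj_def algebra_simps)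
  also have "\<dots> = (\<Sum>y\<in>S. \<Sum>x\<in>S. cnj (cnj (v y) * M y x * u x))"
    by (rule sum.swap)
  finally show ?thesis
    by (simp add: mform_def)
qed

lemma mform_idmat: "finite S \<Longrightarrow> mform S u (idmat S) v = cinner S v u"
  by (simp add: mform_def idmat_def cinner_def if_distrib if_distribR mult.commute cong: if_cong)

lemma conjugate_eq_mform:
  assumes "R \<subseteq> V S"
  shows "conjugate S (basis_matrix S R) M v w = (if v \<in> R \<and> w \<in> R then mform S v M w else 0)"
proof -
  have "conjugate S (basis_matrix S R) M v w =
      (\<Sum>y\<in>S. \<Sum>x\<in>S. cnj (basis_matrix S R x v) * M x y * basis_matrix S R y w)"
    by (simp add: conjugate_def mmul_def adj_def sum_distrib_right)
  also have "\<dots> = (\<Sum>x\<in>S. \<Sum>y\<in>S. cnj (basis_matrix S R x v) * M x y * basis_matrix S R y w)"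
    by (rule sum.swap)
  finally show ?thesis
    by (cases "v \<in> R"; cases "w \<in> R") (simp_all add: basis_matrix_def mform_def)
qed

text \<open>Insert the identity, written as the completeness kernel, between the two
  matrices.\<close>

lemma mform_mmul:
  assumes S: "finite S"
    and complete: "\<And>x y. x \<in> S \<Longrightarrow> y \<in> S \<Longrightarrow> (\<Sum>p\<in>I. f p x * cnj (f p y)) = (if x = y then 1 else 0)"
  shows "mform S u (mmul S M N) v = (\<Sum>p\<in>I. mform S u M (f p) * mform S (f p) N v)"
proof -
  define A where "A y = (\<Sum>x\<in>S. cnj (u x) * M x y)" for y
  define C where "C y = (\<Sum>z\<in>S. N y z * v z)" for y
  have left: "mform S u M w = (\<Sum>y\<in>S. A y * w y)" for w
    unfolding mform_def A_def sum_distrib_right by (rule sum.swap)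
  have right: "mform S w N v = (\<Sum>y\<in>S. cnj (w y) * C y)" for w
    by (simp add: mform_def C_def sum_distrib_left mult.assoc)
  have "mform S u (mmul S M N) v = (\<Sum>x\<in>S. \<Sum>z\<in>S. \<Sum>y\<in>S. (cnj (u x) * M x y) * (N y z * v z))"
    by (simp add: mform_def mmul_def sum_distrib_left sum_distrib_right algebra_simps)
  also have "\<dots> = (\<Sum>x\<in>S. \<Sum>y\<in>S. \<Sum>z\<in>S. (cnj (u x) * M x y) * (N y z * v z))"
    by (intro sum.cong refl sum.swap)
  also have "\<dots> = (\<Sum>y\<in>S. \<Sum>x\<in>S. \<Sum>z\<in>S. (cnj (u x) * M x y) * (N y z * v z))"
    by (rule sum.swap)
  also have "\<dots> = (\<Sum>y\<in>S. A y * C y)"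
    by (simp add: A_def C_def sum_product)
  also have "\<dots> = (\<Sum>y\<in>S. \<Sum>y'\<in>S. A y * C y' * (if y = y' then 1 else 0))"
    using S by (simp add: if_distrib cong: if_cong)
  also have "\<dots> = (\<Sum>y\<in>S. \<Sum>y'\<in>S. A y * C y' * (\<Sum>p\<in>I. f p y * cnj (f p y')))"
    using complete by (intro sum.cong) auto
  also have "\<dots> = (\<Sum>y\<in>S. \<Sum>y'\<in>S. \<Sum>p\<in>I. (A y * f p y) * (cnj (f p y') * C y'))"
    by (simp add: sum_distrib_left algebra_simps)
  also have "\<dots> = (\<Sum>y\<in>S. \<Sum>p\<in>I. \<Sum>y'\<in>S. (A y * f p y) * (cnj (f p y') * C y'))"
    by (intro sum.cong refl sum.swap)
  also have "\<dots> = (\<Sum>p\<in>I. \<Sum>y\<in>S. \<Sum>y'\<in>S. (A y * f p y) * (cnj (f p y') * C y'))"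
    by (rule sum.swap)
  also have "\<dots> = (\<Sum>p\<in>I. mform S u M (f p) * mform S (f p) N v)"
    by (simp add: left right sum_product)
  finally show ?thesis .
qed

text \<open>Only the zero vector is orthogonal to a complete family. This is used first for the
  image of each \<open>f q\<close> under \<open>M\<close>, then for the conjugated rows of
  \<open>M\<close>.\<close>

lemma mform_eq_0:
  assumes S: "finite S"
    and complete: "\<And>x y. x \<in> S \<Longrightarrow> y \<in> S \<Longrightarrow> (\<Sum>p\<in>I. f p x * cnj (f p y)) = (if x = y then 1 else 0)"
    and M: "M \<in> mats S S"
    and z: "\<And>p q. p \<in> I \<Longrightarrow> q \<in> I \<Longrightarrow> mform S (f p) M (f q) = 0"
  shows "M = 0"
proof -
  have ortho: "h x = 0" if h: "\<And>p. p \<in> I \<Longrightarrow> (\<Sum>y\<in>S. cnj (f p y) * h y) = 0" and x: "x \<in> S" for h x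
  proof -
    have "h x = (\<Sum>y\<in>S. (if x = y then 1 else 0) * h y)"
      using S x by (simp add: if_distrib if_distribR cong: if_cong)
    also have "\<dots> = (\<Sum>y\<in>S. \<Sum>p\<in>I. f p x * (cnj (f p y) * h y))"
      using complete[OF x] by (intro sum.cong refl) (simp add: sum_distrib_right[symmetric] flip: mult.assoc)
    also have "\<dots> = (\<Sum>p\<in>I. \<Sum>y\<in>S. f p x * (cnj (f p y) * h y))"
      by (rule sum.swap)
    also have "\<dots> = (\<Sum>p\<in>I. f p x * (\<Sum>y\<in>S. cnj (f p y) * h y))"
      by (simp add: sum_distrib_left)
    also have "\<dots> = 0"
      using h by simp
    finally show ?thesis .
  qed
  have col: "(\<Sum>y\<in>S. M x y * f q y) = 0" if q: "q \<in> I" and x: "x \<in> S" for q x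
  proof (rule ortho[OF _ x])
    fix p assume "p \<in> I"
    then show "(\<Sum>x\<in>S. cnj (f p x) * (\<Sum>y\<in>S. M x y * f q y)) = 0"
      using z[OF _ q, of p] by (simp add: mform_def sum_distrib_left mult.assoc)
  qed
  have "cnj (M x y) = 0" if x: "x \<in> S" and y: "y \<in> S" for x y
  proof (rule ortho[OF _ y, of "\<lambda>y. cnj (M x y)"])
    fix q assume "q \<in> I"
    have "(\<Sum>y\<in>S. cnj (f q y) * cnj (M x y)) = cnj (\<Sum>y\<in>S. M x y * f q y)"
      by (simp add: mult.commute)
    then show "(\<Sum>y\<in>S. cnj (f q y) * cnj (M x y)) = 0"
      using col[OF \<open>q \<in> I\<close> x] by simp
  qed
  then have "M x y = 0" for x y
    using M by (cases "x \<in> S \<and> y \<in> S") (auto simp: mats_def)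
  then show ?thesis
    by (simp add: fun_eq_iff)
qed

context multiplicity_free_action
begin

lemma AX_add: "M \<in> AX G X \<phi> n \<Longrightarrow> N \<in> AX G X \<phi> n \<Longrightarrow> M + N \<in> AX G X \<phi> n"
  and AX_scale: "M \<in> AX G X \<phi> n \<Longrightarrow> (\<lambda>x y. c * M x y) \<in> AX G X \<phi> n"
  and AX_adj: "M \<in> AX G X \<phi> n \<Longrightarrow> adj M \<in> AX G X \<phi> n"
  unfolding AX_iff by (auto simp: mats_def adj_def)

lemma AX_idmat: "idmat (BX X n) \<in> AX G X \<phi> n"
  unfolding AX_iff
proof (intro conjI ballI)
  fix h a b assume h: "h \<in> wreath G n" and ab: "a \<in> BX X n" "b \<in> BX X n"
  have "wact n h a = wact n h b \<longleftrightarrow> a = b"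
    using inj_onD[OF wact_inj[OF h] _ ab] by blast
  then show "idmat (BX X n) (wact n h a) (wact n h b) = idmat (BX X n) a b"
    using ab wact_BX[OF h] by (simp add: idmat_def)
qed (auto simp: mats_def idmat_def)

lemma AX_mmul:
  assumes "M \<in> AX G X \<phi> n" "N \<in> AX G X \<phi> n"
  shows "mmul (BX X n) M N \<in> AX G X \<phi> n"
  unfolding AX_iff
proof (intro conjI ballI)
  have z: "M a b = 0" "N a b = 0" if "a \<notin> BX X n \<or> b \<notin> BX X n" for a b
    using assms that by (auto simp: AX_iff mats_def)
  then show "mmul (BX X n) M N \<in> mats (BX X n) (BX X n)"
    by (auto simp: mats_def mmul_def intro!: sum.neutral)
  fix h a b assume h: "h \<in> wreath G n" and ab: "a \<in> BX X n" "b \<in> BX X n"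
  have "mmul (BX X n) M N (wact n h a) (wact n h b) =
      (\<Sum>c\<in>BX X n. M (wact n h a) (wact n h c) * N (wact n h c) (wact n h b))"
    unfolding mmul_def by (rule sum.reindex_bij_betw[OF wact_bij[OF h], symmetric])
  also have "\<dots> = (\<Sum>c\<in>BX X n. M a c * N c b)"
    using assms h ab unfolding AX_iff by (intro sum.cong) auto
  finally show "mmul (BX X n) M N (wact n h a) (wact n h b) = mmul (BX X n) M N a b"
    by (simp add: mmul_def)
qed

section \<open>One block from each class of chains\<close>

definition rep :: "nat \<Rightarrow> nat \<times> nat \<times> nat list \<Rightarrow> (nat \<Rightarrow> 'x \<Rightarrow> complex) \<times> nat \<times> (nat set \<Rightarrow> complex)" where
  "rep n q = (SOME \<theta>. \<theta> \<in> Theta n \<and> cidx n \<theta> = q)"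

lemma rep: "q \<in> JX m n \<Longrightarrow> rep n q \<in> Theta n" "q \<in> JX m n \<Longrightarrow> cidx n (rep n q) = q"
proof -
  assume "q \<in> JX m n"
  then have "\<exists>\<theta>. \<theta> \<in> Theta n \<and> cidx n \<theta> = q"
    using Theta_exists by metis
  from someI_ex[OF this] show "rep n q \<in> Theta n" "cidx n (rep n q) = q"
    by (simp_all add: rep_def)
qed

text \<open>The blocks are read off at representative chains; by \<open>mform_AX\<close> every chain
  of a class gives the same block.\<close>

definition Phi :: "nat \<Rightarrow> ('x option list \<Rightarrow> 'x option list \<Rightarrow> complex) \<Rightarrow>
    nat \<times> nat \<times> nat list \<Rightarrow> nat \<Rightarrow> nat \<Rightarrow> complex" where
  "Phi n M = (\<lambda>q a b. if q \<in> JX m n \<and> a \<in> ranks n q \<and> b \<in> ranks n q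
     then mform (BX X n) (uvec n (rep n q) a) M (uvec n (rep n q) b) else 0)"

lemma rep_unit_index: "q \<in> JX m n \<Longrightarrow> a \<in> ranks n q \<Longrightarrow> (rep n q, a) \<in> unit_index n"
  using rep[of q n] by (simp add: unit_index_def)

lemma Phi_sum:
  assumes "q \<in> JX m n" "a \<in> ranks n q" "b \<in> ranks n q"
  shows "Phi n (\<lambda>x y. \<Sum>\<mu>\<in>IX m n. c \<mu> * omat n \<mu> x y) q a b = (\<Sum>\<mu>\<in>IX m n. c \<mu> * block_entry n \<mu> q a b)"
proof -
  have "mform (BX X n) (uvec n (rep n q) a) (omat n \<mu>) (uvec n (rep n q) b) = block_entry n \<mu> q a b"
    if "\<mu> \<in> IX m n" for \<mu>
    using mform_omat_uvec[OF that rep_unit_index[OF assms(1,2)] rep_unit_index[OF assms(1,3)]]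
    by (simp add: rep(2)[OF assms(1)])
  then show ?thesis
    using assms by (simp add: Phi_def mform_sum_matrix)
qed

text \<open>For orbit matrices the entries vanish between different chains and otherwise depend on
  the chain only through \<open>cidx\<close>. Both properties extend linearly to their span, the
  commutant.\<close>

lemma mform_AX:
  assumes M: "M \<in> AX G X \<phi> n" and p: "(\<theta>, a) \<in> unit_index n" and q: "(\<theta>', b) \<in> unit_index n"
  shows "mform (BX X n) (uvec n \<theta> a) M (uvec n \<theta>' b) = (if \<theta> = \<theta>' then Phi n M (cidx n \<theta>) a b else 0)"
proof -
  obtain c where c: "M = (\<lambda>x y. \<Sum>\<mu>\<in>IX m n. c \<mu> * omat n \<mu> x y)"
    using M AX_eq_span by blast
  have "mform (BX X n) (uvec n \<theta> a) M (uvec n \<theta>' b) =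
      (\<Sum>\<mu>\<in>IX m n. c \<mu> * (if \<theta> = \<theta>' then block_entry n \<mu> (cidx n \<theta>) a b else 0))"
    unfolding c mform_sum_matrix by (intro sum.cong refl) (simp only: mform_omat_uvec[OF _ p q])
  also have "\<dots> = (if \<theta> = \<theta>' then Phi n M (cidx n \<theta>) a b else 0)"
  proof (cases "\<theta> = \<theta>'")
    case True
    have "\<theta> \<in> Theta n" "a \<in> ranks n (cidx n \<theta>)" "b \<in> ranks n (cidx n \<theta>)"
      using p q True by (auto simp: unit_index_def)
    then show ?thesis
      unfolding c using Phi_sum[OF cidx_JX, of \<theta> n a b c] True by simp
  qed simp
  finally show ?thesis .
qed

lemma Phi_mats: "q \<in> JX m n \<Longrightarrow> Phi n M q \<in> mats (ranks n q) (ranks n q)"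
  by (auto simp: mats_def Phi_def)

lemma Phi_outside: "q \<notin> JX m n \<Longrightarrow> Phi n M q = 0"
  by (auto simp: Phi_def fun_eq_iff)

lemma Phi_omat:
  assumes \<mu>: "\<mu> \<in> IX m n" and q: "q \<in> JX m n"
  shows "Phi n (omat n \<mu>) q = block_entry n \<mu> q"
proof (intro ext)
  fix a b
  show "Phi n (omat n \<mu>) q a b = block_entry n \<mu> q a b"
  proof (cases "a \<in> ranks n q \<and> b \<in> ranks n q")
    case True
    then show ?thesis
      using mform_omat_uvec[OF \<mu> rep_unit_index[OF q] rep_unit_index[OF q], of a b] q rep(2)[OF q]
      by (simp add: Phi_def)
  next
    case False
    then show ?thesis
      by (auto simp: Phi_def block_entry_def ranks_def unit_matrix_def split: prod.splits)
  qed
qed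

lemma uvec_complete:
  assumes "x \<in> BX X n" "y \<in> BX X n"
  shows "(\<Sum>p\<in>unit_index n. uvec n (fst p) (snd p) x * cnj (uvec n (fst p) (snd p) y)) =
    (if x = y then 1 else 0)"
  using uvec_kernel[OF assms] by (simp add: split_beta)

lemma Phi_eq_0:
  assumes M: "M \<in> AX G X \<phi> n" and z: "\<And>q a b. q \<in> JX m n \<Longrightarrow> a \<in> ranks n q \<Longrightarrow> b \<in> ranks n q \<Longrightarrow> Phi n M q a b = 0"
  shows "M = 0"
proof (rule mform_eq_0[OF finite_BX[OF finX] uvec_complete])
  show "M \<in> mats (BX X n) (BX X n)"
    using M by (simp add: AX_iff)
  fix p q assume p: "p \<in> unit_index n" and q: "q \<in> unit_index n"
  show "mform (BX X n) (uvec n (fst p) (snd p)) M (uvec n (fst q) (snd q)) = 0"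
  proof (cases "fst p = fst q")
    case True
    then show ?thesis
      using mform_AX[OF M, of "fst p" "snd p" "fst q" "snd q"] p q z[OF cidx_JX]
      by (auto simp: unit_index_def)
  next
    case False
    then show ?thesis
      using mform_AX[OF M, of "fst p" "snd p" "fst q" "snd q"] p q by simp
  qed
qed

lemma finite_JX: "finite (JX m n)"
proof (rule finite_subset)
  show "JX m n \<subseteq> cidx n ` Theta n"
  proof
    fix q assume "q \<in> JX m n"
    then obtain \<theta> where "\<theta> \<in> Theta n" "cidx n \<theta> = q"
      using Theta_exists by blast
    then show "q \<in> cidx n ` Theta n"
      by blast
  qed
qed (simp add: finite_Theta)

text \<open>The matrix units of the direct sum inject into the index set of the orbit matrices by
  \<open>t = k + max (0, i + j - n - s)\<close> and \<open>l = (t - s, p)\<close>.\<close>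

lemma card_matrix_units:
  "card (SIGMA q:JX m n. ranks n q \<times> ranks n q) \<le> card (IX m n)"
proof (rule card_inj_on_le[OF _ _ finite_IX])
  let ?f = "\<lambda>((k, s, p), (i, j)). let t = k + (i + j - (n + s)) in (i, j, t, (t - s) # p)"
  let ?K = "SIGMA q:JX m n. ranks n q \<times> ranks n q"
  show "?f ` ?K \<subseteq> IX m n"
  proof
    fix \<mu> assume "\<mu> \<in> ?f ` ?K"
    then obtain k s p i j where q: "(k, s, p) \<in> JX m n" "i \<in> ranks n (k, s, p)" "j \<in> ranks n (k, s, p)"
      and \<mu>: "\<mu> = ?f ((k, s, p), (i, j))"
      by auto
    \<comment> \<open>This is the least t >= k with i + j - t <= n + s - k; since s <= k the last
      bound is at most n.\<close>
    define t where "t = k + (i + j - (n + s))"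
    have ks: "k \<le> n" "2 * k - n \<le> s" "s \<le> k" "p \<in> compositions s m"
      and ij: "k \<le> i" "i \<le> n + s - k" "k \<le> j" "j \<le> n + s - k"
      using q by (auto simp: JX_def ranks_def)
    have "t \<le> i" "t \<le> j" "i + j - t \<le> n" "s \<le> t"
      using ks(1-3) ij unfolding t_def by linarith+
    moreover have "(t - s) # p \<in> compositions t (m + 1)"
      using ks(4) \<open>s \<le> t\<close> by (auto simp: compositions_def)
    moreover have "\<mu> = (i, j, t, (t - s) # p)"
      by (simp add: \<mu> t_def Let_def)
    ultimately show "\<mu> \<in> IX m n"
      by (simp add: IX_def)
  qed
  show "inj_on ?f ?K"
  proof (rule inj_onI)
    fix x y assume x: "x \<in> ?K" and y: "y \<in> ?K" and eq: "?f x = ?f y"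
    obtain k s p i j where xe: "x = ((k, s, p), (i, j))"
      by (metis prod_cases3 surj_pair)
    obtain k' s' p' i' j' where ye: "y = ((k', s', p'), (i', j'))"
      by (metis prod_cases3 surj_pair)
    \<comment> \<open>The sum of p recovers s; with s, i and j known, the value of t determines
      k.\<close>
    have "i = i'" "j = j'" "p = p'" and t: "k + (i + j - (n + s)) = k' + (i' + j' - (n + s'))"
      using eq by (auto simp: xe ye Let_def)
    moreover have "sum_list p = s" "sum_list p' = s'"
      using x y by (auto simp: xe ye JX_def compositions_def)
    ultimately show "x = y"
      by (simp add: xe ye)
  qed
qed

text \<open>A relation among the block images of orbit matrices gives a commutant matrix with zero
  blocks, hence zero; its entry at a pair of each type is the coefficient of that type. So the
  images are independent, and by the count of matrix units they span.\<close>

lemma Phi_surjective: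
  obtains M where "M \<in> AX G X \<phi> n"
    "\<And>q a b. q \<in> JX m n \<Longrightarrow> a \<in> ranks n q \<Longrightarrow> b \<in> ranks n q \<Longrightarrow> Phi n M q a b = D q a b"
proof -
  let ?K = "SIGMA q:JX m n. ranks n q \<times> ranks n q"
  define A where "A \<mu> = (\<lambda>(q, (a, b)). if (q, (a, b)) \<in> ?K then block_entry n \<mu> q a b else 0)" for \<mu>
  define v where "v = (\<lambda>(q, (a, b)). if (q, (a, b)) \<in> ?K then D q a b else 0)"
  have "\<exists>c. v = (\<Sum>\<mu>\<in>IX m n. cscale (c \<mu>) (A \<mu>))"
  proof (rule independent_family_spans[OF finite_IX _ card_matrix_units])
    show "finite ?K"
      using finite_JX by (auto simp: ranks_def intro!: finite_SigmaI)
    show "A \<mu> \<in> V ?K" for \<mu>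
      by (auto simp: A_def V_def)
    show "v \<in> V ?K"
      by (auto simp: v_def V_def)
    fix c assume z: "(\<Sum>\<mu>\<in>IX m n. cscale (c \<mu>) (A \<mu>)) = 0"
    let ?M = "\<lambda>x y. \<Sum>\<mu>\<in>IX m n. c \<mu> * omat n \<mu> x y"
    have MA: "?M \<in> AX G X \<phi> n"
      using AX_eq_span by blast
    have "?M = 0"
    proof (rule Phi_eq_0[OF MA])
      fix q a b assume qab: "q \<in> JX m n" "a \<in> ranks n q" "b \<in> ranks n q"
      have "Phi n ?M q a b = (\<Sum>\<mu>\<in>IX m n. cscale (c \<mu>) (A \<mu>)) (q, (a, b))"
        unfolding Phi_sum[OF qab] sum_fun_app cscale_def using qab by (simp add: A_def)
      then show "Phi n ?M q a b = 0"
        by (simp add: z)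
    qed
    show "\<forall>\<mu>\<in>IX m n. c \<mu> = 0"
    proof
      fix \<mu> assume \<mu>: "\<mu> \<in> IX m n"
      obtain x y where xy: "x \<in> BX X n" "y \<in> BX X n" "pair_type x y = \<mu>"
        using pair_type_exists[OF \<mu>] .
      have "c \<mu> = (\<Sum>\<mu>'\<in>IX m n. if \<mu>' = \<mu> then c \<mu>' else 0)"
        using \<mu> finite_IX by simp
      also have "\<dots> = ?M x y"
        using xy by (intro sum.cong refl) (auto simp: omat_eq)
      also have "\<dots> = 0"
        using fun_cong[OF fun_cong[OF \<open>?M = 0\<close>, of x], of y] by simp
      finally show "c \<mu> = 0" .
    qed
  qed
  then obtain c where c: "v = (\<Sum>\<mu>\<in>IX m n. cscale (c \<mu>) (A \<mu>))"
    by blast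
  let ?M = "\<lambda>x y. \<Sum>\<mu>\<in>IX m n. c \<mu> * omat n \<mu> x y"
  have "?M \<in> AX G X \<phi> n"
    using AX_eq_span by blast
  moreover have "Phi n ?M q a b = D q a b" if qab: "q \<in> JX m n" "a \<in> ranks n q" "b \<in> ranks n q" for q a b
  proof -
    have "Phi n ?M q a b = (\<Sum>\<mu>\<in>IX m n. cscale (c \<mu>) (A \<mu>)) (q, (a, b))"
      unfolding Phi_sum[OF qab] sum_fun_app cscale_def using qab by (simp add: A_def)
    also have "\<dots> = D q a b"
      unfolding c[symmetric] using qab by (simp add: v_def)
    finally show ?thesis .
  qed
  ultimately show ?thesis
    using that by blast
qed

section \<open>The image of the commutant under conjugation\<close>

abbreviation conj_UB :: "nat \<Rightarrow> ('x option list \<Rightarrow> 'x option list \<Rightarrow> complex) \<Rightarrow>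
    ('x option list \<Rightarrow> complex) \<Rightarrow> ('x option list \<Rightarrow> complex) \<Rightarrow> complex" where
  "conj_UB n \<equiv> conjugate (BX X n) (basis_matrix (BX X n) (UB n))"

lemma UB_V: "UB n \<subseteq> V (BX X n)"
  using uvec_V by (auto simp: UB_def)

lemma UB_uvec: "(\<theta>, a) \<in> unit_index n \<Longrightarrow> uvec n \<theta> a \<in> UB n"
  by (force simp: UB_def)

lemma conj_UB_uvec:
  assumes "M \<in> AX G X \<phi> n" "(\<theta>, a) \<in> unit_index n" "(\<theta>', b) \<in> unit_index n"
  shows "conj_UB n M (uvec n \<theta> a) (uvec n \<theta>' b) = (if \<theta> = \<theta>' then Phi n M (cidx n \<theta>) a b else 0)"
  unfolding conjugate_eq_mform[OF UB_V] using UB_uvec assms mform_AX by simp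

lemma unitary_left: "mmul (UB n) (basis_matrix (BX X n) (UB n)) (adj (basis_matrix (BX X n) (UB n))) = idmat (BX X n)"
proof (intro ext)
  fix x y
  have inj: "inj_on (\<lambda>(\<theta>, a). uvec n \<theta> a) (unit_index n)"
    by (rule orthonormal_family_image(1)[OF uvec_orthonormal])
  have "mmul (UB n) (basis_matrix (BX X n) (UB n)) (adj (basis_matrix (BX X n) (UB n))) x y =
      (if x \<in> BX X n \<and> y \<in> BX X n then \<Sum>v\<in>UB n. v x * cnj (v y) else 0)"
    by (cases "x \<in> BX X n"; cases "y \<in> BX X n") (simp_all add: mmul_def adj_def basis_matrix_def)
  also have "(\<Sum>v\<in>UB n. v x * cnj (v y)) = (\<Sum>(\<theta>, a)\<in>unit_index n. uvec n \<theta> a x * cnj (uvec n \<theta> a y))"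
    unfolding UB_def by (subst sum.reindex[OF inj]) (simp add: split_beta)
  finally show "mmul (UB n) (basis_matrix (BX X n) (UB n)) (adj (basis_matrix (BX X n) (UB n))) x y =
      idmat (BX X n) x y"
    using uvec_kernel[of x n y] by (auto simp: idmat_def)
qed

lemma unitary_right: "mmul (BX X n) (adj (basis_matrix (BX X n) (UB n))) (basis_matrix (BX X n) (UB n)) = idmat (UB n)"
proof (intro ext)
  fix v w
  have "mmul (BX X n) (adj (basis_matrix (BX X n) (UB n))) (basis_matrix (BX X n) (UB n)) v w =
      (if v \<in> UB n \<and> w \<in> UB n then cinner (BX X n) w v else 0)"
    by (cases "v \<in> UB n"; cases "w \<in> UB n")
      (simp_all add: mmul_def adj_def basis_matrix_def cinner_def mult.commute)
  moreover have "cinner (BX X n) w v = (if v = w then 1 else 0)" if "v \<in> UB n" "w \<in> UB n"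
  proof -
    have "orthonormal (BX X n) (UB n)"
      unfolding UB_def by (rule orthonormal_family_image(2)[OF uvec_orthonormal])
    then show ?thesis
      using that by (auto simp: orthonormal_def)
  qed
  ultimately show "mmul (BX X n) (adj (basis_matrix (BX X n) (UB n))) (basis_matrix (BX X n) (UB n)) v w = idmat (UB n) v w"
    by (auto simp: idmat_def)
qed

text \<open>The forward inclusion is \<open>mform_AX\<close>. Conversely,
  \<open>Phi_surjective\<close> realizes the blocks at the representatives, and the vanishing and
  equality conditions on N determine all its other entries from these.\<close>

lemma conj_image:
  "conj_UB n ` AX G X \<phi> n =
    {N \<in> mats (UB n) (UB n).
       block_diagonal {normalize_vec (BX X n) ` set c |c. c \<in> (\<Union>q\<in>JX m n. Chains n q)} N \<and>
       (\<forall>(k, s, p)\<in>JX m n. \<forall>c\<in>Chains n (k, s, p). \<forall>c'\<in>Chains n (k, s, p).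
          \<forall>a\<in>{k..n + s - k}. \<forall>b\<in>{k..n + s - k}.
            N (normalize_vec (BX X n) (c ! (a - k))) (normalize_vec (BX X n) (c ! (b - k))) =
            N (normalize_vec (BX X n) (c' ! (a - k))) (normalize_vec (BX X n) (c' ! (b - k))))}"
    (is "_ = ?R")
proof (intro equalityI subsetI)
  fix N assume "N \<in> conj_UB n ` AX G X \<phi> n"
  then obtain M where M: "M \<in> AX G X \<phi> n" and N: "N = conj_UB n M"
    by blast
  have "N \<in> mats (UB n) (UB n)"
    by (simp add: N mats_def conjugate_eq_mform[OF UB_V])
  moreover have "block_diagonal {normalize_vec (BX X n) ` set c |c. c \<in> (\<Union>q\<in>JX m n. Chains n q)} N"
    unfolding block_diagonal_def
  proof (intro ballI impI)
    fix A A' v w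
    assume "A \<in> {normalize_vec (BX X n) ` set c |c. c \<in> (\<Union>q\<in>JX m n. Chains n q)}"
      "A' \<in> {normalize_vec (BX X n) ` set c |c. c \<in> (\<Union>q\<in>JX m n. Chains n q)}"
      and ne: "A \<noteq> A'" and vw: "v \<in> A" "w \<in> A'"
    then obtain c c' where c: "c \<in> (\<Union>q\<in>JX m n. Chains n q)" "A = normalize_vec (BX X n) ` set c"
      and c': "c' \<in> (\<Union>q\<in>JX m n. Chains n q)" "A' = normalize_vec (BX X n) ` set c'"
      by blast
    obtain \<theta> where \<theta>0: "\<theta> \<in> Theta n" "c = chain n \<theta>"
      using c(1) unfolding Chains_def by blast
    obtain \<theta>' where \<theta>0': "\<theta>' \<in> Theta n" "c' = chain n \<theta>'"
      using c'(1) unfolding Chains_def by blast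
    have \<theta>: "\<theta> \<in> Theta n" "A = uvec n \<theta> ` ranks n (cidx n \<theta>)"
      and \<theta>': "\<theta>' \<in> Theta n" "A' = uvec n \<theta>' ` ranks n (cidx n \<theta>')"
      using \<theta>0 \<theta>0' c(2) c'(2) normalize_set_chain by simp_all
    obtain a b where "a \<in> ranks n (cidx n \<theta>)" "v = uvec n \<theta> a" "b \<in> ranks n (cidx n \<theta>')" "w = uvec n \<theta>' b"
      using vw \<theta> \<theta>' by auto
    moreover have "\<theta> \<noteq> \<theta>'"
      using ne \<theta> \<theta>' by auto
    ultimately show "N v w = 0"
      using conj_UB_uvec[OF M, of \<theta> a \<theta>' b] \<theta> \<theta>' by (simp add: N unit_index_def)
  qed
  moreover have "N (normalize_vec (BX X n) (c ! (a - k))) (normalize_vec (BX X n) (c ! (b - k))) = Phi n M (k, s, p) a b"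
    if "c \<in> Chains n (k, s, p)" "a \<in> {k..n + s - k}" "b \<in> {k..n + s - k}" for k s p c a b
  proof -
    obtain \<theta> where \<theta>: "\<theta> \<in> Theta n" "cidx n \<theta> = (k, s, p)" "c = chain n \<theta>"
      using \<open>c \<in> Chains n (k, s, p)\<close> by (auto simp: Chains_def)
    have "(\<theta>, a) \<in> unit_index n" "(\<theta>, b) \<in> unit_index n"
      using \<theta> that by (simp_all add: unit_index_def ranks_def)
    then show ?thesis
      using conj_UB_uvec[OF M, of \<theta> a \<theta> b] \<theta> that by (simp add: N chain_normalize)
  qed
  ultimately show "N \<in> ?R"
    by auto
next
  fix N assume "N \<in> ?R"
  then have N: "N \<in> mats (UB n) (UB n)"
    and bd: "block_diagonal {normalize_vec (BX X n) ` set c |c. c \<in> (\<Union>q\<in>JX m n. Chains n q)} N"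
    and same: "\<And>k s p c c' a b. (k, s, p) \<in> JX m n \<Longrightarrow> c \<in> Chains n (k, s, p) \<Longrightarrow> c' \<in> Chains n (k, s, p) \<Longrightarrow>
      a \<in> {k..n + s - k} \<Longrightarrow> b \<in> {k..n + s - k} \<Longrightarrow>
            N (normalize_vec (BX X n) (c ! (a - k))) (normalize_vec (BX X n) (c ! (b - k))) =
            N (normalize_vec (BX X n) (c' ! (a - k))) (normalize_vec (BX X n) (c' ! (b - k)))"
    by blast+
  obtain M where M: "M \<in> AX G X \<phi> n"
    "\<And>q a b. q \<in> JX m n \<Longrightarrow> a \<in> ranks n q \<Longrightarrow> b \<in> ranks n q \<Longrightarrow>
      Phi n M q a b = N (uvec n (rep n q) a) (uvec n (rep n q) b)"
    by (rule Phi_surjective[of n "\<lambda>q a b. N (uvec n (rep n q) a) (uvec n (rep n q) b)"]) blast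
  have "conj_UB n M v w = N v w" for v w
  proof (cases "v \<in> UB n \<and> w \<in> UB n")
    case False
    then show ?thesis
      using N by (auto simp: conjugate_eq_mform[OF UB_V] mats_def)
  next
    case True
    then obtain \<theta> a \<theta>' b where p: "(\<theta>, a) \<in> unit_index n" "v = uvec n \<theta> a"
      and q: "(\<theta>', b) \<in> unit_index n" "w = uvec n \<theta>' b"
      by (auto simp: UB_def)
    have \<theta>: "\<theta> \<in> Theta n" "a \<in> ranks n (cidx n \<theta>)" and \<theta>': "\<theta>' \<in> Theta n" "b \<in> ranks n (cidx n \<theta>')"
      using p q by (auto simp: unit_index_def)
    show ?thesis
    proof (cases "\<theta> = \<theta>'")
      case eq: True
      obtain k s p where c: "cidx n \<theta> = (k, s, p)"
        by (metis prod_cases3)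
      have J: "(k, s, p) \<in> JX m n"
        using cidx_JX[OF \<theta>(1)] c by simp
      have ab: "a \<in> {k..n + s - k}" "b \<in> {k..n + s - k}"
        using \<theta> \<theta>' eq c by (auto simp: ranks_def)
      have ch: "chain n \<theta> \<in> Chains n (k, s, p)" "chain n (rep n (k, s, p)) \<in> Chains n (k, s, p)"
        using chain_in_Chains[OF \<theta>(1)] chain_in_Chains[OF rep(1)[OF J]] rep(2)[OF J] c by simp_all
      have "conj_UB n M v w = Phi n M (k, s, p) a b"
        using conj_UB_uvec[OF M(1) p(1) q(1)] p q eq c by simp
      also have "\<dots> = N (uvec n (rep n (k, s, p)) a) (uvec n (rep n (k, s, p)) b)"
        using M(2)[OF J] \<theta>(2) \<theta>'(2) eq c by simp
      also have "\<dots> = N v w"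
        using same[OF J ch ab]
        unfolding chain_normalize[OF \<theta>(1) c ab(1)] chain_normalize[OF \<theta>(1) c ab(2)]
          chain_normalize[OF rep(1)[OF J] rep(2)[OF J] ab(1)] chain_normalize[OF rep(1)[OF J] rep(2)[OF J] ab(2)]
        using p q eq by simp
      finally show ?thesis .
    next
      case False
      let ?A = "normalize_vec (BX X n) ` set (chain n \<theta>)" and ?A' = "normalize_vec (BX X n) ` set (chain n \<theta>')"
      have vA: "v \<in> ?A" "w \<in> ?A'"
        using p q \<theta> \<theta>' by (auto simp: normalize_set_chain)
      \<comment> \<open>\<open>block_diagonal\<close> compares blocks as sets of vectors, so
        different labels have to be shown to give different sets.\<close>
      have "v \<notin> ?A'"
      proof
        assume "v \<in> ?A'"
        then obtain b' where "b' \<in> ranks n (cidx n \<theta>')" "v = uvec n \<theta>' b'"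
          using normalize_set_chain[OF \<theta>'(1)] by auto
        then show False
          using uvec_inj(1)[OF p(1), of \<theta>' b'] \<theta>'(1) p(2) False by (simp add: unit_index_def)
      qed
      then have "?A \<noteq> ?A'"
        using vA by blast
      moreover have "normalize_vec (BX X n) ` set (chain n \<eta>) \<in>
          {normalize_vec (BX X n) ` set c |c. c \<in> (\<Union>q\<in>JX m n. Chains n q)}" if "\<eta> \<in> Theta n" for \<eta>
        using chain_in_Chains[OF that] cidx_JX[OF that] by blast
      ultimately have "N v w = 0"
        using bd[unfolded block_diagonal_def, rule_format, OF _ _ _ vA] \<theta>(1) \<theta>'(1) by simp
      moreover have "conj_UB n M v w = 0"
        using conj_UB_uvec[OF M(1) p(1) q(1)] p q False by simp
      ultimately show ?thesis
        by simp
    qed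
  qed
  then have "conj_UB n M = N"
    by (simp add: fun_eq_iff)
  then show "N \<in> conj_UB n ` AX G X \<phi> n"
    using M(1) by blast
qed

lemma Phi_conj:
  assumes M: "M \<in> AX G X \<phi> n" and c: "c \<in> Chains n (k, s, p)"
    and ab: "a \<in> {k..n + s - k}" "b \<in> {k..n + s - k}"
  shows "Phi n M (k, s, p) a b =
    conj_UB n M (normalize_vec (BX X n) (c ! (a - k))) (normalize_vec (BX X n) (c ! (b - k)))"
proof -
  obtain \<theta> where \<theta>: "\<theta> \<in> Theta n" "cidx n \<theta> = (k, s, p)" "c = chain n \<theta>"
    using c by (auto simp: Chains_def)
  have "(\<theta>, a) \<in> unit_index n" "(\<theta>, b) \<in> unit_index n"
    using \<theta> ab by (simp_all add: unit_index_def ranks_def)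
  then show ?thesis
    using conj_UB_uvec[OF M, of \<theta> a \<theta> b] \<theta> ab by (simp add: chain_normalize)
qed

section \<open>The star-algebra isomorphism\<close>

lemma Phi_add: "Phi n (M + N) = Phi n M + Phi n N"
  by (auto simp: Phi_def fun_eq_iff mform_add)

text \<open>After inserting the complete family, only intermediate vectors on the representative
  chain contribute, which leaves the product of the two blocks.\<close>

lemma Phi_mmul:
  assumes M: "M \<in> AX G X \<phi> n" and N: "N \<in> AX G X \<phi> n"
  shows "Phi n (mmul (BX X n) M N) = (\<lambda>q. mmul (ranks n q) (Phi n M q) (Phi n N q))"
proof (intro ext)
  fix q a b
  show "Phi n (mmul (BX X n) M N) q a b = mmul (ranks n q) (Phi n M q) (Phi n N q) a b"
  proof (cases "q \<in> JX m n \<and> a \<in> ranks n q \<and> b \<in> ranks n q")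
    case False
    then show ?thesis
      by (auto simp: Phi_def mmul_def)
  next
    case True
    let ?\<theta> = "rep n q"
    have p: "(?\<theta>, a) \<in> unit_index n" "(?\<theta>, b) \<in> unit_index n"
      using True rep_unit_index by auto
    have "Phi n (mmul (BX X n) M N) q a b =
        (\<Sum>r\<in>unit_index n. mform (BX X n) (uvec n ?\<theta> a) M (uvec n (fst r) (snd r)) *
          mform (BX X n) (uvec n (fst r) (snd r)) N (uvec n ?\<theta> b))"
      using True by (simp add: Phi_def mform_mmul[OF finite_BX[OF finX] uvec_complete])
    also have "\<dots> = (\<Sum>r\<in>unit_index n. if fst r = ?\<theta> then Phi n M q a (snd r) * Phi n N q (snd r) b else 0)"
    proof (intro sum.cong refl)
      fix r assume r: "r \<in> unit_index n"
      then have "(fst r, snd r) \<in> unit_index n"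
        by simp
      then show "mform (BX X n) (uvec n ?\<theta> a) M (uvec n (fst r) (snd r)) *
          mform (BX X n) (uvec n (fst r) (snd r)) N (uvec n ?\<theta> b) =
          (if fst r = ?\<theta> then Phi n M q a (snd r) * Phi n N q (snd r) b else 0)"
        using mform_AX[OF M p(1), of "fst r" "snd r"] mform_AX[OF N _ p(2), of "fst r" "snd r"] rep(2) True
        by auto
    qed
    also have "\<dots> = (\<Sum>r\<in>{r \<in> unit_index n. fst r = ?\<theta>}. Phi n M q a (snd r) * Phi n N q (snd r) b)"
      by (rule sum.inter_filter[OF finite_unit_index, symmetric])
    also have "\<dots> = (\<Sum>c\<in>ranks n q. Phi n M q a c * Phi n N q c b)"
      by (rule sum.reindex_bij_witness[of _ "\<lambda>c. (?\<theta>, c)" snd])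
        (use True rep[of q n] in \<open>auto simp: unit_index_def\<close>)
    finally show ?thesis
      by (simp add: mmul_def)
  qed
qed

lemma Phi_iso:
  "star_algebra_iso (matrix_star_algebra (BX X n) (AX G X \<phi> n))
    (matrix_direct_sum (JX m n) (\<lambda>(k, s, p). {k..n + s - k})) (Phi n)"
proof -
  let ?E = "{N. (\<forall>q\<in>JX m n. N q \<in> mats (ranks n q) (ranks n q)) \<and> (\<forall>q. q \<notin> JX m n \<longrightarrow> N q = 0)}"
  have inj: "inj_on (Phi n) (AX G X \<phi> n)"
  proof (rule inj_onI)
    fix M N assume M: "M \<in> AX G X \<phi> n" and N: "N \<in> AX G X \<phi> n" and eq: "Phi n M = Phi n N"
    \<comment> \<open>The difference is written with a scalar -1 so that \<open>AX_add\<close> and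
      \<open>AX_scale\<close> put it into the commutant.\<close>
    let ?D = "M + (\<lambda>x y. (- 1) * N x y)"
    have D: "?D \<in> AX G X \<phi> n"
      by (intro AX_add AX_scale M N)
    have "Phi n ?D q a b = 0" for q a b
    proof -
      have "Phi n ?D q a b = Phi n M q a b - Phi n N q a b"
        by (simp add: Phi_def mform_add mform_scale[of _ _ "- 1", simplified])
      then show ?thesis
        by (simp add: eq)
    qed
    then have "?D = 0"
      using Phi_eq_0[OF D] by blast
    then have "?D x y = 0" for x y
      by (metis zero_fun_apply)
    then have "M x y = N x y" for x y
      by simp
    then show "M = N"
      by (simp add: fun_eq_iff)
  qed
  have image: "Phi n ` AX G X \<phi> n = ?E"
  proof (intro equalityI subsetI)
    fix N assume "N \<in> Phi n ` AX G X \<phi> n"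
    then show "N \<in> ?E"
      using Phi_mats Phi_outside by auto
  next
    fix N assume N: "N \<in> ?E"
    obtain M where M: "M \<in> AX G X \<phi> n"
      "\<And>q a b. q \<in> JX m n \<Longrightarrow> a \<in> ranks n q \<Longrightarrow> b \<in> ranks n q \<Longrightarrow> Phi n M q a b = N q a b"
      by (rule Phi_surjective[of n N]) blast
    have "Phi n M q a b = N q a b" for q a b
    proof (cases "q \<in> JX m n \<and> a \<in> ranks n q \<and> b \<in> ranks n q")
      case False
      have "N q a b = 0"
      proof (cases "q \<in> JX m n")
        case True
        then have "N q \<in> mats (ranks n q) (ranks n q)"
          using N by blast
        then show ?thesis
          using True False by (auto simp: mats_def)
      next
        case False
        then have "N q = 0"
          using N by blast
        then show ?thesis
          by simp
      qed
      then show ?thesis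
        using False by (auto simp: Phi_def)
    qed (use M in auto)
    then have "Phi n M = N"
      by (simp add: fun_eq_iff)
    then show "N \<in> Phi n ` AX G X \<phi> n"
      using M(1) by blast
  qed
  have unit: "Phi n (idmat (BX X n)) = (\<lambda>q. if q \<in> JX m n then idmat (ranks n q) else 0)"
  proof (intro ext)
    fix q a b
    have "cinner (BX X n) (uvec n (rep n q) b) (uvec n (rep n q) a) = (if a = b then 1 else 0)"
      if "q \<in> JX m n" "a \<in> ranks n q" "b \<in> ranks n q"
      using cinner_uvec[OF rep_unit_index rep_unit_index] that by auto
    then show "Phi n (idmat (BX X n)) q a b = (if q \<in> JX m n then idmat (ranks n q) else 0) a b"
      unfolding Phi_def mform_idmat[OF finite_BX[OF finX]] by (auto simp: idmat_def)
  qed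
  have scale: "Phi n (\<lambda>x y. c * M x y) = (\<lambda>q x y. c * Phi n M q x y)" for c M
    by (auto simp: Phi_def fun_eq_iff mform_scale)
  have adjoint: "Phi n (adj M) = (\<lambda>q. adj (Phi n M q))" for M
    by (auto simp: Phi_def fun_eq_iff mform_adj) (auto simp: adj_def)
  have r: "(\<lambda>(k, s, p). {k..n + s - k}) = ranks n"
    by (simp add: ranks_def)
  show ?thesis
    unfolding r star_algebra_iso_def matrix_star_algebra_def matrix_direct_sum_def
      star_algebra.select_convs bij_betw_def
    by (intro conjI ballI allI inj image unit AX_idmat Phi_add scale adjoint Phi_mmul
        AX_add AX_scale AX_mmul AX_adj)
qed

end

theorem theorem1p1:
  fixes G :: "('g, 'r) monoid_scheme" and X :: "'x set" and \<phi> :: "'g \<Rightarrow> 'x \<Rightarrow> 'x"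
    and m n :: nat
    and Z :: "nat \<Rightarrow> ('x \<times> 'x) set" and W :: "nat \<Rightarrow> ('x \<Rightarrow> complex) set"
  assumes "group_action G X \<phi>" and "finite (carrier G)" and "finite X"
    and "multiplicity_free G X \<phi> m" and "m \<ge> 1" and "n \<ge> 1"
    and "orbital_labelling G X \<phi> m Z"
    and "irreducible_labelling G X \<phi> m W"
  shows "\<exists>(J :: ('x option list \<Rightarrow> complex) set)
          (Ch :: nat \<times> nat \<times> nat list \<Rightarrow> ('x option list \<Rightarrow> complex) list set).
    let B = BX X n;
        nrm = normalize_vec B;
        J' = nrm ` J;
        U = basis_matrix B J';
        \<A> = AX G X \<phi> n
    in
      orthogonal_semisymmetric_jordan_basis B BX_le rk n J \<and>

      J = (\<Union>q\<in>JX m n. chain_union (Ch q)) \<and>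
      disjoint_family_on (\<lambda>q. chain_union (Ch q)) (JX m n) \<and>
      (\<forall>(k, s, p)\<in>JX m n.
         disjoint_chains (Ch (k, s, p)) \<and> finite (Ch (k, s, p)) \<and>
         int (card (Ch (k, s, p))) = mu m (\<lambda>w. cfun.dim (W w)) n k s p \<and>
         (\<forall>c\<in>Ch (k, s, p). semisymmetric_chain B BX_le rk n c \<and>
            vrank B rk (hd c) = k \<and> vrank B rk (last c) = n + s - k)) \<and>

      mmul J' U (adj U) = idmat B \<and> mmul B (adj U) U = idmat J' \<and>

      conjugate B U ` \<A> =
        {N \<in> mats J' J'.
           block_diagonal {nrm ` set c |c. c \<in> (\<Union>q\<in>JX m n. Ch q)} N \<and>
           (\<forall>(k, s, p)\<in>JX m n. \<forall>c\<in>Ch (k, s, p). \<forall>c'\<in>Ch (k, s, p).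
              \<forall>a\<in>{k..n + s - k}. \<forall>b\<in>{k..n + s - k}.
                N (nrm (c ! (a - k))) (nrm (c ! (b - k))) =
                N (nrm (c' ! (a - k))) (nrm (c' ! (b - k))))} \<and>

      (\<exists>\<Phi>.
         (\<forall>M\<in>\<A>. \<forall>(k, s, p)\<in>JX m n. \<forall>c\<in>Ch (k, s, p).
            \<forall>a\<in>{k..n + s - k}. \<forall>b\<in>{k..n + s - k}.
              \<Phi> M (k, s, p) a b = conjugate B U M (nrm (c ! (a - k))) (nrm (c ! (b - k)))) \<and>
         star_algebra_iso (matrix_star_algebra B \<A>)
           (matrix_direct_sum (JX m n) (\<lambda>(k, s, p). {k..n + s - k})) \<Phi> \<and>
         (\<forall>(i, j, t, l)\<in>IX m n. \<forall>(k, s, p)\<in>JX m n.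
            \<Phi> (orbit_matrix X m Z n i j t l) (k, s, p) =
              (if k \<le> i \<and> i \<le> n + s - k \<and> k \<le> j \<and> j \<le> n + s - k
               then (\<lambda>a b. complex_of_real
                       (1 / sqrt (real ((n + s - 2 * k) choose (i - k))) *
                        (1 / sqrt (real ((n + s - 2 * k) choose (j - k))))) *
                      alpha X m (lam X Z W) n t l p i j k s * unit_matrix i j a b)
               else 0)))"
proof -
  interpret multiplicity_free_action G X \<phi> m Z W
    using assms by (intro multiplicity_free_action.intro multiplicity_free_action_axioms.intro)
  have chains: "\<forall>(k, s, p)\<in>JX m n.
         disjoint_chains (Chains n (k, s, p)) \<and> finite (Chains n (k, s, p)) \<and>
         int (card (Chains n (k, s, p))) = mu m (\<lambda>w. cfun.dim (W w)) n k s p \<and>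
         (\<forall>c\<in>Chains n (k, s, p). semisymmetric_chain (BX X n) BX_le rk n c \<and>
            vrank (BX X n) rk (hd c) = k \<and> vrank (BX X n) rk (last c) = n + s - k)"
    using Chains_disjoint Chains_finite card_Chains chain_semisymmetric by (auto simp: Chains_def)
  have coords: "\<forall>M\<in>AX G X \<phi> n. \<forall>(k, s, p)\<in>JX m n. \<forall>c\<in>Chains n (k, s, p).
            \<forall>a\<in>{k..n + s - k}. \<forall>b\<in>{k..n + s - k}.
              Phi n M (k, s, p) a b =
                conj_UB n M (normalize_vec (BX X n) (c ! (a - k))) (normalize_vec (BX X n) (c ! (b - k)))"
    using Phi_conj by auto
  have entries: "\<forall>(i, j, t, l)\<in>IX m n. \<forall>(k, s, p)\<in>JX m n.
      Phi n (orbit_matrix X m Z n i j t l) (k, s, p) = block_entry n (i, j, t, l) (k, s, p)"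
    using Phi_omat by fastforce
  show ?thesis
    unfolding Let_def
    \<comment> \<open>Rewriting with \<open>normalize_JB\<close> replaces the normalized basis by
      \<open>UB n\<close> throughout, the form in which unitarity and the image have been
      proved.\<close>
    by (rule exI[of _ "JB n"], rule exI[of _ "Chains n"], unfold normalize_JB)
      (intro conjI exI[of _ "Phi n"] JB_basis JB_def Chains_disjoint_family chains unitary_left
        unitary_right conj_image coords Phi_iso entries[unfolded block_entry_def prod.case])
qed

end
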